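(* Let $\mathcal{B}$ be the complete quadrilateral with lines $L_1,\dots,L_6$ and multiple points $p_1,\dots,p_7$ labelled as in the context, let $I=\{p_1,p_2,p_3,p_4,p_5\}$, and let $M(\mathcal{B},I)$ be the blow up of $\mathbb{P}^2$ at $p_1,\dots,p_5$ minus the strict transforms of the six lines. Let $D=[0:1]+[1:-1]+[1:0]$ on $\mathbb{P}^1$ and $r=(2,+\infty,2)$. Then there exists an orbifold morphism $f$ from $M(\mathcal{B},I)$ to $\mathcal{X}(\mathbb{P}^1,D,r)$ which comes from a pencil of conics and which induces an isomorphism $f_*:\pi_1(M(\mathcal{B},I))\to\pi_1(\mathcal{X}(\mathbb{P}^1,D,r))$ of (orbifold) fundamental groups.
   Context: The complete quadrilateral is the arrangement $\mathcal{B}=\{L_1,\dots,L_6\}$ of the six lines in $\mathbb{P}^2=\mathbb{CP}^2$ with equation $(z_1^2-z_2^2)(z_1^2-z_3^2)(z_2^2-z_3^2)=0$, with labels such that its multiple points are: triple points $p_1=L_2\cap L_3\cap L_4$, $p_4=L_1\cap L_3\cap L_5$, $p_5=L_1\cap L_2\cap L_6$, $p_7=L_4\cap L_5\cap L_6$; double points $p_2=L_2\cap L_5$, $p_3=L_1\cap L_4$, $p_6=L_3\cap L_6$. $\mathcal{X}(\mathbb{P}^1,D,r)$, for $D=y_1+\dots+y_l$ a sum of distinct points and $r\in(\mathbb{N}^*\cup\{+\infty\})^l$, is the orbifold with underlying curve $\mathbb{P}^1$ minus the points $y_i$ with $r_i=+\infty$ and with isotropy of order $r_i$ at $y_i$ when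 $r_i<\infty$. Its fundamental group is the quotient of $\pi_1(\mathbb{P}^1\setminus\{y_1,\dots,y_l\})$ by the normal subgroup generated by the $r_i$-th powers of the meridians of the $y_i$ with $r_i<\infty$. A dominant algebraic morphism $f:X\to\mathbb{P}^1$ from a smooth algebraic variety is an orbifold morphism to $\mathcal{X}(\mathbb{P}^1,D,r)$ if, for each $i$ with $r_i<\infty$, the multiplicity of the fibre $f^*(y_i)$ is divisible by $r_i$, and $f(X)$ does not contain the points $y_i$ with $r_i=+\infty$. Such an $f$ induces $f_*:\pi_1(X)\to\pi_1(\mathcal{X}(\mathbb{P}^1,D,r))$, obtained from $\pi_1(f^{-1}(\mathbb{P}^1\setminus\{y_1,\dots,y_l\}))\to\pi_1(\mathbb{P}^1\setminus\{y_1,\dots,y_l\})$ by passing to quotients. "Comes from a pencil of conics" means that on $\mathbb{P}^2\setminus\bigcup_i L_i\subset M(\mathcal{B},I)$ the map $f$ is $(z_1:z_2:z_3)\mapsto(F:G)$ for two linearly independent quadratic forms $F,G$ without common factor. *)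

theory Defs
  imports "HOL-Analysis.Analysis" "HOL-Algebra.Coset"
begin

section \<open>Complex projective spaces\<close>

text \<open>The points of \<open>'n proj\<close> are the lines through the origin of \<open>complex ^ 'n\<close>, so that
  \<open>3 proj\<close> is the projective plane and \<open>2 proj\<close> the projective line.\<close>

typedef (overloaded) ('n::finite) proj =
  "{l :: (complex ^ 'n) set. \<exists>v. v \<noteq> 0 \<and> l = range (\<lambda>c. c *s v)}"
proof -
  have "vec 1 \<noteq> (0 :: complex ^ 'n)"
    by (simp add: vec_eq_iff)
  then show ?thesis by blast
qed

text \<open>Only meaningful for \<open>v \<noteq> 0\<close>.\<close>

definition proj_pt :: "complex ^ 'n \<Rightarrow> ('n::finite) proj" where
  "proj_pt v = Abs_proj (range (\<lambda>c. c *s v))"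

text \<open>The classical topology, as a quotient of the punctured vector space.\<close>

instantiation proj :: (finite) topological_space
begin

definition open_proj :: "'a proj set \<Rightarrow> bool" where
  "open_proj U \<longleftrightarrow> open {v :: complex ^ 'a. v \<noteq> 0 \<and> proj_pt v \<in> U}"

instance
proof
  have "{v :: complex ^ 'a. v \<noteq> 0 \<and> proj_pt v \<in> UNIV} = - {0}" by auto
  then show "open (UNIV :: 'a proj set)"
    unfolding open_proj_def by (metis open_Compl closed_singleton)
next
  fix S T :: "'a proj set"
  assume "open S" "open T"
  then have "open ({v :: complex ^ 'a. v \<noteq> 0 \<and> proj_pt v \<in> S} \<inter> {v. v \<noteq> 0 \<and> proj_pt v \<in> T})"
    unfolding open_proj_def by (rule open_Int)
  moreover have "{v :: complex ^ 'a. v \<noteq> 0 \<and> proj_pt v \<in> S} \<inter> {v. v \<noteq> 0 \<and> proj_pt v \<in> T}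
      = {v. v \<noteq> 0 \<and> proj_pt v \<in> S \<inter> T}" by auto
  ultimately show "open (S \<inter> T)" unfolding open_proj_def by simp
next
  fix K :: "'a proj set set"
  assume "\<forall>S\<in>K. open S"
  then have "open (\<Union>S\<in>K. {v :: complex ^ 'a. v \<noteq> 0 \<and> proj_pt v \<in> S})"
    unfolding open_proj_def by blast
  moreover have "(\<Union>S\<in>K. {v :: complex ^ 'a. v \<noteq> 0 \<and> proj_pt v \<in> S})
      = {v. v \<noteq> 0 \<and> proj_pt v \<in> \<Union>K}" by auto
  ultimately show "open (\<Union>K)" unfolding open_proj_def by simp
qed

end

abbreviation P1_pt :: "complex \<Rightarrow> complex \<Rightarrow> 2 proj" where
  "P1_pt a b \<equiv> proj_pt (vector [a, b])"


section \<open>Algebraic geometry in products of projective spaces\<close>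

text \<open>Varieties are subsets \<open>X\<close> of a product of copies of a projective space, that is, of
  \<open>'i \<Rightarrow> 'n proj\<close>; homogeneous coordinates of a point are families \<open>'i \<Rightarrow> complex ^ 'n\<close>.\<close>

inductive_set poly_funs :: "('a \<Rightarrow> complex) set \<Rightarrow> ('a \<Rightarrow> complex) set"
  for X :: "('a \<Rightarrow> complex) set" where
  const: "(\<lambda>_. c) \<in> poly_funs X"
| gen: "x \<in> X \<Longrightarrow> x \<in> poly_funs X"
| add: "P \<in> poly_funs X \<Longrightarrow> Q \<in> poly_funs X \<Longrightarrow> (\<lambda>w. P w + Q w) \<in> poly_funs X"
| mult: "P \<in> poly_funs X \<Longrightarrow> Q \<in> poly_funs X \<Longrightarrow> (\<lambda>w. P w * Q w) \<in> poly_funs X"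

definition hom_coords :: "('i \<Rightarrow> complex ^ 'n) \<Rightarrow> ('i \<Rightarrow> ('n::finite) proj) \<Rightarrow> bool" where
  "hom_coords w m \<longleftrightarrow> (\<forall>i. w i \<noteq> 0 \<and> proj_pt (w i) = m i)"

text \<open>Multihomogeneous polynomials of multidegree \<open>d\<close>.\<close>

definition multiforms :: "('i \<Rightarrow> nat) \<Rightarrow> (('i \<Rightarrow> complex ^ 'n::finite) \<Rightarrow> complex) set" where
  "multiforms d = {P \<in> poly_funs {\<lambda>w. w i $ k | i k. True}.
     \<forall>w i c. P (w(i := c *s w i)) = c ^ d i * P w}"

text \<open>Zariski topology induced on \<open>X\<close>: unions of loci where a form does not vanish.\<close>

definition zariski_open :: "('i \<Rightarrow> ('n::finite) proj) set \<Rightarrow> ('i \<Rightarrow> 'n proj) set \<Rightarrow> bool" where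
  "zariski_open X U \<longleftrightarrow> U \<subseteq> X \<and>
     (\<forall>m\<in>U. \<exists>d. \<exists>P\<in>multiforms d.
        (\<exists>w. hom_coords w m \<and> P w \<noteq> 0) \<and>
        {m'\<in>X. \<exists>w. hom_coords w m' \<and> P w \<noteq> 0} \<subseteq> U)"

definition regular_function ::
    "('i \<Rightarrow> ('n::finite) proj) set \<Rightarrow> (('i \<Rightarrow> 'n proj) \<Rightarrow> complex) \<Rightarrow> bool" where
  "regular_function X h \<longleftrightarrow>
     (\<forall>m\<in>X. \<exists>V d A B. zariski_open X V \<and> m \<in> V \<and> A \<in> multiforms d \<and> B \<in> multiforms d \<and>
        (\<forall>m'\<in>V. \<forall>w. hom_coords w m' \<longrightarrow> B w \<noteq> 0 \<and> h m' = A w / B w))"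

definition morphism_to_P1 ::
    "('i \<Rightarrow> ('n::finite) proj) set \<Rightarrow> (('i \<Rightarrow> 'n proj) \<Rightarrow> 2 proj) \<Rightarrow> bool" where
  "morphism_to_P1 X f \<longleftrightarrow>
     (\<forall>m\<in>X. \<exists>V d A B. zariski_open X V \<and> m \<in> V \<and> A \<in> multiforms d \<and> B \<in> multiforms d \<and>
        (\<forall>m'\<in>V. \<forall>w. hom_coords w m' \<longrightarrow>
           (A w \<noteq> 0 \<or> B w \<noteq> 0) \<and> f m' = P1_pt (A w) (B w)))"

text \<open>Zariski density of the image; the projective line is viewed as a product indexed by
  \<open>unit\<close>.\<close>

definition dominant :: "('i \<Rightarrow> ('n::finite) proj) set \<Rightarrow> (('i \<Rightarrow> 'n proj) \<Rightarrow> 2 proj) \<Rightarrow> bool" where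
  "dominant X f \<longleftrightarrow>
     (\<forall>U :: (unit \<Rightarrow> 2 proj) set. zariski_open UNIV U \<and> U \<noteq> {} \<longrightarrow> (\<exists>m\<in>X. (\<lambda>_. f m) \<in> U))"

definition zariski_irreducible ::
    "('i \<Rightarrow> ('n::finite) proj) set \<Rightarrow> ('i \<Rightarrow> 'n proj) set \<Rightarrow> bool" where
  "zariski_irreducible X Z \<longleftrightarrow> Z \<subseteq> X \<and> Z \<noteq> {} \<and>
     (\<forall>U V. zariski_open X U \<and> zariski_open X V \<and> U \<inter> Z \<noteq> {} \<and> V \<inter> Z \<noteq> {} \<longrightarrow> U \<inter> V \<inter> Z \<noteq> {})"

definition irreducible_components ::
    "('i \<Rightarrow> ('n::finite) proj) set \<Rightarrow> ('i \<Rightarrow> 'n proj) set \<Rightarrow> ('i \<Rightarrow> 'n proj) set set" where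
  "irreducible_components X Y = {Z. Z \<subseteq> Y \<and> zariski_irreducible X Z \<and>
     (\<forall>Z'. Z \<subseteq> Z' \<and> Z' \<subseteq> Y \<and> zariski_irreducible X Z' \<longrightarrow> Z' = Z)}"

text \<open>The multiplicity of a component \<open>C\<close> in the divisor \<open>f\<^sup>*(y)\<close> is the order at the generic point
  of \<open>C\<close> of \<open>g\<close>, the pullback of the local coordinate \<open>t \<mapsto> [u + t w]\<close> centred at \<open>y = [u]\<close>. The local
  ring there being a discrete valuation ring, \<open>g\<close> has order at least \<open>k\<close> iff, on some open set
  meeting \<open>C\<close>, it is a regular multiple of a product of \<open>k\<close> regular functions vanishing on \<open>C\<close>.\<close>

definition component_multiplicity ::
    "('i \<Rightarrow> ('n::finite) proj) set \<Rightarrow> (('i \<Rightarrow> 'n proj) \<Rightarrow> 2 proj) \<Rightarrow> 2 proj \<Rightarrow>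
     ('i \<Rightarrow> 'n proj) set \<Rightarrow> nat" where
  "component_multiplicity X f y C = (GREATEST k. \<exists>U u w g e h.
     zariski_open X U \<and> U \<inter> C \<noteq> {} \<and>
     u \<noteq> 0 \<and> w \<noteq> 0 \<and> proj_pt u = y \<and> proj_pt w \<noteq> y \<and>
     (\<forall>m\<in>U. f m = proj_pt (u + g m *s w)) \<and>
     regular_function U e \<and>
     (\<forall>j<k. regular_function U (h j) \<and> (\<forall>m\<in>U \<inter> C. h j m = 0)) \<and>
     (\<forall>m\<in>U. g m = e m * (\<Prod>j<k. h j m)))"

text \<open>The gcd of the multiplicities of the components; 0 for an empty fibre.\<close>

definition fibre_multiplicity ::
    "('i \<Rightarrow> ('n::finite) proj) set \<Rightarrow> (('i \<Rightarrow> 'n proj) \<Rightarrow> 2 proj) \<Rightarrow> 2 proj \<Rightarrow> nat" where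
  "fibre_multiplicity X f y =
     Gcd (component_multiplicity X f y ` irreducible_components X {m\<in>X. f m = y})"

text \<open>The orbifold \<open>\<X>(P\<^sup>1, D, r)\<close> is given by the list of the pairs \<open>(y\<^sub>i, r\<^sub>i)\<close>.\<close>

type_synonym orbifold_data = "(2 proj \<times> enat) list"

definition marked_points :: "orbifold_data \<Rightarrow> 2 proj set" where
  "marked_points D = fst ` set D"

definition orbifold_morphism ::
    "('i \<Rightarrow> ('n::finite) proj) set \<Rightarrow> orbifold_data \<Rightarrow> (('i \<Rightarrow> 'n proj) \<Rightarrow> 2 proj) \<Rightarrow> bool" where
  "orbifold_morphism X D f \<longleftrightarrow> morphism_to_P1 X f \<and> dominant X f \<and>
     (\<forall>(y, r)\<in>set D. case r of
        enat k \<Rightarrow> k dvd fibre_multiplicity X f y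
      | \<infinity> \<Rightarrow> y \<notin> f ` X)"


section \<open>Fundamental groups\<close>

definition path_class :: "'a::topological_space set \<Rightarrow> (real \<Rightarrow> 'a) \<Rightarrow> (real \<Rightarrow> 'a) set" where
  "path_class X p = {q. homotopic_paths X p q}"

definition fundamental_group :: "'a::topological_space set \<Rightarrow> 'a \<Rightarrow> (real \<Rightarrow> 'a) set monoid" where
  "fundamental_group X a =
     \<lparr>carrier = path_class X ` {p. path p \<and> path_image p \<subseteq> X \<and> pathstart p = a \<and> pathfinish p = a},
      mult = (\<lambda>A B. {q. \<exists>\<alpha>\<in>A. \<exists>\<beta>\<in>B. homotopic_paths X (\<alpha> +++ \<beta>) q}),
      one = path_class X (\<lambda>_. a)\<rparr>"

definition normal_closure :: "('a, 'b) monoid_scheme \<Rightarrow> 'a set \<Rightarrow> 'a set" where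
  "normal_closure G S = \<Inter>{N. N \<lhd> G \<and> S \<subseteq> N}"

text \<open>Meridians of \<open>y = [u]\<close> in the complement of \<open>Y\<close>, based at \<open>b\<close>: go along \<open>c\<close> to the boundary
  of the closed disc \<open>{[u + t w] | \<bar>t\<bar> \<le> 1}\<close>, which meets \<open>Y\<close> only at its centre \<open>y\<close>, turn once
  around it in the positive sense, and come back.\<close>

definition meridians :: "2 proj set \<Rightarrow> 2 proj \<Rightarrow> 2 proj \<Rightarrow> (real \<Rightarrow> 2 proj) set set" where
  "meridians Y b y = {path_class (- Y)
       (c +++ (\<lambda>s. proj_pt (u + exp (2 * of_real pi * \<i> * of_real s) *s w)) +++ reversepath c) | c u w.
     u \<noteq> 0 \<and> w \<noteq> 0 \<and> proj_pt u = y \<and> proj_pt w \<noteq> y \<and>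
     (\<forall>t. 0 < norm t \<and> norm t \<le> 1 \<longrightarrow> proj_pt (u + t *s w) \<notin> Y) \<and>
     path c \<and> path_image c \<subseteq> - Y \<and> pathstart c = b \<and> pathfinish c = proj_pt (u + w)}"

definition orbifold_kernel :: "orbifold_data \<Rightarrow> 2 proj \<Rightarrow> (real \<Rightarrow> 2 proj) set set" where
  "orbifold_kernel D b = (let Y = marked_points D; G = fundamental_group (- Y) b in
     normal_closure G {\<mu> [^]\<^bsub>G\<^esub> k | \<mu> k y. (y, enat k) \<in> set D \<and> \<mu> \<in> meridians Y b y})"

definition orbifold_fundamental_group ::
    "orbifold_data \<Rightarrow> 2 proj \<Rightarrow> (real \<Rightarrow> 2 proj) set set monoid" where
  "orbifold_fundamental_group D b =
     fundamental_group (- marked_points D) b Mod orbifold_kernel D b"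

text \<open>The map \<open>f\<^sub>*\<close> at the base point \<open>a\<close>, obtained by passing to quotients: the class \<open>A\<close> is sent to
  the coset of \<open>[f \<circ> \<gamma>]\<close> for the loops \<open>\<gamma>\<close> in \<open>A\<close> avoiding the fibres of the marked points. Taking the
  union over all such \<open>\<gamma>\<close> involves no choice: the value is a coset exactly when there is such
  a \<open>\<gamma>\<close> and the coset does not depend on it.\<close>

definition orbifold_pushforward ::
    "orbifold_data \<Rightarrow> ('a::topological_space \<Rightarrow> 2 proj) \<Rightarrow> 'a \<Rightarrow>
     (real \<Rightarrow> 'a) set \<Rightarrow> (real \<Rightarrow> 2 proj) set set" where
  "orbifold_pushforward D f a A = (let Y = marked_points D; G = fundamental_group (- Y) (f a) in
     \<Union>{orbifold_kernel D (f a) #>\<^bsub>G\<^esub> path_class (- Y) (f \<circ> \<gamma>) | \<gamma>.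
        \<gamma> \<in> A \<and> f ` path_image \<gamma> \<inter> Y = {}})"


section \<open>Line arrangements and blow-ups of the plane\<close>

text \<open>A line is given by its coefficients, a point of the dual plane.\<close>

definition proj_line :: "3 proj \<Rightarrow> 3 proj set" where
  "proj_line l = {proj_pt v | v. v \<noteq> 0 \<and> (\<forall>a. a \<noteq> 0 \<and> proj_pt a = l \<longrightarrow> (\<Sum>k\<in>UNIV. a $ k * v $ k) = 0)}"

text \<open>The blow-up of the plane at a finite set \<open>S\<close>, as the fibre product over the plane of the
  incidence varieties \<open>{(x, l) | p, x \<in> l}\<close>, \<open>p \<in> S\<close>. The coordinate \<open>None\<close> of a point is its image \<open>x\<close>
  in the plane and the coordinate \<open>Some p\<close> is the line \<open>l\<close> through \<open>p\<close>; the coordinates \<open>Some p\<close>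
  with \<open>p \<notin> S\<close> are unused and hence fixed.\<close>

definition blowup :: "3 proj set \<Rightarrow> (3 proj option \<Rightarrow> 3 proj) set" where
  "blowup S = {m. (\<forall>p\<in>S. p \<in> proj_line (m (Some p)) \<and> m None \<in> proj_line (m (Some p))) \<and>
                  (\<forall>p. p \<notin> S \<longrightarrow> m (Some p) = undefined)}"

definition strict_transform ::
    "3 proj set \<Rightarrow> 3 proj set \<Rightarrow> (3 proj option \<Rightarrow> 3 proj) set" where
  "strict_transform S L = blowup S \<inter> closure {m \<in> blowup S. m None \<in> L - S}"

definition blowup_complement ::
    "3 proj set set \<Rightarrow> 3 proj set \<Rightarrow> (3 proj option \<Rightarrow> 3 proj) set" where
  "blowup_complement \<B> S = blowup S - (\<Union>L\<in>\<B>. strict_transform S L)"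

text \<open>The arrangement with the labels of its lines and of its multiple points.\<close>

definition complete_quadrilateral :: "(nat \<Rightarrow> 3 proj set) \<Rightarrow> (nat \<Rightarrow> 3 proj) \<Rightarrow> bool" where
  "complete_quadrilateral L p \<longleftrightarrow>
     inj_on L {1..6} \<and> (\<forall>i\<in>{1..6}. \<exists>l. L i = proj_line l) \<and>
     (\<Union>i\<in>{1..6}. L i) = {proj_pt z | z. z \<noteq> 0 \<and>
        ((z $ 1)\<^sup>2 - (z $ 2)\<^sup>2) * ((z $ 1)\<^sup>2 - (z $ 3)\<^sup>2) * ((z $ 2)\<^sup>2 - (z $ 3)\<^sup>2) = 0} \<and>
     L 2 \<inter> L 3 \<inter> L 4 = {p 1} \<and> L 1 \<inter> L 3 \<inter> L 5 = {p 4} \<and>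
     L 1 \<inter> L 2 \<inter> L 6 = {p 5} \<and> L 4 \<inter> L 5 \<inter> L 6 = {p 7} \<and>
     L 2 \<inter> L 5 = {p 2} \<and> L 1 \<inter> L 4 = {p 3} \<and> L 3 \<inter> L 6 = {p 6}"

definition quadratic_form :: "(complex ^ 3 \<Rightarrow> complex) \<Rightarrow> bool" where
  "quadratic_form F \<longleftrightarrow> (\<exists>A :: complex ^ 3 ^ 3. \<forall>v. F v = (\<Sum>i\<in>UNIV. \<Sum>j\<in>UNIV. A $ i $ j * v $ i * v $ j))"

definition no_common_factor :: "(complex ^ 3 \<Rightarrow> complex) \<Rightarrow> (complex ^ 3 \<Rightarrow> complex) \<Rightarrow> bool" where
  "no_common_factor F G \<longleftrightarrow> (\<forall>H A B.
     {H, A, B} \<subseteq> poly_funs {\<lambda>v. v $ k | k. True} \<and> F = (\<lambda>v. H v * A v) \<and> G = (\<lambda>v. H v * B v)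
     \<longrightarrow> (\<exists>c. H = (\<lambda>_. c)))"

definition from_pencil_of_conics ::
    "3 proj set set \<Rightarrow> 3 proj set \<Rightarrow> ((3 proj option \<Rightarrow> 3 proj) \<Rightarrow> 2 proj) \<Rightarrow> bool" where
  "from_pencil_of_conics \<B> S f \<longleftrightarrow> (\<exists>F G. quadratic_form F \<and> quadratic_form G \<and>
     (\<forall>a b. (\<forall>v. a * F v + b * G v = 0) \<longrightarrow> a = 0 \<and> b = 0) \<and> no_common_factor F G \<and>
     (\<forall>m\<in>blowup_complement \<B> S. \<forall>v. v \<noteq> 0 \<and> proj_pt v = m None \<and> m None \<notin> \<Union>\<B> \<longrightarrow>
        (F v \<noteq> 0 \<or> G v \<noteq> 0) \<and> f m = P1_pt (F v) (G v)))"

end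

theory Submission
  imports Defs "HOL-Algebra.Generated_Groups" "HOL-Complex_Analysis.Complex_Analysis"
begin

text \<open>Let \<open>x\<^sub>1, x\<^sub>2, x\<^sub>3\<close> be linear forms defining \<open>L\<^sub>1, L\<^sub>2, L\<^sub>3\<close>, scaled so that the other three lines are
  \<open>x\<^sub>i = x\<^sub>j\<close>. The Cremona transformation \<open>x\<^sub>i = 1 / y\<^sub>i\<close> identifies \<open>M\<close>, off the exceptional curves over
  \<open>p\<^sub>2\<close> and \<open>p\<^sub>3\<close>, with the complement of the concurrent lines \<open>y\<^sub>i = y\<^sub>j\<close>, and \<open>f = (y\<^sub>3 - y\<^sub>1 : y\<^sub>2 - y\<^sub>3)\<close>
  is given by the pencil of the conics \<open>x\<^sub>2 (x\<^sub>1 - x\<^sub>3)\<close> and \<open>x\<^sub>1 (x\<^sub>3 - x\<^sub>2)\<close>. With the normalization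
  \<open>y\<^sub>2 - y\<^sub>1 = 1\<close>, \<open>c = y\<^sub>3\<close> and the affine coordinate \<open>y\<close> of the line in which the marked points are
  \<open>1, \<infinity>, -1\<close>, the whole of \<open>M\<close> becomes the surface \<open>c\<^sup>2 = (1 - y\<^sup>2) b\<close> without its singular points
  \<open>(\<plusminus>1, 0, 0)\<close>; its fibres over \<open>y = \<plusminus>1\<close> are the double curves \<open>c\<^sup>2 = 0\<close>. The map
  \<open>(z, \<beta>) \<mapsto> (cos z, \<beta> sin z, \<beta>\<^sup>2)\<close> covers this surface by the plane without a discrete set, which is
  simply connected, and its deck group is the infinite dihedral group. Loops of the surface can be
  pushed into the section \<open>c = const\<close> over the plane without \<open>\<plusminus>1\<close>, and a loop of that section is null
  homotopic iff it lifts to a closed loop along \<open>cos\<close>, up to the squares of the meridians of \<open>\<plusminus>1\<close>.\<close>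

section \<open>Fundamental groups\<close>

text \<open>A loop of the surface may cross the double fibres, near which \<open>f\<close> has no
  section; this is what forces the detour through a covering. Lifted to a simply connected space, a
  path may be replaced by any other with the same ends, in particular by one over the section, and
  the ends of lifts tell which loops are null homotopic. The cosine is the universal orbifold
  covering of the affine line with points of order two at \<open>1\<close> and \<open>-1\<close>,
  and \<open>sin\<close> is the root of \<open>1 - y\<^sup>2\<close> that makes the double fibres
  reduced upstairs. For the kernel it is enough that two circles generate the group of the twice
  punctured plane: modulo their squares the words have a dihedral normal form, on which lifts can be
  evaluated. The coordinate \<open>b\<close> is there to see the exceptional curves over the double
  points: they are the double fibres, \<open>c\<close> vanishes on them, and \<open>b\<close> is
  their parameter up to a constant. Multiplicity exactly 2 takes two bounds, as a greatest order has
  a value only if it is bounded: the coordinate of the line is a regular multiple of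
  \<open>c\<^sup>2\<close>, and a transversal curve has the parameter \<open>c\<close>.\<close>

lemma path_const_fun [simp]: "path (\<lambda>_. a)"
  by (simp add: path_def)

lemma const_fun_ends [simp]: "pathstart (\<lambda>_. a) = a" "pathfinish (\<lambda>_. a) = a"
    "path_image (\<lambda>_::real. a) = {a}"
  by (auto simp: pathstart_def pathfinish_def path_image_def)

text \<open>Constant loops are written \<open>\<lambda>_. a\<close> instead of
  \<open>linepath a a\<close>, as the spaces here include products of projective spaces, where
  segments make no sense. The reparametrization waits at 0 during the first half.\<close>

lemma homotopic_paths_const_left:
  assumes "path p" "path_image p \<subseteq> S" "a = pathstart p"
  shows "homotopic_paths S ((\<lambda>_. a) +++ p) p"
proof (rule homotopic_paths_sym, rule homotopic_paths_reparametrize)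
  let ?f = "\<lambda>t::real. max 0 (2 * t - 1)"
  show "continuous_on {0..1} ?f" by (intro continuous_intros)
  show "((\<lambda>_. a) +++ p) t = p (?f t)" if "t \<in> {0..1}" for t
  proof (cases "t = 1/2")
    case True
    then show ?thesis unfolding True using assms by (simp add: joinpaths_def pathstart_def)
  qed (use that assms in \<open>auto simp: joinpaths_def pathstart_def max_def\<close>)
qed (use assms in auto)

text \<open>The stage \<open>s\<close> of the homotopy follows \<open>p\<close> up to the time
  \<open>s\<close> and returns: the time is \<open>s\<close> times a tent function of height
  1.\<close>

lemma homotopic_paths_reverse_right:
  assumes "path p" "path_image p \<subseteq> S" "a = pathstart p"
  shows "homotopic_paths S (p +++ reversepath p) (\<lambda>_. a)"
proof -
  have p: "continuous_on {0..1} p"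
    using assms by (auto simp: path_def)
  let ?A = "{0..1} \<times> {0..1} :: (real \<times> real) set"
  let ?h = "\<lambda>x. p (fst x * min (2 * snd x) (2 - 2 * snd x))"
  have "continuous_on ?A ?h"
    by (intro continuous_on_compose2 [OF p] continuous_intros) (auto simp: mult_le_one min_def)
  moreover have "?h ` ?A \<subseteq> S"
  proof -
    have "fst x * min (2 * snd x) (2 - 2 * snd x) \<in> {0..1}" if "x \<in> ?A" for x
      using that by (auto simp: mult_le_one min_def)
    then show ?thesis using assms(2) unfolding path_image_def by blast
  qed
  moreover have "?h (1, t) = (p +++ reversepath p) t" if "t \<in> {0..1}" for t
    using that by (auto simp: joinpaths_def reversepath_def min_def)
  ultimately have "homotopic_paths S (\<lambda>_. a) (p +++ reversepath p)"
    unfolding homotopic_paths using assms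
    by (intro exI[of _ ?h]) (auto simp: pathstart_def pathfinish_def joinpaths_def reversepath_def)
  then show ?thesis by (rule homotopic_paths_sym)
qed

lemma homotopic_paths_reverse_left:
  assumes "path p" "path_image p \<subseteq> S" "a = pathfinish p"
  shows "homotopic_paths S (reversepath p +++ p) (\<lambda>_. a)"
  using homotopic_paths_reverse_right[of "reversepath p"] assms by simp

definition loops_at :: "'a::topological_space set \<Rightarrow> 'a \<Rightarrow> (real \<Rightarrow> 'a) set" where
  "loops_at X a = {p. path p \<and> path_image p \<subseteq> X \<and> pathstart p = a \<and> pathfinish p = a}"

lemma loops_atD:
  assumes "p \<in> loops_at X a"
  shows "path p" "path_image p \<subseteq> X" "pathstart p = a" "pathfinish p = a"
  using assms by (auto simp: loops_at_def)

lemma loops_at_join: "p \<in> loops_at X a \<Longrightarrow> q \<in> loops_at X a \<Longrightarrow> p +++ q \<in> loops_at X a"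
  by (auto simp: loops_at_def path_image_join)

lemma loops_at_reverse: "p \<in> loops_at X a \<Longrightarrow> reversepath p \<in> loops_at X a"
  by (auto simp: loops_at_def)

lemma loops_at_const: "a \<in> X \<Longrightarrow> (\<lambda>_. a) \<in> loops_at X a"
  by (auto simp: loops_at_def)

lemma loops_at_image:
  assumes "p \<in> loops_at X a" "continuous_on X g" "g ` X \<subseteq> Y" "b = g a"
  shows "g \<circ> p \<in> loops_at Y b"
proof -
  have "path (g \<circ> p)"
    using assms(1,2) by (meson continuous_on_subset loops_atD(1,2) path_continuous_image)
  then show ?thesis
    using assms by (auto simp: loops_at_def path_image_compose pathstart_compose pathfinish_compose)
qed

lemma path_class_eq_iff:
  assumes "path p" "path_image p \<subseteq> X"
  shows "path_class X p = path_class X q \<longleftrightarrow> homotopic_paths X p q"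
proof
  assume "path_class X p = path_class X q"
  moreover have "p \<in> path_class X p" using assms by (simp add: path_class_def)
  ultimately show "homotopic_paths X p q" by (metis homotopic_paths_sym mem_Collect_eq path_class_def)
qed (auto simp: path_class_def intro: homotopic_paths_trans homotopic_paths_sym)

lemma path_class_eqI: "homotopic_paths X p q \<Longrightarrow> path_class X p = path_class X q"
  by (auto simp: path_class_def intro: homotopic_paths_trans homotopic_paths_sym)

lemma carrier_fundamental_group:
  "carrier (fundamental_group X a) = path_class X ` loops_at X a"
  by (simp add: fundamental_group_def loops_at_def)

lemma one_fundamental_group: "\<one>\<^bsub>fundamental_group X a\<^esub> = path_class X (\<lambda>_. a)"
  by (simp add: fundamental_group_def)

lemma mult_fundamental_group:
  assumes "p \<in> loops_at X a" "q \<in> loops_at X a"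
  shows "path_class X p \<otimes>\<^bsub>fundamental_group X a\<^esub> path_class X q = path_class X (p +++ q)"
proof -
  have "homotopic_paths X (p' +++ q') (p +++ q)"
    if "homotopic_paths X p p'" "homotopic_paths X q q'" for p' q'
    using that assms
    by (metis homotopic_paths_join homotopic_paths_sym loops_atD(3,4))
  moreover have "homotopic_paths X p p" "homotopic_paths X q q"
    using assms by (auto simp: loops_at_def)
  ultimately have "(\<exists>\<alpha>\<in>path_class X p. \<exists>\<beta>\<in>path_class X q. homotopic_paths X (\<alpha> +++ \<beta>) r)
      \<longleftrightarrow> homotopic_paths X (p +++ q) r" for r
    unfolding path_class_def mem_Collect_eq Bex_def
    by (meson homotopic_paths_trans homotopic_paths_sym)
  then show ?thesis
    unfolding fundamental_group_def by (simp add: path_class_def)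
qed

lemma group_fundamental_group:
  assumes "a \<in> X"
  shows "group (fundamental_group X a)"
proof (rule groupI)
  let ?G = "fundamental_group X a"
  show "\<one>\<^bsub>?G\<^esub> \<in> carrier ?G"
    using assms by (simp add: carrier_fundamental_group one_fundamental_group loops_at_const)
  fix A assume A: "A \<in> carrier ?G"
  then obtain p where p: "p \<in> loops_at X a" "A = path_class X p"
    by (auto simp: carrier_fundamental_group)
  show "\<one>\<^bsub>?G\<^esub> \<otimes>\<^bsub>?G\<^esub> A = A"
    using p assms by (auto simp: one_fundamental_group mult_fundamental_group loops_at_const loops_atD
        dest: loops_atD(2)[THEN subsetD] intro!: path_class_eqI homotopic_paths_const_left)
  have "path_class X (reversepath p) \<otimes>\<^bsub>?G\<^esub> A = \<one>\<^bsub>?G\<^esub>"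
    using p assms by (auto simp: one_fundamental_group mult_fundamental_group loops_at_reverse loops_atD
        dest: loops_atD(2)[THEN subsetD] intro!: path_class_eqI homotopic_paths_reverse_left)
  then show "\<exists>B\<in>carrier ?G. B \<otimes>\<^bsub>?G\<^esub> A = \<one>\<^bsub>?G\<^esub>"
    using p(1) by (metis carrier_fundamental_group image_eqI loops_at_reverse)
  fix B assume "B \<in> carrier ?G"
  then obtain q where q: "q \<in> loops_at X a" "B = path_class X q"
    by (auto simp: carrier_fundamental_group)
  show "A \<otimes>\<^bsub>?G\<^esub> B \<in> carrier ?G"
    using p q by (simp add: mult_fundamental_group carrier_fundamental_group loops_at_join)
  fix C assume "C \<in> carrier ?G"
  then obtain r where r: "r \<in> loops_at X a" "C = path_class X r"
    by (auto simp: carrier_fundamental_group)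
  have *: "homotopic_paths X ((p +++ q) +++ r) (p +++ (q +++ r))"
    using p q r by (intro homotopic_paths_sym[OF homotopic_paths_assoc]) (auto simp: loops_at_def)
  then show "A \<otimes>\<^bsub>?G\<^esub> B \<otimes>\<^bsub>?G\<^esub> C = A \<otimes>\<^bsub>?G\<^esub> (B \<otimes>\<^bsub>?G\<^esub> C)"
    using p q r by (simp add: mult_fundamental_group loops_at_join path_class_eqI[OF *])
qed

lemma inv_fundamental_group:
  assumes "p \<in> loops_at X a"
  shows "inv\<^bsub>fundamental_group X a\<^esub> path_class X p = path_class X (reversepath p)"
proof -
  have aX: "a \<in> X" using assms by (metis loops_atD(2,3) pathstart_in_path_image subsetD)
  interpret group "fundamental_group X a" using aX by (rule group_fundamental_group)
  show ?thesis
  proof (rule inv_equality)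
    show "path_class X (reversepath p) \<otimes>\<^bsub>fundamental_group X a\<^esub> path_class X p = \<one>\<^bsub>fundamental_group X a\<^esub>"
      using assms by (auto simp: one_fundamental_group mult_fundamental_group loops_at_reverse loops_atD
        dest: loops_atD(2)[THEN subsetD] intro!: path_class_eqI homotopic_paths_reverse_left)
  qed (use assms in \<open>auto simp: carrier_fundamental_group loops_at_reverse\<close>)
qed

text \<open>Homotopic loops have the same image class, so the union is that class and no
  representative has to be chosen.\<close>

definition induced_map :: "'b::topological_space set \<Rightarrow> ('a::topological_space \<Rightarrow> 'b) \<Rightarrow>
    (real \<Rightarrow> 'a) set \<Rightarrow> (real \<Rightarrow> 'b) set" where
  "induced_map Y g A = (\<Union>\<alpha>\<in>A. path_class Y (g \<circ> \<alpha>))"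

lemma induced_map_class:
  assumes "path p" "path_image p \<subseteq> X" "continuous_on X g" "g ` X \<subseteq> Y"
  shows "induced_map Y g (path_class X p) = path_class Y (g \<circ> p)"
proof -
  have "path_class Y (g \<circ> \<alpha>) = path_class Y (g \<circ> p)" if "\<alpha> \<in> path_class X p" for \<alpha>
  proof -
    have "homotopic_paths Y (g \<circ> p) (g \<circ> \<alpha>)"
      using that assms(3,4) by (intro homotopic_paths_continuous_image) (auto simp: path_class_def)
    then show ?thesis by (metis path_class_eqI)
  qed
  moreover have "p \<in> path_class X p" using assms by (simp add: path_class_def)
  ultimately show ?thesis
    unfolding induced_map_def by blast
qed

lemma joinpaths_compose: "g \<circ> (p +++ q) = (g \<circ> p) +++ (g \<circ> q)"
  by (auto simp: joinpaths_def fun_eq_iff)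

lemma reversepath_compose: "g \<circ> reversepath p = reversepath (g \<circ> p)"
  by (auto simp: reversepath_def fun_eq_iff)

lemma induced_map_hom:
  assumes "continuous_on X g" "g ` X \<subseteq> Y" "a \<in> X"
  shows "group_hom (fundamental_group X a) (fundamental_group Y (g a)) (induced_map Y g)"
proof -
  have *: "induced_map Y g (path_class X p) = path_class Y (g \<circ> p)" "g \<circ> p \<in> loops_at Y (g a)"
    if "p \<in> loops_at X a" for p
    using that assms by (simp_all add: induced_map_class[where X = X] loops_atD loops_at_image)
  have "induced_map Y g \<in> hom (fundamental_group X a) (fundamental_group Y (g a))"
    unfolding hom_def carrier_fundamental_group
    by (auto simp: * loops_at_join mult_fundamental_group joinpaths_compose)
  moreover have "g a \<in> Y" using assms by blast
  ultimately show ?thesis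
    using assms(3)
    by (auto intro!: group_hom.intro group_fundamental_group simp: group_hom_axioms_def)
qed

text \<open>Carries the orbifold kernel from the projective line to its affine coordinate.\<close>

lemma normal_vimage:
  assumes "group_hom G H h" "N \<lhd> H"
  shows "{x \<in> carrier G. h x \<in> N} \<lhd> G"
proof -
  interpret group_hom G H h by fact
  interpret N: normal N H by fact
  have one: "\<one>\<^bsub>H\<^esub> \<in> N" by simp
  have "subgroup {x \<in> carrier G. h x \<in> N} G"
    by (rule G.subgroupI) (use one in \<open>auto simp: hom_mult\<close>)
  then show ?thesis
    by (subst G.normal_inv_iff) (auto simp: N.inv_op_closed2 hom_mult)
qed

lemma normal_closure_normal:
  fixes G (structure)
  assumes "group G" "S \<subseteq> carrier G"
  shows "normal_closure G S \<lhd> G"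
proof -
  interpret group G by fact
  let ?F = "{N. N \<lhd> G \<and> S \<subseteq> N}"
  have "carrier G \<in> ?F" using assms(2) by (auto simp: normal_inv_iff subgroup_self)
  then have ne: "?F \<noteq> {}" by blast
  have "subgroup (\<Inter>?F) G"
    using ne by (intro subgroups_Inter) (auto simp: normal_imp_subgroup)
  moreover have "\<forall>x\<in>carrier G. \<forall>h\<in>\<Inter>?F. x \<otimes> h \<otimes> inv x \<in> \<Inter>?F"
  proof (intro ballI InterI)
    fix x h N assume "x \<in> carrier G" "h \<in> \<Inter>?F" "N \<in> ?F"
    then show "x \<otimes> h \<otimes> inv x \<in> N" by (simp add: normal.inv_op_closed2)
  qed
  ultimately show ?thesis unfolding normal_closure_def normal_inv_iff by (rule conjI)
qed

lemma normal_closure_subset: "S \<subseteq> normal_closure G S"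
  by (auto simp: normal_closure_def)

lemma normal_closure_least: "N \<lhd> G \<Longrightarrow> S \<subseteq> N \<Longrightarrow> normal_closure G S \<subseteq> N"
  by (auto simp: normal_closure_def)

text \<open>The section \<open>s\<close> inverts \<open>f_*\<close>: by \<open>surj\<close> the
  loops \<open>s \<circ> \<delta>\<close> represent all classes of \<open>M\<close>, and by
  \<open>ker\<close> two of them agree exactly if the underlying loops differ by \<open>K\<close>.
  \<open>retract\<close> makes the value of \<open>orbifold_pushforward\<close> independent of the
  loop that represents a class.\<close>

lemma orbifold_pushforward_iso:
  fixes M :: "'a::topological_space set" and f :: "'a \<Rightarrow> 2 proj" and D :: orbifold_data and a :: 'a
  defines "Y \<equiv> marked_points D"
  defines "G \<equiv> fundamental_group (- Y) (f a)"
  defines "K \<equiv> orbifold_kernel D (f a)"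
  assumes a: "a \<in> M" "f a \<notin> Y"
    and K: "K \<lhd> G"
    and s: "continuous_on (- Y) s" "s ` (- Y) \<subseteq> M" "\<And>y. y \<notin> Y \<Longrightarrow> f (s y) = y" "s (f a) = a"
    and f: "continuous_on {m \<in> M. f m \<notin> Y} f"
    and retract: "\<And>\<gamma>. \<gamma> \<in> loops_at {m \<in> M. f m \<notin> Y} a \<Longrightarrow> homotopic_paths M \<gamma> (s \<circ> (f \<circ> \<gamma>))"
    and surj: "\<And>p. p \<in> loops_at M a \<Longrightarrow> \<exists>\<delta>\<in>loops_at (- Y) (f a). homotopic_paths M p (s \<circ> \<delta>)"
    and ker: "\<And>\<delta>. \<delta> \<in> loops_at (- Y) (f a) \<Longrightarrow>
      homotopic_paths M (s \<circ> \<delta>) (\<lambda>_. a) \<longleftrightarrow> path_class (- Y) \<delta> \<in> K"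
  shows "orbifold_pushforward D f a
    \<in> iso (fundamental_group M a) (orbifold_fundamental_group D (f a))"
proof -
  let ?B = "- Y" and ?\<Phi> = "orbifold_pushforward D f a" and ?GM = "fundamental_group M a"
  interpret G: group G unfolding G_def using a by (simp add: group_fundamental_group)
  interpret K: normal K G by fact
  have fM: "orbifold_fundamental_group D (f a) = G Mod K"
    by (simp add: orbifold_fundamental_group_def G_def K_def Y_def)
  have carG: "carrier G = path_class ?B ` loops_at ?B (f a)"
    by (simp add: G_def carrier_fundamental_group)
  have sl: "s \<circ> \<delta> \<in> loops_at M a" if "\<delta> \<in> loops_at ?B (f a)" for \<delta>
    using loops_at_image[OF that s(1,2)] s(4) by simp
  have fs: "f \<circ> (s \<circ> \<delta>) \<in> loops_at ?B (f a)" "path_class ?B (f \<circ> (s \<circ> \<delta>)) = path_class ?B \<delta>"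
    if \<delta>: "\<delta> \<in> loops_at ?B (f a)" for \<delta>
  proof -
    have "f (s (\<delta> t)) = \<delta> t" if "t \<in> {0..1}" for t
    proof -
      have "\<delta> t \<in> path_image \<delta>" unfolding path_image_def using that by (rule imageI)
      then show ?thesis using loops_atD(2)[OF \<delta>] s(3) by blast
    qed
    then have *: "homotopic_paths ?B \<delta> (f \<circ> (s \<circ> \<delta>))"
      using loops_atD[OF \<delta>] by (intro homotopic_paths_eq) auto
    then show "path_class ?B (f \<circ> (s \<circ> \<delta>)) = path_class ?B \<delta>"
      by (metis path_class_eqI)
    have "path (f \<circ> (s \<circ> \<delta>))" "path_image (f \<circ> (s \<circ> \<delta>)) \<subseteq> ?B"
      using * homotopic_paths_imp_path homotopic_paths_imp_subset by blast+
    moreover have "pathstart (f \<circ> (s \<circ> \<delta>)) = f a" "pathfinish (f \<circ> (s \<circ> \<delta>)) = f a"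
      using loops_atD(3,4)[OF \<delta>] s(4) by (simp_all add: pathstart_compose pathfinish_compose)
    ultimately show "f \<circ> (s \<circ> \<delta>) \<in> loops_at ?B (f a)" by (simp add: loops_at_def)
  qed
  \<comment> \<open>This equivalence contains both halves: from left to right it makes the
    pushforward well defined, from right to left injective.\<close>
  have coset_iff: "homotopic_paths M (s \<circ> \<delta>) (s \<circ> \<delta>') \<longleftrightarrow>
      K #>\<^bsub>G\<^esub> path_class ?B \<delta> = K #>\<^bsub>G\<^esub> path_class ?B \<delta>'"
    if \<delta>: "\<delta> \<in> loops_at ?B (f a)" and \<delta>': "\<delta>' \<in> loops_at ?B (f a)" for \<delta> \<delta>'
  proof -
    interpret M: group ?GM using a by (simp add: group_fundamental_group)
    have l: "\<delta> +++ reversepath \<delta>' \<in> loops_at ?B (f a)"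
      using \<delta> \<delta>' by (simp add: loops_at_join loops_at_reverse)
    have "homotopic_paths M (s \<circ> \<delta>) (s \<circ> \<delta>') \<longleftrightarrow> path_class M (s \<circ> \<delta>) = path_class M (s \<circ> \<delta>')"
      using sl[OF \<delta>] by (simp add: path_class_eq_iff loops_atD)
    also have "\<dots> \<longleftrightarrow> path_class M (s \<circ> \<delta>) \<otimes>\<^bsub>?GM\<^esub> inv\<^bsub>?GM\<^esub> path_class M (s \<circ> \<delta>') = \<one>\<^bsub>?GM\<^esub>"
    proof -
      have "path_class M (s \<circ> \<delta>) \<in> carrier ?GM" "path_class M (s \<circ> \<delta>') \<in> carrier ?GM"
        using sl[OF \<delta>] sl[OF \<delta>'] by (auto simp: carrier_fundamental_group)
      then show ?thesis using M.inv_solve_right by (metis M.l_one M.one_closed)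
    qed
    also have "\<dots> \<longleftrightarrow> path_class M (s \<circ> (\<delta> +++ reversepath \<delta>')) = path_class M (\<lambda>_. a)"
      using sl[OF \<delta>] sl[OF \<delta>']
      by (simp add: inv_fundamental_group mult_fundamental_group one_fundamental_group
          loops_at_reverse joinpaths_compose reversepath_compose)
    also have "\<dots> \<longleftrightarrow> path_class ?B (\<delta> +++ reversepath \<delta>') \<in> K"
      using ker[OF l] sl[OF l] by (simp add: path_class_eq_iff loops_atD)
    also have "\<dots> \<longleftrightarrow> path_class ?B \<delta> \<otimes>\<^bsub>G\<^esub> inv\<^bsub>G\<^esub> path_class ?B \<delta>' \<in> K"
      using \<delta> \<delta>' by (simp add: G_def inv_fundamental_group mult_fundamental_group loops_at_reverse)
    also have "\<dots> \<longleftrightarrow> K #>\<^bsub>G\<^esub> path_class ?B \<delta> = K #>\<^bsub>G\<^esub> path_class ?B \<delta>'"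
      using \<delta> \<delta>' carG K.subgroup_axioms
      by (metis G.rcos_self G.repr_independence K.rcos_module K.is_subgroup G.is_group image_eqI)
    finally show ?thesis .
  qed
  \<comment> \<open>Every loop contributing to the union retracts to
    \<open>s \<circ> (f \<circ> \<gamma>)\<close> and so yields the same coset;
    \<open>s \<circ> \<delta>\<close> itself contributes, so the union is not empty.\<close>
  have \<Phi>: "?\<Phi> (path_class M (s \<circ> \<delta>)) = K #>\<^bsub>G\<^esub> path_class ?B \<delta>"
    if \<delta>: "\<delta> \<in> loops_at ?B (f a)" for \<delta>
  proof -
    have "K #>\<^bsub>G\<^esub> path_class ?B (f \<circ> \<gamma>) = K #>\<^bsub>G\<^esub> path_class ?B \<delta>"
      if \<gamma>: "\<gamma> \<in> path_class M (s \<circ> \<delta>)" "f ` path_image \<gamma> \<inter> Y = {}" for \<gamma>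
    proof -
      have h: "homotopic_paths M (s \<circ> \<delta>) \<gamma>" using \<gamma>(1) by (simp add: path_class_def)
      then have "\<gamma> \<in> loops_at {m \<in> M. f m \<notin> Y} a"
        using \<gamma>(2) loops_atD[OF sl[OF \<delta>]] homotopic_paths_imp_path[OF h] homotopic_paths_imp_subset[OF h]
          homotopic_paths_imp_pathstart[OF h] homotopic_paths_imp_pathfinish[OF h]
        by (auto simp: loops_at_def)
      moreover from this have "f \<circ> \<gamma> \<in> loops_at ?B (f a)"
        by (rule loops_at_image[OF _ f]) auto
      ultimately show ?thesis
        using coset_iff[OF _ \<delta>] homotopic_paths_sym[OF homotopic_paths_trans[OF h retract]] by blast
    qed
    moreover have "s \<circ> \<delta> \<in> path_class M (s \<circ> \<delta>)" "f ` path_image (s \<circ> \<delta>) \<inter> Y = {}"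
      "K #>\<^bsub>G\<^esub> path_class ?B (f \<circ> (s \<circ> \<delta>)) = K #>\<^bsub>G\<^esub> path_class ?B \<delta>"
      using loops_atD[OF sl[OF \<delta>]] loops_atD(2)[OF fs(1)[OF \<delta>]] fs(2)[OF \<delta>]
      by (auto simp: path_class_def path_image_compose image_image)
    ultimately show ?thesis
      unfolding orbifold_pushforward_def Let_def
      by (fold Y_def G_def K_def, fold G_def) blast
  qed
  have carM: "carrier ?GM = (\<lambda>\<delta>. path_class M (s \<circ> \<delta>)) ` loops_at ?B (f a)"
  proof
    show "carrier ?GM \<subseteq> (\<lambda>\<delta>. path_class M (s \<circ> \<delta>)) ` loops_at ?B (f a)"
    proof
      fix A assume "A \<in> carrier ?GM"
      then obtain p where p: "p \<in> loops_at M a" "A = path_class M p"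
        by (auto simp: carrier_fundamental_group)
      from surj[OF p(1)] obtain \<delta> where "\<delta> \<in> loops_at ?B (f a)" "homotopic_paths M p (s \<circ> \<delta>)" by blast
      with p(2) show "A \<in> (\<lambda>\<delta>. path_class M (s \<circ> \<delta>)) ` loops_at ?B (f a)"
        using path_class_eqI by blast
    qed
  qed (use sl in \<open>auto simp: carrier_fundamental_group\<close>)
  have carQ: "carrier (G Mod K) = (\<lambda>\<delta>. K #>\<^bsub>G\<^esub> path_class ?B \<delta>) ` loops_at ?B (f a)"
    by (auto simp: carrier_FactGroup carG)
  have "?\<Phi> \<in> hom ?GM (G Mod K)"
  proof (rule homI)
    fix A B assume "A \<in> carrier ?GM" "B \<in> carrier ?GM"
    then obtain \<delta> \<epsilon> where d: "\<delta> \<in> loops_at ?B (f a)" "A = path_class M (s \<circ> \<delta>)"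
      and e: "\<epsilon> \<in> loops_at ?B (f a)" "B = path_class M (s \<circ> \<epsilon>)"
      unfolding carM by blast
    show "?\<Phi> (A \<otimes>\<^bsub>?GM\<^esub> B) = ?\<Phi> A \<otimes>\<^bsub>G Mod K\<^esub> ?\<Phi> B"
    proof -
      have "A \<otimes>\<^bsub>?GM\<^esub> B = path_class M (s \<circ> (\<delta> +++ \<epsilon>))"
        using d e sl by (simp add: mult_fundamental_group joinpaths_compose)
      then have "?\<Phi> (A \<otimes>\<^bsub>?GM\<^esub> B) = K #>\<^bsub>G\<^esub> path_class ?B (\<delta> +++ \<epsilon>)"
        using \<Phi>[OF loops_at_join[OF d(1) e(1)]] by simp
      also have "path_class ?B (\<delta> +++ \<epsilon>) = path_class ?B \<delta> \<otimes>\<^bsub>G\<^esub> path_class ?B \<epsilon>"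
        using d e by (simp add: G_def mult_fundamental_group)
      finally show ?thesis
        using d e \<Phi> carG by (simp add: K.rcos_sum)
    qed
  qed (use \<Phi> in \<open>auto simp: carM carQ\<close>)
  moreover have "bij_betw ?\<Phi> (carrier ?GM) (carrier (G Mod K))"
  proof (rule bij_betw_imageI)
    show "inj_on ?\<Phi> (carrier ?GM)"
    proof (rule inj_onI)
      fix A B assume "A \<in> carrier ?GM" "B \<in> carrier ?GM" and eq: "?\<Phi> A = ?\<Phi> B"
      then obtain \<delta> \<epsilon> where d: "\<delta> \<in> loops_at ?B (f a)" "A = path_class M (s \<circ> \<delta>)"
        and e: "\<epsilon> \<in> loops_at ?B (f a)" "B = path_class M (s \<circ> \<epsilon>)"
        unfolding carM by blast
      show "A = B"
        unfolding d e using eq \<Phi>[OF d(1)] \<Phi>[OF e(1)] coset_iff[OF d(1) e(1)] d(2) e(2)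
        by (intro path_class_eqI) simp
    qed
    show "?\<Phi> ` carrier ?GM = carrier (G Mod K)"
      unfolding carM carQ image_image using \<Phi> by (intro image_cong) auto
  qed
  ultimately show ?thesis unfolding fM iso_def by simp
qed

section \<open>A universal covering\<close>

text \<open>A loop is moved to a polynomial one and contracted along segments to a common point
  \<open>v\<close>. The points \<open>v\<close> for which some segment hits a given point of
  \<open>S\<close> form the image of a two-parameter family, hence a set of measure zero in
  dimension at least three.\<close>

lemma simply_connected_Compl_countable:
  fixes S :: "'a::euclidean_space set"
  assumes "countable S" "closed S" "3 \<le> DIM('a)"
  shows "simply_connected (- S)"
  unfolding simply_connected_eq_contractible_loop_some
proof (intro conjI allI impI)
  show "path_connected (- S)"
    using assms by (intro path_connected_complement_countable) auto
  fix p :: "real \<Rightarrow> 'a"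
  assume p: "path p \<and> path_image p \<subseteq> - S \<and> pathfinish p = pathstart p"
  have "open (- S)" using assms by auto
  with p obtain e where e: "e > 0" "\<And>h. path h \<Longrightarrow> pathfinish h = pathstart h \<Longrightarrow>
      (\<And>t. t \<in> {0..1} \<Longrightarrow> norm (h t - p t) < e) \<Longrightarrow> homotopic_loops (- S) p h"
    using homotopic_nearby_loops[of p "- S"] by metis
  obtain g where g: "polynomial_function g" "pathstart g = pathstart p" "pathfinish g = pathfinish p"
      "\<And>t. t \<in> {0..1} \<Longrightarrow> norm (g t - p t) < e"
    using path_approx_polynomial_function[of p e] p e(1) by auto
  have pg: "homotopic_loops (- S) p g"
    using g p by (intro e(2)) (auto simp: path_polynomial_function)
  then have gS: "path_image g \<subseteq> - S" using homotopic_loops_imp_subset by blast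
  \<comment> \<open>\<open>k q (s, t)\<close> is the only \<open>v\<close> for which the segment
    from \<open>g t\<close> to \<open>v\<close> is at \<open>q\<close> at the time \<open>s\<close>;
    at \<open>s = 0\<close> the segment is on the loop, which avoids \<open>S\<close>.\<close>
  define k where "k q x = (1 / fst x) *\<^sub>R (q - (1 - fst x) *\<^sub>R g (snd x))" for q and x :: "real \<times> real"
  have "negligible (k q ` ({0<..1} \<times> {0..1}))" for q
  proof (rule negligible_differentiable_image_lowdim)
    have "k q differentiable at x" if "x \<in> {0<..1} \<times> {0..1}" for x
    proof -
      have "g differentiable at (snd x)"
        using g(1) by (rule differentiable_at_polynomial_function)
      then have "(\<lambda>x. g (snd x)) differentiable at x"
        using differentiable_compose[of g snd x UNIV]
        by (simp add: bounded_linear_imp_differentiable bounded_linear_snd differentiable_at_withinI)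
      moreover have "fst x \<noteq> 0" using that by auto
      ultimately show ?thesis
        unfolding k_def
        by (intro differentiable_scaleR differentiable_diff differentiable_divide differentiable_const
            bounded_linear_imp_differentiable[OF bounded_linear_fst]) auto
    qed
    then show "k q differentiable_on ({0<..1} \<times> {0..1})"
      by (simp add: differentiable_at_imp_differentiable_on)
  qed (use assms in auto)
  then have "negligible (\<Union>q\<in>S. k q ` ({0<..1} \<times> {0..1}))"
    using assms(1) by (intro negligible_countable_Union) auto
  then have "(\<Union>q\<in>S. k q ` ({0<..1} \<times> {0..1})) \<noteq> UNIV"
    using non_negligible_UNIV by metis
  then obtain v where v: "\<And>q. q \<in> S \<Longrightarrow> v \<notin> k q ` ({0<..1} \<times> {0..1})" by blast
  have "closed_segment (g t) v \<subseteq> - S" if t: "t \<in> {0..1}" for t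
  proof
    fix x assume "x \<in> closed_segment (g t) v"
    then obtain s where s: "0 \<le> s" "s \<le> 1" "x = (1 - s) *\<^sub>R g t + s *\<^sub>R v"
      by (auto simp: closed_segment_def)
    show "x \<in> - S"
    proof
      assume "x \<in> S"
      show False
      proof (cases "s = 0")
        case True
        moreover have "g t \<in> path_image g" unfolding path_image_def using t by (rule imageI)
        ultimately show ?thesis using \<open>x \<in> S\<close> s gS by auto
      next
        case False
        then have "v = k x (s, t)" using s by (simp add: k_def)
        moreover have "(s, t) \<in> {0<..1} \<times> {0..1}" using False s t by auto
        ultimately show ?thesis using v[OF \<open>x \<in> S\<close>] by blast
      qed
    qed
  qed
  note seg = this
  have "homotopic_loops (- S) g (linepath v v)"
    using g p seg by (intro homotopic_loops_linear) (auto simp: path_polynomial_function linepath_refl)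
  moreover have "v \<in> - S" using seg[of 0] by auto
  ultimately show "\<exists>a. a \<in> - S \<and> homotopic_loops (- S) p (linepath a a)"
    using pg homotopic_loops_trans by blast
qed

text \<open>If \<open>p\<close> is injective on \<open>V\<close>, the image of \<open>V\<close> is
  evenly covered by the translates of \<open>V\<close>: translates that meet do so at images of the
  same point of \<open>V\<close>, so \<open>free\<close> makes them equal.\<close>

lemma covering_space_orbits:
  fixes p :: "'a::topological_space \<Rightarrow> 'b::topological_space"
  assumes cont: "continuous_on C p" and im: "p ` C = S"
    and opn: "\<And>U. openin (top_of_set C) U \<Longrightarrow> openin (top_of_set S) (p ` U)"
    and H: "\<And>g. g \<in> H \<Longrightarrow> \<exists>g'. homeomorphism C C g g'"
    and orbit: "\<And>x x'. x \<in> C \<Longrightarrow> x' \<in> C \<Longrightarrow> p x = p x' \<longleftrightarrow> (\<exists>g\<in>H. x' = g x)"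
    and free: "\<And>g g' x. g \<in> H \<Longrightarrow> g' \<in> H \<Longrightarrow> x \<in> C \<Longrightarrow> g x = g' x \<Longrightarrow> \<forall>y\<in>C. g y = g' y"
    and inj: "\<And>x. x \<in> C \<Longrightarrow> \<exists>V. openin (top_of_set C) V \<and> x \<in> V \<and> inj_on p V"
  shows "covering_space C p S"
proof (rule covering_spaceI)
  fix x assume "x \<in> S"
  then obtain c where c: "c \<in> C" "p c = x" using im by blast
  obtain V where V: "openin (top_of_set C) V" "c \<in> V" "inj_on p V" using inj[OF c(1)] by blast
  then have VC: "V \<subseteq> C" using openin_imp_subset by blast
  have gC: "g y \<in> C" if "g \<in> H" "y \<in> C" for g y
    using H[OF that(1)] that(2) unfolding homeomorphism_def by blast
  have pg: "p (g y) = p y" if "g \<in> H" "y \<in> C" for g y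
    using orbit[of y "g y"] that gC by auto
  let ?v = "(\<lambda>g. g ` V) ` H"
  have "\<Union>?v = C \<inter> p -` (p ` V)"
  proof (intro equalityI subsetI)
    fix y assume "y \<in> C \<inter> p -` (p ` V)"
    then obtain u where "u \<in> V" "p y = p u" "y \<in> C" by auto
    then show "y \<in> \<Union>?v" using orbit[of u y] VC by auto
  qed (use VC gC pg in auto)
  moreover have gV: "openin (top_of_set C) (g ` V)" if "g \<in> H" for g
    using H[OF that] V(1) homeomorphism_imp_open_map by blast
  moreover have "pairwise disjnt ?v"
  proof (rule pairwiseI)
    fix A B assume "A \<in> ?v" "B \<in> ?v" "A \<noteq> B"
    then obtain g g' where g: "g \<in> H" "A = g ` V" "g' \<in> H" "B = g' ` V" by blast
    show "disjnt A B"
    proof (rule ccontr)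
      assume "\<not> disjnt A B"
      then obtain u u' where u: "u \<in> V" "u' \<in> V" "g u = g' u'"
        unfolding disjnt_def g by blast
      then have "p u = p u'" using pg[OF g(1), of u] pg[OF g(3), of u'] VC by (metis subsetD)
      then have "u = u'" using V(3) u by (auto simp: inj_on_def)
      then have "\<forall>y\<in>C. g y = g' y" using free[OF g(1,3), of u] u VC by auto
      then have "A = B" unfolding g using VC by (intro image_cong) auto
      with \<open>A \<noteq> B\<close> show False by simp
    qed
  qed
  moreover have "\<exists>q. homeomorphism U (p ` V) p q" if U: "U \<in> ?v" for U
  proof -
    obtain g where g: "g \<in> H" "U = g ` V" using U by blast
    have UC: "U \<subseteq> C" using gV[OF g(1)] g(2) openin_imp_subset by blast
    have "p ` U = p ` V" unfolding g(2) image_image using pg[OF g(1)] VC by (intro image_cong) auto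
    moreover have "inj_on p U"
      unfolding g(2) inj_on_def using pg[OF g(1)] VC V(3) by (auto simp: inj_on_def subset_iff)
    moreover have "openin (top_of_set (p ` V)) (p ` W)" if "openin (top_of_set U) W" for W
    proof -
      have "openin (top_of_set C) W" using that gV[OF g(1)] g(2) openin_trans by blast
      then have "openin (top_of_set S) (p ` W)" by (rule opn)
      moreover have "p ` W \<subseteq> p ` V" using openin_imp_subset[OF that] calculation \<open>p ` U = p ` V\<close> by blast
      moreover have "p ` V \<subseteq> S" using im VC by blast
      ultimately show ?thesis by (meson openin_subset_trans)
    qed
    ultimately show ?thesis
      using homeomorphism_injective_open_map[of U p "p ` V"] continuous_on_subset[OF cont UC] by metis
  qed
  ultimately show "\<exists>T. x \<in> T \<and> openin (top_of_set S) T \<and>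
                 (\<exists>v. \<Union>v = C \<inter> p -` T \<and> (\<forall>u\<in>v. openin (top_of_set C) u) \<and>
                   pairwise disjnt v \<and> (\<forall>u\<in>v. \<exists>q. homeomorphism u T p q))"
    using V c(2) opn[OF V(1)] by (intro exI[of _ "p ` V"] conjI exI[of _ ?v]) auto
qed (use assms in auto)

section \<open>The covering of the conic surface and its deck transformations\<close>

lemma sin_cos_complex_2pi [simp]:
  "sin (2 * of_int k * of_real pi :: complex) = 0" "cos (2 * of_int k * of_real pi :: complex) = 1"
proof -
  have "2 * of_int k * of_real pi = (of_real ((2 * pi) * of_int k) :: complex)" by simp
  then show "sin (2 * of_int k * of_real pi :: complex) = 0" "cos (2 * of_int k * of_real pi :: complex) = 1"
    by (simp_all only: sin_of_real cos_of_real sin_int_2pin cos_int_2pin of_real_0 of_real_1)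
qed

lemma cos_eq_cos_iff:
  "cos w = cos z \<longleftrightarrow> (\<exists>\<epsilon>\<in>{1, -1}. \<exists>k::int. w = \<epsilon> * z + 2 * of_int k * of_real pi)" for w z :: complex
  by (auto simp: complex_cos_eq Ints_def)

text \<open>The removed points \<open>(k * pi, 0)\<close> are those that the formula of
  \<open>conic_proj\<close> sends to the two singular points of the surface.\<close>

definition conic_cover :: "(complex \<times> complex) set" where
  "conic_cover = {(z, \<beta>). sin z \<noteq> 0 \<or> \<beta> \<noteq> 0}"

definition conic_surface :: "(complex \<times> complex \<times> complex) set" where
  "conic_surface = {(y, c, b). c\<^sup>2 = (1 - y\<^sup>2) * b \<and> (y\<^sup>2 \<noteq> 1 \<or> b \<noteq> 0)}"

text \<open>Substituting \<open>y = cos z\<close> turns \<open>1 - y\<^sup>2\<close> into a square,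
  so that the equation \<open>c\<^sup>2 = (1 - y\<^sup>2) * b\<close> is solved by means of a square
  root \<open>\<beta>\<close> of \<open>b\<close>.\<close>

definition conic_proj :: "complex \<times> complex \<Rightarrow> complex \<times> complex \<times> complex" where
  "conic_proj = (\<lambda>(z, \<beta>). (cos z, \<beta> * sin z, \<beta>\<^sup>2))"

text \<open>On the \<open>z\<close>-line these are the translations by multiples of
  \<open>2 * pi\<close> and the reflections in the zeros of \<open>sin\<close>; with the sign on
  \<open>\<beta>\<close>, a reflection fixes only removed points.\<close>

definition deck :: "complex \<Rightarrow> int \<Rightarrow> complex \<times> complex \<Rightarrow> complex \<times> complex" where
  "deck \<epsilon> k = (\<lambda>(z, \<beta>). (\<epsilon> * z + 2 * of_int k * of_real pi, \<epsilon> * \<beta>))"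

lemma conic_cover_eq: "conic_cover = - (range (\<lambda>k::int. (of_int k * of_real pi, 0)))"
  by (auto simp: conic_cover_def sin_eq_0)

lemma simply_connected_conic_cover: "simply_connected conic_cover"
proof -
  let ?f = "\<lambda>k::int. (of_int k * of_real pi, 0) :: complex \<times> complex"
  have "\<exists>e>0. \<forall>x\<in>range ?f. \<forall>y\<in>range ?f. dist y x < e \<longrightarrow> y = x"
  \<comment> \<open>Distinct removed points have distance at least \<open>pi\<close>, so they form a
    closed set; the surrounding space has real dimension four.\<close>
  proof (intro exI[of _ pi] conjI ballI impI)
    fix x y assume "x \<in> range ?f" "y \<in> range ?f" "dist y x < pi"
    then obtain j k where jk: "x = ?f j" "y = ?f k" by blast
    have "dist y x = norm (of_int (k - j) * complex_of_real pi)"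
      by (simp add: jk dist_Pair_Pair dist_norm left_diff_distrib)
    also have "\<dots> = \<bar>k - j\<bar> * pi" by (simp only: norm_mult norm_of_int norm_of_real) simp
    finally have "\<bar>k - j\<bar> * pi < 1 * pi" using \<open>dist y x < pi\<close> by simp
    then have "k = j" by (simp del: mult_1)
    then show "y = x" using jk by simp
  qed simp
  then have "closed (range ?f)"
    by (metis discrete_imp_closed)
  then show ?thesis
    unfolding conic_cover_eq by (intro simply_connected_Compl_countable) auto
qed

lemma deck_in_cover:
  assumes "\<epsilon> \<in> {1, -1}"
  shows "deck \<epsilon> k x \<in> conic_cover \<longleftrightarrow> x \<in> conic_cover"
  using assms by (auto simp: deck_def conic_cover_def sin_add cos_add split: prod.splits)

lemma conic_proj_eq_iff:
  assumes "x \<in> conic_cover" "x' \<in> conic_cover"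
  shows "conic_proj x = conic_proj x' \<longleftrightarrow> (\<exists>\<epsilon>\<in>{1, -1}. \<exists>k. x' = deck \<epsilon> k x)"
proof -
  obtain z \<beta> z' \<beta>' where x: "x = (z, \<beta>)" "x' = (z', \<beta>')" by fastforce
  show ?thesis
  proof
    assume "conic_proj x = conic_proj x'"
    then have eq: "cos z' = cos z" "\<beta> * sin z = \<beta>' * sin z'" "\<beta>'\<^sup>2 = \<beta>\<^sup>2"
      by (simp_all add: x conic_proj_def)
    obtain \<epsilon> and k :: int where e: "\<epsilon> = 1 \<or> \<epsilon> = -1" and z': "z' = \<epsilon> * z + 2 * of_int k * of_real pi"
      using eq(1) unfolding cos_eq_cos_iff by blast
    have s: "sin z' = \<epsilon> * sin z" using e by (auto simp: z' sin_add)
    show "\<exists>\<epsilon>\<in>{1, -1}. \<exists>k. x' = deck \<epsilon> k x"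
    proof (cases "sin z = 0")
      case False
      then have "\<beta>' = \<epsilon> * \<beta>" using eq(2) e by (auto simp: s)
      then show ?thesis using e z' by (auto simp: x deck_def)
    next
      \<comment> \<open>At a zero of \<open>sin\<close> both signs are possible for the cosine,
        since \<open>z = - z + 2 * n * pi\<close>; the sign is read off from
        \<open>\<beta>' = \<plusminus> \<beta>\<close> instead.\<close>
      case True
      then obtain n :: int where n: "z = of_int n * of_real pi" by (auto simp: sin_eq_0)
      have "\<beta>' = \<beta> \<or> \<beta>' = - \<beta>" using eq(3) by (simp add: power2_eq_iff)
      moreover have "z' = 1 * z + 2 * of_int (if \<epsilon> = 1 then k else k - n) * of_real pi"
        "z' = -1 * z + 2 * of_int (if \<epsilon> = 1 then k + n else k) * of_real pi"
        using e by (auto simp: z' n algebra_simps)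
      ultimately have "x' = deck 1 (if \<epsilon> = 1 then k else k - n) x \<or> x' = deck (-1) (if \<epsilon> = 1 then k + n else k) x"
        unfolding x deck_def by auto
      then show ?thesis by blast
    qed
  next
    assume "\<exists>\<epsilon>\<in>{1, -1}. \<exists>k. x' = deck \<epsilon> k x"
    then show "conic_proj x = conic_proj x'"
      by (auto simp: x deck_def conic_proj_def cos_add sin_add cos_diff sin_diff)
  qed
qed

lemma deck_free:
  assumes "\<epsilon> \<in> {1, -1}" "\<epsilon>' \<in> {1, -1}" "x \<in> conic_cover" "deck \<epsilon> k x = deck \<epsilon>' k' x"
  shows "\<epsilon> = \<epsilon>' \<and> k = k'"
proof -
  obtain z \<beta> where x: "x = (z, \<beta>)" by fastforce
  have eq: "\<epsilon> * z + 2 * of_int k * of_real pi = \<epsilon>' * z + 2 * of_int k' * of_real pi" "\<epsilon> * \<beta> = \<epsilon>' * \<beta>"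
    using assms(4) by (simp_all add: x deck_def)
  have "\<epsilon> = \<epsilon>'"
  proof (rule ccontr)
    assume ne: "\<epsilon> \<noteq> \<epsilon>'"
    then have "2 * z = 2 * (of_int (k' - k) * of_real pi) \<or> 2 * z = 2 * (of_int (k - k') * of_real pi)"
      using assms(1,2) eq(1) by (auto simp: algebra_simps)
    then have "z = of_int (k' - k) * of_real pi \<or> z = of_int (k - k') * of_real pi"
      by (simp only: mult_cancel_left) simp
    then have "sin z = 0" unfolding sin_eq_0 by (metis of_real_mult of_real_of_int_eq)
    moreover have "\<beta> = 0" using eq(2) ne by simp
    ultimately show False using assms(3) by (simp add: x conic_cover_def)
  qed
  with eq(1) show ?thesis by simp
qed

lemma open_cos_ball: "open (cos ` ball z r)" for z :: complex
proof (rule open_mapping_thm[of cos UNIV])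
  show "\<not> cos constant_on (UNIV :: complex set)"
  proof
    assume "cos constant_on (UNIV :: complex set)"
    then have "cos (0::complex) = cos (of_real pi)" unfolding constant_on_def by (metis UNIV_I)
    then show False by (simp add: cos_of_real)
  qed
qed (auto intro!: holomorphic_intros)

lemma open_square_ball: "open ((\<lambda>z. z\<^sup>2) ` ball z r)" for z :: complex
proof (rule open_mapping_thm[of "\<lambda>z. z\<^sup>2" UNIV])
  show "\<not> (\<lambda>z. z\<^sup>2) constant_on (UNIV :: complex set)"
  proof
    assume "(\<lambda>z. z\<^sup>2) constant_on (UNIV :: complex set)"
    then have "(0::complex)\<^sup>2 = 1\<^sup>2" unfolding constant_on_def by (metis UNIV_I)
    then show False by simp
  qed
qed (auto intro!: holomorphic_intros)

lemma conic_proj_in_surface: "x \<in> conic_cover \<Longrightarrow> conic_proj x \<in> conic_surface"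
  by (auto simp: conic_cover_def conic_proj_def conic_surface_def power_mult_distrib cos_squared_eq
      split: prod.splits)

lemma conic_proj_surj:
  assumes "w \<in> conic_surface"
  shows "w \<in> conic_proj ` conic_cover"
proof -
  obtain y c b where w: "w = (y, c, b)" by (metis prod_cases3)
  have eq: "c\<^sup>2 = (1 - y\<^sup>2) * b" "y\<^sup>2 \<noteq> 1 \<or> b \<noteq> 0" using assms by (auto simp: w conic_surface_def)
  define z where "z = Arccos y"
  have y: "y = cos z" by (simp add: z_def)
  have s: "(sin z)\<^sup>2 = 1 - y\<^sup>2" by (simp add: y sin_squared_eq)
  show ?thesis
  proof (cases "sin z = 0")
    case True
    then have "y\<^sup>2 = 1" using s by simp
    then have "c = 0" "b \<noteq> 0" using eq by auto
    then show ?thesis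
      using True by (intro image_eqI[of _ _ "(z, csqrt b)"]) (auto simp: w y conic_proj_def conic_cover_def)
  next
    case False
    then have "b = (c / sin z)\<^sup>2" using eq(1) by (simp add: power_divide flip: s)
    then show ?thesis
      using False by (intro image_eqI[of _ _ "(z, c / sin z)"]) (auto simp: w y conic_proj_def conic_cover_def)
  qed
qed

text \<open>Openness of \<open>conic_proj\<close> in metric form. If \<open>sin z0\<close> is not
  zero, \<open>\<beta>\<close> is forced to be \<open>c / sin z\<close>; otherwise \<open>z\<close>
  and \<open>\<beta>\<close> are found near the centre because the cosine and squaring are open
  maps, and \<open>c\<close> is right up to its sign.\<close>

lemma conic_proj_local_lift:
  assumes x: "(z0, \<beta>0) \<in> conic_cover" and e: "e > 0"
  shows "\<exists>d>0. \<forall>w\<in>conic_surface. dist w (conic_proj (z0, \<beta>0)) < d \<longrightarrow>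
    (\<exists>z \<beta>. (z, \<beta>) \<in> conic_cover \<and> dist z z0 < e \<and> dist \<beta> \<beta>0 < e \<and> conic_proj (z, \<beta>) = w)"
proof (cases "sin z0 = 0")
  case False
  have "isCont (\<lambda>x. snd x / sin (fst x)) (z0, \<beta>0 * sin z0)"
    using False by (intro continuous_intros) auto
  then have "\<exists>d>0. \<forall>x. dist x (z0, \<beta>0 * sin z0) < d \<longrightarrow> dist (snd x / sin (fst x)) \<beta>0 < e"
    using e False by (auto simp: continuous_at_eps_delta dist_commute)
  then obtain d1 where d1: "d1 > 0" "\<And>x. dist x (z0, \<beta>0 * sin z0) < d1 \<Longrightarrow> dist (snd x / sin (fst x)) \<beta>0 < e"
    by blast
  have "isCont sin z0" by (intro continuous_intros)
  then obtain d2 where d2: "d2 > 0" "\<And>z. dist z z0 < d2 \<Longrightarrow> sin z \<noteq> 0"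
    using False continuous_at_avoid[of z0 sin 0] by (auto simp: dist_commute)
  define r where "r = min (d1 / 2) (min d2 e)"
  have r: "r > 0" using d1 d2 e by (simp add: r_def)
  have "cos z0 \<in> cos ` ball z0 r" using r by simp
  then obtain d3 where d3: "d3 > 0" "ball (cos z0) d3 \<subseteq> cos ` ball z0 r"
    using open_cos_ball[of z0 r] by (metis openE)
  show ?thesis
  proof (intro exI[of _ "min d3 (d1 / 2)"] conjI ballI impI)
    fix w assume w: "w \<in> conic_surface" "dist w (conic_proj (z0, \<beta>0)) < min d3 (d1 / 2)"
    obtain y c b where wy: "w = (y, c, b)" by (metis prod_cases3)
    have eq: "c\<^sup>2 = (1 - y\<^sup>2) * b" using w(1) by (simp add: wy conic_surface_def)
    have dy: "dist y (cos z0) < d3" and dc: "dist c (\<beta>0 * sin z0) < d1 / 2"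
      using w(2) dist_fst_le[of w "conic_proj (z0, \<beta>0)"] dist_fst_le[of "snd w" "snd (conic_proj (z0, \<beta>0))"]
        dist_snd_le[of w "conic_proj (z0, \<beta>0)"]
      by (auto simp: wy conic_proj_def)
    have "y \<in> cos ` ball z0 r" using dy d3(2) by (auto simp: dist_commute)
    then obtain z where z: "dist z z0 < r" "y = cos z" by (metis dist_commute imageE mem_ball)
    have s: "sin z \<noteq> 0" using d2(2) z(1) by (simp add: r_def)
    have "dist (z, c) (z0, \<beta>0 * sin z0) \<le> dist z z0 + dist c (\<beta>0 * sin z0)"
      by (simp add: dist_Pair_Pair sqrt_sum_squares_le_sum)
    also have "\<dots> < d1" using z(1) dc by (simp add: r_def)
    finally have "dist (c / sin z) \<beta>0 < e" using d1(2)[of "(z, c)"] by simp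
    moreover have "(c / sin z)\<^sup>2 = b"
      using eq s by (simp add: z(2) power_divide flip: sin_squared_eq)
    ultimately show "\<exists>z \<beta>. (z, \<beta>) \<in> conic_cover \<and> dist z z0 < e \<and> dist \<beta> \<beta>0 < e \<and> conic_proj (z, \<beta>) = w"
      using s z by (intro exI[of _ z] exI[of _ "c / sin z"]) (auto simp: r_def conic_cover_def conic_proj_def wy)
  qed (use d1 d3 in auto)
next
  case True
  then have b0: "\<beta>0 \<noteq> 0" using x by (auto simp: conic_cover_def)
  define r where "r = min e (norm \<beta>0)"
  have r: "r > 0" using e b0 by (simp add: r_def)
  have "cos z0 \<in> cos ` ball z0 r" using r by simp
  then obtain d3 where d3: "d3 > 0" "ball (cos z0) d3 \<subseteq> cos ` ball z0 r"
    using open_cos_ball[of z0 r] by (metis openE)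
  have "\<beta>0\<^sup>2 \<in> (\<lambda>z. z\<^sup>2) ` ball \<beta>0 r" using r by simp
  then obtain d4 where d4: "d4 > 0" "ball (\<beta>0\<^sup>2) d4 \<subseteq> (\<lambda>z. z\<^sup>2) ` ball \<beta>0 r"
    using open_square_ball[of \<beta>0 r] by (metis openE)
  have c2: "sin (2 * z0) = 0" "cos (2 * z0) = 1"
    using True by (simp_all add: sin_double cos_double cos_squared_eq)
  show ?thesis
  proof (intro exI[of _ "min d3 d4"] conjI ballI impI)
    fix w assume w: "w \<in> conic_surface" "dist w (conic_proj (z0, \<beta>0)) < min d3 d4"
    obtain y c b where wy: "w = (y, c, b)" by (metis prod_cases3)
    have eq: "c\<^sup>2 = (1 - y\<^sup>2) * b" using w(1) by (simp add: wy conic_surface_def)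
    have dy: "dist y (cos z0) < d3" and db: "dist b (\<beta>0\<^sup>2) < d4"
      using w(2) dist_fst_le[of w "conic_proj (z0, \<beta>0)"] dist_snd_le[of "snd w" "snd (conic_proj (z0, \<beta>0))"]
        dist_snd_le[of w "conic_proj (z0, \<beta>0)"]
      by (auto simp: wy conic_proj_def)
    have "y \<in> cos ` ball z0 r" using dy d3(2) by (auto simp: dist_commute)
    then obtain z where z: "dist z z0 < r" "y = cos z" by (metis dist_commute imageE mem_ball)
    have "b \<in> (\<lambda>z. z\<^sup>2) ` ball \<beta>0 r" using db d4(2) by (auto simp: dist_commute)
    then obtain \<beta> where \<beta>: "dist \<beta> \<beta>0 < r" "b = \<beta>\<^sup>2" by (metis (no_types, lifting) dist_commute imageE mem_ball)
    have bn: "\<beta> \<noteq> 0" using \<beta>(1) by (auto simp: r_def dist_norm)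
    have "c\<^sup>2 = (\<beta> * sin z)\<^sup>2"
      using eq by (simp add: z(2) \<beta>(2) power_mult_distrib sin_squared_eq mult.commute)
    then consider "c = \<beta> * sin z" | "c = - (\<beta> * sin z)" by (auto simp: power2_eq_iff)
    then show "\<exists>z \<beta>. (z, \<beta>) \<in> conic_cover \<and> dist z z0 < e \<and> dist \<beta> \<beta>0 < e \<and> conic_proj (z, \<beta>) = w"
    proof cases
      case 1
      then show ?thesis using z \<beta> bn
        by (intro exI[of _ z] exI[of _ \<beta>]) (auto simp: r_def conic_cover_def conic_proj_def wy)
    next
      case 2
      \<comment> \<open>Reflecting \<open>z\<close> in \<open>z0\<close> keeps the cosine and the
        distance to \<open>z0\<close> but changes the sign of \<open>sin\<close>.\<close>
      have "cos (2 * z0 - z) = cos z" "sin (2 * z0 - z) = - sin z"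
        using c2 by (simp_all add: cos_diff sin_diff)
      moreover have "dist (2 * z0 - z) z0 = dist z z0" by (simp add: dist_norm norm_minus_commute)
      ultimately show ?thesis using z \<beta> bn 2
        by (intro exI[of _ "2 * z0 - z"] exI[of _ \<beta>]) (auto simp: r_def conic_cover_def conic_proj_def wy)
    qed
  qed (use d3 d4 in auto)
qed

text \<open>Away from the zeros of \<open>sin\<close> this is local injectivity of the cosine. At a
  zero, the ball of radius \<open>norm \<beta>0\<close> about \<open>\<beta>0\<close> contains no
  two opposite numbers, so \<open>b\<close> determines \<open>\<beta>\<close>, then \<open>c\<close>
  determines \<open>sin z\<close>, and together with \<open>cos z\<close> this determines
  \<open>z\<close> modulo \<open>2 * pi\<close>.\<close>

lemma conic_proj_inj_nbhd:
  assumes x: "x \<in> conic_cover"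
  shows "\<exists>V. openin (top_of_set conic_cover) V \<and> x \<in> V \<and> inj_on conic_proj V"
proof -
  obtain z0 \<beta>0 where x0: "x = (z0, \<beta>0)" by fastforce
  have "\<exists>V. open V \<and> x \<in> V \<and> inj_on conic_proj V"
  proof (cases "sin z0 = 0")
    case False
    have hol: "cos holomorphic_on (UNIV :: complex set)" by (intro holomorphic_intros)
    have "deriv cos z0 \<noteq> 0" using False by (simp add: DERIV_imp_deriv[OF DERIV_cos])
    then obtain r where r: "r > 0" "inj_on cos (ball z0 r)"
      using has_complex_derivative_locally_injective[of cos UNIV z0] hol by (metis UNIV_I open_UNIV)
    have "isCont sin z0" by (intro continuous_intros)
    then obtain d where d: "d > 0" "\<And>z. dist z z0 < d \<Longrightarrow> sin z \<noteq> 0"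
      using False continuous_at_avoid[of z0 sin 0] by (auto simp: dist_commute)
    have "inj_on conic_proj (ball z0 (min r d) \<times> UNIV)"
    proof (rule inj_onI, clarsimp simp: conic_proj_def)
      fix z \<beta> z' \<beta>'
      assume z: "dist z0 z < r" "dist z0 z < d" "dist z0 z' < r"
        and eq: "cos z = cos z'" "\<beta> * sin z = \<beta>' * sin z'"
      have "z = z'" using r(2) z eq(1) by (auto simp: inj_on_def)
      then show "z = z' \<and> \<beta> = \<beta>'" using d(2)[of z] z(2) eq(2) by (simp add: dist_commute)
    qed
    then show ?thesis
      using r(1) d(1) by (intro exI[of _ "ball z0 (min r d) \<times> UNIV"]) (auto simp: x0 open_Times)
  next
    case True
    then have b0: "\<beta>0 \<noteq> 0" using x by (auto simp: x0 conic_cover_def)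
    have "inj_on conic_proj (ball z0 1 \<times> ball \<beta>0 (norm \<beta>0))"
    proof (rule inj_onI, clarsimp simp: conic_proj_def)
      fix z \<beta> z' \<beta>'
      assume z: "dist z0 z < 1" "dist z0 z' < 1" "dist \<beta>0 \<beta> < norm \<beta>0" "dist \<beta>0 \<beta>' < norm \<beta>0"
        and eq: "cos z = cos z'" "\<beta> * sin z = \<beta>' * sin z'" "\<beta>\<^sup>2 = \<beta>'\<^sup>2"
      have "\<beta> \<noteq> - \<beta>'"
      proof
        assume "\<beta> = - \<beta>'"
        then have "2 * norm \<beta>0 = norm ((\<beta>0 - \<beta>) + (\<beta>0 - \<beta>'))" by (simp add: norm_mult)
        also have "\<dots> \<le> norm (\<beta>0 - \<beta>) + norm (\<beta>0 - \<beta>')" by (rule norm_triangle_ineq)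
        finally show False using z by (simp add: dist_norm)
      qed
      then have \<beta>: "\<beta> = \<beta>'" using eq(3) by (simp add: power2_eq_iff)
      moreover have "\<beta> \<noteq> 0" using z(3) by auto
      ultimately have "sin z = sin z'" using eq(2) by simp
      then have "exp (\<i> * z) = exp (\<i> * z')" using eq(1) by (simp add: exp_Euler)
      then obtain n :: int where "\<i> * z = \<i> * z' + of_int (2 * n) * of_real pi * \<i>"
        unfolding exp_eq by auto
      then have "\<i> * z = \<i> * (z' + of_int (2 * n) * of_real pi)" by (simp add: algebra_simps)
      then have n: "z = z' + of_int (2 * n) * of_real pi" by simp
      have "dist z z' \<le> dist z0 z + dist z0 z'" by (metis dist_commute dist_triangle)
      then have "norm (z - z') < 2" using z by (simp add: dist_norm)
      then have "norm (of_int (2 * n) * complex_of_real pi) < 2" by (simp add: n)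
      then have "\<bar>2 * n\<bar> * pi < 2" by (simp only: norm_mult norm_of_int norm_of_real) simp
      then have "n = 0"
      proof -
        have "real_of_int \<bar>2 * n\<bar> * 2 \<le> real_of_int \<bar>2 * n\<bar> * pi"
          using pi_ge_two by (intro mult_left_mono) auto
        then have "real_of_int \<bar>2 * n\<bar> < 1" using \<open>\<bar>2 * n\<bar> * pi < 2\<close> by linarith
        then show ?thesis by linarith
      qed
      then show "z = z' \<and> \<beta> = \<beta>'" using n \<beta> by simp
    qed
    then show ?thesis
      using b0 by (intro exI[of _ "ball z0 1 \<times> ball \<beta>0 (norm \<beta>0)"]) (auto simp: x0 open_Times)
  qed
  then obtain V where "open V" "x \<in> V" "inj_on conic_proj V" by blast
  then show ?thesis
    using x by (intro exI[of _ "conic_cover \<inter> V"]) (auto intro: inj_on_subset)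
qed

lemma covering_space_conic: "covering_space conic_cover conic_proj conic_surface"
proof (rule covering_space_orbits[where H = "{deck \<epsilon> k | \<epsilon> k. \<epsilon> \<in> {1, -1}}"])
  show cont: "continuous_on conic_cover conic_proj"
    unfolding conic_proj_def case_prod_unfold by (intro continuous_intros)
  show "conic_proj ` conic_cover = conic_surface"
    using conic_proj_in_surface conic_proj_surj by blast
  fix U assume U: "openin (top_of_set conic_cover) U"
  show "openin (top_of_set conic_surface) (conic_proj ` U)"
    unfolding openin_euclidean_subtopology_iff
  proof (intro conjI ballI)
    show "conic_proj ` U \<subseteq> conic_surface"
      using U conic_proj_in_surface openin_imp_subset by blast
    fix w assume "w \<in> conic_proj ` U"
    then obtain z0 \<beta>0 where w: "(z0, \<beta>0) \<in> U" "w = conic_proj (z0, \<beta>0)" by auto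
    obtain e where e: "e > 0" "\<And>x'. x' \<in> conic_cover \<Longrightarrow> dist x' (z0, \<beta>0) < e \<Longrightarrow> x' \<in> U"
      using U w(1) unfolding openin_euclidean_subtopology_iff by blast
    have "(z0, \<beta>0) \<in> conic_cover" "e / 2 > 0" using w(1) U openin_imp_subset e by auto
    then obtain d where d: "d > 0" "\<And>w'. w' \<in> conic_surface \<Longrightarrow> dist w' w < d \<Longrightarrow>
        \<exists>z \<beta>. (z, \<beta>) \<in> conic_cover \<and> dist z z0 < e / 2 \<and> dist \<beta> \<beta>0 < e / 2 \<and> conic_proj (z, \<beta>) = w'"
      using conic_proj_local_lift[of z0 \<beta>0 "e / 2"] w(2) by auto
    have "w' \<in> conic_proj ` U" if w': "w' \<in> conic_surface" "dist w' w < d" for w'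
    proof -
      obtain z \<beta> where z: "(z, \<beta>) \<in> conic_cover" "dist z z0 < e / 2" "dist \<beta> \<beta>0 < e / 2" "conic_proj (z, \<beta>) = w'"
        using d(2)[OF w'] by blast
      have "dist (z, \<beta>) (z0, \<beta>0) \<le> dist z z0 + dist \<beta> \<beta>0"
        by (simp add: dist_Pair_Pair sqrt_sum_squares_le_sum)
      then have "(z, \<beta>) \<in> U" using z by (intro e(2)) auto
      then show ?thesis using z(4) by blast
    qed
    then show "\<exists>e>0. \<forall>x'\<in>conic_surface. dist x' w < e \<longrightarrow> x' \<in> conic_proj ` U"
      using d(1) by blast
  qed
next
  fix g assume "g \<in> {deck \<epsilon> k | \<epsilon> k. \<epsilon> \<in> {1, -1}}"
  then obtain \<epsilon> k where g: "g = deck \<epsilon> k" "\<epsilon> \<in> {1, -1}" by blast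
  \<comment> \<open>Reflections are their own inverses, translations are inverted by
    \<open>- k\<close>.\<close>
  define k' where "k' = (if \<epsilon> = 1 then - k else k)"
  have inv: "deck \<epsilon> k' (deck \<epsilon> k x) = x" "deck \<epsilon> k (deck \<epsilon> k' x) = x" for x
    using g(2) by (auto simp: deck_def k'_def split: prod.splits)
  have cont: "continuous_on conic_cover (deck \<epsilon> j)" for j
    unfolding deck_def case_prod_unfold by (intro continuous_intros)
  have "homeomorphism conic_cover conic_cover (deck \<epsilon> k) (deck \<epsilon> k')"
    by (rule homeomorphismI) (use cont inv deck_in_cover[OF g(2)] in auto)
  then show "\<exists>g'. homeomorphism conic_cover conic_cover g g'" using g(1) by blast
next
  fix x x' assume "x \<in> conic_cover" "x' \<in> conic_cover"
  then show "conic_proj x = conic_proj x' \<longleftrightarrow> (\<exists>g\<in>{deck \<epsilon> k | \<epsilon> k. \<epsilon> \<in> {1, -1}}. x' = g x)"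
    by (subst conic_proj_eq_iff) blast+
next
  fix g g' x
  assume "g \<in> {deck \<epsilon> k | \<epsilon> k. \<epsilon> \<in> {1, -1}}" "g' \<in> {deck \<epsilon> k | \<epsilon> k. \<epsilon> \<in> {1, -1}}"
    "x \<in> conic_cover" "g x = g' x"
  then obtain \<epsilon> k \<epsilon>' k' where "g = deck \<epsilon> k" "\<epsilon> \<in> {1, -1}" "g' = deck \<epsilon>' k'" "\<epsilon>' \<in> {1, -1}"
    and "x \<in> conic_cover" "deck \<epsilon> k x = deck \<epsilon>' k' x" by blast
  then show "\<forall>y\<in>conic_cover. g y = g' y" using deck_free[of \<epsilon> \<epsilon>' x k k'] by simp
qed (rule conic_proj_inj_nbhd)

section \<open>Generation of fundamental groups by an open cover\<close>

definition path_from :: "'a::topological_space set \<Rightarrow> (real \<Rightarrow> 'a) \<Rightarrow> 'a \<Rightarrow> 'a \<Rightarrow> bool" where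
  "path_from X p x y \<longleftrightarrow> path p \<and> path_image p \<subseteq> X \<and> pathstart p = x \<and> pathfinish p = y"

lemma path_from_join: "path_from X p x y \<Longrightarrow> path_from X q y z \<Longrightarrow> path_from X (p +++ q) x z"
  by (auto simp: path_from_def path_image_join)

lemma path_from_reverse: "path_from X p x y \<Longrightarrow> path_from X (reversepath p) y x"
  by (auto simp: path_from_def)

lemma path_from_subset: "path_from X p x y \<Longrightarrow> X \<subseteq> Y \<Longrightarrow> path_from Y p x y"
  by (auto simp: path_from_def)

lemma path_from_const: "x \<in> X \<Longrightarrow> path_from X (\<lambda>_. x) x x"
  by (auto simp: path_from_def)

lemma path_from_loop: "path_from X p x x \<longleftrightarrow> p \<in> loops_at X x"
  by (auto simp: path_from_def loops_at_def)

lemma hp_refl: "path_from X p x y \<Longrightarrow> homotopic_paths X p p"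
  by (simp add: path_from_def)

lemma hp_assoc:
  "path_from X p x y \<Longrightarrow> path_from X q y z \<Longrightarrow> path_from X r z w \<Longrightarrow>
    homotopic_paths X ((p +++ q) +++ r) (p +++ (q +++ r))"
  by (rule homotopic_paths_sym[OF homotopic_paths_assoc]) (auto simp: path_from_def)

lemma hp_cong:
  "homotopic_paths X p p' \<Longrightarrow> homotopic_paths X q q' \<Longrightarrow> path_from X p x y \<Longrightarrow> path_from X q y z \<Longrightarrow>
    homotopic_paths X (p +++ q) (p' +++ q')"
  by (rule homotopic_paths_join) (auto simp: path_from_def)

lemma hp_right:
  "homotopic_paths X q q' \<Longrightarrow> path_from X p x y \<Longrightarrow> path_from X q y z \<Longrightarrow>
    homotopic_paths X (p +++ q) (p +++ q')"
  using hp_cong hp_refl by blast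

lemma hp_left:
  "homotopic_paths X p p' \<Longrightarrow> path_from X p x y \<Longrightarrow> path_from X q y z \<Longrightarrow>
    homotopic_paths X (p +++ q) (p' +++ q)"
  using hp_cong hp_refl by blast

lemma hp_cancel:
  assumes p: "path_from X p x y" and q: "path_from X q x z"
  shows "homotopic_paths X (p +++ (reversepath p +++ q)) q"
proof -
  have "homotopic_paths X (p +++ (reversepath p +++ q)) ((p +++ reversepath p) +++ q)"
    using hp_assoc[OF p path_from_reverse[OF p] q] by (rule homotopic_paths_sym)
  also have "homotopic_paths X \<dots> ((\<lambda>_. x) +++ q)"
    using p q by (intro hp_left[OF _ path_from_join q] homotopic_paths_reverse_right path_from_reverse)
      (auto simp: path_from_def)
  also have "homotopic_paths X \<dots> q"
    using q by (intro homotopic_paths_const_left) (auto simp: path_from_def)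
  finally show ?thesis .
qed

lemma hp_cancel':
  assumes p: "path_from X p y x" and q: "path_from X q x z"
  shows "homotopic_paths X (reversepath p +++ (p +++ q)) q"
  using hp_cancel[OF path_from_reverse[OF p] q] by simp

lemma path_class_mult:
  assumes "path_from X p a a" "path_from X q a a" "homotopic_paths X (p +++ q) r"
  shows "path_class X p \<otimes>\<^bsub>fundamental_group X a\<^esub> path_class X q = path_class X r"
  using assms by (simp add: path_from_loop mult_fundamental_group path_class_eqI)

text \<open>A generation theorem in the style of van Kampen: cutting a loop into pieces inside
  single sets \<open>W j\<close> and inserting the paths \<open>\<rho>\<close> writes it, up to
  conjugation, as a product of the change loops of \<open>\<rho>_change\<close>. Intersections of
  the \<open>W j\<close> may be disconnected.\<close>

lemma fundamental_group_eq_subgroup: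
  fixes X :: "'a::real_normed_vector set" and \<rho> :: "'j \<Rightarrow> 'a \<Rightarrow> real \<Rightarrow> 'a" and x0 :: 'a
  defines "G \<equiv> fundamental_group X x0"
  assumes x0: "x0 \<in> X" and \<Gamma>: "subgroup \<Gamma> G"
    and W: "\<And>j. j \<in> J \<Longrightarrow> openin (top_of_set X) (W j)" "X \<subseteq> (\<Union>j\<in>J. W j)"
    and \<rho>: "\<And>j p. j \<in> J \<Longrightarrow> p \<in> W j \<Longrightarrow> path_from X (\<rho> j p) p x0"
    and \<rho>_hom: "\<And>j p q \<eta>. j \<in> J \<Longrightarrow> path_from (W j) \<eta> p q \<Longrightarrow> homotopic_paths X (\<eta> +++ \<rho> j q) (\<rho> j p)"
    and \<rho>_change: "\<And>j k p. j \<in> J \<Longrightarrow> k \<in> J \<Longrightarrow> p \<in> W j \<Longrightarrow> p \<in> W k \<Longrightarrow>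
      path_class X (reversepath (\<rho> j p) +++ \<rho> k p) \<in> \<Gamma>"
  shows "\<Gamma> = carrier G"
proof
  interpret G: group G unfolding G_def using x0 by (rule group_fundamental_group)
  interpret \<Gamma>: subgroup \<Gamma> G by fact
  show "\<Gamma> \<subseteq> carrier G" by (rule \<Gamma>.subset)
  have conj: "path_class X (reversepath (\<rho> j x0) +++ (\<delta> +++ \<rho> j x0)) \<in> \<Gamma>"
    if \<delta>: "\<delta> \<in> loops_at X x0" and j: "j \<in> J" "x0 \<in> W j" for \<delta> j
  proof -
    let ?T = "\<lambda>j s k t. reversepath (\<rho> j (\<delta> s)) +++ (subpath s t \<delta> +++ \<rho> k (\<delta> t))"
    \<comment> \<open>Connectedness of the unit interval does the cutting: \<open>R\<close> is an
      equivalence relation that holds locally. Quantifying over all \<open>j\<close> and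
      \<open>k\<close> makes it transitive whichever set is chosen at the intermediate time.\<close>
    define R where "R s t \<longleftrightarrow> (\<forall>j\<in>J. \<forall>k\<in>J. \<delta> s \<in> W j \<and> \<delta> t \<in> W k \<longrightarrow> path_class X (?T j s k t) \<in> \<Gamma>)" for s t
    have \<delta>X: "\<delta> t \<in> X" if "t \<in> {0..1}" for t
      using loops_atD(2)[OF \<delta>] that unfolding path_image_def by blast
    have sub: "path_from X (subpath s t \<delta>) (\<delta> s) (\<delta> t)" if "s \<in> {0..1}" "t \<in> {0..1}" for s t
      unfolding path_from_def
      using that loops_atD[OF \<delta>] path_image_subpath_subset[of s t \<delta>] by auto
    have T: "path_from X (?T j s k t) x0 x0"
      if "s \<in> {0..1}" "t \<in> {0..1}" "j \<in> J" "k \<in> J" "\<delta> s \<in> W j" "\<delta> t \<in> W k" for j s k t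
      using that by (intro path_from_join[OF path_from_reverse[OF \<rho>] path_from_join[OF sub \<rho>]])
    have "R 0 1"
    proof (rule connected_equivalence_relation[of "{0..1}"])
      fix s t :: real assume R: "R s t" and st: "s \<in> {0..1}" "t \<in> {0..1}"
      show "R t s"
        unfolding R_def
      proof (intro ballI impI)
        fix j k assume jk: "j \<in> J" "k \<in> J" "\<delta> t \<in> W j \<and> \<delta> s \<in> W k"
        have "path_class X (?T k s j t) \<in> \<Gamma>" using R jk unfolding R_def by blast
        then have "inv\<^bsub>G\<^esub> path_class X (?T k s j t) \<in> \<Gamma>" by simp
        also have "inv\<^bsub>G\<^esub> path_class X (?T k s j t) = path_class X (reversepath (?T k s j t))"
          using T[OF st, of k j] jk unfolding G_def path_from_loop by (simp add: inv_fundamental_group)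
        also have "reversepath (?T k s j t) = (reversepath (\<rho> j (\<delta> t)) +++ subpath t s \<delta>) +++ \<rho> k (\<delta> s)"
          using jk st \<rho> by (simp add: reversepath_joinpaths path_from_def reversepath_subpath)
        also have "path_class X \<dots> = path_class X (?T j t k s)"
          using jk st by (intro path_class_eqI hp_assoc[OF path_from_reverse[OF \<rho>[of j "\<delta> t"]] sub[of t s] \<rho>[of k "\<delta> s"]]) auto
        finally show "path_class X (?T j t k s) \<in> \<Gamma>" .
      qed
    next
      fix s t u :: real
      assume R: "R s t" "R t u" and stu: "s \<in> {0..1}" "t \<in> {0..1}" "u \<in> {0..1}"
      show "R s u"
        unfolding R_def
      proof (intro ballI impI)
        fix j k assume jk: "j \<in> J" "k \<in> J" "\<delta> s \<in> W j \<and> \<delta> u \<in> W k"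
        obtain m where m: "m \<in> J" "\<delta> t \<in> W m" using \<delta>X[OF stu(2)] W(2) by blast
        \<comment> \<open>The detour to the base point along \<open>\<rho> m\<close> and back
          cancels.\<close>
        let ?a = "reversepath (\<rho> j (\<delta> s))" and ?b = "subpath s t \<delta>" and ?c = "\<rho> m (\<delta> t)"
          and ?d = "subpath t u \<delta>" and ?e = "\<rho> k (\<delta> u)"
        have a: "path_from X ?a x0 (\<delta> s)" and b: "path_from X ?b (\<delta> s) (\<delta> t)"
          and c: "path_from X ?c (\<delta> t) x0" and d: "path_from X ?d (\<delta> t) (\<delta> u)"
          and e: "path_from X ?e (\<delta> u) x0"
          using jk m stu by (auto intro!: \<rho> sub path_from_reverse)
        note c' = path_from_reverse[OF c]
        have "homotopic_paths X ((?a +++ (?b +++ ?c)) +++ (reversepath ?c +++ (?d +++ ?e)))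
            (?a +++ ((?b +++ ?c) +++ (reversepath ?c +++ (?d +++ ?e))))"
          by (rule hp_assoc[OF a path_from_join[OF b c] path_from_join[OF c' path_from_join[OF d e]]])
        also have "homotopic_paths X \<dots> (?a +++ (?b +++ (?c +++ (reversepath ?c +++ (?d +++ ?e)))))"
          by (rule hp_right[OF hp_assoc[OF b c path_from_join[OF c' path_from_join[OF d e]]] a
                path_from_join[OF path_from_join[OF b c] path_from_join[OF c' path_from_join[OF d e]]]])
        also have "homotopic_paths X \<dots> (?a +++ (?b +++ (?d +++ ?e)))"
          by (rule hp_right[OF hp_right[OF hp_cancel[OF c path_from_join[OF d e]] b
                  path_from_join[OF c path_from_join[OF c' path_from_join[OF d e]]]] a
                path_from_join[OF b path_from_join[OF c path_from_join[OF c' path_from_join[OF d e]]]]])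
        also have "homotopic_paths X \<dots> (?a +++ ((?b +++ ?d) +++ ?e))"
          by (rule hp_right[OF homotopic_paths_sym[OF hp_assoc[OF b d e]] a
                path_from_join[OF b path_from_join[OF d e]]])
        also have "homotopic_paths X \<dots> (?T j s k u)"
        proof (rule hp_right[OF hp_left[OF _ path_from_join[OF b d] e] a path_from_join[OF path_from_join[OF b d] e]])
          show "homotopic_paths X (?b +++ ?d) (subpath s u \<delta>)"
            using loops_atD[OF \<delta>] stu by (intro homotopic_join_subpaths) auto
        qed
        finally have "path_class X (?T j s m t) \<otimes>\<^bsub>G\<^esub> path_class X (?T m t k u) = path_class X (?T j s k u)"
          unfolding G_def using T stu jk m by (intro path_class_mult) auto
        moreover have "path_class X (?T j s m t) \<in> \<Gamma>" "path_class X (?T m t k u) \<in> \<Gamma>"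
          using R jk m unfolding R_def by auto
        ultimately show "path_class X (?T j s k u) \<in> \<Gamma>" by (metis \<Gamma>.m_closed)
      qed
    next
      fix t0 :: real assume t0: "t0 \<in> {0..1}"
      obtain j where j: "j \<in> J" "\<delta> t0 \<in> W j" using \<delta>X[OF t0] W(2) by blast
      have "continuous_on {0..1} \<delta>" "\<delta> \<in> {0..1} \<rightarrow> X" using loops_atD(1)[OF \<delta>] \<delta>X by (auto simp: path_def)
      then have "openin (top_of_set {0..1}) ({0..1} \<inter> \<delta> -` W j)"
        using W(1)[OF j(1)] by (rule continuous_openin_preimage)
      then obtain e where e: "e > 0" "\<And>t. t \<in> {0..1} \<Longrightarrow> dist t t0 < e \<Longrightarrow> \<delta> t \<in> W j"
        using t0 j(2) unfolding openin_euclidean_subtopology_iff by (metis IntD2 IntI vimageD vimageI)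
      \<comment> \<open>Inside one set \<open>W j\<close> the piece of the loop is homotopic to
        \<open>\<rho> j\<close> at its start followed by the reverse of \<open>\<rho> j\<close> at
        its end, so a product of two change loops remains.\<close>
      have "R t0 t" if t: "t \<in> {0..1} \<inter> ball t0 e" for t
        unfolding R_def
      proof (intro ballI impI)
        fix l k assume lk: "l \<in> J" "k \<in> J" "\<delta> t0 \<in> W l \<and> \<delta> t \<in> W k"
        have t1: "t \<in> {0..1}" using t by simp
        have "path_image (subpath t0 t \<delta>) \<subseteq> W j"
        proof -
          have "closed_segment t0 t \<subseteq> {0..1} \<inter> ball t0 e"
            using t t0 e(1) by (intro closed_segment_subset convex_Int) auto
          then show ?thesis
            unfolding path_image_subpath_gen using e(2) by (auto simp: dist_commute subset_iff)
        qed
        then have S: "path_from (W j) (subpath t0 t \<delta>) (\<delta> t0) (\<delta> t)"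
          using sub[OF t0 t1] by (simp add: path_from_def)
        have tj: "\<delta> t \<in> W j" using e(2)[OF t1] t by (simp add: dist_commute)
        let ?S = "subpath t0 t \<delta>" and ?l = "\<rho> l (\<delta> t0)" and ?k = "\<rho> k (\<delta> t)" and ?j0 = "\<rho> j (\<delta> t0)"
          and ?j1 = "\<rho> j (\<delta> t)"
        have l: "path_from X ?l (\<delta> t0) x0" and k: "path_from X ?k (\<delta> t) x0"
          and j0: "path_from X ?j0 (\<delta> t0) x0" and j1: "path_from X ?j1 (\<delta> t) x0"
          and S': "path_from X ?S (\<delta> t0) (\<delta> t)"
          using lk j tj t0 t1 by (auto intro!: \<rho> sub)
        note l' = path_from_reverse[OF l] and j1' = path_from_reverse[OF j1]
        have "homotopic_paths X ((reversepath ?l +++ ?j0) +++ (reversepath ?j1 +++ ?k))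
            (reversepath ?l +++ (?j0 +++ (reversepath ?j1 +++ ?k)))"
          by (rule hp_assoc[OF l' j0 path_from_join[OF j1' k]])
        also have "homotopic_paths X \<dots> (reversepath ?l +++ ((?S +++ ?j1) +++ (reversepath ?j1 +++ ?k)))"
          by (rule hp_right[OF hp_left[OF homotopic_paths_sym[OF \<rho>_hom[OF j(1) S]] j0 path_from_join[OF j1' k]]
                l' path_from_join[OF j0 path_from_join[OF j1' k]]])
        also have "homotopic_paths X \<dots> (reversepath ?l +++ (?S +++ (?j1 +++ (reversepath ?j1 +++ ?k))))"
          by (rule hp_right[OF hp_assoc[OF S' j1 path_from_join[OF j1' k]] l'
                path_from_join[OF path_from_join[OF S' j1] path_from_join[OF j1' k]]])
        also have "homotopic_paths X \<dots> (?T l t0 k t)"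
          by (rule hp_right[OF hp_right[OF hp_cancel[OF j1 k] S' path_from_join[OF j1 path_from_join[OF j1' k]]]
                l' path_from_join[OF S' path_from_join[OF j1 path_from_join[OF j1' k]]]])
        finally have "path_class X (reversepath ?l +++ ?j0) \<otimes>\<^bsub>G\<^esub> path_class X (reversepath ?j1 +++ ?k)
            = path_class X (?T l t0 k t)"
          unfolding G_def by (intro path_class_mult path_from_join[OF l' j0] path_from_join[OF j1' k])
        then show "path_class X (?T l t0 k t) \<in> \<Gamma>"
          using \<rho>_change j tj lk by (metis \<Gamma>.m_closed)
      qed
      then show "\<exists>T. openin (top_of_set {0..1}) T \<and> t0 \<in> T \<and> (\<forall>x\<in>T. R t0 x)"
        using t0 e(1) by (intro exI[of _ "{0..1} \<inter> ball t0 e"]) auto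
    qed auto
    then have "path_class X (?T j 0 j 1) \<in> \<Gamma>"
      using j loops_atD(3,4)[OF \<delta>] unfolding R_def by (auto simp: pathstart_def pathfinish_def)
    then show ?thesis
      using loops_atD(3,4)[OF \<delta>] by (simp add: pathstart_def pathfinish_def)
  qed
  show "carrier G \<subseteq> \<Gamma>"
  proof
    fix h assume h: "h \<in> carrier G"
    obtain j where j: "j \<in> J" "x0 \<in> W j" using x0 W(2) by blast
    have r: "path_from X (\<rho> j x0) x0 x0" by (rule \<rho>[OF j])
    let ?g = "path_class X (\<rho> j x0)"
    have g: "?g \<in> carrier G" using r by (auto simp: G_def carrier_fundamental_group path_from_loop)
    \<comment> \<open>\<open>conj\<close> yields \<open>h\<close> when it is applied to a loop
      representing the conjugate of \<open>h\<close> by the class of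
      \<open>\<rho> j x0\<close>.\<close>
    have "?g \<otimes>\<^bsub>G\<^esub> h \<otimes>\<^bsub>G\<^esub> inv\<^bsub>G\<^esub> ?g \<in> carrier G" using g h by simp
    then obtain \<delta> where \<delta>: "\<delta> \<in> loops_at X x0" "?g \<otimes>\<^bsub>G\<^esub> h \<otimes>\<^bsub>G\<^esub> inv\<^bsub>G\<^esub> ?g = path_class X \<delta>"
      by (auto simp: G_def carrier_fundamental_group)
    have "path_class X (reversepath (\<rho> j x0) +++ (\<delta> +++ \<rho> j x0)) = inv\<^bsub>G\<^esub> ?g \<otimes>\<^bsub>G\<^esub> (path_class X \<delta> \<otimes>\<^bsub>G\<^esub> ?g)"
      using r \<delta>(1) unfolding path_from_loop G_def
      by (simp add: inv_fundamental_group mult_fundamental_group loops_at_join loops_at_reverse)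
    also have "\<dots> = h"
      unfolding \<delta>(2)[symmetric] using g h by (simp add: G.m_assoc G.inv_solve_left')
    finally show "h \<in> \<Gamma>" using conj[OF \<delta>(1) j] by simp
  qed
qed

section \<open>The plane without two points\<close>

abbreviation twice_punctured :: "complex set" where
  "twice_punctured \<equiv> - {1, -1}"

lemma homotopic_paths_starlike:
  fixes S :: "'a::real_normed_vector set"
  assumes "starlike S" "S \<subseteq> X" "path_from S p x y" "path_from S q x y"
  shows "homotopic_paths X p q"
proof -
  have "homotopic_paths S p q"
    using starlike_imp_simply_connected[OF assms(1)] assms(3,4)
    unfolding simply_connected_eq_homotopic_paths path_from_def by auto
  then show ?thesis using assms(2) homotopic_paths_subset by blast
qed

lemma path_from_linepath:
  "closed_segment x y \<subseteq> S \<Longrightarrow> path_from S (linepath x y) x y"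
  by (simp add: path_from_def)

text \<open>Of the real axis one of the three intervals cut out by the punctures is kept. Each set
  is starlike about \<open>2 * j\<close>, and two of them meet in the two open half planes.\<close>

definition slit_plane :: "int \<Rightarrow> complex set" where
  "slit_plane j = {y. Im y = 0 \<longrightarrow> (if j = 0 then \<bar>Re y\<bar> < 1 else of_int j * Re y > 1)}"

text \<open>Paths passing a puncture on the same side are compared in such a half plane, which is
  starlike about \<open>k * \<i>\<close> and contains the real axis without the punctures.\<close>

definition closed_half :: "real \<Rightarrow> complex set" where
  "closed_half k = {y. k * Im y \<ge> 0} - {1, -1}"

lemma segment_coords:
  assumes "z \<in> closed_segment a (b :: complex)"
  obtains t where "0 \<le> t" "t \<le> 1" "Re z = (1 - t) * Re a + t * Re b" "Im z = (1 - t) * Im a + t * Im b"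
  using assms by (auto simp: closed_segment_def)

lemma slit_plane_star:
  assumes "j \<in> {0, 1, -1}" "y \<in> slit_plane j"
  shows "closed_segment (2 * of_int j) y \<subseteq> slit_plane j"
proof
  fix z assume "z \<in> closed_segment (2 * of_int j) y"
  then obtain t where t: "0 \<le> t" "t \<le> 1" "Re z = (1 - t) * (2 * of_int j) + t * Re y" "Im z = t * Im y"
    by (rule segment_coords) simp
  show "z \<in> slit_plane j"
  proof (cases "Im y = 0 \<and> t \<noteq> 0")
    case True
    show ?thesis
    proof (cases "j = 0")
      case j: True
      then have "\<bar>Re y\<bar> < 1" using True assms(2) by (simp add: slit_plane_def)
      then have "\<bar>Re z\<bar> < 1" using t j True
        by (simp add: abs_mult) (meson abs_ge_zero le_less_trans mult_left_le_one_le)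
      then show ?thesis using j by (simp add: slit_plane_def)
    next
      case False
      then have "of_int j * Re y > 1" "of_int j * of_int j = (1::real)"
        using True assms by (auto simp: slit_plane_def)
      have "of_int j * Re z = (of_int j * of_int j) * ((1 - t) * 2) + t * (of_int j * Re y)"
        by (simp add: t(3) algebra_simps)
      then have "of_int j * Re z = (1 - t) * 2 + t * (of_int j * Re y)"
        using \<open>of_int j * of_int j = (1::real)\<close> by simp
      moreover have "t * 1 < t * (of_int j * Re y)"
        using t True \<open>of_int j * Re y > 1\<close> by (intro mult_strict_left_mono) auto
      ultimately have "of_int j * Re z > 1" using t(2) by argo
      then show ?thesis using False by (simp add: slit_plane_def)
    qed
  next
    case False
    then show ?thesis using t assms(1) by (auto simp: slit_plane_def)
  qed
qed

lemma slit_plane_subset: "j \<in> {0, 1, -1} \<Longrightarrow> slit_plane j \<subseteq> twice_punctured"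
  by (auto simp: slit_plane_def)

lemma starlike_slit_plane: "j \<in> {0, 1, -1} \<Longrightarrow> starlike (slit_plane j)"
  unfolding starlike_def using slit_plane_star
  by (intro bexI[of _ "2 * of_int j"]) (auto simp: slit_plane_def)

lemma open_slit_plane:
  assumes "j \<in> {0, 1, -1}"
  shows "open (slit_plane j)"
proof -
  have "slit_plane j = {y. Im y \<noteq> 0} \<union> (if j = 0 then {y. \<bar>Re y\<bar> < 1} else {y. of_int j * Re y > 1})"
    by (auto simp: slit_plane_def)
  moreover have "open {y. Im y \<noteq> 0}" "open {y. \<bar>Re y\<bar> < 1}" "open {y. of_int j * Re y > (1::real)}"
    by (intro open_Collect_neq open_Collect_less continuous_intros)+
  ultimately show ?thesis by auto
qed

lemma closed_half_star:
  assumes "k \<in> {1, -1}" "y \<in> closed_half k"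
  shows "closed_segment (of_real k * \<i>) y \<subseteq> closed_half k"
proof
  fix z assume "z \<in> closed_segment (of_real k * \<i>) y"
  then obtain t where t: "0 \<le> t" "t \<le> 1" "Re z = t * Re y" "Im z = (1 - t) * k + t * Im y"
    by (rule segment_coords) simp
  have "k * k = 1" using assms(1) by auto
  then have kz: "k * Im z = (1 - t) + t * (k * Im y)" by (simp add: t algebra_simps)
  have ky: "k * Im y \<ge> 0" using assms(2) by (simp add: closed_half_def)
  then have "k * Im z \<ge> 0" unfolding kz using t by simp
  moreover have "z \<notin> {1, -1}" if "t = 1"
    using that t assms(2) by (auto simp: closed_half_def complex_eq_iff)
  moreover have "z \<notin> {1, -1}" if "t \<noteq> 1"
  proof -
    have "t * (k * Im y) \<ge> 0" using ky t by simp
    then have "k * Im z > 0" unfolding kz using that t by simp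
    then show ?thesis by auto
  qed
  ultimately show "z \<in> closed_half k" by (auto simp: closed_half_def)
qed

lemma starlike_closed_half: "k \<in> {1, -1} \<Longrightarrow> starlike (closed_half k)"
  unfolding starlike_def using closed_half_star
  by (intro bexI[of _ "of_real k * \<i>"]) (auto simp: closed_half_def complex_eq_iff[of "\<i>"] complex_eq_iff[of "- \<i>"])

lemma closed_half_subset: "closed_half k \<subseteq> twice_punctured"
  by (auto simp: closed_half_def)

section \<open>Circles around the punctures\<close>

definition unit_circle :: "real \<Rightarrow> complex" where
  "unit_circle s = exp (2 * of_real pi * \<i> * of_real s)"

lemma unit_circle_eq: "unit_circle s = Complex (cos (2 * pi * s)) (sin (2 * pi * s))"
  by (simp add: unit_circle_def complex_eq_iff Re_exp Im_exp)

lemma norm_unit_circle [simp]: "norm (unit_circle s) = 1"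
  by (simp add: unit_circle_def)

lemma unit_circle_ends [simp]: "unit_circle 0 = 1" "unit_circle 1 = 1"
  by (simp_all add: unit_circle_def exp_two_pi_i)

lemma continuous_on_unit_circle [continuous_intros]:
  "continuous_on A f \<Longrightarrow> continuous_on A (\<lambda>x. unit_circle (f x))"
  unfolding unit_circle_def by (intro continuous_intros)

text \<open>The circle of radius 1 about \<open>k\<close>, started at 0; it passes
  \<open>2 * k\<close> half way, and its halves lie in opposite half planes.\<close>

definition pole_loop :: "real \<Rightarrow> real \<Rightarrow> complex" where
  "pole_loop k s = of_real k * (1 - unit_circle s)"

lemma pole_loop_avoids: "k \<in> {1, -1} \<Longrightarrow> pole_loop k s \<in> twice_punctured"
proof
  assume k: "k \<in> {1, -1}" and "pole_loop k s \<in> {1, -1}"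
  then have "unit_circle s = 0 \<or> unit_circle s = 2"
    by (auto simp: pole_loop_def algebra_simps)
  then have "norm (unit_circle s) \<in> {0, 2}"
    by (elim disjE) (simp_all only: norm_zero norm_numeral insert_iff simp_thms)
  then show False by simp
qed

lemma path_from_pole_loop:
  assumes "k \<in> {1, -1}"
  shows "path_from twice_punctured (pole_loop k) 0 0"
proof -
  have "path (pole_loop k)"
    unfolding path_def pole_loop_def by (intro continuous_intros)
  then show ?thesis
    using pole_loop_avoids[OF assms] unfolding path_from_def path_image_def pathstart_def pathfinish_def
    by (auto simp: pole_loop_def)
qed

lemma pole_loop_half:
  assumes "k \<in> {1, -1}"
  shows "path_from (closed_half (- k)) (subpath 0 (1/2) (pole_loop k)) 0 (2 * of_real k)"
    and "path_from (closed_half k) (subpath (1/2) 1 (pole_loop k)) (2 * of_real k) 0"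
proof -
  have p: "path (pole_loop k)" using path_from_pole_loop[OF assms] by (simp add: path_from_def)
  have half: "pole_loop k (1/2) = 2 * of_real k"
    by (simp add: pole_loop_def unit_circle_eq complex_eq_iff)
  have im: "k * Im (pole_loop k s) = - sin (2 * pi * s)" for s
    using assms by (auto simp: pole_loop_def unit_circle_eq)
  have "pole_loop k s \<in> closed_half (- k)" if "s \<in> {0..1/2}" for s
  proof -
    have "sin (2 * pi * s) \<ge> 0" using that by (intro sin_ge_zero) auto
    then show ?thesis using pole_loop_avoids[OF assms, of s] im[of s] by (simp add: closed_half_def)
  qed
  then have "path_image (subpath 0 (1/2) (pole_loop k)) \<subseteq> closed_half (- k)"
    by (auto simp: path_image_subpath)
  then show "path_from (closed_half (- k)) (subpath 0 (1/2) (pole_loop k)) 0 (2 * of_real k)"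
    using p half by (simp add: path_from_def pole_loop_def)
  have "pole_loop k s \<in> closed_half k" if "s \<in> {1/2..1}" for s
  proof -
    have "sin (2 * pi * s - pi) \<ge> 0" using that by (intro sin_ge_zero) (auto simp: field_simps)
    then show ?thesis using pole_loop_avoids[OF assms, of s] im[of s] by (simp add: closed_half_def)
  qed
  then have "path_image (subpath (1/2) 1 (pole_loop k)) \<subseteq> closed_half k"
    by (auto simp: path_image_subpath)
  then show "path_from (closed_half k) (subpath (1/2) 1 (pole_loop k)) (2 * of_real k) 0"
    using p half by (simp add: path_from_def pole_loop_def)
qed

lemma path_from_half_linepath:
  assumes "j \<in> {0, 1, -1}" "p \<in> slit_plane j" "k * Im p \<ge> 0"
  shows "path_from (closed_half k) (linepath p (2 * of_int j)) p (2 * of_int j)"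
proof (rule path_from_linepath, rule)
  fix z assume "z \<in> closed_segment p (2 * of_int j)"
  then have z: "z \<in> closed_segment (2 * of_int j) p" by (simp add: closed_segment_commute)
  then obtain t where "0 \<le> t" "Im z = t * Im p" by (rule segment_coords) simp
  then have "k * Im z \<ge> 0" using assms(3) by (simp add: mult.left_commute[of k])
  then show "z \<in> closed_half k"
    using slit_plane_star[OF assms(1,2)] slit_plane_subset[OF assms(1)] z by (auto simp: closed_half_def)
qed

text \<open>In one of the two half planes common to \<open>slit_plane 0\<close> and
  \<open>slit_plane k\<close> the change loop is trivial, in the other it is the circle about
  \<open>k\<close>; so the circles generate by \<open>fundamental_group_eq_subgroup\<close>.\<close>

lemma generate_twice_punctured:
  assumes \<kappa>: "path_from twice_punctured \<kappa> 0 y0"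
    and \<Gamma>: "subgroup \<Gamma> (fundamental_group twice_punctured y0)"
    and gen: "\<And>k. k \<in> {1, -1} \<Longrightarrow>
      path_class twice_punctured (reversepath \<kappa> +++ (pole_loop k +++ \<kappa>)) \<in> \<Gamma>"
  shows "\<Gamma> = carrier (fundamental_group twice_punctured y0)"
proof -
  let ?B = twice_punctured and ?G = "fundamental_group twice_punctured y0"
  have y0: "y0 \<in> ?B" using \<kappa> unfolding path_from_def by (metis pathfinish_in_path_image subsetD)
  interpret G: group ?G using y0 by (rule group_fundamental_group)
  interpret \<Gamma>: subgroup \<Gamma> ?G by fact
  define J where "J = {0, 1, -1 :: int}"
  \<comment> \<open>\<open>r j\<close> leads from the centre \<open>2 * j\<close> to 0 within
    \<open>closed_half j\<close>; the reference path of \<open>slit_plane j\<close> then continues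
    with \<open>\<kappa>\<close>.\<close>
  define r where "r j = (linepath (2 * of_int j) (of_int j * \<i>) +++ linepath (of_int j * \<i>) 0 :: real \<Rightarrow> complex)" for j
  define \<kappa>' where "\<kappa>' j = (if j = 0 then \<kappa> else r j +++ \<kappa>)" for j
  define \<rho> where "\<rho> j p = linepath p (2 * of_int j) +++ \<kappa>' j" for j p
  have seg: "path_from (closed_half (of_int j)) (r j) (2 * of_int j) 0" if "j \<in> {1, -1}" for j
  proof -
    have j: "real_of_int j \<in> {1, -1}" and mem: "2 * of_int j \<in> closed_half (of_int j)" "0 \<in> closed_half (of_int j)"
      using that by (auto simp: closed_half_def)
    show ?thesis
      unfolding r_def
      using closed_half_star[OF j mem(1)] closed_half_star[OF j mem(2)]
      by (intro path_from_join[OF path_from_linepath path_from_linepath])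
        (auto simp: closed_segment_commute)
  qed
  have \<kappa>': "path_from ?B (\<kappa>' j) (2 * of_int j) y0" if "j \<in> J" for j
    using that \<kappa> path_from_join[OF path_from_subset[OF seg closed_half_subset] \<kappa>]
    by (auto simp: J_def \<kappa>'_def)
  have lin: "path_from (slit_plane j) (linepath p (2 * of_int j)) p (2 * of_int j)"
    if "j \<in> J" "p \<in> slit_plane j" for j p
    using slit_plane_star[of j p] that by (intro path_from_linepath) (auto simp: J_def closed_segment_commute)
  have lin': "path_from ?B (linepath p (2 * of_int j)) p (2 * of_int j)"
    if "j \<in> J" "p \<in> slit_plane j" for j p
    using path_from_subset[OF lin[OF that] slit_plane_subset] that by (simp add: J_def)
  have \<rho>: "path_from ?B (\<rho> j p) p y0" if "j \<in> J" "p \<in> slit_plane j" for j p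
    unfolding \<rho>_def using that by (intro path_from_join[OF lin' \<kappa>'])
  have one: "path_class ?B (reversepath (\<rho> j p) +++ \<rho> j p) \<in> \<Gamma>" if "j \<in> J" "p \<in> slit_plane j" for j p
  proof -
    have "path_class ?B (reversepath (\<rho> j p) +++ \<rho> j p) = \<one>\<^bsub>?G\<^esub>"
      unfolding one_fundamental_group using \<rho>[OF that]
      by (intro path_class_eqI homotopic_paths_reverse_left) (auto simp: path_from_def)
    then show ?thesis by simp
  qed
  have change: "path_class ?B (reversepath (\<rho> 0 p) +++ \<rho> k p) \<in> \<Gamma>"
    if k: "k \<in> {1, -1}" and p: "p \<in> slit_plane 0" "p \<in> slit_plane k" for k p
  proof -
    have kJ: "k \<in> J" "0 \<in> J" "k \<noteq> 0" using k by (auto simp: J_def)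
    have k': "real_of_int k \<in> {1, -1}" using k by auto
    let ?l0 = "linepath p 0" and ?lk = "linepath p (2 * of_int k)"
    have l0: "path_from ?B ?l0 p 0" and lk: "path_from ?B ?lk p (2 * of_int k)"
      using lin'[OF kJ(2) p(1)] lin'[OF kJ(1) p(2)] by simp_all
    have rB: "path_from ?B (r k) (2 * of_int k) 0"
      using path_from_subset[OF seg[OF k] closed_half_subset] .
    have \<rho>0: "\<rho> 0 p = ?l0 +++ \<kappa>" and \<rho>k: "\<rho> k p = ?lk +++ (r k +++ \<kappa>)"
      using kJ by (simp_all add: \<rho>_def \<kappa>'_def)
    have "Im p \<noteq> 0" using p k by (auto simp: slit_plane_def)
    then consider "of_int k * Im p > 0" | "of_int k * Im p < 0" using k by (fastforce simp: neq_iff)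
    then show ?thesis
    proof cases
      \<comment> \<open>Both ways from \<open>p\<close> to 0 stay in
        \<open>closed_half k\<close>.\<close>
      case 1
      have "homotopic_paths ?B (\<rho> k p) ((?lk +++ r k) +++ \<kappa>)"
        unfolding \<rho>k by (rule homotopic_paths_sym[OF hp_assoc[OF lk rB \<kappa>]])
      also have "homotopic_paths ?B \<dots> (\<rho> 0 p)"
        unfolding \<rho>0
      proof (rule hp_left[OF _ path_from_join[OF lk rB] \<kappa>])
        show "homotopic_paths ?B (?lk +++ r k) ?l0"
          using path_from_half_linepath[of k p "of_int k"] path_from_half_linepath[of 0 p "of_int k"] p 1 k
          by (intro homotopic_paths_starlike[OF starlike_closed_half[OF k'] closed_half_subset
                path_from_join[OF _ seg[OF k]]]) auto
      qed
      finally have "homotopic_paths ?B (reversepath (\<rho> 0 p) +++ \<rho> k p) (reversepath (\<rho> 0 p) +++ \<rho> 0 p)"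
        using hp_right[OF _ path_from_reverse[OF \<rho>[OF kJ(2) p(1)]] \<rho>[OF kJ(1) p(2)]] by blast
      then show ?thesis using one[OF kJ(2) p(1)] path_class_eqI by metis
    next
      \<comment> \<open>Now \<open>p\<close> and \<open>r k\<close> lie on opposite sides: the
        segment to \<open>2 * k\<close> is replaced by the one to 0 followed by the first half of
        the circle, and \<open>r k\<close> by the second half.\<close>
      case 2
      let ?a = "subpath 0 (1/2) (pole_loop (of_int k))" and ?b = "subpath (1/2) 1 (pole_loop (of_int k))"
      have a: "path_from (closed_half (- of_int k)) ?a 0 (2 * of_int k)"
        and b: "path_from (closed_half (of_int k)) ?b (2 * of_int k) 0"
        using pole_loop_half[OF k'] by simp_all
      have aB: "path_from ?B ?a 0 (2 * of_int k)" and bB: "path_from ?B ?b (2 * of_int k) 0"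
        using path_from_subset[OF a closed_half_subset] path_from_subset[OF b closed_half_subset] by auto
      have c: "path_from ?B (pole_loop (of_int k)) 0 0" by (rule path_from_pole_loop[OF k'])
      have "homotopic_paths ?B ?lk (?l0 +++ ?a)"
        using path_from_half_linepath[of k p "- of_int k"] path_from_half_linepath[of 0 p "- of_int k"] p 2 k k'
        by (intro homotopic_paths_starlike[OF starlike_closed_half[of "- of_int k"] closed_half_subset _
              path_from_join[OF _ a]]) auto
      moreover have "homotopic_paths ?B (r k) ?b"
        by (rule homotopic_paths_starlike[OF starlike_closed_half[OF k'] closed_half_subset seg[OF k] b])
      ultimately have "homotopic_paths ?B (\<rho> k p) ((?l0 +++ ?a) +++ (?b +++ \<kappa>))"
        unfolding \<rho>k using hp_cong hp_left[OF _ rB \<kappa>] lk path_from_join[OF rB \<kappa>] by blast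
      also have "homotopic_paths ?B \<dots> (?l0 +++ (?a +++ (?b +++ \<kappa>)))"
        by (rule hp_assoc[OF l0 aB path_from_join[OF bB \<kappa>]])
      also have "homotopic_paths ?B \<dots> (?l0 +++ ((?a +++ ?b) +++ \<kappa>))"
        by (rule hp_right[OF homotopic_paths_sym[OF hp_assoc[OF aB bB \<kappa>]] l0
              path_from_join[OF aB path_from_join[OF bB \<kappa>]]])
      also have "homotopic_paths ?B \<dots> (?l0 +++ (pole_loop (of_int k) +++ \<kappa>))"
      proof (rule hp_right[OF hp_left[OF _ path_from_join[OF aB bB] \<kappa>] l0
              path_from_join[OF path_from_join[OF aB bB] \<kappa>]])
        show "homotopic_paths ?B (?a +++ ?b) (pole_loop (of_int k))"
          using homotopic_join_subpaths[of "pole_loop (of_int k)" ?B 0 "1/2" 1] c by (simp add: path_from_def)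
      qed
      finally have 3: "homotopic_paths ?B (\<rho> k p) (?l0 +++ (pole_loop (of_int k) +++ \<kappa>))" .
      note c\<kappa> = path_from_join[OF c \<kappa>]
      have rev: "reversepath (\<rho> 0 p) = reversepath \<kappa> +++ reversepath ?l0"
        unfolding \<rho>0 using l0 \<kappa> by (intro reversepath_joinpaths) (simp add: path_from_def)
      have "homotopic_paths ?B (reversepath (\<rho> 0 p) +++ \<rho> k p)
          (reversepath (\<rho> 0 p) +++ (?l0 +++ (pole_loop (of_int k) +++ \<kappa>)))"
        by (rule hp_right[OF 3 path_from_reverse[OF \<rho>[OF kJ(2) p(1)]] \<rho>[OF kJ(1) p(2)]])
      also have "homotopic_paths ?B \<dots> (reversepath \<kappa> +++ (reversepath ?l0 +++ (?l0 +++ (pole_loop (of_int k) +++ \<kappa>))))"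
        unfolding rev by (rule hp_assoc[OF path_from_reverse[OF \<kappa>] path_from_reverse[OF l0] path_from_join[OF l0 c\<kappa>]])
      also have "homotopic_paths ?B \<dots> (reversepath \<kappa> +++ (pole_loop (of_int k) +++ \<kappa>))"
        by (rule hp_right[OF hp_cancel'[OF l0 c\<kappa>] path_from_reverse[OF \<kappa>]
              path_from_join[OF path_from_reverse[OF l0] path_from_join[OF l0 c\<kappa>]]])
      finally show ?thesis using gen[OF k'] path_class_eqI by metis
    qed
  qed
  have change': "path_class ?B (reversepath (\<rho> k p) +++ \<rho> 0 p) \<in> \<Gamma>"
    if k: "k \<in> {1, -1}" and p: "p \<in> slit_plane 0" "p \<in> slit_plane k" for k p
  proof -
    have kJ: "k \<in> J" "0 \<in> J" using k by (auto simp: J_def)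
    have *: "path_from ?B (reversepath (\<rho> 0 p) +++ \<rho> k p) y0 y0"
      by (rule path_from_join[OF path_from_reverse[OF \<rho>[OF kJ(2) p(1)]] \<rho>[OF kJ(1) p(2)]])
    have "inv\<^bsub>?G\<^esub> path_class ?B (reversepath (\<rho> 0 p) +++ \<rho> k p) \<in> \<Gamma>"
      using change[OF k p] by simp
    also have "inv\<^bsub>?G\<^esub> path_class ?B (reversepath (\<rho> 0 p) +++ \<rho> k p) = path_class ?B (reversepath (\<rho> k p) +++ \<rho> 0 p)"
      using * \<rho>[OF kJ(2) p(1)] \<rho>[OF kJ(1) p(2)] unfolding path_from_loop
      by (simp add: inv_fundamental_group reversepath_joinpaths path_from_def)
    finally show ?thesis .
  qed
  show ?thesis
  proof (rule fundamental_group_eq_subgroup[where J = J and W = slit_plane and \<rho> = \<rho>])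
    show "openin (top_of_set ?B) (slit_plane j)" if "j \<in> J" for j
      using that open_slit_plane[of j] slit_plane_subset[of j] open_subset by (auto simp: J_def)
    show "?B \<subseteq> (\<Union>j\<in>J. slit_plane j)"
      by (auto simp: J_def slit_plane_def complex_eq_iff)
  next
    fix j p q \<eta> assume j: "j \<in> J" and \<eta>: "path_from (slit_plane j) \<eta> p q"
    have pq: "p \<in> slit_plane j" "q \<in> slit_plane j"
      using \<eta> unfolding path_from_def by (metis pathfinish_in_path_image pathstart_in_path_image subsetD)+
    have j': "j \<in> {0, 1, -1}" using j by (simp add: J_def)
    have \<eta>B: "path_from ?B \<eta> p q" by (rule path_from_subset[OF \<eta> slit_plane_subset[OF j']])
    have "homotopic_paths ?B (\<eta> +++ \<rho> j q) ((\<eta> +++ linepath q (2 * of_int j)) +++ \<kappa>' j)"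
      unfolding \<rho>_def by (rule homotopic_paths_sym[OF hp_assoc[OF \<eta>B lin'[OF j pq(2)] \<kappa>'[OF j]]])
    also have "homotopic_paths ?B \<dots> (\<rho> j p)"
      unfolding \<rho>_def
      by (rule hp_left[OF homotopic_paths_starlike[OF starlike_slit_plane[OF j'] slit_plane_subset[OF j']
              path_from_join[OF \<eta> lin[OF j pq(2)]] lin[OF j pq(1)]]
              path_from_join[OF \<eta>B lin'[OF j pq(2)]] \<kappa>'[OF j]])
    finally show "homotopic_paths ?B (\<eta> +++ \<rho> j q) (\<rho> j p)" .
  next
    fix j k p assume jk: "j \<in> J" "k \<in> J" "p \<in> slit_plane j" "p \<in> slit_plane k"
    show "path_class ?B (reversepath (\<rho> j p) +++ \<rho> k p) \<in> \<Gamma>"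
    proof (cases "j = k")
      case True
      then show ?thesis using one jk by simp
    next
      case False
      \<comment> \<open>A point of two different slit planes is not real, so it lies in
        \<open>slit_plane 0\<close>, through which the change can be factored.\<close>
      have p0: "p \<in> slit_plane 0" and J0: "0 \<in> J"
        using jk False by (auto simp: slit_plane_def J_def split: if_splits)
      have 1: "path_class ?B (reversepath (\<rho> j p) +++ \<rho> 0 p) \<in> \<Gamma>"
        using change'[of j p] one[of 0 p] jk p0 J0 by (cases "j = 0") (auto simp: J_def)
      have 2: "path_class ?B (reversepath (\<rho> 0 p) +++ \<rho> k p) \<in> \<Gamma>"
        using change[of k p] one[of 0 p] jk p0 J0 by (cases "k = 0") (auto simp: J_def)
      note a = path_from_reverse[OF \<rho>[OF jk(1,3)]] and b = \<rho>[OF J0 p0] and c = \<rho>[OF jk(2,4)]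
      have "homotopic_paths ?B ((reversepath (\<rho> j p) +++ \<rho> 0 p) +++ (reversepath (\<rho> 0 p) +++ \<rho> k p))
          (reversepath (\<rho> j p) +++ (\<rho> 0 p +++ (reversepath (\<rho> 0 p) +++ \<rho> k p)))"
        by (rule hp_assoc[OF a b path_from_join[OF path_from_reverse[OF b] c]])
      also have "homotopic_paths ?B \<dots> (reversepath (\<rho> j p) +++ \<rho> k p)"
        by (rule hp_right[OF hp_cancel[OF b c] a path_from_join[OF b path_from_join[OF path_from_reverse[OF b] c]]])
      finally have "path_class ?B (reversepath (\<rho> j p) +++ \<rho> 0 p) \<otimes>\<^bsub>?G\<^esub> path_class ?B (reversepath (\<rho> 0 p) +++ \<rho> k p)
          = path_class ?B (reversepath (\<rho> j p) +++ \<rho> k p)"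
        by (intro path_class_mult path_from_join[OF a b] path_from_join[OF path_from_reverse[OF b] c])
      then show ?thesis using 1 2 by (metis \<Gamma>.m_closed)
    qed
  qed (use y0 \<Gamma> \<rho> in auto)
qed

section \<open>The fundamental group of the conic surface\<close>

definition conic_section :: "complex \<Rightarrow> complex \<Rightarrow> complex \<times> complex \<times> complex" where
  "conic_section c y = (y, c, c\<^sup>2 / (1 - y\<^sup>2))"

lemma square_ne_one: "y \<in> twice_punctured \<Longrightarrow> 1 - y\<^sup>2 \<noteq> 0" "y \<in> twice_punctured \<Longrightarrow> y\<^sup>2 \<noteq> 1"
  by (auto simp: power2_eq_1_iff)

lemma conic_section_in: "y \<in> twice_punctured \<Longrightarrow> conic_section c y \<in> conic_surface"
  using square_ne_one[of y] by (simp add: conic_section_def conic_surface_def)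

lemma continuous_on_conic_section: "continuous_on twice_punctured (conic_section c)"
  unfolding conic_section_def using square_ne_one by (intro continuous_intros) auto

lemma conic_surface_eq_section:
  assumes "w \<in> conic_surface" "fst w \<in> twice_punctured"
  shows "w = conic_section (fst (snd w)) (fst w)"
  using assms square_ne_one[of "fst w"] by (auto simp: conic_surface_def conic_section_def)

text \<open>Off the double fibres the surface is the product of the punctured line of
  \<open>y\<close> and the line of \<open>c\<close>, so \<open>c\<close> can be moved linearly while
  \<open>y\<close> is kept. The formula for \<open>h\<close> is part of the conclusion because its
  users have to control both ends of the paths.\<close>

lemma conic_surface_slide:
  assumes "path y" "path_image y \<subseteq> twice_punctured" "path c" "path c'"
  defines "p \<equiv> \<lambda>t. conic_section (c t) (y t)" and "p' \<equiv> \<lambda>t. conic_section (c' t) (y t)"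
  shows "\<exists>h. continuous_on ({0..1} \<times> {0..1}) h \<and> h \<in> ({0..1} \<times> {0..1}) \<rightarrow> conic_surface \<and>
    (\<forall>x\<in>{0..1}. h (0, x) = p x) \<and> (\<forall>x\<in>{0..1}. h (1, x) = p' x) \<and>
    (\<forall>s. \<forall>t. h (s, t) = conic_section ((1 - of_real s) * c t + of_real s * c' t) (y t))"
proof -
  let ?h = "\<lambda>(s, t). conic_section ((1 - of_real s) * c t + of_real s * c' t) (y t)"
  have y: "y t \<in> twice_punctured" if "t \<in> {0..1}" for t
    using assms(2) that unfolding path_image_def by blast
  have cont: "continuous_on {0..1} y" "continuous_on {0..1} c" "continuous_on {0..1} c'"
    using assms(1,3,4) by (simp_all add: path_def)
  have "continuous_on ({0..1} \<times> {0..1}) (\<lambda>x. y (snd x))"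
    "continuous_on ({0..1} \<times> {0..1}) (\<lambda>x. c (snd x))"
    "continuous_on ({0..1} \<times> {0..1}) (\<lambda>x. c' (snd x))"
    by (rule continuous_on_compose2[OF cont(1)] continuous_on_compose2[OF cont(2)]
        continuous_on_compose2[OF cont(3)]; auto intro: continuous_intros)+
  then have "continuous_on ({0..1} \<times> {0..1}) ?h"
    unfolding conic_section_def case_prod_unfold
    using square_ne_one(1)[OF y] by (intro continuous_intros) auto
  then show ?thesis
    using conic_section_in[OF y] by (intro exI[of _ ?h]) (auto simp: p_def p'_def)
qed

lemma conic_surface_retract:
  assumes \<gamma>: "\<gamma> \<in> loops_at {w \<in> conic_surface. fst w \<in> twice_punctured} a"
  shows "homotopic_paths conic_surface \<gamma> (conic_section (fst (snd a)) \<circ> (fst \<circ> \<gamma>))"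
proof -
  let ?y = "fst \<circ> \<gamma>" and ?c = "fst \<circ> snd \<circ> \<gamma>" and ?c' = "\<lambda>_::real. fst (snd a)"
  note D = loops_atD[OF \<gamma>]
  have p: "path ?y" "path ?c" using D(1) by (auto simp: path_def intro!: continuous_intros)
  have y: "path_image ?y \<subseteq> twice_punctured" using D(2) by (auto simp: path_image_compose)
  have eq: "conic_section (?c t) (?y t) = \<gamma> t" if "t \<in> {0..1}" for t
  proof -
    have "\<gamma> t \<in> path_image \<gamma>" unfolding path_image_def using that by (rule imageI)
    then show ?thesis using D(2) conic_surface_eq_section[of "\<gamma> t"] by auto
  qed
  obtain h where h: "continuous_on ({0..1} \<times> {0..1}) h" "h \<in> ({0..1} \<times> {0..1}) \<rightarrow> conic_surface"
    "\<forall>x\<in>{0..1}. h (0, x) = conic_section (?c x) (?y x)" "\<forall>x\<in>{0..1}. h (1, x) = conic_section (?c' x) (?y x)"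
    "\<And>s t. h (s, t) = conic_section ((1 - of_real s) * ?c t + of_real s * ?c' t) (?y t)"
    using conic_surface_slide[OF p(1) y p(2), of ?c'] by auto
  have ends: "\<gamma> 0 = a" "\<gamma> 1 = a" using D(3,4) by (auto simp: pathstart_def pathfinish_def)
  have "h (s, t) = \<gamma> t" if "t \<in> {0, 1}" for s t
  proof -
    have "(1 - of_real s) * ?c t + of_real s * ?c' t = ?c t" using that ends by (auto simp: algebra_simps)
    then show ?thesis using h(5) eq[of t] that by auto
  qed
  then show ?thesis
    unfolding homotopic_paths using h(1-4) eq
    by (intro exI[of _ h]) (auto simp: pathstart_def pathfinish_def)
qed

text \<open>The loop may cross the double fibres. Its lift to the covering is replaced by a path
  with the same ends that avoids the zeros of \<open>sin\<close> and has
  \<open>\<beta> = c / sin z\<close>; this one projects into the section.\<close>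

lemma conic_surface_loop_lift:
  assumes y0: "y0 \<in> twice_punctured" and p: "p \<in> loops_at conic_surface (conic_section c y0)"
  shows "\<exists>\<delta>\<in>loops_at twice_punctured y0. homotopic_paths conic_surface p (conic_section c \<circ> \<delta>)"
proof -
  note D = loops_atD[OF p]
  define z0 where "z0 = Arccos y0"
  have z0: "cos z0 = y0" by (simp add: z0_def)
  have sq: "(sin z)\<^sup>2 = 1 - (cos z)\<^sup>2" for z :: complex by (rule sin_squared_eq)
  have s0: "sin z0 \<noteq> 0" using sq[of z0] square_ne_one(1)[OF y0] by (auto simp: z0)
  have proj: "conic_proj (z, c / sin z) = conic_section c (cos z)" if "sin z \<noteq> 0" for z
    using that by (simp add: conic_proj_def conic_section_def power_divide flip: sq)
  have "(z0, c / sin z0) \<in> conic_cover" using s0 by (simp add: conic_cover_def)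
  moreover have "pathstart p = conic_proj (z0, c / sin z0)" using D(3) proj[OF s0] by (simp add: z0)
  ultimately obtain P where P: "path P" "path_image P \<subseteq> conic_cover" "pathstart P = (z0, c / sin z0)"
    "\<And>t. t \<in> {0..1} \<Longrightarrow> conic_proj (P t) = p t"
    using covering_space_lift_path_strong[OF covering_space_conic _ D(1,2)] by metis
  obtain z1 \<beta>1 where P1: "pathfinish P = (z1, \<beta>1)" by fastforce
  have "conic_proj (z1, \<beta>1) = conic_section c y0"
    using P(4)[of 1] D(4) P1 by (simp add: pathfinish_def)
  then have z1: "cos z1 = y0" "\<beta>1 * sin z1 = c" by (simp_all add: conic_proj_def conic_section_def)
  then have s1: "sin z1 \<noteq> 0" using sq[of z1] square_ne_one(1)[OF y0] by auto
  have \<beta>1: "\<beta>1 = c / sin z1" using z1 s1 by (simp add: field_simps)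
  let ?E = "{z :: complex. sin z \<noteq> 0}"
  have "?E = - (range (\<lambda>n::int. of_real (n * pi)))" by (auto simp: sin_eq_0)
  then have "path_connected ?E"
    using path_connected_complement_countable[of "range (\<lambda>n::int. complex_of_real (n * pi))"] by simp
  then obtain \<zeta> where \<zeta>: "path \<zeta>" "path_image \<zeta> \<subseteq> ?E" "pathstart \<zeta> = z0" "pathfinish \<zeta> = z1"
    unfolding path_connected_def using s0 s1 by blast
  have \<zeta>E: "sin (\<zeta> t) \<noteq> 0" if "t \<in> {0..1}" for t using \<zeta>(2) that unfolding path_image_def by blast
  let ?P' = "\<lambda>t. (\<zeta> t, c / sin (\<zeta> t))"
  have "path ?P'" using \<zeta>(1) \<zeta>E unfolding path_def by (intro continuous_intros) auto
  moreover have "path_image ?P' \<subseteq> conic_cover"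
    using \<zeta>E by (auto simp: path_image_def conic_cover_def)
  moreover have "pathstart ?P' = pathstart P" "pathfinish ?P' = pathfinish P"
    using P(3) P1 \<zeta>(3,4) \<beta>1 by (auto simp: pathstart_def pathfinish_def)
  ultimately have "homotopic_paths conic_cover P ?P'"
    using simply_connected_conic_cover P(1,2) unfolding simply_connected_eq_homotopic_paths by metis
  then have h: "homotopic_paths conic_surface (conic_proj \<circ> P) (conic_proj \<circ> ?P')"
    using covering_space_imp_continuous[OF covering_space_conic] conic_proj_in_surface
    by (intro homotopic_paths_continuous_image) auto
  have "homotopic_paths conic_surface p (conic_proj \<circ> P)"
    using D P(4) by (intro homotopic_paths_eq) auto
  also note h
  also have "homotopic_paths conic_surface (conic_proj \<circ> ?P') (conic_section c \<circ> (cos \<circ> \<zeta>))"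
  proof (rule homotopic_paths_eq)
    show "path (conic_proj \<circ> ?P')" "path_image (conic_proj \<circ> ?P') \<subseteq> conic_surface"
      using homotopic_paths_imp_path[OF h] homotopic_paths_imp_subset[OF h] by auto
    show "(conic_proj \<circ> ?P') t = (conic_section c \<circ> (cos \<circ> \<zeta>)) t" if "t \<in> {0..1}" for t
      using proj[OF \<zeta>E[OF that]] by simp
  qed
  finally have "homotopic_paths conic_surface p (conic_section c \<circ> (cos \<circ> \<zeta>))" .
  moreover have "cos \<circ> \<zeta> \<in> loops_at twice_punctured y0"
  proof -
    have "path (cos \<circ> \<zeta>)" using \<zeta>(1) by (auto simp: path_def intro!: continuous_intros)
    moreover have "path_image (cos \<circ> \<zeta>) \<subseteq> twice_punctured"
    proof -
      have "cos z \<in> twice_punctured" if "sin z \<noteq> 0" for z :: complex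
        using sq[of z] that by auto
      then show ?thesis using \<zeta>(2) by (auto simp: path_image_compose)
    qed
    ultimately show ?thesis
      using \<zeta>(3,4) z0 z1(1) by (simp add: loops_at_def pathstart_compose pathfinish_compose)
  qed
  ultimately show ?thesis by blast
qed

section \<open>Loops around the double fibres\<close>

lemma path_from_image:
  assumes "path_from X p x y" "continuous_on X g" "g ` X \<subseteq> Y"
  shows "path_from Y (g \<circ> p) (g x) (g y)"
proof -
  have "path (g \<circ> p)"
    using assms(1,2) by (meson continuous_on_subset path_continuous_image path_from_def)
  then show ?thesis
    using assms by (auto simp: path_from_def path_image_compose pathstart_compose pathfinish_compose)
qed

lemma conic_section_image: "conic_section c ` twice_punctured \<subseteq> conic_surface"
  using conic_section_in by blast

text \<open>Near a double fibre the surface has the coordinate \<open>s\<close> with \<open>s\<^sup>2 \<rho> = \<sigma> = (1 \<mp> y) / 2\<close>, so that a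
  loop going twice around the branch point bounds the image of the disc of the parameter \<open>s\<close>.\<close>

lemma conic_section_double_loop_null:
  fixes \<rho> :: "complex \<Rightarrow> complex" and k :: real
  assumes k: "k \<in> {1, -1}" and \<rho>: "continuous_on (cball 0 1) \<rho>"
    "\<And>t. t \<in> cball 0 1 \<Longrightarrow> \<rho> t \<noteq> 0" "\<And>t. t \<in> cball 0 1 \<Longrightarrow> t * \<rho> t \<noteq> 1"
  defines "ll \<equiv> \<lambda>s. of_real k * (1 - 2 * (unit_circle s * \<rho> (unit_circle s)))"
  shows "homotopic_paths conic_surface (conic_section c \<circ> (ll +++ ll)) (\<lambda>_. conic_section c (ll 0))"
    and "ll \<in> loops_at twice_punctured (ll 0)"
proof -
  let ?D = "cball 0 1 :: complex set"
  define \<sigma> where "\<sigma> s = s\<^sup>2 * \<rho> (s\<^sup>2)" for s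
  \<comment> \<open>\<open>d\<close> maps the disc into the surface: by
    \<open>1 - y\<^sup>2 = 4 * \<sigma> * (1 - \<sigma>)\<close> and
    \<open>\<sigma> = s\<^sup>2 * \<rho> (s\<^sup>2)\<close> the second coordinate is a root of
    \<open>(1 - y\<^sup>2) * b\<close>. The double fibre is crossed at \<open>s = 0\<close>, where
    \<open>b = \<rho> 0\<close> is not zero.\<close>
  define d where "d s = (of_real k * (1 - 2 * \<sigma> s), 2 * s * \<rho> (s\<^sup>2) * (1 - \<sigma> s), \<rho> (s\<^sup>2) * (1 - \<sigma> s))" for s
  have sqD: "s\<^sup>2 \<in> ?D" if "s \<in> ?D" for s using that by (simp add: norm_power power_le_one)
  have k2: "complex_of_real k * of_real k = 1" using k by auto
  have d_in: "d s \<in> conic_surface" if "s \<in> ?D" for s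
  proof -
    have "\<rho> (s\<^sup>2) \<noteq> 0" "\<sigma> s \<noteq> 1" using \<rho>(2,3)[OF sqD[OF that]] by (auto simp: \<sigma>_def)
    moreover have "(of_real k * (1 - 2 * \<sigma> s))\<^sup>2 = (1 - 2 * \<sigma> s)\<^sup>2"
    proof -
      have "(of_real k * (1 - 2 * \<sigma> s))\<^sup>2 = (complex_of_real k * of_real k) * (1 - 2 * \<sigma> s)\<^sup>2"
        by (simp only: power2_eq_square mult_ac)
      then show ?thesis using k2 by simp
    qed
    moreover have "(2 * s * \<rho> (s\<^sup>2) * (1 - \<sigma> s))\<^sup>2 = (1 - (1 - 2 * \<sigma> s)\<^sup>2) * (\<rho> (s\<^sup>2) * (1 - \<sigma> s))"
    proof -
      have "(2 * s * \<rho> (s\<^sup>2) * (1 - \<sigma> s))\<^sup>2 = 4 * \<sigma> s * (1 - \<sigma> s) * (\<rho> (s\<^sup>2) * (1 - \<sigma> s))"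
        by (simp add: \<sigma>_def power2_eq_square)
      also have "4 * \<sigma> s * (1 - \<sigma> s) = 1 - (1 - 2 * \<sigma> s)\<^sup>2"
        by (simp add: power2_eq_square algebra_simps)
      finally show ?thesis .
    qed
    ultimately show ?thesis
      unfolding conic_surface_def d_def by simp
  qed
  have u: "unit_circle s \<in> ?D" for s by simp
  have cont_\<rho>u: "continuous_on UNIV (\<lambda>s. \<rho> (unit_circle s))"
    by (rule continuous_on_compose2[OF \<rho>(1)]) (auto intro: continuous_intros)
  have cont_\<rho>2: "continuous_on ?D (\<lambda>s. \<rho> (s\<^sup>2))"
    by (rule continuous_on_compose2[OF \<rho>(1)]) (auto intro!: continuous_intros sqD simp del: mem_cball)
  have "path ll" unfolding path_def ll_def
    by (intro continuous_intros continuous_on_subset[OF cont_\<rho>u]) auto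
  moreover have "ll s \<in> twice_punctured" for s
  proof -
    have "unit_circle s * \<rho> (unit_circle s) \<noteq> 1" "unit_circle s * \<rho> (unit_circle s) \<noteq> 0"
      using \<rho>(2,3)[OF u] norm_unit_circle[of s] by (auto simp del: norm_unit_circle)
    then show ?thesis using k by (auto simp: ll_def)
  qed
  moreover have "pathstart ll = ll 0" "pathfinish ll = ll 0"
    by (simp_all add: pathstart_def pathfinish_def ll_def)
  ultimately show ll: "ll \<in> loops_at twice_punctured (ll 0)"
    by (auto simp: loops_at_def path_image_def)
  let ?y = "ll +++ ll"
  have y: "path ?y" "path_image ?y \<subseteq> twice_punctured" "pathstart ?y = ll 0" "pathfinish ?y = ll 0"
    using loops_atD[OF loops_at_join[OF ll ll]] by auto
  \<comment> \<open>While \<open>s\<close> runs once around the boundary of the disc,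
    \<open>s\<^sup>2\<close> runs around it twice, so the first coordinate of \<open>d\<close>
    traverses \<open>ll\<close> twice.\<close>
  have double: "unit_circle (2 * s) = (unit_circle s)\<^sup>2" "unit_circle (2 * s - 1) = (unit_circle s)\<^sup>2" for s
  proof -
    show *: "unit_circle (2 * s) = (unit_circle s)\<^sup>2"
      by (simp add: unit_circle_def power2_eq_square mult_ac flip: exp_add)
    have "unit_circle (2 * s - 1) = unit_circle (2 * s) / unit_circle 1"
      by (simp only: of_real_diff right_diff_distrib exp_diff unit_circle_def)
    then show "unit_circle (2 * s - 1) = (unit_circle s)\<^sup>2" using * by simp
  qed
  have fst_d: "?y s = fst (d (unit_circle s))" for s
    by (simp add: joinpaths_def ll_def d_def \<sigma>_def double)
  let ?c' = "\<lambda>s. fst (snd (d (unit_circle s)))"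
  have cd: "continuous_on ?D d"
    unfolding d_def \<sigma>_def by (intro continuous_intros cont_\<rho>2)
  have cdu: "continuous_on UNIV (\<lambda>s. d (unit_circle s))"
    by (rule continuous_on_compose2[OF cd]) (auto intro: continuous_intros)
  have "path ?c'" unfolding path_def
    by (intro continuous_intros continuous_on_subset[OF cdu]) auto
  then obtain h where h: "continuous_on ({0..1} \<times> {0..1}) h" "h \<in> ({0..1} \<times> {0..1}) \<rightarrow> conic_surface"
    "\<forall>x\<in>{0..1}. h (0, x) = conic_section c (?y x)" "\<forall>x\<in>{0..1}. h (1, x) = conic_section (?c' x) (?y x)"
    "\<And>s t. h (s, t) = conic_section ((1 - of_real s) * c + of_real s * ?c' t) (?y t)"
    using conic_surface_slide[OF y(1,2), of "\<lambda>_. c" ?c'] by auto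
  have du: "d (unit_circle s) = conic_section (?c' s) (?y s)" if "s \<in> {0..1}" for s
  proof -
    have "?y s \<in> path_image ?y" unfolding path_image_def using that by (rule imageI)
    then show ?thesis using conic_surface_eq_section[OF d_in[OF u], of s] y(2) fst_d[of s] by auto
  qed
  have "h (s, 0) = h (s, 1)" for s
    using y(3,4) by (simp add: h(5) pathstart_def pathfinish_def)
  \<comment> \<open>The boundary of the disc and the loop in the section have the same
    \<open>y\<close>; sliding \<open>c\<close> gives a free homotopy between them, and
    \<open>d\<close> then contracts the boundary.\<close>
  then have "homotopic_loops conic_surface (conic_section c \<circ> ?y) (d \<circ> unit_circle)"
    unfolding homotopic_loops using h(1-4) du
    by (intro exI[of _ h]) (auto simp: pathstart_def pathfinish_def)
  moreover have "homotopic_loops ?D unit_circle (linepath 0 0)"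
  proof (rule homotopic_loops_linear)
    show "path unit_circle" unfolding path_def using continuous_on_unit_circle[OF continuous_on_id] by simp
    show "closed_segment (unit_circle t) (linepath 0 0 t) \<subseteq> ?D" if "t \<in> {0..1}" for t
      by (rule closed_segment_subset) (auto simp: linepath_refl)
  qed (auto simp: pathstart_def pathfinish_def linepath_refl)
  then have "homotopic_loops conic_surface (d \<circ> unit_circle) (d \<circ> linepath 0 0)"
    using cd d_in by (intro homotopic_loops_continuous_image) auto
  moreover have "d \<circ> linepath 0 0 = linepath (d 0) (d 0)"
    by (auto simp: linepath_refl)
  ultimately have "homotopic_loops conic_surface (conic_section c \<circ> ?y) (linepath (d 0) (d 0))"
    using homotopic_loops_trans by metis
  from homotopic_loops_imp_homotopic_paths_null[OF this]
  show "homotopic_paths conic_surface (conic_section c \<circ> (ll +++ ll)) (\<lambda>_. conic_section c (ll 0))"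
    using y(3) by (simp add: pathstart_compose linepath_refl)
qed

text \<open>The two tails between the copies of \<open>ll\<close> cancel.\<close>

lemma conjugate_square:
  assumes \<kappa>: "path_from X \<kappa> x y" and ll: "path_from X ll y y"
    and null: "homotopic_paths X (ll +++ ll) (\<lambda>_. y)"
  defines "\<mu> \<equiv> \<kappa> +++ (ll +++ reversepath \<kappa>)"
  shows "homotopic_paths X (\<mu> +++ \<mu>) (\<lambda>_. x)"
proof -
  let ?r = "reversepath \<kappa>"
  note r = path_from_reverse[OF \<kappa>] and lr = path_from_join[OF ll path_from_reverse[OF \<kappa>]]
  note \<mu> = path_from_join[OF \<kappa> lr, folded \<mu>_def]
  have yX: "y \<in> X" using ll unfolding path_from_def by (metis pathstart_in_path_image subsetD)
  have "homotopic_paths X (\<mu> +++ \<mu>) (\<kappa> +++ ((ll +++ ?r) +++ \<mu>))"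
    unfolding \<mu>_def by (rule hp_assoc[OF \<kappa> lr \<mu>[unfolded \<mu>_def]])
  also have "homotopic_paths X \<dots> (\<kappa> +++ (ll +++ (?r +++ \<mu>)))"
    by (rule hp_right[OF hp_assoc[OF ll r \<mu>] \<kappa> path_from_join[OF lr \<mu>]])
  also have "homotopic_paths X \<dots> (\<kappa> +++ (ll +++ (ll +++ ?r)))"
    unfolding \<mu>_def
    by (rule hp_right[OF hp_right[OF hp_cancel'[OF \<kappa> lr] ll path_from_join[OF r \<mu>[unfolded \<mu>_def]]]
          \<kappa> path_from_join[OF ll path_from_join[OF r \<mu>[unfolded \<mu>_def]]]])
  also have "homotopic_paths X \<dots> (\<kappa> +++ ((ll +++ ll) +++ ?r))"
    by (rule hp_right[OF homotopic_paths_sym[OF hp_assoc[OF ll ll r]] \<kappa> path_from_join[OF ll lr]])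
  also have "homotopic_paths X \<dots> (\<kappa> +++ ((\<lambda>_. y) +++ ?r))"
    by (rule hp_right[OF hp_left[OF null path_from_join[OF ll ll] r] \<kappa> path_from_join[OF path_from_join[OF ll ll] r]])
  also have "homotopic_paths X \<dots> (\<kappa> +++ ?r)"
    using r by (intro hp_right[OF homotopic_paths_const_left \<kappa> path_from_join[OF path_from_const[OF yX] r]])
      (auto simp: path_from_def)
  also have "homotopic_paths X \<dots> (\<lambda>_. x)"
    using \<kappa> by (intro homotopic_paths_reverse_right) (auto simp: path_from_def)
  finally show ?thesis .
qed

text \<open>Conjugation by \<open>x\<close> inverts \<open>x \<otimes> y\<close>, so products and
  inverses of these words can be brought back to the same form: two involutions generate a dihedral
  group.\<close>

lemma dihedral_subgroup:
  fixes Q (structure)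
  assumes "group Q" and x: "x \<in> carrier Q" "x \<otimes> x = \<one>" and y: "y \<in> carrier Q" "y \<otimes> y = \<one>"
  shows "subgroup {g. \<exists>n::int. g = (x \<otimes> y) [^] n \<or> g = (x \<otimes> y) [^] n \<otimes> x} Q" (is "subgroup ?D Q")
    and "y \<in> {g. \<exists>n::int. g = (x \<otimes> y) [^] n \<or> g = (x \<otimes> y) [^] n \<otimes> x}"
proof -
  interpret group Q by fact
  define q where "q = x \<otimes> y"
  have q: "q \<in> carrier Q" using x y by (simp add: q_def)
  have inv: "inv x = x" "inv y = y" using x y by (simp_all add: inv_equality)
  have "(\<lambda>g. x \<otimes> g \<otimes> x) \<in> hom Q Q"
  proof (rule homI)
    fix g h assume gh: "g \<in> carrier Q" "h \<in> carrier Q"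
    have "x \<otimes> g \<otimes> x \<otimes> (x \<otimes> h \<otimes> x) = x \<otimes> g \<otimes> ((x \<otimes> x) \<otimes> h \<otimes> x)"
      using gh x(1) by (simp add: m_assoc)
    then show "x \<otimes> (g \<otimes> h) \<otimes> x = x \<otimes> g \<otimes> x \<otimes> (x \<otimes> h \<otimes> x)"
      using gh x by (simp add: m_assoc)
  qed (use x in auto)
  then have "x \<otimes> q [^] n \<otimes> x = (x \<otimes> q \<otimes> x) [^] n" for n :: int
    using hom_int_pow[of "\<lambda>g. x \<otimes> g \<otimes> x" Q Q q n] q is_group by simp
  moreover have "x \<otimes> q \<otimes> x = inv q"
  proof -
    have "x \<otimes> q \<otimes> x = (x \<otimes> x) \<otimes> y \<otimes> x" using x(1) y(1) by (simp add: q_def m_assoc)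
    then show ?thesis using x y by (simp add: q_def inv_mult_group inv)
  qed
  ultimately have conj: "x \<otimes> q [^] n \<otimes> x = q [^] (- n)" for n :: int
    using q by (simp add: int_pow_inv int_pow_neg)
  have swap: "x \<otimes> q [^] n = q [^] (- n) \<otimes> x" for n :: int
  proof -
    have "x \<otimes> q [^] n = (x \<otimes> q [^] n \<otimes> x) \<otimes> x" using x q by (simp add: m_assoc)
    then show ?thesis by (simp add: conj)
  qed
  have mult: "q [^] m \<otimes> q [^] n = q [^] (m + n)" for m n :: int using q by (simp add: int_pow_mult)
  have D: "?D = {g. \<exists>n::int. g = q [^] n \<or> g = q [^] n \<otimes> x}" by (simp add: q_def)
  show "subgroup ?D Q"
    unfolding D
  proof (rule subgroupI)
    show "{g. \<exists>n::int. g = q [^] n \<or> g = q [^] n \<otimes> x} \<subseteq> carrier Q" using q x by auto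
    show "{g. \<exists>n::int. g = q [^] n \<or> g = q [^] n \<otimes> x} \<noteq> {}" by blast
    fix g assume "g \<in> {g. \<exists>n::int. g = q [^] n \<or> g = q [^] n \<otimes> x}"
    then obtain n :: int where n: "g = q [^] n \<or> g = q [^] n \<otimes> x" by blast
    have "inv (q [^] n \<otimes> x) = q [^] n \<otimes> x"
      using q x swap[of "- n"] by (simp add: inv_mult_group inv flip: int_pow_neg)
    then have "inv g = q [^] (- n) \<or> inv g = q [^] n \<otimes> x"
      using n q by (auto simp: int_pow_neg)
    then show "inv g \<in> {g. \<exists>n::int. g = q [^] n \<or> g = q [^] n \<otimes> x}" by blast
    fix h assume "h \<in> {g. \<exists>n::int. g = q [^] n \<or> g = q [^] n \<otimes> x}"
    then obtain m :: int where m: "h = q [^] m \<or> h = q [^] m \<otimes> x" by blast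
    have a: "q [^] n \<otimes> x \<otimes> q [^] m = q [^] (n + - m) \<otimes> x"
      using q x mult[of n "- m"] by (simp add: m_assoc swap) (simp flip: m_assoc)
    have b: "q [^] n \<otimes> x \<otimes> (q [^] m \<otimes> x) = q [^] (n + - m)"
    proof -
      have "q [^] n \<otimes> x \<otimes> (q [^] m \<otimes> x) = (q [^] n \<otimes> x \<otimes> q [^] m) \<otimes> x" using q x by (simp add: m_assoc)
      also have "\<dots> = q [^] (n + - m) \<otimes> (x \<otimes> x)" unfolding a using q x(1) by (simp add: m_assoc)
      finally show ?thesis using q x by simp
    qed
    have c: "q [^] n \<otimes> (q [^] m \<otimes> x) = q [^] (n + m) \<otimes> x"
      using q x by (simp flip: m_assoc mult)
    show "g \<otimes> h \<in> {g. \<exists>n::int. g = q [^] n \<or> g = q [^] n \<otimes> x}"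
      using n m a b c mult by (elim disjE) auto
  qed
  have "y = x \<otimes> q" using x y by (simp add: q_def flip: m_assoc)
  also have "\<dots> = q [^] (- 1 :: int) \<otimes> x" using swap[of 1] q by simp
  finally show "y \<in> ?D" unfolding q_def by blast
qed

section \<open>Lifting loops along the cosine\<close>

definition cos_lifts :: "(real \<Rightarrow> complex) \<Rightarrow> complex \<Rightarrow> complex \<Rightarrow> bool" where
  "cos_lifts \<delta> z w \<longleftrightarrow> (\<exists>\<zeta>. path \<zeta> \<and> pathstart \<zeta> = z \<and> pathfinish \<zeta> = w \<and> (\<forall>t\<in>{0..1}. cos (\<zeta> t) = \<delta> t))"

lemma cos_lifts_join:
  assumes "cos_lifts \<delta> z w" "cos_lifts \<delta>' w v"
  shows "cos_lifts (\<delta> +++ \<delta>') z v"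
proof -
  obtain \<zeta> \<zeta>' where "path \<zeta>" "pathstart \<zeta> = z" "pathfinish \<zeta> = w" "\<forall>t\<in>{0..1}. cos (\<zeta> t) = \<delta> t"
    "path \<zeta>'" "pathstart \<zeta>' = w" "pathfinish \<zeta>' = v" "\<forall>t\<in>{0..1}. cos (\<zeta>' t) = \<delta>' t"
    using assms unfolding cos_lifts_def by blast
  then show ?thesis
    unfolding cos_lifts_def
    by (intro exI[of _ "\<zeta> +++ \<zeta>'"] conjI ballI) (simp_all, simp add: joinpaths_def)
qed

lemma cos_lifts_reverse:
  assumes "cos_lifts \<delta> z w"
  shows "cos_lifts (reversepath \<delta>) w z"
proof -
  obtain \<zeta> where "path \<zeta>" "pathstart \<zeta> = z" "pathfinish \<zeta> = w" "\<forall>t\<in>{0..1}. cos (\<zeta> t) = \<delta> t"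
    using assms unfolding cos_lifts_def by blast
  then show ?thesis
    unfolding cos_lifts_def
    by (intro exI[of _ "reversepath \<zeta>"] conjI ballI) (simp_all, simp add: reversepath_def)
qed

lemma cos_lifts_deck:
  assumes "cos_lifts \<delta> z w" "\<epsilon> \<in> {1, -1}"
  shows "cos_lifts \<delta> (\<epsilon> * z + 2 * of_int k * of_real pi) (\<epsilon> * w + 2 * of_int k * of_real pi)"
proof -
  obtain \<zeta> where \<zeta>: "path \<zeta>" "pathstart \<zeta> = z" "pathfinish \<zeta> = w" "\<forall>t\<in>{0..1}. cos (\<zeta> t) = \<delta> t"
    using assms unfolding cos_lifts_def by blast
  let ?\<zeta> = "\<lambda>t. \<epsilon> * \<zeta> t + 2 * of_int k * of_real pi"
  have "path ?\<zeta>" using \<zeta>(1) unfolding path_def by (intro continuous_intros)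
  moreover have "cos (?\<zeta> t) = cos (\<zeta> t)" for t
    unfolding cos_eq_cos_iff using assms(2) by blast
  ultimately show ?thesis
    unfolding cos_lifts_def using \<zeta> by (intro exI[of _ ?\<zeta>]) (auto simp: pathstart_def pathfinish_def)
qed

text \<open>With \<open>\<beta> = c / sin z\<close> a lift along the cosine becomes a lift to the
  covering of the surface, where monodromy compares it with the constant lift.\<close>

lemma cos_lifts_null_closed:
  assumes null: "homotopic_paths conic_surface (conic_section c \<circ> \<delta>) (\<lambda>_. conic_section c (\<delta> 0))"
    and \<delta>: "path_image \<delta> \<subseteq> twice_punctured" and lift: "cos_lifts \<delta> z w"
  shows "z = w"
proof -
  obtain \<zeta> where \<zeta>: "path \<zeta>" "pathstart \<zeta> = z" "pathfinish \<zeta> = w" "\<forall>t\<in>{0..1}. cos (\<zeta> t) = \<delta> t"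
    using lift unfolding cos_lifts_def by blast
  have s: "sin (\<zeta> t) \<noteq> 0" "(sin (\<zeta> t))\<^sup>2 = 1 - (\<delta> t)\<^sup>2" if "t \<in> {0..1}" for t
  proof -
    have "\<delta> t \<in> path_image \<delta>" unfolding path_image_def using that by (rule imageI)
    then have "\<delta> t \<in> twice_punctured" using \<delta> by blast
    moreover show 1: "(sin (\<zeta> t))\<^sup>2 = 1 - (\<delta> t)\<^sup>2" using \<zeta>(4) that by (simp add: sin_squared_eq)
    ultimately show "sin (\<zeta> t) \<noteq> 0" using square_ne_one(1) by (metis zero_power2)
  qed
  let ?P = "\<lambda>t. (\<zeta> t, c / sin (\<zeta> t))"
  have "pathfinish (\<lambda>_. ?P 0) = pathfinish ?P"
  proof (rule covering_space_monodromy[OF covering_space_conic])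
    show "homotopic_paths conic_surface (\<lambda>_. conic_section c (\<delta> 0)) (conic_section c \<circ> \<delta>)"
      using null by (rule homotopic_paths_sym)
    then show "path (conic_section c \<circ> \<delta>)" "path_image (conic_section c \<circ> \<delta>) \<subseteq> conic_surface"
      "path (\<lambda>_::real. conic_section c (\<delta> 0))" "path_image (\<lambda>_::real. conic_section c (\<delta> 0)) \<subseteq> conic_surface"
      using homotopic_paths_imp_path homotopic_paths_imp_subset by blast+
    show "path ?P" using \<zeta>(1) s(1) unfolding path_def by (intro continuous_intros) auto
    show "path_image ?P \<subseteq> conic_cover" "path_image (\<lambda>_. ?P 0) \<subseteq> conic_cover"
      using s(1) by (auto simp: path_image_def conic_cover_def)
    show P: "conic_proj (?P t) = (conic_section c \<circ> \<delta>) t" if "t \<in> {0..1}" for t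
      using s[OF that] \<zeta>(4) that by (auto simp: conic_proj_def conic_section_def power_divide)
    show "conic_proj (?P 0) = conic_section c (\<delta> 0)" using P[of 0] by simp
  qed (auto simp: pathstart_def)
  then show ?thesis using \<zeta>(2,3) by (auto simp: pathstart_def pathfinish_def)
qed

text \<open>By \<open>cos (2 * a) = 1 - 2 * (sin a)\<^sup>2\<close> the circle
  \<open>1 - unit_circle s\<close> is the cosine of twice the arcsine of \<open>v s\<close>, a root
  of \<open>unit_circle s / 2\<close>. This root stays inside the unit disc and changes its sign in
  one turn, so the lift goes from \<open>pi / 2\<close> to \<open>- pi / 2\<close>. The map
  \<open>z \<mapsto> pi - z\<close> gives the lift of the other circle.\<close>

lemma cos_lifts_pole_loop:
  "cos_lifts (pole_loop 1) (of_real pi / 2) (- of_real pi / 2)"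
  "cos_lifts (pole_loop (-1)) (of_real pi / 2) (2 * of_real pi - of_real pi / 2)"
proof -
  define v where "v s = exp (of_real pi * \<i> * of_real s) / of_real (sqrt 2)" for s :: real
  define \<zeta> where "\<zeta> s = 2 * Arcsin (v s)" for s
  have nv: "norm (v s) < 1" for s
    by (simp add: v_def norm_divide)
  have "\<bar>Re (v s)\<bar> < 1" for s using abs_Re_le_cmod[of "v s"] nv[of s] by linarith
  then have "continuous_on (range v) Arcsin" by (intro continuous_on_Arcsin) auto
  moreover have "continuous_on {0..1} v" unfolding v_def by (intro continuous_intros) auto
  ultimately have "continuous_on {0..1} \<zeta>"
    unfolding \<zeta>_def by (intro continuous_on_mult_left continuous_on_compose2[of "range v" Arcsin _ v]) auto
  then have p: "path \<zeta>" by (simp add: path_def)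
  have v2: "(v s)\<^sup>2 = unit_circle s / 2" for s
  proof -
    have "(of_real (sqrt 2) :: complex)\<^sup>2 = 2" by (simp flip: of_real_power)
    then show ?thesis
      by (simp add: v_def unit_circle_def power_divide exp_double[symmetric] mult_ac)
  qed
  have c: "cos (\<zeta> s) = 1 - unit_circle s" for s
    by (simp only: \<zeta>_def cos_double_sin sin_Arcsin v2) simp
  have "sqrt 2 / 2 = 1 / sqrt 2" by (simp add: field_simps)
  then have "sin (of_real (pi / 4)) = (of_real (1 / sqrt 2) :: complex)"
    by (simp only: sin_of_real sin_45)
  then have s45: "sin (of_real pi / 4) = (1 / of_real (sqrt 2) :: complex)" by simp
  have "Arcsin (1 / of_real (sqrt 2)) = of_real pi / 4" "Arcsin (- (1 / of_real (sqrt 2))) = - (of_real pi / 4)"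
    unfolding s45[symmetric] sin_minus[symmetric] by (intro Arcsin_sin; simp)+
  moreover have "v 0 = 1 / of_real (sqrt 2)" "v 1 = - (1 / of_real (sqrt 2))"
    by (simp_all add: v_def exp_pi_i)
  ultimately have e: "\<zeta> 0 = of_real pi / 2" "\<zeta> 1 = - of_real pi / 2"
    by (simp_all only: \<zeta>_def) simp_all
  show "cos_lifts (pole_loop 1) (of_real pi / 2) (- of_real pi / 2)"
    unfolding cos_lifts_def using p c e
    by (intro exI[of _ \<zeta>]) (auto simp: pole_loop_def pathstart_def pathfinish_def)
  have "path (\<lambda>s. of_real pi - \<zeta> s)" using p unfolding path_def by (intro continuous_intros)
  then show "cos_lifts (pole_loop (-1)) (of_real pi / 2) (2 * of_real pi - of_real pi / 2)"
    unfolding cos_lifts_def using c e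
    by (intro exI[of _ "\<lambda>s. of_real pi - \<zeta> s"])
      (auto simp: pole_loop_def pathstart_def pathfinish_def cos_diff field_simps simp flip: cos_of_real sin_of_real)
qed

text \<open>Modulo the squares of the two meridians \<open>x\<close> and \<open>y\<close>, the class
  of \<open>\<delta>\<close> is \<open>(x y)^n\<close> or \<open>(x y)^n x\<close>. Lifted from
  \<open>z0\<close> along the cosine, such a word ends at \<open>z0 - 2 * n * pi\<close> or at
  \<open>- z0 - 2 * n * pi\<close>, while a null homotopic loop has a closed lift; so only the empty
  word is left.\<close>

lemma conic_section_kernel:
  assumes y0: "y0 \<in> twice_punctured"
    and N: "N \<lhd> fundamental_group twice_punctured y0"
    and squares: "\<And>\<kappa> k. path_from twice_punctured \<kappa> y0 0 \<Longrightarrow> k \<in> {1, -1} \<Longrightarrow>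
      path_class twice_punctured (\<kappa> +++ (pole_loop k +++ reversepath \<kappa>)) [^]\<^bsub>fundamental_group twice_punctured y0\<^esub> (2::nat) \<in> N"
    and \<delta>: "\<delta> \<in> loops_at twice_punctured y0"
    and null: "homotopic_paths conic_surface (conic_section c \<circ> \<delta>) (\<lambda>_. conic_section c y0)"
  shows "path_class twice_punctured \<delta> \<in> N"
proof -
  let ?B = twice_punctured and ?S = conic_surface and ?s = "conic_section c"
    and ?G = "fundamental_group twice_punctured y0"
  let ?H = "fundamental_group ?S (?s y0)" and ?ind = "induced_map ?S ?s"
  interpret G: group ?G using y0 by (rule group_fundamental_group)
  interpret s: group_hom ?G ?H ?ind
    using continuous_on_conic_section conic_section_image y0 by (rule induced_map_hom)
  have s_class: "?ind (path_class ?B p) = path_class ?S (?s \<circ> p)" if "p \<in> loops_at ?B y0" for p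
    using that by (intro induced_map_class[OF loops_atD(1,2) continuous_on_conic_section conic_section_image])
  have s_null: "?ind (path_class ?B p) = \<one>\<^bsub>?H\<^esub> \<longleftrightarrow> homotopic_paths ?S (?s \<circ> p) (\<lambda>_. ?s y0)"
    if "p \<in> loops_at ?B y0" for p
    using loops_at_image[OF that continuous_on_conic_section conic_section_image refl, of c]
    by (simp add: s_class[OF that] one_fundamental_group path_class_eq_iff loops_atD)
  \<comment> \<open>The intersection still contains the squares, as these are null homotopic in the
    surface; and a class has the same image in the surface as its normal form modulo
    \<open>N1\<close>.\<close>
  define N1 where "N1 = N \<inter> kernel ?G ?H ?ind"
  have N1: "N1 \<lhd> ?G"
    unfolding N1_def using N s.normal_kernel by (rule G.normal_subgroup_intersect)
  interpret N1: normal N1 ?G by (rule N1)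
  let ?Q = "?G Mod N1" and ?\<pi> = "\<lambda>g. N1 #>\<^bsub>?G\<^esub> g"
  interpret Q: group_hom ?G ?Q ?\<pi>
    using N1.r_coset_hom_Mod N1.factorgroup_is_group by (intro group_hom.intro group_hom_axioms.intro G.is_group)
  define z0 where "z0 = Arccos y0"
  have z0: "cos z0 = y0" by (simp add: z0_def)
  have s0: "sin z0 \<noteq> 0" using sin_squared_eq[of z0] square_ne_one(1)[OF y0] by (auto simp: z0)
  let ?E = "{z :: complex. sin z \<noteq> 0}"
  have "?E = - (range (\<lambda>n::int. of_real (n * pi)))" by (auto simp: sin_eq_0)
  then have pc: "path_connected ?E"
    using path_connected_complement_countable[of "range (\<lambda>n::int. complex_of_real (n * pi))"] by simp
  have half_pi: "sin (of_real pi / 2 :: complex) = 1" "cos (of_real pi / 2 :: complex) = 0"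
    using sin_of_real[of "pi / 2", where ?'a = complex] cos_of_real[of "pi / 2", where ?'a = complex] by simp_all
  have "z0 \<in> ?E" "of_real pi / 2 \<in> ?E" using s0 half_pi(1) by simp_all
  \<comment> \<open>The tail \<open>\<kappa>\<close> is chosen as a cosine image, so that its lift
    from \<open>z0\<close> to \<open>pi / 2\<close>, where the lifts of the circles start, is
    known.\<close>
  then obtain \<zeta> where \<zeta>: "path \<zeta>" "path_image \<zeta> \<subseteq> ?E" "pathstart \<zeta> = z0" "pathfinish \<zeta> = of_real pi / 2"
    using pc unfolding path_connected_def by meson
  define \<kappa> where "\<kappa> = cos \<circ> \<zeta>"
  have \<kappa>: "path_from ?B \<kappa> y0 0"
  proof -
    have "cos z \<in> ?B" if "sin z \<noteq> 0" for z :: complex using sin_squared_eq[of z] that by auto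
    then have "path_image \<kappa> \<subseteq> ?B" using \<zeta>(2) by (auto simp: \<kappa>_def path_image_compose)
    moreover have "path \<kappa>" using \<zeta>(1) unfolding \<kappa>_def by (auto simp: path_def intro!: continuous_intros)
    ultimately show ?thesis
      unfolding path_from_def by (simp add: \<kappa>_def pathstart_compose pathfinish_compose \<zeta>(3,4) z0 half_pi)
  qed
  have \<kappa>_lift: "cos_lifts \<kappa> z0 (of_real pi / 2)"
    unfolding cos_lifts_def \<kappa>_def using \<zeta> by (intro exI[of _ \<zeta>]) auto
  define X where "X k = \<kappa> +++ (pole_loop k +++ reversepath \<kappa>)" for k
  have X: "path_from ?B (X k) y0 y0" if "k \<in> {1, -1}" for k
    unfolding X_def by (intro path_from_join[OF \<kappa>] path_from_join[OF path_from_pole_loop[OF that]] path_from_reverse[OF \<kappa>])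
  define x y where "x = path_class ?B (X 1)" and "y = path_class ?B (X (-1))"
  have xy: "x \<in> carrier ?G" "y \<in> carrier ?G"
    using X[of 1] X[of "-1"] by (auto simp: x_def y_def carrier_fundamental_group path_from_loop)
  have sq: "path_class ?B (X k) \<otimes>\<^bsub>?G\<^esub> path_class ?B (X k) \<in> N1" if k: "k \<in> {1, -1}" for k
  proof -
    have XG: "path_class ?B (X k) \<in> carrier ?G" using X[OF k] by (auto simp: carrier_fundamental_group path_from_loop)
    have eq: "path_class ?B (X k) \<otimes>\<^bsub>?G\<^esub> path_class ?B (X k) = path_class ?B (X k +++ X k)"
      using X[OF k] by (simp add: path_from_loop mult_fundamental_group)
    have "path_class ?B (X k) [^]\<^bsub>?G\<^esub> (2::nat) \<in> N" unfolding X_def by (rule squares[OF \<kappa> k])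
    then have "path_class ?B (X k) \<otimes>\<^bsub>?G\<^esub> path_class ?B (X k) \<in> N"
      using XG by (simp add: numeral_2_eq_2)
    moreover have "homotopic_paths ?S (?s \<circ> (X k +++ X k)) (\<lambda>_. ?s y0)"
    proof -
      have "homotopic_paths ?S (?s \<circ> (pole_loop k +++ pole_loop k)) (\<lambda>_. ?s (pole_loop k 0))"
      proof -
        have "t * (1 / 2) \<noteq> 1" if "t \<in> cball 0 1" for t :: complex
          using that by auto
        then show ?thesis
          using conic_section_double_loop_null(1)[OF k, of "\<lambda>_. 1 / 2" c] by (simp add: pole_loop_def[abs_def])
      qed
      moreover have "?s (pole_loop k 0) = ?s 0" by (simp add: pole_loop_def)
      ultimately show ?thesis
        using conjugate_square[OF path_from_image[OF \<kappa> continuous_on_conic_section conic_section_image]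
            path_from_image[OF path_from_pole_loop[OF k] continuous_on_conic_section conic_section_image]]
        unfolding X_def joinpaths_compose reversepath_compose by simp
    qed
    then have "?ind (path_class ?B (X k +++ X k)) = \<one>\<^bsub>?H\<^esub>"
      using X[OF k] by (subst s_null) (auto simp: path_from_loop loops_at_join)
    ultimately show ?thesis
      unfolding N1_def kernel_def using XG by (simp add: eq[symmetric] del: s.hom_mult)
  qed
  have one_iff: "?\<pi> g = \<one>\<^bsub>?Q\<^esub> \<longleftrightarrow> g \<in> N1" if "g \<in> carrier ?G" for g
    using that N1.is_subgroup by (metis G.coset_join1 G.coset_join2 N1.subset one_FactGroup)
  have \<pi>x: "?\<pi> x \<otimes>\<^bsub>?Q\<^esub> ?\<pi> x = \<one>\<^bsub>?Q\<^esub>" "?\<pi> y \<otimes>\<^bsub>?Q\<^esub> ?\<pi> y = \<one>\<^bsub>?Q\<^esub>"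
    using sq[of 1] sq[of "-1"] xy one_iff[of "x \<otimes>\<^bsub>?G\<^esub> x"] one_iff[of "y \<otimes>\<^bsub>?G\<^esub> y"]
    by (simp_all only: x_def y_def Q.hom_mult[symmetric] G.m_closed insert_iff simp_thms)
  define D where "D = {g. \<exists>n::int. g = (?\<pi> x \<otimes>\<^bsub>?Q\<^esub> ?\<pi> y) [^]\<^bsub>?Q\<^esub> n \<or> g = (?\<pi> x \<otimes>\<^bsub>?Q\<^esub> ?\<pi> y) [^]\<^bsub>?Q\<^esub> n \<otimes>\<^bsub>?Q\<^esub> ?\<pi> x}"
  have D: "subgroup D ?Q" and yD: "?\<pi> y \<in> D"
    unfolding D_def
    using dihedral_subgroup[OF Q.H.is_group Q.hom_closed[OF xy(1)] \<pi>x(1) Q.hom_closed[OF xy(2)] \<pi>x(2)] by auto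
  have "?\<pi> x = (?\<pi> x \<otimes>\<^bsub>?Q\<^esub> ?\<pi> y) [^]\<^bsub>?Q\<^esub> (0::int) \<otimes>\<^bsub>?Q\<^esub> ?\<pi> x"
    using Q.hom_closed[OF xy(1)] by (simp only: int_pow_0 Q.H.l_one)
  then have xD: "?\<pi> x \<in> D" unfolding D_def by blast
  define \<Gamma> where "\<Gamma> = {g \<in> carrier ?G. ?\<pi> g \<in> D}"
  interpret D: subgroup D ?Q by (rule D)
  have \<Gamma>: "subgroup \<Gamma> ?G"
    unfolding \<Gamma>_def by (rule G.subgroupI) (use D.one_closed in \<open>auto simp: Q.hom_mult simp del: one_FactGroup mult_FactGroup\<close>)
  have "\<Gamma> = carrier ?G"
  proof (rule generate_twice_punctured[OF path_from_reverse[OF \<kappa>] \<Gamma>])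
    fix k :: real assume "k \<in> {1, -1}"
    then show "path_class ?B (reversepath (reversepath \<kappa>) +++ (pole_loop k +++ reversepath \<kappa>)) \<in> \<Gamma>"
      using xD yD xy unfolding \<Gamma>_def x_def y_def by (auto simp: X_def)
  qed
  \<comment> \<open>\<open>\<Lambda> \<epsilon> k g\<close> records the deck transformation that
    takes the start \<open>z0\<close> of the lift of some loop in \<open>g\<close> to its
    end.\<close>
  define \<Lambda> where "\<Lambda> \<epsilon> k g \<longleftrightarrow> (\<exists>p\<in>loops_at ?B y0. g = path_class ?B p \<and> cos_lifts p z0 (\<epsilon> * z0 + 2 * of_int k * of_real pi))"
    for \<epsilon> :: complex and k :: int and g
  \<comment> \<open>The lift of the second loop starts where the first one ends, hence is moved by
    the deck transformation of the first.\<close>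
  have \<Lambda>_mult: "\<Lambda> (\<epsilon> * \<epsilon>') (\<epsilon>i * k' + k) (g \<otimes>\<^bsub>?G\<^esub> g')"
    if gg: "\<Lambda> \<epsilon> k g" "\<Lambda> \<epsilon>' k' g'" and \<epsilon>: "\<epsilon> = of_int \<epsilon>i" "\<epsilon>i \<in> {1, -1}" for \<epsilon> \<epsilon>' \<epsilon>i k k' g g'
  proof -
    obtain p p' where p: "p \<in> loops_at ?B y0" "g = path_class ?B p" "cos_lifts p z0 (\<epsilon> * z0 + 2 * of_int k * of_real pi)"
      and p': "p' \<in> loops_at ?B y0" "g' = path_class ?B p'" "cos_lifts p' z0 (\<epsilon>' * z0 + 2 * of_int k' * of_real pi)"
      using gg unfolding \<Lambda>_def by blast
    have "cos_lifts (p +++ p') z0 (\<epsilon> * (\<epsilon>' * z0 + 2 * of_int k' * of_real pi) + 2 * of_int k * of_real pi)"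
      using \<epsilon> by (intro cos_lifts_join[OF p(3)] cos_lifts_deck[OF p'(3)]) auto
    also have "\<epsilon> * (\<epsilon>' * z0 + 2 * of_int k' * of_real pi) + 2 * of_int k * of_real pi
        = (\<epsilon> * \<epsilon>') * z0 + 2 * of_int (\<epsilon>i * k' + k) * of_real pi"
      by (simp add: \<epsilon>(1) algebra_simps)
    finally show ?thesis
      unfolding \<Lambda>_def using p p' by (intro bexI[of _ "p +++ p'"]) (auto simp: mult_fundamental_group loops_at_join)
  qed
  have \<Lambda>_inv: "\<Lambda> 1 (- k) (inv\<^bsub>?G\<^esub> g)" if L: "\<Lambda> 1 k g" for k g
  proof -
    obtain p where p: "p \<in> loops_at ?B y0" "g = path_class ?B p" "cos_lifts p z0 (1 * z0 + 2 * of_int k * of_real pi)"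
      using L unfolding \<Lambda>_def by blast
    have "cos_lifts (reversepath p) (1 * (1 * z0 + 2 * of_int k * of_real pi) + 2 * of_int (- k) * of_real pi)
        (1 * z0 + 2 * of_int (- k) * of_real pi)"
      by (intro cos_lifts_deck cos_lifts_reverse[OF p(3)]) auto
    then have "cos_lifts (reversepath p) z0 (1 * z0 + 2 * of_int (- k) * of_real pi)" by simp
    then show ?thesis
      unfolding \<Lambda>_def using p
      by (intro bexI[of _ "reversepath p"]) (auto simp: inv_fundamental_group loops_at_reverse)
  qed
  have \<Lambda>x: "\<Lambda> (-1) 0 x"
  proof -
    have "cos_lifts (reversepath \<kappa>) (-1 * (of_real pi / 2) + 2 * of_int 0 * of_real pi) (-1 * z0 + 2 * of_int 0 * of_real pi)"
      by (intro cos_lifts_deck cos_lifts_reverse[OF \<kappa>_lift]) auto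
    then have "cos_lifts (X 1) z0 (-1 * z0 + 2 * of_int 0 * of_real pi)"
      unfolding X_def by (intro cos_lifts_join[OF \<kappa>_lift] cos_lifts_join[OF cos_lifts_pole_loop(1)]) simp
    then show ?thesis unfolding \<Lambda>_def x_def using X[of 1] by (auto simp: path_from_loop)
  qed
  have \<Lambda>y: "\<Lambda> (-1) 1 y"
  proof -
    have "cos_lifts (reversepath \<kappa>) (-1 * (of_real pi / 2) + 2 * of_int 1 * of_real pi) (-1 * z0 + 2 * of_int 1 * of_real pi)"
      by (intro cos_lifts_deck cos_lifts_reverse[OF \<kappa>_lift]) auto
    then have "cos_lifts (X (-1)) z0 (-1 * z0 + 2 * of_int 1 * of_real pi)"
      unfolding X_def by (intro cos_lifts_join[OF \<kappa>_lift] cos_lifts_join[OF cos_lifts_pole_loop(2)]) simp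
    then show ?thesis unfolding \<Lambda>_def y_def using X[of "-1"] by (auto simp: path_from_loop)
  qed
  let ?q = "x \<otimes>\<^bsub>?G\<^esub> y"
  have q: "?q \<in> carrier ?G" using xy by simp
  \<comment> \<open>\<open>x\<close> belongs to \<open>z \<mapsto> - z\<close> and \<open>y\<close>
    to \<open>z \<mapsto> - z + 2 * pi\<close>; the composition is the translation by
    \<open>- 2 * pi\<close>.\<close>
  have \<Lambda>q: "\<Lambda> 1 (-1) ?q" using \<Lambda>_mult[OF \<Lambda>x \<Lambda>y, of "-1"] by simp
  have \<Lambda>n: "\<Lambda> 1 (- int n) (?q [^]\<^bsub>?G\<^esub> n)" for n
  proof (induction n)
    case 0
    have "cos_lifts (\<lambda>_. y0) z0 z0" unfolding cos_lifts_def using z0 by (intro exI[of _ "\<lambda>_. z0"]) auto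
    then show ?case
      unfolding \<Lambda>_def using y0 by (auto simp: one_fundamental_group intro!: bexI[of _ "\<lambda>_. y0"] loops_at_const)
  next
    case (Suc n)
    then show ?case using \<Lambda>_mult[OF Suc \<Lambda>q, of 1] by (simp add: algebra_simps)
  qed
  have \<Lambda>int: "\<Lambda> 1 (- n) (?q [^]\<^bsub>?G\<^esub> n)" for n :: int
  proof (cases n rule: int_cases2)
    case (nonneg m)
    then show ?thesis using \<Lambda>n[of m] by (simp add: int_pow_int)
  next
    case (nonpos m)
    then show ?thesis using \<Lambda>_inv[OF \<Lambda>n[of m]] q by (simp add: G.int_pow_neg_int)
  qed
  have closed: "\<epsilon> * z0 + 2 * of_int k * of_real pi = z0" if \<Lambda>: "\<Lambda> \<epsilon> k g" and g: "?ind g = \<one>\<^bsub>?H\<^esub>" for \<epsilon> k g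
  proof -
    obtain p where p: "p \<in> loops_at ?B y0" "g = path_class ?B p" "cos_lifts p z0 (\<epsilon> * z0 + 2 * of_int k * of_real pi)"
      using \<Lambda> unfolding \<Lambda>_def by blast
    have "p 0 = y0" using loops_atD(3)[OF p(1)] by (simp add: pathstart_def)
    then show ?thesis
      using cos_lifts_null_closed[OF _ loops_atD(2)[OF p(1)] p(3), of c] g s_null[OF p(1)] p(2) by simp
  qed
  let ?d = "path_class ?B \<delta>"
  have d: "?d \<in> carrier ?G" using \<delta> by (simp add: carrier_fundamental_group)
  have d1: "?ind ?d = \<one>\<^bsub>?H\<^esub>" using s_null[OF \<delta>] null by simp
  have "?\<pi> ?d \<in> D" using d \<open>\<Gamma> = carrier ?G\<close> unfolding \<Gamma>_def by blast
  then obtain n :: int where "?\<pi> ?d = (?\<pi> x \<otimes>\<^bsub>?Q\<^esub> ?\<pi> y) [^]\<^bsub>?Q\<^esub> n \<or>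
      ?\<pi> ?d = (?\<pi> x \<otimes>\<^bsub>?Q\<^esub> ?\<pi> y) [^]\<^bsub>?Q\<^esub> n \<otimes>\<^bsub>?Q\<^esub> ?\<pi> x" unfolding D_def by blast
  then have "?\<pi> ?d = ?\<pi> (?q [^]\<^bsub>?G\<^esub> n) \<or> ?\<pi> ?d = ?\<pi> (?q [^]\<^bsub>?G\<^esub> n \<otimes>\<^bsub>?G\<^esub> x)"
    using xy q by (simp add: Q.hom_int_pow Q.hom_mult del: mult_FactGroup)
  moreover have "?q [^]\<^bsub>?G\<^esub> n \<in> carrier ?G" "?q [^]\<^bsub>?G\<^esub> n \<otimes>\<^bsub>?G\<^esub> x \<in> carrier ?G" using q xy by simp_all
  moreover have "\<Lambda> (-1) (- n) (?q [^]\<^bsub>?G\<^esub> n \<otimes>\<^bsub>?G\<^esub> x)"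
    using \<Lambda>_mult[OF \<Lambda>int[of n] \<Lambda>x, of 1] by simp
  ultimately obtain g \<epsilon> where g: "g \<in> carrier ?G" "?\<pi> ?d = ?\<pi> g" "\<Lambda> \<epsilon> (- n) g"
    "(\<epsilon> = 1 \<and> g = ?q [^]\<^bsub>?G\<^esub> n) \<or> \<epsilon> = -1"
    using \<Lambda>int[of n] by blast
  have "?\<pi> (?d \<otimes>\<^bsub>?G\<^esub> inv\<^bsub>?G\<^esub> g) = \<one>\<^bsub>?Q\<^esub>"
    by (simp only: Q.hom_mult[OF d G.inv_closed[OF g(1)]] Q.hom_inv[OF g(1)] g(2) Q.H.r_inv[OF Q.hom_closed[OF g(1)]])
  then have dg: "?d \<otimes>\<^bsub>?G\<^esub> inv\<^bsub>?G\<^esub> g \<in> N1"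
    using one_iff[OF G.m_closed[OF d G.inv_closed[OF g(1)]]] by (rule iffD1[rotated])
  \<comment> \<open>By the choice of \<open>N1\<close> the normal form \<open>g\<close> has the same
    image as the class of \<open>\<delta>\<close>, so it is null homotopic in the surface, too, and
    its lift is closed.\<close>
  then have "?ind (?d \<otimes>\<^bsub>?G\<^esub> inv\<^bsub>?G\<^esub> g) = \<one>\<^bsub>?H\<^esub>" unfolding N1_def kernel_def by blast
  then have "?ind ?d \<otimes>\<^bsub>?H\<^esub> inv\<^bsub>?H\<^esub> ?ind g = \<one>\<^bsub>?H\<^esub>"
    by (simp only: s.hom_mult[OF d G.inv_closed[OF g(1)]] s.hom_inv[OF g(1)])
  then have "inv\<^bsub>?H\<^esub> ?ind g = \<one>\<^bsub>?H\<^esub>"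
    by (simp only: d1 s.H.l_one[OF s.H.inv_closed[OF s.hom_closed[OF g(1)]]])
  then have "?ind g = \<one>\<^bsub>?H\<^esub>"
    using s.H.inv_inv[OF s.hom_closed[OF g(1)]] s.H.inv_one by metis
  from closed[OF g(3) this] have cl: "\<epsilon> * z0 + 2 * of_int (- n) * of_real pi = z0" .
  \<comment> \<open>A reflection fixes only multiples of \<open>pi\<close>, where \<open>sin\<close>
    vanishes.\<close>
  have "\<epsilon> \<noteq> -1"
  proof
    assume "\<epsilon> = -1"
    then have "(- z0) + 2 * (of_int (- n) * of_real pi) = z0" using cl by (simp only: mult_minus1 mult.assoc)
    then have "2 * z0 = 2 * (of_int (- n) * of_real pi)" by (metis add.commute diff_add_cancel mult_2 uminus_add_conv_diff)
    then have "z0 = of_real (of_int (- n) * pi)" by simp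
    then have "sin z0 = 0" unfolding sin_eq_0 by blast
    with s0 show False by simp
  qed
  then have "n = 0" "g = ?q [^]\<^bsub>?G\<^esub> n" using cl g(4) by auto
  then have "g = \<one>\<^bsub>?G\<^esub>" by simp
  then have "?d \<in> N1" using dg G.r_one[OF d] by (simp only: G.inv_one)
  then show ?thesis by (simp add: N1_def)
qed

section \<open>Projective spaces\<close>

lemma proj_pt_cases:
  obtains v where "v \<noteq> 0" "l = proj_pt v"
proof -
  obtain v where v: "v \<noteq> 0" "Rep_proj l = range (\<lambda>c. c *s v)" using Rep_proj[of l] by blast
  then have "l = proj_pt v" unfolding proj_pt_def by (metis Rep_proj_inverse)
  with v(1) show ?thesis by (rule that)
qed

lemma proj_pt_eq_iff:
  fixes v w :: "complex ^ 'n::finite"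
  assumes "v \<noteq> 0" "w \<noteq> 0"
  shows "proj_pt v = proj_pt w \<longleftrightarrow> (\<exists>c. c \<noteq> 0 \<and> w = c *s v)"
proof -
  have "proj_pt v = proj_pt w \<longleftrightarrow> range (\<lambda>c. c *s v) = range (\<lambda>c. c *s w)"
    unfolding proj_pt_def using assms by (subst Abs_proj_inject) blast+
  also have "\<dots> \<longleftrightarrow> (\<exists>c. c \<noteq> 0 \<and> w = c *s v)"
  proof
    assume eq: "range (\<lambda>c. c *s v) = range (\<lambda>c. c *s w)"
    have "1 *s w \<in> range (\<lambda>c. c *s w)" by (rule rangeI)
    then obtain c where c: "w = c *s v" unfolding eq[symmetric] by auto
    then have "c \<noteq> 0" using assms(2) by auto
    with c show "\<exists>c. c \<noteq> 0 \<and> w = c *s v" by blast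
  next
    assume "\<exists>c. c \<noteq> 0 \<and> w = c *s v"
    then obtain c where c: "c \<noteq> 0" "w = c *s v" by blast
    show "range (\<lambda>c. c *s v) = range (\<lambda>c. c *s w)"
    proof (intro equalityI subsetI)
      fix x assume "x \<in> range (\<lambda>c. c *s v)"
      then obtain d where "x = d *s v" by blast
      then have "x = (d / c) *s w" using c by simp
      then show "x \<in> range (\<lambda>c. c *s w)" by blast
    qed (use c in auto)
  qed
  finally show ?thesis .
qed

lemma proj_pt_scale: "c \<noteq> 0 \<Longrightarrow> v \<noteq> 0 \<Longrightarrow> proj_pt (c *s v) = proj_pt (v :: complex ^ 'n::finite)"
  by (subst proj_pt_eq_iff) (auto intro!: exI[of _ "1 / c"] simp: vector_mul_eq_0)

lemma proj_pt_eqI: "v \<noteq> 0 \<Longrightarrow> c \<noteq> 0 \<Longrightarrow> w = c *s v \<Longrightarrow> proj_pt v = proj_pt (w :: complex ^ 'n::finite)"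
  by (simp add: proj_pt_scale)

lemma open_proj_iff: "open U \<longleftrightarrow> open {v. v \<noteq> 0 \<and> proj_pt v \<in> U}"
  by (simp add: open_proj_def)

lemma continuous_on_proj_pt: "continuous_on (- {0}) proj_pt"
proof -
  have "proj_pt -` B \<inter> - {0} = {v. v \<noteq> 0 \<and> proj_pt v \<in> B}" for B :: "'a proj set" by auto
  then show ?thesis
    by (subst continuous_on_open_vimage) (auto simp: open_proj_iff)
qed

lemma continuous_on_proj_pt_compose:
  assumes "continuous_on S f" "\<And>x. x \<in> S \<Longrightarrow> f x \<noteq> 0"
  shows "continuous_on S (\<lambda>x. proj_pt (f x))"
  using assms by (intro continuous_on_compose2[OF continuous_on_proj_pt]) auto

text \<open>The topology is a quotient topology, so continuity is tested on the punctured vector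
  space.\<close>

lemma continuous_on_proj:
  assumes "open U" "continuous_on {v. v \<noteq> 0 \<and> proj_pt v \<in> U} (\<lambda>v. g (proj_pt v))"
  shows "continuous_on U g"
proof -
  let ?V = "{v. v \<noteq> 0 \<and> proj_pt v \<in> U}"
  have V: "open ?V" using assms(1) open_proj_iff by blast
  show ?thesis
  proof (subst continuous_on_open_vimage[OF assms(1)], intro allI impI)
    fix B :: "'b set" assume "open B"
    then have "open ((\<lambda>v. g (proj_pt v)) -` B \<inter> ?V)"
      using assms(2) continuous_on_open_vimage[OF V] by blast
    moreover have "(\<lambda>v. g (proj_pt v)) -` B \<inter> ?V = {v. v \<noteq> 0 \<and> proj_pt v \<in> g -` B \<inter> U}" by auto
    ultimately show "open (g -` B \<inter> U)" by (simp add: open_proj_iff)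
  qed
qed

text \<open>Bilinear, not Hermitian.\<close>

definition dot :: "complex ^ 'n \<Rightarrow> complex ^ 'n \<Rightarrow> complex" where
  "dot a v = (\<Sum>k\<in>UNIV. a $ k * v $ k)"

lemma dot_simps [simp]:
  "dot a (v + w) = dot a v + dot a w" "dot a (v - w) = dot a v - dot a w" "dot a (c *s v) = c * dot a v"
  "dot (a + b) v = dot a v + dot b v" "dot (a - b) v = dot a v - dot b v" "dot (c *s a) v = c * dot a v"
  "dot 0 v = 0" "dot a 0 = 0" "dot (- a) v = - dot a v" "dot a (- v) = - dot a v"
  by (simp_all add: dot_def algebra_simps sum.distrib sum_subtractf sum_distrib_left sum_negf)

lemma dot_commute: "dot a v = dot v a"
  by (simp add: dot_def mult.commute)

lemma dot_3: "dot a v = a $ 1 * v $ 1 + a $ 2 * v $ 2 + a $ (3::3) * v $ 3"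
  by (simp add: dot_def sum_3)

lemma dot_2: "dot a v = a $ 1 * v $ 1 + a $ (2::2) * v $ 2"
  by (simp add: dot_def sum_2)

lemma continuous_on_dot [continuous_intros]:
  "continuous_on S f \<Longrightarrow> continuous_on S (\<lambda>x. dot a (f x))"
  unfolding dot_def by (intro continuous_intros)

lemma dot_eq_0_all: "(\<And>v. dot a v = 0) \<Longrightarrow> a = 0"
proof -
  assume *: "\<And>v. dot a v = 0"
  have "a $ k = 0" for k
    using *[of "axis k 1"] by (simp add: dot_def axis_def if_distrib cong: if_cong)
  then show "a = 0" by (simp add: vec_eq_iff)
qed

section \<open>Affine coordinates on projective spaces\<close>

definition ratio :: "complex ^ 'n \<Rightarrow> complex ^ 'n \<Rightarrow> ('n::finite) proj \<Rightarrow> complex" where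
  "ratio a b l = (let v = SOME v. v \<noteq> 0 \<and> proj_pt v = l in dot a v / dot b v)"

lemma ratio_proj_pt:
  assumes "v \<noteq> 0"
  shows "ratio a b (proj_pt v) = dot a v / dot b v"
proof -
  obtain w where w: "w \<noteq> 0" "proj_pt w = proj_pt v" "ratio a b (proj_pt v) = dot a w / dot b w"
    using someI[of "\<lambda>w. w \<noteq> 0 \<and> proj_pt w = proj_pt v" v] assms by (auto simp: ratio_def Let_def)
  then obtain c where "c \<noteq> 0" "v = c *s w" using proj_pt_eq_iff[of w v] assms by auto
  then show ?thesis using w(3) by simp
qed

definition nonvan :: "complex ^ 'n \<Rightarrow> ('n::finite) proj set" where
  "nonvan b = {l. \<forall>v. v \<noteq> 0 \<and> proj_pt v = l \<longrightarrow> dot b v \<noteq> 0}"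

lemma nonvan_proj_pt:
  assumes "v \<noteq> 0"
  shows "proj_pt v \<in> nonvan b \<longleftrightarrow> dot b v \<noteq> 0"
proof
  assume b: "dot b v \<noteq> 0"
  have "dot b w \<noteq> 0" if "w \<noteq> 0" "proj_pt w = proj_pt v" for w
    using that b proj_pt_eq_iff[OF that(1) assms] by auto
  then show "proj_pt v \<in> nonvan b" by (simp add: nonvan_def)
qed (use assms in \<open>auto simp: nonvan_def\<close>)

lemma open_nonvan: "open (nonvan b)"
proof -
  have "{v. v \<noteq> 0 \<and> proj_pt v \<in> nonvan b} = {v. dot b v \<noteq> 0}"
  proof -
    have "v \<noteq> 0 \<and> proj_pt v \<in> nonvan b \<longleftrightarrow> dot b v \<noteq> 0" for v
      by (cases "v = 0") (simp_all add: nonvan_proj_pt)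
    then show ?thesis by simp
  qed
  moreover have "open {v. dot b v \<noteq> 0}"
    by (intro open_Collect_neq continuous_intros continuous_on_id)
  ultimately show ?thesis by (simp add: open_proj_iff)
qed

lemma continuous_on_ratio: "continuous_on (nonvan b) (ratio a b)"
proof (rule continuous_on_proj[OF open_nonvan])
  have "continuous_on {v. v \<noteq> 0 \<and> proj_pt v \<in> nonvan b} (\<lambda>v. dot a v / dot b v)"
    by (intro continuous_intros continuous_on_id) (auto simp: nonvan_proj_pt)
  then show "continuous_on {v. v \<noteq> 0 \<and> proj_pt v \<in> nonvan b} (\<lambda>v. ratio a b (proj_pt v))"
    by (rule continuous_on_eq) (auto simp: ratio_proj_pt)
qed

subsection \<open>Lines in the plane\<close>

text \<open>In homogeneous coordinates this is the join of two points and, dually, the meet of two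
  lines.\<close>

definition cross :: "complex ^ 3 \<Rightarrow> complex ^ 3 \<Rightarrow> complex ^ 3" where
  "cross v w = vector [v $ 2 * w $ 3 - v $ 3 * w $ 2, v $ 3 * w $ 1 - v $ 1 * w $ 3, v $ 1 * w $ 2 - v $ 2 * w $ 1]"

lemma dot_cross [simp]: "dot (cross v w) v = 0" "dot (cross v w) w = 0"
  by (simp_all add: dot_3 cross_def algebra_simps)

lemma cross_eq_0_iff:
  assumes "v \<noteq> 0" "w \<noteq> 0"
  shows "cross v w = 0 \<longleftrightarrow> proj_pt v = proj_pt w"
proof
  assume "cross v w = 0"
  then have eq: "v $ 2 * w $ 3 = v $ 3 * w $ 2" "v $ 3 * w $ 1 = v $ 1 * w $ 3" "v $ 1 * w $ 2 = v $ 2 * w $ 1"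
    by (simp_all add: cross_def vec_eq_iff forall_3)
  obtain k where k: "v $ k \<noteq> 0" using assms(1) by (auto simp: vec_eq_iff)
  have "v $ k * w $ j = w $ k * v $ j" for j
  proof -
    have "v $ i * w $ i' = w $ i * v $ i'" if "i = 1 \<or> i = 2 \<or> i = 3" "i' = 1 \<or> i' = 2 \<or> i' = 3" for i i' :: 3
      using that(1)
    proof (elim disjE)
      show ?thesis if "i = 1" using \<open>i' = 1 \<or> i' = 2 \<or> i' = 3\<close> eq unfolding that by (metis mult.commute)
      show ?thesis if "i = 2" using \<open>i' = 1 \<or> i' = 2 \<or> i' = 3\<close> eq unfolding that by (metis mult.commute)
      show ?thesis if "i = 3" using \<open>i' = 1 \<or> i' = 2 \<or> i' = 3\<close> eq unfolding that by (metis mult.commute)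
    qed
    then show ?thesis using exhaust_3[of j] exhaust_3[of k] by blast
  qed
  then have "w $ j = (w $ k / v $ k) * v $ j" for j
    using k by (simp add: field_simps)
  then obtain d where "\<And>j. w $ j = d * v $ j" by blast
  then have w: "w = d *s v" by (simp add: vec_eq_iff)
  moreover have "d \<noteq> 0" using assms(2) w by auto
  ultimately show "proj_pt v = proj_pt w" using proj_pt_eq_iff[OF assms] by blast
next
  assume "proj_pt v = proj_pt w"
  then obtain c where "w = c *s v" using proj_pt_eq_iff[OF assms] by blast
  then show "cross v w = 0" by (simp add: cross_def vec_eq_iff forall_3)
qed

text \<open>By the triple product identity a form vanishing at \<open>v\<close> and \<open>w\<close>
  is parallel to their join.\<close>

lemma cross_unique:
  assumes "cross v w \<noteq> 0" "dot a v = 0" "dot a w = 0"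
  shows "\<exists>c. a = c *s cross v w"
proof (cases "a = 0")
  case False
  have "dot (cross v w) v = 0" by simp
  have "cross (cross v w) a = (dot a v) *s w - (dot a w) *s v"
    by (simp add: cross_def dot_3 vec_eq_iff forall_3 algebra_simps)
  then have "cross (cross v w) a = 0" using assms by simp
  then obtain c where "a = c *s cross v w"
    using cross_eq_0_iff[OF assms(1) False] proj_pt_eq_iff[OF assms(1) False] by blast
  then show ?thesis by blast
qed (auto intro: exI[of _ 0])

lemma proj_line_iff:
  assumes "a \<noteq> 0" "v \<noteq> 0"
  shows "proj_pt v \<in> proj_line (proj_pt a) \<longleftrightarrow> dot a v = 0"
proof
  assume "proj_pt v \<in> proj_line (proj_pt a)"
  then obtain w where w: "proj_pt v = proj_pt w" "w \<noteq> 0" "dot a w = 0"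
    unfolding proj_line_def dot_def[symmetric] using assms(1) by auto
  then obtain c where "v = c *s w" using proj_pt_eq_iff[of w v] assms by auto
  then show "dot a v = 0" using w by simp
next
  assume av: "dot a v = 0"
  have "dot b v = 0" if "b \<noteq> 0" "proj_pt b = proj_pt a" for b
    using av that proj_pt_eq_iff[of a b] assms by auto
  then show "proj_pt v \<in> proj_line (proj_pt a)"
    unfolding proj_line_def dot_def[symmetric] using assms by auto
qed

lemma proj_line_unique:
  assumes "x \<in> proj_line l" "x' \<in> proj_line l" "x \<in> proj_line l'" "x' \<in> proj_line l'" "x \<noteq> x'"
  shows "l = l'"
proof -
  obtain v w a b where r: "v \<noteq> 0" "x = proj_pt v" "w \<noteq> 0" "x' = proj_pt w"
    "a \<noteq> 0" "l = proj_pt a" "b \<noteq> 0" "l' = proj_pt b"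
    by (meson proj_pt_cases)
  have c: "cross v w \<noteq> 0" using assms(5) r by (simp add: cross_eq_0_iff)
  obtain s t where "a = s *s cross v w" "b = t *s cross v w"
    using cross_unique[OF c, of a] cross_unique[OF c, of b] assms r by (auto simp: proj_line_iff)
  moreover from this have "s \<noteq> 0" "t \<noteq> 0" using r by auto
  ultimately show ?thesis using c r by (simp add: proj_pt_scale)
qed

lemma proj_line_meet:
  assumes "x \<in> proj_line l" "x' \<in> proj_line l" "x \<in> proj_line l'" "x' \<in> proj_line l'" "l \<noteq> l'"
  shows "x = x'"
  using assms by (metis proj_line_unique)

lemma closed_proj_singleton: "closed {l :: 3 proj}"
proof -
  obtain a where a: "a \<noteq> 0" "l = proj_pt a" by (meson proj_pt_cases)
  have "{v. v \<noteq> 0 \<and> proj_pt v \<in> - {l}} = {v. cross a v \<noteq> 0}"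
  proof -
    have "v \<noteq> 0 \<and> proj_pt v \<in> - {l} \<longleftrightarrow> cross a v \<noteq> 0" for v
      using a by (cases "v = 0") (auto simp: cross_eq_0_iff, simp add: cross_def vec_eq_iff forall_3)
    then show ?thesis by simp
  qed
  moreover have "{v. cross a v \<noteq> 0} = {v. cross a v $ 1 \<noteq> 0} \<union> {v. cross a v $ 2 \<noteq> 0} \<union> {v. cross a v $ 3 \<noteq> 0}"
    by (auto simp: vec_eq_iff forall_3)
  moreover have "open {v. cross a v $ 1 \<noteq> 0}" "open {v. cross a v $ 2 \<noteq> 0}" "open {v. cross a v $ 3 \<noteq> 0}"
    unfolding cross_def vector_3 by (intro open_Collect_neq continuous_intros)+
  ultimately have "open {v. v \<noteq> 0 \<and> proj_pt v \<in> - {l}}" by (simp add: open_Un)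
  then show ?thesis by (simp add: closed_def open_proj_iff)
qed

section \<open>Coordinates adapted to the complete quadrilateral\<close>

lemma isCont_nonzero_nearby:
  fixes g :: "complex \<Rightarrow> complex"
  assumes "isCont g 0" "g 0 \<noteq> 0"
  obtains s where "s \<noteq> 0" "g s \<noteq> 0"
proof -
  obtain e where e: "e > 0" "\<And>s. dist 0 s < e \<Longrightarrow> g s \<noteq> 0"
    using continuous_at_avoid[OF assms(1) assms(2)] by auto
  show thesis by (rule that[of "of_real (e / 2)"]) (use e in auto)
qed

definition quadrilateral_poly :: "complex ^ 3 \<Rightarrow> complex" where
  "quadrilateral_poly z = ((z $ 1)\<^sup>2 - (z $ 2)\<^sup>2) * ((z $ 1)\<^sup>2 - (z $ 3)\<^sup>2) * ((z $ 2)\<^sup>2 - (z $ 3)\<^sup>2)"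

text \<open>A general point of one line, moved in the direction \<open>P\<close>, stays in the
  arrangement and, for small steps, off the other lines, hence on its own line. Three of the lines
  already force \<open>P = 0\<close>. It follows that the six lines have no common point.\<close>

lemma quadrilateral_no_vertex:
  assumes "\<And>x s. quadrilateral_poly x = 0 \<Longrightarrow> quadrilateral_poly (x + s *s P) = 0"
  shows "P = 0"
proof -
  have 1: "P $ 1 = P $ 2"
  proof -
    \<comment> \<open>A point of the line \<open>z\<^sub>1 = z\<^sub>2\<close> on none of the
      others; \<open>?g\<close> is the product of the remaining factors along the motion.\<close>
    let ?x = "vector [1, 1, 3] :: complex ^ 3"
    let ?g = "\<lambda>s. (2 + s * (P $ 1 + P $ 2)) * (((1 + s * P $ 1)\<^sup>2 - (3 + s * P $ 3)\<^sup>2) * ((1 + s * P $ 2)\<^sup>2 - (3 + s * P $ 3)\<^sup>2))"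
    obtain s where s: "s \<noteq> 0" "?g s \<noteq> 0"
      by (rule isCont_nonzero_nearby[of ?g]) (auto intro!: continuous_intros)
    have "quadrilateral_poly (?x + s *s P) = 0" by (rule assms) (simp add: quadrilateral_poly_def)
    also have "quadrilateral_poly (?x + s *s P) = s * (P $ 1 - P $ 2) * ?g s"
      by (simp add: quadrilateral_poly_def) algebra
    finally show ?thesis using s by simp
  qed
  have 2: "P $ 1 = - P $ 2"
  proof -
    let ?x = "vector [1, -1, 3] :: complex ^ 3"
    let ?g = "\<lambda>s. (2 + s * (P $ 1 - P $ 2)) * (((1 + s * P $ 1)\<^sup>2 - (3 + s * P $ 3)\<^sup>2) * ((-1 + s * P $ 2)\<^sup>2 - (3 + s * P $ 3)\<^sup>2))"
    obtain s where s: "s \<noteq> 0" "?g s \<noteq> 0"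
      by (rule isCont_nonzero_nearby[of ?g]) (auto intro!: continuous_intros)
    have "quadrilateral_poly (?x + s *s P) = 0" by (rule assms) (simp add: quadrilateral_poly_def)
    also have "quadrilateral_poly (?x + s *s P) = s * (P $ 1 + P $ 2) * ?g s"
      by (simp add: quadrilateral_poly_def) algebra
    finally show ?thesis using s by (simp add: eq_neg_iff_add_eq_0)
  qed
  have 3: "P $ 2 = P $ 3"
  proof -
    let ?x = "vector [3, 1, 1] :: complex ^ 3"
    let ?g = "\<lambda>s. (2 + s * (P $ 2 + P $ 3)) * (((3 + s * P $ 1)\<^sup>2 - (1 + s * P $ 2)\<^sup>2) * ((3 + s * P $ 1)\<^sup>2 - (1 + s * P $ 3)\<^sup>2))"
    obtain s where s: "s \<noteq> 0" "?g s \<noteq> 0"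
      by (rule isCont_nonzero_nearby[of ?g]) (auto intro!: continuous_intros)
    have "quadrilateral_poly (?x + s *s P) = 0" by (rule assms) (simp add: quadrilateral_poly_def)
    also have "quadrilateral_poly (?x + s *s P) = s * (P $ 2 - P $ 3) * ?g s"
      by (simp add: quadrilateral_poly_def) algebra
    finally show ?thesis using s by simp
  qed
  have "P $ 1 = 0" using 1 2 by simp
  then show ?thesis using 1 3 by (simp add: vec_eq_iff forall_3)
qed

text \<open>The vectors \<open>e1\<close>, \<open>e2\<close>, \<open>e3\<close> will represent the
  triple points \<open>p 1\<close>, \<open>p 4\<close>, \<open>p 5\<close>, which are the vertices
  of the triangle formed by \<open>L 1\<close>, \<open>L 2\<close>, \<open>L 3\<close>; the dual
  forms \<open>l1\<close>, \<open>l2\<close>, \<open>l3\<close> define its sides.\<close>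

locale quadrilateral_frame =
  fixes e1 e2 e3 l1 l2 l3 :: "complex ^ 3"
  assumes dual: "dot l1 e1 = 1" "dot l1 e2 = 0" "dot l1 e3 = 0"
    "dot l2 e1 = 0" "dot l2 e2 = 1" "dot l2 e3 = 0"
    "dot l3 e1 = 0" "dot l3 e2 = 0" "dot l3 e3 = 1"
    and expand: "\<And>v. v = dot l1 v *s e1 + dot l2 v *s e2 + dot l3 v *s e3"

lemma cramer:
  "dot a (cross b c) *s v = dot a v *s cross b c + dot b v *s cross c a + dot c v *s cross a b"
  by (simp add: dot_3 cross_def vec_eq_iff forall_3 algebra_simps)

text \<open>The labelled arrangement is known only through its union and its incidences, and the
  frame is recovered from these. The triangle of the first three lines fixes it up to scaling; the
  fourth triple point \<open>p 7\<close> serves as unit point, which makes the other lines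
  differences of the forms.\<close>

lemma complete_quadrilateral_frame:
  assumes "complete_quadrilateral L p"
  shows "\<exists>e1 e2 e3 l1 l2 l3. quadrilateral_frame e1 e2 e3 l1 l2 l3 \<and>
    L 1 = proj_line (proj_pt l1) \<and> L 2 = proj_line (proj_pt l2) \<and> L 3 = proj_line (proj_pt l3) \<and>
    L 4 = proj_line (proj_pt (l2 - l3)) \<and> L 5 = proj_line (proj_pt (l1 - l3)) \<and>
    L 6 = proj_line (proj_pt (l1 - l2)) \<and>
    p 1 = proj_pt e1 \<and> p 4 = proj_pt e2 \<and> p 5 = proj_pt e3 \<and>
    p 2 = proj_pt (e1 + e3) \<and> p 3 = proj_pt (e2 + e3)"
proof -
  note A = assms[unfolded complete_quadrilateral_def]
  have "\<forall>i\<in>{1..6}. \<exists>a. a \<noteq> 0 \<and> L i = proj_line (proj_pt a)"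
    using A by (metis proj_pt_cases)
  then obtain a where a: "\<And>i. i \<in> {1..6} \<Longrightarrow> a i \<noteq> 0" "\<And>i. i \<in> {1..6} \<Longrightarrow> L i = proj_line (proj_pt (a i))"
    by metis
  have I: "1 \<in> {1..6::nat}" "2 \<in> {1..6::nat}" "3 \<in> {1..6::nat}" "4 \<in> {1..6::nat}" "5 \<in> {1..6::nat}" "6 \<in> {1..6::nat}"
    by auto
  have inj: "L i = L j \<longleftrightarrow> i = j" if "i \<in> {1..6}" "j \<in> {1..6}" for i j
    using A that by (auto simp: inj_on_def)
  have meet: "x = x'" if "i \<in> {1..6}" "j \<in> {1..6}" "i \<noteq> j" "x \<in> L i" "x \<in> L j" "x' \<in> L i" "x' \<in> L j" for i j x x'
    using that inj[of i j] a(2) proj_line_meet by metis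
  have mem: "p 1 \<in> L 2" "p 1 \<in> L 3" "p 1 \<in> L 4" "p 4 \<in> L 1" "p 4 \<in> L 3" "p 4 \<in> L 5"
    "p 5 \<in> L 1" "p 5 \<in> L 2" "p 5 \<in> L 6" "p 7 \<in> L 4" "p 7 \<in> L 5" "p 7 \<in> L 6"
    "p 2 \<in> L 2" "p 2 \<in> L 5" "p 3 \<in> L 1" "p 3 \<in> L 4"
    using A by blast+
  \<comment> \<open>If the first three lines met in one point, this would be \<open>p 1\<close>,
    \<open>p 4\<close> and \<open>p 5\<close> at once and lie on all six lines, so the arrangement
    would be a cone.\<close>
  have indep: "dot (a 1) (cross (a 2) (a 3)) \<noteq> 0"
  proof
    assume 0: "dot (a 1) (cross (a 2) (a 3)) = 0"
    let ?P = "cross (a 2) (a 3)"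
    have "proj_pt (a 2) \<noteq> proj_pt (a 3)" using inj[of 2 3] a(2)[of 2] a(2)[of 3] by auto
    then have P: "?P \<noteq> 0" using a(1) I by (simp add: cross_eq_0_iff)
    have "dot (a 2) ?P = 0" "dot (a 3) ?P = 0" by (metis dot_commute dot_cross)+
    then have "proj_pt ?P \<in> L 1" "proj_pt ?P \<in> L 2" "proj_pt ?P \<in> L 3"
      using 0 a I P by (simp_all add: proj_line_iff)
    then have "proj_pt ?P = p 1" "proj_pt ?P = p 4" "proj_pt ?P = p 5"
      using meet[of 2 3] meet[of 1 3] meet[of 1 2] mem by auto
    then have PL: "proj_pt ?P \<in> L i" if "i \<in> {1..6}" for i
    proof -
      have "i = 1 \<or> i = 2 \<or> i = 3 \<or> i = 4 \<or> i = 5 \<or> i = 6" using that by auto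
      then show ?thesis using mem \<open>proj_pt ?P = p 1\<close> \<open>proj_pt ?P = p 4\<close> \<open>proj_pt ?P = p 5\<close> by metis
    qed
    have un: "(\<Union>i\<in>{1..6}. L i) = {proj_pt z | z. z \<noteq> 0 \<and> quadrilateral_poly z = 0}"
      using A unfolding quadrilateral_poly_def by blast
    have homog: "quadrilateral_poly (c *s z) = c ^ 6 * quadrilateral_poly z" for c z
      by (simp add: quadrilateral_poly_def) algebra
    have mem_iff: "(\<exists>i\<in>{1..6}. dot (a i) z = 0) \<longleftrightarrow> quadrilateral_poly z = 0" if z: "z \<noteq> 0" for z
    proof -
      have "(\<exists>i\<in>{1..6}. dot (a i) z = 0) \<longleftrightarrow> proj_pt z \<in> (\<Union>i\<in>{1..6}. L i)"
        using z a by (auto simp: proj_line_iff)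
      also have "\<dots> \<longleftrightarrow> quadrilateral_poly z = 0"
      proof
        assume "proj_pt z \<in> (\<Union>i\<in>{1..6}. L i)"
        then obtain z' where z': "z' \<noteq> 0" "quadrilateral_poly z' = 0" "proj_pt z' = proj_pt z"
          unfolding un by auto
        then obtain c where "z = c *s z'" using proj_pt_eq_iff[of z' z] z by blast
        then show "quadrilateral_poly z = 0" using z' by (simp add: homog)
      qed (use z un in blast)
      finally show ?thesis .
    qed
    have "?P = 0"
    proof (rule quadrilateral_no_vertex)
      fix x s assume x: "quadrilateral_poly x = 0"
      show "quadrilateral_poly (x + s *s ?P) = 0"
      proof (cases "x = 0 \<or> x + s *s ?P = 0")
        case True
        have "quadrilateral_poly ?P = 0"
          using mem_iff[OF P] PL[of 1] a P I by (auto simp: proj_line_iff)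
        then show ?thesis using True by (auto simp: homog) (simp add: quadrilateral_poly_def)
      next
        case False
        then obtain i where i: "i \<in> {1..6}" "dot (a i) x = 0" using mem_iff[of x] x by auto
        moreover have "dot (a i) ?P = 0" using PL[OF i(1)] a i(1) P by (simp add: proj_line_iff)
        ultimately have "dot (a i) (x + s *s ?P) = 0" by simp
        then show ?thesis using mem_iff[of "x + s *s ?P"] False i(1) by blast
      qed
    qed
    with P show False by simp
  qed
  obtain w where w: "w \<noteq> 0" "p 7 = proj_pt w" by (rule proj_pt_cases)
  have ne: "cross (a i) (a j) \<noteq> 0" if "i \<in> {1..6}" "j \<in> {1..6}" "i \<noteq> j" for i j
    using inj[OF that(1,2)] that a by (auto simp: cross_eq_0_iff)
  have vertex: "p k = proj_pt (cross (a i) (a j))"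
    if "i \<in> {1..6}" "j \<in> {1..6}" "i \<noteq> j" "p k \<in> L i" "p k \<in> L j" for i j k
  proof -
    have "dot (a i) (cross (a i) (a j)) = 0" "dot (a j) (cross (a i) (a j)) = 0"
      by (metis dot_commute dot_cross)+
    then show ?thesis using that a ne by (intro meet[OF that(1,2,3)]) (simp_all add: proj_line_iff)
  qed
  have v1: "p 1 = proj_pt (cross (a 2) (a 3))" and v4: "p 4 = proj_pt (cross (a 3) (a 1))"
    and v5: "p 5 = proj_pt (cross (a 1) (a 2))"
    using mem by (intro vertex; simp)+
  have "dot (a 1) (cross (a 2) (a 3)) = dot (a 2) (cross (a 3) (a 1))"
    "dot (a 1) (cross (a 2) (a 3)) = dot (a 3) (cross (a 1) (a 2))"
    by (simp_all add: dot_3 cross_def algebra_simps)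
  then have "p 1 \<notin> L 1" "p 4 \<notin> L 2" "p 5 \<notin> L 3"
    using v1 v4 v5 indep a ne I by (simp_all add: proj_line_iff)
  then have dist: "p 1 \<noteq> p 4" "p 1 \<noteq> p 5" "p 4 \<noteq> p 5" using mem by auto
  have "p 7 \<notin> L 1"
  proof
    assume "p 7 \<in> L 1"
    then have "p 7 = p 5" "p 7 = p 4" using meet[of 1 6] meet[of 1 5] mem by auto
    with dist show False by simp
  qed
  moreover have "p 7 \<notin> L 2"
  proof
    assume "p 7 \<in> L 2"
    then have "p 7 = p 1" "p 7 = p 5" using meet[of 2 4] meet[of 2 6] mem by auto
    with dist show False by simp
  qed
  moreover have "p 7 \<notin> L 3"
  proof
    assume "p 7 \<in> L 3"
    then have "p 7 = p 1" "p 7 = p 4" using meet[of 3 4] meet[of 3 5] mem by auto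
    with dist show False by simp
  qed
  ultimately have wn: "dot (a 1) w \<noteq> 0" "dot (a 2) w \<noteq> 0" "dot (a 3) w \<noteq> 0"
    using w a I by (auto simp: proj_line_iff)
  define \<Delta> where "\<Delta> = dot (a 1) (cross (a 2) (a 3))"
  \<comment> \<open>Each form is scaled to the value 1 at \<open>p 7\<close>, and the vertices are
    scaled dually.\<close>
  define l1 l2 l3 where "l1 = (1 / dot (a 1) w) *s a 1" and "l2 = (1 / dot (a 2) w) *s a 2"
    and "l3 = (1 / dot (a 3) w) *s a 3"
  define e1 e2 e3 where "e1 = (dot (a 1) w / \<Delta>) *s cross (a 2) (a 3)"
    and "e2 = (dot (a 2) w / \<Delta>) *s cross (a 3) (a 1)" and "e3 = (dot (a 3) w / \<Delta>) *s cross (a 1) (a 2)"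
  have \<Delta>: "\<Delta> \<noteq> 0" using indep by (simp add: \<Delta>_def)
  have det: "dot (a 1) (cross (a 2) (a 3)) = \<Delta>" "dot (a 2) (cross (a 3) (a 1)) = \<Delta>" "dot (a 3) (cross (a 1) (a 2)) = \<Delta>"
    "dot (a 1) (cross (a 3) (a 1)) = 0" "dot (a 1) (cross (a 1) (a 2)) = 0" "dot (a 2) (cross (a 2) (a 3)) = 0"
    "dot (a 2) (cross (a 1) (a 2)) = 0" "dot (a 3) (cross (a 2) (a 3)) = 0" "dot (a 3) (cross (a 3) (a 1)) = 0"
    by (simp_all add: \<Delta>_def dot_3 cross_def algebra_simps)
  have frame: "quadrilateral_frame e1 e2 e3 l1 l2 l3"
  proof
    fix v
    have "dot l1 v *s e1 + dot l2 v *s e2 + dot l3 v *s e3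
        = (1 / \<Delta>) *s (dot (a 1) v *s cross (a 2) (a 3) + dot (a 2) v *s cross (a 3) (a 1) + dot (a 3) v *s cross (a 1) (a 2))"
      using wn \<Delta> by (simp add: l1_def l2_def l3_def e1_def e2_def e3_def vec_eq_iff field_simps)
    also have "\<dots> = v" unfolding cramer[symmetric] det using \<Delta> by simp
    finally show "v = dot l1 v *s e1 + dot l2 v *s e2 + dot l3 v *s e3" by simp
  qed (use det wn \<Delta> in \<open>simp_all add: l1_def l2_def l3_def e1_def e2_def e3_def\<close>)
  then interpret quadrilateral_frame e1 e2 e3 l1 l2 l3 .
  have lw: "dot l1 w = 1" "dot l2 w = 1" "dot l3 w = 1" using wn by (simp_all add: l1_def l2_def l3_def)
  then have w': "w = e1 + e2 + e3" using expand[of w] by simp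
  have L: "L 1 = proj_line (proj_pt l1)" "L 2 = proj_line (proj_pt l2)" "L 3 = proj_line (proj_pt l3)"
    using wn a I by (simp_all add: l1_def l2_def l3_def proj_pt_scale)
  have P: "p 1 = proj_pt e1" "p 4 = proj_pt e2" "p 5 = proj_pt e3"
    using v1 v4 v5 wn \<Delta> ne by (simp_all add: e1_def e2_def e3_def proj_pt_scale)
  have nz: "e1 \<noteq> 0" "e2 \<noteq> 0" "e3 \<noteq> 0" "l1 \<noteq> 0" "l2 \<noteq> 0" "l3 \<noteq> 0" "l2 - l3 \<noteq> 0" "l1 - l3 \<noteq> 0" "l1 - l2 \<noteq> 0"
    "e1 + e3 \<noteq> 0" "e2 + e3 \<noteq> 0"
    using dual dot_simps(7,8) by (metis zero_neq_one eq_iff_diff_eq_0 dot_simps(1) add.left_neutral add.right_neutral)+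
  have line: "L i = proj_line (proj_pt l)"
    if "i \<in> {1..6}" "l \<noteq> 0" "proj_pt e \<in> L i" "proj_pt w \<in> L i" "e \<noteq> 0" "dot l e = 0" "dot l w = 0" "proj_pt e \<noteq> proj_pt w" for i l e
  proof -
    have "proj_pt (a i) = proj_pt l"
      using that a w by (intro proj_line_unique[of "proj_pt e" _ "proj_pt w"]) (simp_all add: proj_line_iff)
    then show ?thesis using a that by simp
  qed
  have d7: "p 7 \<noteq> p 1" "p 7 \<noteq> p 4" "p 7 \<noteq> p 5" using \<open>p 7 \<notin> L 1\<close> \<open>p 7 \<notin> L 2\<close> mem by auto
  \<comment> \<open>\<open>L 4\<close> joins \<open>p 1\<close> to \<open>p 7\<close>, and
    \<open>l2 - l3\<close> vanishes at both; the other two lines are found in the same way.\<close>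
  have L': "L 4 = proj_line (proj_pt (l2 - l3))" "L 5 = proj_line (proj_pt (l1 - l3))" "L 6 = proj_line (proj_pt (l1 - l2))"
    using line[of 4 "l2 - l3" e1] line[of 5 "l1 - l3" e2] line[of 6 "l1 - l2" e3] nz mem P w d7 lw dual by auto
  have "p 2 = proj_pt (e1 + e3)"
    using mem nz dual by (intro meet[of 2 5]) (auto simp: L L' proj_line_iff simp del: One_nat_def)
  moreover have "p 3 = proj_pt (e2 + e3)"
    using mem nz dual by (intro meet[of 1 4]) (auto simp: L L' proj_line_iff simp del: One_nat_def)
  ultimately show ?thesis using frame L L' P by blast
qed

lemma continuous_on_vecI:
  fixes f :: "'a::topological_space \<Rightarrow> 'b::topological_space ^ 'n"
  assumes "\<And>k. continuous_on S (\<lambda>x. f x $ k)"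
  shows "continuous_on S f"
  using continuous_on_vec_lambda[of S "\<lambda>k x. f x $ k"] assms by simp

lemma continuous_on_vector_smult [continuous_intros]:
  fixes g :: "_ \<Rightarrow> complex ^ 'n"
  assumes "continuous_on S f" "continuous_on S g"
  shows "continuous_on S (\<lambda>x. f x *s g x)"
  using assms by (intro continuous_on_vecI) (auto intro!: continuous_intros)

lemma continuous_on_cross [continuous_intros]:
  assumes "continuous_on S f" "continuous_on S g"
  shows "continuous_on S (\<lambda>x. cross (f x) (g x))"
proof (rule continuous_on_vecI)
  fix k :: 3
  show "continuous_on S (\<lambda>x. cross (f x) (g x) $ k)"
    unfolding cross_def using assms exhaust_3[of k] by (elim disjE) (auto intro!: continuous_intros)
qed

section \<open>Strict transforms\<close>

text \<open>The coordinate at a centre is the line joining it to the point of the plane unless the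
  two coincide; so only the direction at the point itself carries further information.\<close>

lemma blowup_eqI:
  assumes "m \<in> blowup S" "m' \<in> blowup S" "m None = m' None"
    "m None \<in> S \<Longrightarrow> m (Some (m None)) = m' (Some (m None))"
  shows "m = m'"
proof
  fix i
  show "m i = m' i"
  proof (cases i)
    case (Some p)
    consider "p \<notin> S" | "p \<in> S" "p = m None" | "p \<in> S" "p \<noteq> m None" by blast
    then show ?thesis
    proof cases
      case 3
      then show ?thesis
        using assms(1-3) Some by (intro proj_line_unique[of p _ "m None"]) (auto simp: blowup_def)
    qed (use assms Some in \<open>auto simp: blowup_def\<close>)
  qed (use assms in auto)
qed

lemma strict_transform_off_centre:
  "m \<in> blowup S \<Longrightarrow> m None \<in> L \<Longrightarrow> m None \<notin> S \<Longrightarrow> m \<in> strict_transform S L"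
  using closure_subset[of "{m \<in> blowup S. m None \<in> L - S}"] by (auto simp: strict_transform_def)

text \<open>Over a point of the line off the centres, the coordinate at \<open>p\<close> is the line
  joining the two, that is \<open>l\<close>; this is a closed condition and persists in the
  closure.\<close>

lemma strict_transform_direction:
  assumes "m \<in> strict_transform S (proj_line l)" "p \<in> S" "p \<in> proj_line l"
  shows "m (Some p) = l"
proof -
  have "closed {m :: 3 proj option \<Rightarrow> 3 proj. m (Some p) = l}"
  proof -
    have "continuous_on UNIV (\<lambda>m :: 3 proj option \<Rightarrow> 3 proj. m (Some p))"
      by (rule continuous_on_product_coordinates)
    then have "closed ((\<lambda>m :: 3 proj option \<Rightarrow> 3 proj. m (Some p)) -` {l})"
      using closed_proj_singleton by (intro closed_vimage) auto
    moreover have "(\<lambda>m :: 3 proj option \<Rightarrow> 3 proj. m (Some p)) -` {l} = {m. m (Some p) = l}" by auto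
    ultimately show ?thesis by simp
  qed
  moreover have "m' (Some p) = l" if "m' \<in> blowup S" "m' None \<in> proj_line l - S" for m'
    using that assms(2,3) by (intro proj_line_unique[of p _ "m' None"]) (auto simp: blowup_def)
  ultimately have "closure {m \<in> blowup S. m None \<in> proj_line l - S} \<subseteq> {m. m (Some p) = l}"
    by (intro closure_minimal) auto
  then show ?thesis using assms(1) by (auto simp: strict_transform_def)
qed

lemma continuous_on_option_fun:
  fixes f :: "'a::topological_space \<Rightarrow> 'i \<Rightarrow> 'b::topological_space"
  assumes "\<And>i. continuous_on S (\<lambda>x. f x i)"
  shows "continuous_on S f"
  using assms by (rule continuous_on_coordinatewise_then_product)

text \<open>The point \<open>m\<close> is approached along the line \<open>l\<close>: its image
  moves on \<open>l\<close> away from \<open>p\<close>, the coordinate at \<open>p\<close> stays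
  \<open>l\<close>, and the coordinates at the other centres vary continuously.\<close>

lemma strict_transform_centre:
  assumes m: "m \<in> blowup S" and S: "finite S" and p: "p \<in> S" "m None = p" "m (Some p) = l"
  shows "m \<in> strict_transform S (proj_line l)"
proof -
  obtain v where v: "v \<noteq> 0" "p = proj_pt v" by (rule proj_pt_cases)
  obtain a where a: "a \<noteq> 0" "l = proj_pt a" by (rule proj_pt_cases)
  have "p \<in> proj_line l" using m p by (auto simp: blowup_def)
  then have av: "dot a v = 0" using a v by (simp add: proj_line_iff)
  \<comment> \<open>This \<open>u\<close> makes \<open>d\<close> a point of the line different from
    \<open>v\<close>.\<close>
  obtain u where u: "dot v u \<noteq> 0" using dot_eq_0_all v(1) by blast
  define d where "d = cross a u"
  have "cross v d = dot v u *s a - dot v a *s u"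
    by (simp add: d_def cross_def dot_3 vec_eq_iff forall_3 algebra_simps)
  then have vd: "cross v d \<noteq> 0" using av u a by (simp add: dot_commute vector_mul_eq_0)
  have ad: "dot a d = 0" by (metis d_def dot_commute dot_cross(1))
  define x where "x t = v + t *s d" for t
  have cross_x: "cross (x t) d = cross v d" "cross v (x t) = t *s cross v d" for t
    by (simp_all add: x_def cross_def vec_eq_iff forall_3 algebra_simps)
  have x0: "x t \<noteq> 0" for t
  proof
    assume "x t = 0"
    then have "cross v d = 0" using cross_x(1)[of t] by (simp add: cross_def vec_eq_iff forall_3)
    with vd show False by simp
  qed
  have "\<forall>q. \<exists>w. w \<noteq> 0 \<and> q = proj_pt w" by (meson proj_pt_cases)
  then obtain rep :: "3 proj \<Rightarrow> complex ^ 3" where rep: "\<And>q. rep q \<noteq> 0" "\<And>q. proj_pt (rep q) = q" by metis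
  \<comment> \<open>The parameters at which the moving point avoids the other centres, so that the
    joins with them are defined.\<close>
  define T where "T = (\<Inter>q\<in>S - {p}. {t. cross (x t) (rep q) \<noteq> 0})"
  have cont_cross: "continuous_on A (\<lambda>t. cross (x t) w)" for w A
    unfolding x_def by (intro continuous_intros)
  have "open {t. cross (x t) w \<noteq> 0}" for w
  proof -
    have "open ((\<lambda>t. cross (x t) w) -` (- {0}))"
      using cont_cross by (intro open_vimage) auto
    then show ?thesis by (simp add: vimage_def)
  qed
  then have T: "open T" unfolding T_def using S by (intro open_INT) auto
  have T0: "0 \<in> T"
    unfolding T_def using v rep by (auto simp: x_def cross_eq_0_iff)
  define c where "c t i = (case i of None \<Rightarrow> proj_pt (x t)
    | Some q \<Rightarrow> if q = p then l else if q \<in> S then proj_pt (cross (x t) (rep q)) else undefined)" for t i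
  have c_in: "c t \<in> blowup S" if t: "t \<in> T" for t
  proof -
    have "q \<in> proj_line (c t (Some q)) \<and> c t None \<in> proj_line (c t (Some q))" if q: "q \<in> S" for q
    proof (cases "q = p")
      case True
      then show ?thesis using a v av ad x0 by (simp add: c_def proj_line_iff) (simp add: x_def)
    next
      case False
      then have "cross (x t) (rep q) \<noteq> 0" using t q by (auto simp: T_def)
      then show ?thesis
        using False q x0 rep proj_line_iff[of "cross (x t) (rep q)" "rep q"] proj_line_iff[of "cross (x t) (rep q)" "x t"]
        by (simp add: c_def)
    qed
    then show ?thesis using p by (auto simp: blowup_def c_def)
  qed
  have "c 0 = m"
    using p v by (intro blowup_eqI[OF c_in[OF T0] m]) (auto simp: c_def x_def)
  have "continuous_on T c"
  proof (rule continuous_on_option_fun)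
    fix i
    show "continuous_on T (\<lambda>t. c t i)"
    proof (cases i)
      case None
      then show ?thesis unfolding c_def using x0
        by (auto intro!: continuous_on_proj_pt_compose) (auto simp: x_def intro!: continuous_intros)
    next
      case (Some q)
      have "continuous_on T (\<lambda>t. proj_pt (cross (x t) (rep q)))" if "q \<noteq> p" "q \<in> S"
      proof (rule continuous_on_proj_pt_compose)
        show "continuous_on T (\<lambda>t. cross (x t) (rep q))" by (rule cont_cross)
        show "cross (x t) (rep q) \<noteq> 0" if "t \<in> T" for t
          using that \<open>q \<noteq> p\<close> \<open>q \<in> S\<close> by (auto simp: T_def)
      qed
      then show ?thesis using Some by (cases "q = p"; cases "q \<in> S") (auto simp: c_def)
    qed
  qed
  then have "isCont c 0" using T T0 by (simp add: continuous_on_eq_continuous_at)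
  then have lim: "(c \<longlongrightarrow> m) (at 0)" using \<open>c 0 = m\<close> by (simp add: isCont_def)
  let ?A = "{m \<in> blowup S. m None \<in> proj_line l - S}"
  have "c t \<in> ?A" if t: "t \<in> T" "t \<noteq> 0" for t
  proof -
    have "proj_pt (x t) \<noteq> q" if "q \<in> S" for q
    proof (cases "q = p")
      case True
      have "cross v (x t) \<noteq> 0" using vd t(2) by (simp add: cross_x vector_mul_eq_0)
      then show ?thesis using True v x0 by (auto simp: cross_eq_0_iff)
    next
      case False
      then have "cross (x t) (rep q) \<noteq> 0" using t that by (auto simp: T_def)
      then show ?thesis using x0 rep by (auto simp: cross_eq_0_iff)
    qed
    moreover have "proj_pt (x t) \<in> proj_line l" using a av ad x0 by (simp add: proj_line_iff) (simp add: x_def)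
    ultimately show ?thesis using c_in[OF t(1)] by (auto simp: c_def)
  qed
  moreover have "eventually (\<lambda>t. t \<in> T \<and> t \<noteq> 0) (at 0)"
    using T T0 by (auto simp: eventually_at_topological)
  ultimately have "eventually (\<lambda>t. c t \<in> ?A) (at 0)" by (elim eventually_mono) blast
  then have "eventually (\<lambda>t. c t \<in> closure ?A) (at 0)"
    by (rule eventually_mono) (rule subsetD[OF closure_subset])
  then have "m \<in> closure ?A"
    by (intro Lim_in_closed_set[OF closed_closure _ _ lim]) auto
  then show ?thesis using m by (simp add: strict_transform_def)
qed

section \<open>The blow-up in coordinates\<close>

context quadrilateral_frame
begin

definition pnt :: "complex \<Rightarrow> complex \<Rightarrow> complex \<Rightarrow> complex ^ 3" where
  "pnt x1 x2 x3 = x1 *s e1 + x2 *s e2 + x3 *s e3"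

definition lin :: "complex \<Rightarrow> complex \<Rightarrow> complex \<Rightarrow> complex ^ 3" where
  "lin a1 a2 a3 = a1 *s l1 + a2 *s l2 + a3 *s l3"

lemma dot_lin_pnt: "dot (lin a1 a2 a3) (pnt x1 x2 x3) = a1 * x1 + a2 * x2 + a3 * x3"
  by (simp add: lin_def pnt_def dual algebra_simps)

lemma dot_pnt [simp]: "dot l1 (pnt x1 x2 x3) = x1" "dot l2 (pnt x1 x2 x3) = x2" "dot l3 (pnt x1 x2 x3) = x3"
  by (simp_all add: pnt_def dual)

lemma dot_lin [simp]: "dot (lin a1 a2 a3) e1 = a1" "dot (lin a1 a2 a3) e2 = a2" "dot (lin a1 a2 a3) e3 = a3"
  "dot e1 (lin a1 a2 a3) = a1" "dot e2 (lin a1 a2 a3) = a2" "dot e3 (lin a1 a2 a3) = a3"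
  by (simp_all add: lin_def dual dot_commute[of e1] dot_commute[of e2] dot_commute[of e3])

lemma pnt_expand: "v = pnt (dot l1 v) (dot l2 v) (dot l3 v)"
  unfolding pnt_def by (rule expand)

lemma lin_expand: "a = lin (dot a e1) (dot a e2) (dot a e3)"
proof -
  have "dot (a - lin (dot a e1) (dot a e2) (dot a e3)) v = 0" for v
  proof -
    have "dot a v = dot l1 v * dot a e1 + dot l2 v * dot a e2 + dot l3 v * dot a e3"
      by (subst expand[of v]) simp
    then show ?thesis by (simp add: lin_def algebra_simps)
  qed
  then have "a - lin (dot a e1) (dot a e2) (dot a e3) = 0" by (rule dot_eq_0_all)
  then show ?thesis by simp
qed

lemma pnt_eq_0 [simp]: "pnt x1 x2 x3 = 0 \<longleftrightarrow> x1 = 0 \<and> x2 = 0 \<and> x3 = 0"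
  by (metis dot_pnt dot_simps(8) pnt_def add_0 vector_smult_lzero)

lemma lin_eq_0 [simp]: "lin a1 a2 a3 = 0 \<longleftrightarrow> a1 = 0 \<and> a2 = 0 \<and> a3 = 0"
  by (metis dot_lin(1-3) dot_simps(7) lin_def add_0 vector_smult_lzero)

lemma smult_pnt: "c *s pnt x1 x2 x3 = pnt (c * x1) (c * x2) (c * x3)"
  by (simp add: pnt_def vector_add_ldistrib)

lemma smult_lin: "c *s lin x1 x2 x3 = lin (c * x1) (c * x2) (c * x3)"
  by (simp add: lin_def vector_add_ldistrib)

lemma pnt_inject [simp]: "pnt x1 x2 x3 = pnt y1 y2 y3 \<longleftrightarrow> x1 = y1 \<and> x2 = y2 \<and> x3 = y3"
  by (metis dot_pnt)

lemma lin_inject [simp]: "lin x1 x2 x3 = lin y1 y2 y3 \<longleftrightarrow> x1 = y1 \<and> x2 = y2 \<and> x3 = y3"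
  by (metis dot_lin(1-3))

lemma triple_parallel:
  fixes a1 a2 a3 b1 b2 b3 :: complex
  assumes "a1 \<noteq> 0 \<or> a2 \<noteq> 0 \<or> a3 \<noteq> 0" "b1 \<noteq> 0 \<or> b2 \<noteq> 0 \<or> b3 \<noteq> 0"
  shows "(\<exists>c. c \<noteq> 0 \<and> b1 = c * a1 \<and> b2 = c * a2 \<and> b3 = c * a3) \<longleftrightarrow>
    a1 * b2 = a2 * b1 \<and> a1 * b3 = a3 * b1 \<and> a2 * b3 = a3 * b2" (is "?L \<longleftrightarrow> ?R")
proof
  assume R: ?R
  consider "a1 \<noteq> 0" | "a2 \<noteq> 0" | "a3 \<noteq> 0" using assms(1) by blast
  then show ?L
  proof cases
    case 1
    then show ?thesis using R assms(2) by (intro exI[of _ "b1 / a1"]) (auto simp: field_simps)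
  next
    case 2
    then show ?thesis using R assms(2) by (intro exI[of _ "b2 / a2"]) (auto simp: field_simps)
  next
    case 3
    then show ?thesis using R assms(2) by (intro exI[of _ "b3 / a3"]) (auto simp: field_simps)
  qed
qed (auto simp: algebra_simps)

lemma proj_pnt_eq_iff:
  assumes "x1 \<noteq> 0 \<or> x2 \<noteq> 0 \<or> x3 \<noteq> 0" "y1 \<noteq> 0 \<or> y2 \<noteq> 0 \<or> y3 \<noteq> 0"
  shows "proj_pt (pnt x1 x2 x3) = proj_pt (pnt y1 y2 y3) \<longleftrightarrow>
    x1 * y2 = x2 * y1 \<and> x1 * y3 = x3 * y1 \<and> x2 * y3 = x3 * y2"
  using assms unfolding triple_parallel[OF assms, symmetric]
  by (subst proj_pt_eq_iff) (auto simp: smult_pnt)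

lemma proj_lin_eq_iff:
  assumes "x1 \<noteq> 0 \<or> x2 \<noteq> 0 \<or> x3 \<noteq> 0" "y1 \<noteq> 0 \<or> y2 \<noteq> 0 \<or> y3 \<noteq> 0"
  shows "proj_pt (lin x1 x2 x3) = proj_pt (lin y1 y2 y3) \<longleftrightarrow>
    x1 * y2 = x2 * y1 \<and> x1 * y3 = x3 * y1 \<and> x2 * y3 = x3 * y2"
  using assms unfolding triple_parallel[OF assms, symmetric]
  by (subst proj_pt_eq_iff) (auto simp: smult_lin)

lemma pnt_in_line_iff:
  assumes "a1 \<noteq> 0 \<or> a2 \<noteq> 0 \<or> a3 \<noteq> 0" "x1 \<noteq> 0 \<or> x2 \<noteq> 0 \<or> x3 \<noteq> 0"
  shows "proj_pt (pnt x1 x2 x3) \<in> proj_line (proj_pt (lin a1 a2 a3)) \<longleftrightarrow> a1 * x1 + a2 * x2 + a3 * x3 = 0"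
  using assms by (subst proj_line_iff) (auto simp: dot_lin_pnt)

definition "q1 = proj_pt (pnt 1 0 0)"
definition "q2 = proj_pt (pnt 1 0 1)"
definition "q3 = proj_pt (pnt 0 1 1)"
definition "q4 = proj_pt (pnt 0 1 0)"
definition "q5 = proj_pt (pnt 0 0 1)"
lemmas q_defs = q1_def q2_def q3_def q4_def q5_def

definition "centres = {q1, q2, q3, q4, q5}"

definition line :: "nat \<Rightarrow> 3 proj" where
  "line i = (if i = 1 then proj_pt (lin 1 0 0) else if i = 2 then proj_pt (lin 0 1 0)
    else if i = 3 then proj_pt (lin 0 0 1) else if i = 4 then proj_pt (lin 0 1 (-1))
    else if i = 5 then proj_pt (lin 1 0 (-1)) else proj_pt (lin 1 (-1) 0))"

definition "X = blowup_complement ((\<lambda>i. proj_line (line i)) ` {1..6}) centres"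

lemma q_distinct [simp]:
  "q1 \<noteq> q2" "q1 \<noteq> q3" "q1 \<noteq> q4" "q1 \<noteq> q5" "q2 \<noteq> q3" "q2 \<noteq> q4" "q2 \<noteq> q5" "q3 \<noteq> q4" "q3 \<noteq> q5" "q4 \<noteq> q5"
  "q2 \<noteq> q1" "q3 \<noteq> q1" "q4 \<noteq> q1" "q5 \<noteq> q1" "q3 \<noteq> q2" "q4 \<noteq> q2" "q5 \<noteq> q2" "q4 \<noteq> q3" "q5 \<noteq> q3" "q5 \<noteq> q4"
  by (simp_all add: q_defs proj_pnt_eq_iff)

lemma finite_centres [simp]: "finite centres"
  by (simp add: centres_def)

lemma centres_simps [simp]: "q1 \<in> centres" "q2 \<in> centres" "q3 \<in> centres" "q4 \<in> centres" "q5 \<in> centres"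
  by (simp_all add: centres_def)

lemma centre_on_line_iff:
  assumes "a1 \<noteq> 0 \<or> a2 \<noteq> 0 \<or> a3 \<noteq> 0"
  shows "q1 \<in> proj_line (proj_pt (lin a1 a2 a3)) \<longleftrightarrow> a1 = 0"
    "q2 \<in> proj_line (proj_pt (lin a1 a2 a3)) \<longleftrightarrow> a1 + a3 = 0"
    "q3 \<in> proj_line (proj_pt (lin a1 a2 a3)) \<longleftrightarrow> a2 + a3 = 0"
    "q4 \<in> proj_line (proj_pt (lin a1 a2 a3)) \<longleftrightarrow> a2 = 0"
    "q5 \<in> proj_line (proj_pt (lin a1 a2 a3)) \<longleftrightarrow> a3 = 0"
  using assms by (simp_all add: q_defs pnt_in_line_iff)

lemma six_cases: "i \<in> {1..6::nat} \<Longrightarrow> i = 1 \<or> i = 2 \<or> i = 3 \<or> i = 4 \<or> i = 5 \<or> i = 6"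
  by auto

lemma line_simps:
  "line (Suc 0) = proj_pt (lin 1 0 0)"
  "line 1 = proj_pt (lin 1 0 0)" "line 2 = proj_pt (lin 0 1 0)" "line 3 = proj_pt (lin 0 0 1)"
  "line 4 = proj_pt (lin 0 1 (-1))" "line 5 = proj_pt (lin 1 0 (-1))" "line 6 = proj_pt (lin 1 (-1) 0)"
  by (simp_all add: line_def)

text \<open>By \<open>strict_transform_direction\<close> a line is excluded as soon as
  \<open>m\<close> has another direction at one centre on it. This treats points on and off the line
  alike.\<close>

lemma in_XI:
  assumes "m \<in> blowup centres" "\<And>i. i \<in> {1..6} \<Longrightarrow> \<exists>q\<in>centres. q \<in> proj_line (line i) \<and> m (Some q) \<noteq> line i"
  shows "m \<in> X"
  using assms strict_transform_direction unfolding X_def blowup_complement_def by blast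

lemma in_XD:
  assumes "m \<in> X" "i \<in> {1..6}"
  shows "m \<in> blowup centres" "m None \<notin> centres \<Longrightarrow> m None \<notin> proj_line (line i)"
    "m None \<in> centres \<Longrightarrow> m (Some (m None)) \<noteq> line i"
proof -
  show m: "m \<in> blowup centres" using assms by (simp add: X_def blowup_complement_def)
  have n: "m \<notin> strict_transform centres (proj_line (line i))"
    using assms by (auto simp: X_def blowup_complement_def)
  show "m None \<notin> centres \<Longrightarrow> m None \<notin> proj_line (line i)"
    using n strict_transform_off_centre[OF m] by blast
  show "m None \<in> centres \<Longrightarrow> m (Some (m None)) \<noteq> line i"
    using n strict_transform_centre[OF m] by auto
qed

text \<open>Points of the blow-up are given by a point of the plane and by lines through \<open>q1\<close>, ..., \<open>q5\<close>.\<close>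

definition mk :: "complex ^ 3 \<Rightarrow> complex ^ 3 \<Rightarrow> complex ^ 3 \<Rightarrow> complex ^ 3 \<Rightarrow> complex ^ 3 \<Rightarrow> complex ^ 3 \<Rightarrow>
    3 proj option \<Rightarrow> 3 proj" where
  "mk x a1 a2 a3 a4 a5 i = (case i of None \<Rightarrow> proj_pt x | Some q \<Rightarrow>
    if q = q1 then proj_pt a1 else if q = q2 then proj_pt a2 else if q = q3 then proj_pt a3
    else if q = q4 then proj_pt a4 else if q = q5 then proj_pt a5 else undefined)"

lemma mk_simps [simp]:
  "mk x a1 a2 a3 a4 a5 None = proj_pt x" "mk x a1 a2 a3 a4 a5 (Some q1) = proj_pt a1"
  "mk x a1 a2 a3 a4 a5 (Some q2) = proj_pt a2" "mk x a1 a2 a3 a4 a5 (Some q3) = proj_pt a3"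
  "mk x a1 a2 a3 a4 a5 (Some q4) = proj_pt a4" "mk x a1 a2 a3 a4 a5 (Some q5) = proj_pt a5"
  by (simp_all add: mk_def)

lemma mk_in_blowup:
  assumes "x \<noteq> 0" "a1 \<noteq> 0" "a2 \<noteq> 0" "a3 \<noteq> 0" "a4 \<noteq> 0" "a5 \<noteq> 0"
    "dot a1 x = 0" "dot a2 x = 0" "dot a3 x = 0" "dot a4 x = 0" "dot a5 x = 0"
    "dot a1 (pnt 1 0 0) = 0" "dot a2 (pnt 1 0 1) = 0" "dot a3 (pnt 0 1 1) = 0" "dot a4 (pnt 0 1 0) = 0"
    "dot a5 (pnt 0 0 1) = 0"
  shows "mk x a1 a2 a3 a4 a5 \<in> blowup centres"
proof -
  have "q1 \<in> proj_line (proj_pt a1)" "q2 \<in> proj_line (proj_pt a2)" "q3 \<in> proj_line (proj_pt a3)"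
    "q4 \<in> proj_line (proj_pt a4)" "q5 \<in> proj_line (proj_pt a5)"
    unfolding q_defs using assms by (simp_all add: proj_line_iff)
  moreover have "proj_pt x \<in> proj_line (proj_pt a)" if "a \<in> {a1, a2, a3, a4, a5}" for a
    using that assms by (auto simp: proj_line_iff)
  moreover have "mk x a1 a2 a3 a4 a5 (Some p) = undefined" if "p \<notin> centres" for p
    using that by (simp add: mk_def centres_def)
  ultimately show ?thesis by (simp add: blowup_def) (simp add: centres_def)
qed

lemma mk_eqI:
  assumes "x \<noteq> 0" "a1 \<noteq> 0" "a2 \<noteq> 0" "a3 \<noteq> 0" "a4 \<noteq> 0" "a5 \<noteq> 0"
    "c \<noteq> 0 \<and> x' = c *s x" "c1 \<noteq> 0 \<and> a1' = c1 *s a1" "c2 \<noteq> 0 \<and> a2' = c2 *s a2" "c3 \<noteq> 0 \<and> a3' = c3 *s a3"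
    "c4 \<noteq> 0 \<and> a4' = c4 *s a4" "c5 \<noteq> 0 \<and> a5' = c5 *s a5"
  shows "mk x' a1' a2' a3' a4' a5' = mk x a1 a2 a3 a4 a5"
  using assms by (auto simp: mk_def fun_eq_iff proj_pt_scale split: option.split)

text \<open>The Cremona transformation \<open>x\<^sub>i = 1 / y\<^sub>i\<close> turns the complement of the exceptional curves over
  the double points into the complement of three concurrent lines of the \<open>y\<close>-plane.\<close>

definition mkU :: "complex \<Rightarrow> complex \<Rightarrow> complex \<Rightarrow> 3 proj option \<Rightarrow> 3 proj" where
  "mkU y1 y2 y3 = mk (pnt (y2 * y3) (y1 * y3) (y1 * y2)) (lin 0 y2 (- y3))
    (lin (y1 * y3) (y2 * (y1 - y3)) (- (y1 * y3))) (lin (y1 * (y3 - y2)) (- (y2 * y3)) (y2 * y3))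
    (lin y1 0 (- y3)) (lin y1 (- y2) 0)"

text \<open>The joins with the centres are multiplied out so that they keep their meaning if one of
  the \<open>y\<close>'s vanishes; being distinct, no two of them vanish together. The loci
  \<open>y1 = 0\<close>, \<open>y2 = 0\<close>, \<open>y3 = 0\<close> are the exceptional curves
  over \<open>q1\<close>, \<open>q4\<close>, \<open>q5\<close>.\<close>

lemma mkU_nonzero:
  assumes "y1 \<noteq> y2" "y1 \<noteq> y3" "y2 \<noteq> y3"
  shows "pnt (y2 * y3) (y1 * y3) (y1 * y2) \<noteq> 0 \<and> lin 0 y2 (- y3) \<noteq> 0 \<and>
    lin (y1 * y3) (y2 * (y1 - y3)) (- (y1 * y3)) \<noteq> 0 \<and>
    lin (y1 * (y3 - y2)) (- (y2 * y3)) (y2 * y3) \<noteq> 0 \<and> lin y1 0 (- y3) \<noteq> 0 \<and> lin y1 (- y2) 0 \<noteq> 0"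
  using assms by auto

lemma mkU_in_X:
  assumes "y1 \<noteq> y2" "y1 \<noteq> y3" "y2 \<noteq> y3"
  shows "mkU y1 y2 y3 \<in> X"
proof (rule in_XI)
  show "mkU y1 y2 y3 \<in> blowup centres"
    unfolding mkU_def using assms by (intro mk_in_blowup) (auto simp: dot_lin_pnt algebra_simps)
  let ?m = "mkU y1 y2 y3"
  have nz: "y2 \<noteq> 0 \<or> y3 \<noteq> 0" "y1 \<noteq> 0 \<or> y3 \<noteq> 0" "y1 \<noteq> 0 \<or> y2 \<noteq> 0" using assms by auto
  have m: "?m (Some q1) = proj_pt (lin 0 y2 (- y3))" "?m (Some q4) = proj_pt (lin y1 0 (- y3))"
    "?m (Some q5) = proj_pt (lin y1 (- y2) 0)"
    by (simp_all add: mkU_def)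
  fix i :: nat assume "i \<in> {1..6}"
  from six_cases[OF this] show "\<exists>q\<in>centres. q \<in> proj_line (line i) \<and> ?m (Some q) \<noteq> line i"
  proof (elim disjE)
    assume "i = 1"
    then show ?thesis using assms m
      by (intro bexI[of _ "if y2 = 0 then q4 else q5"]) (auto simp: line_simps proj_lin_eq_iff centre_on_line_iff)
  next
    assume "i = 2"
    then show ?thesis using assms m
      by (intro bexI[of _ "if y3 = 0 then q5 else q1"]) (auto simp: line_simps proj_lin_eq_iff centre_on_line_iff)
  next
    assume "i = 3"
    then show ?thesis using assms m
      by (intro bexI[of _ "if y2 = 0 then q4 else q1"]) (auto simp: line_simps proj_lin_eq_iff centre_on_line_iff)
  next
    assume "i = 4"
    then show ?thesis using assms nz
      by (intro bexI[of _ q1]) (auto simp: m line_simps proj_lin_eq_iff centre_on_line_iff)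
  next
    assume "i = 5"
    then show ?thesis using assms nz
      by (intro bexI[of _ q4]) (auto simp: m line_simps proj_lin_eq_iff centre_on_line_iff)
  next
    assume "i = 6"
    then show ?thesis using assms nz
      by (intro bexI[of _ q5]) (auto simp: m line_simps proj_lin_eq_iff centre_on_line_iff)
  qed
qed

definition E2 :: "complex \<Rightarrow> 3 proj option \<Rightarrow> 3 proj" where
  "E2 p = mk (pnt 1 0 1) (lin 0 1 0) (lin p (-1) (- p)) (lin (-1) (-1) 1) (lin 1 0 (-1)) (lin 0 (-1) 0)"

definition E3 :: "complex \<Rightarrow> 3 proj option \<Rightarrow> 3 proj" where
  "E3 q = mk (pnt 0 1 1) (lin 0 1 (-1)) (lin (-1) (-1) 1) (lin 1 (- q) q) (lin 1 0 0) (lin 1 0 0)"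

lemma E2_in_X:
  assumes "p \<noteq> 0"
  shows "E2 p \<in> X"
proof (rule in_XI)
  show "E2 p \<in> blowup centres"
    unfolding E2_def using assms by (intro mk_in_blowup) (auto simp: dot_lin_pnt)
  fix i :: nat assume "i \<in> {1..6}"
  from six_cases[OF this] show "\<exists>q\<in>centres. q \<in> proj_line (line i) \<and> E2 p (Some q) \<noteq> line i"
    using assms
    by (intro bexI[of _ "if i = 3 \<or> i = 4 then q1 else if i = 2 \<or> i = 5 then q2 else q5"])
      (auto simp: E2_def line_def proj_lin_eq_iff centre_on_line_iff)
qed

lemma E3_in_X:
  assumes "q \<noteq> 0"
  shows "E3 q \<in> X"
proof (rule in_XI)
  show "E3 q \<in> blowup centres"
    unfolding E3_def using assms by (intro mk_in_blowup) (auto simp: dot_lin_pnt)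
  fix i :: nat assume "i \<in> {1..6}"
  from six_cases[OF this] show "\<exists>p\<in>centres. p \<in> proj_line (line i) \<and> E3 q (Some p) \<noteq> line i"
    using assms
    by (intro bexI[of _ "if i = 3 \<or> i = 2 then q1 else if i = 1 \<or> i = 4 then q3 else if i = 5 then q4 else q5"])
      (auto simp: E3_def line_def proj_lin_eq_iff centre_on_line_iff)
qed

lemma E_simps:
  "E2 p None = q2" "E2 p (Some q2) = proj_pt (lin p (-1) (- p))"
  "E3 q None = q3" "E3 q (Some q3) = proj_pt (lin 1 (- q) q)"
  by (simp_all add: E2_def E3_def q2_def[symmetric] q3_def[symmetric])

text \<open>Off the centres all six forms are non-zero and \<open>y\<^sub>i = 1 / x\<^sub>i\<close>
  can be taken. Over the triple points \<open>q1\<close>, \<open>q4\<close>, \<open>q5\<close> one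
  of the \<open>y\<close>'s is zero and the direction gives the other two. Only the double points
  \<open>q2\<close> and \<open>q3\<close> lead to points outside the chart.\<close>

lemma X_cases:
  assumes m: "m \<in> X"
  obtains (U) y1 y2 y3 where "y1 \<noteq> y2" "y1 \<noteq> y3" "y2 \<noteq> y3" "m = mkU y1 y2 y3"
    | (E2) p where "p \<noteq> 0" "m = E2 p"
    | (E3) q where "q \<noteq> 0" "m = E3 q"
proof -
  have I: "1 \<in> {1..6::nat}" "2 \<in> {1..6::nat}" "3 \<in> {1..6::nat}" "4 \<in> {1..6::nat}" "5 \<in> {1..6::nat}" "6 \<in> {1..6::nat}"
    by auto
  have mB: "m \<in> blowup centres" using in_XD(1)[OF m I(1)] .
  have eqI: "m = m'" if "m' \<in> X" "m None = m' None" "m None \<in> centres \<Longrightarrow> m (Some (m None)) = m' (Some (m None))" for m'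
    using blowup_eqI[OF mB in_XD(1)[OF that(1) I(1)]] that(2,3) by blast
  obtain x where x: "x \<noteq> 0" "m None = proj_pt x" by (rule proj_pt_cases)
  define x1 x2 x3 where "x1 = dot l1 x" "x2 = dot l2 x" "x3 = dot l3 x"
  have x': "x = pnt x1 x2 x3" unfolding x1_x2_x3_def by (rule pnt_expand)
  have dir: "\<exists>a1 a2 a3. (a1 \<noteq> 0 \<or> a2 \<noteq> 0 \<or> a3 \<noteq> 0) \<and> m (Some q) = proj_pt (lin a1 a2 a3) \<and> q \<in> proj_line (proj_pt (lin a1 a2 a3))"
    if q: "q \<in> centres" for q
  proof -
    obtain a where a: "a \<noteq> 0" "m (Some q) = proj_pt a" by (rule proj_pt_cases)
    moreover have "q \<in> proj_line (m (Some q))" using mB q by (auto simp: blowup_def)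
    ultimately show ?thesis
      using lin_eq_0 lin_expand[of a] by metis
  qed
  consider "m None \<notin> centres" | "m None = q1" | "m None = q2" | "m None = q3" | "m None = q4" | "m None = q5"
    by (auto simp: centres_def)
  then show thesis
  proof cases
    case 1
    have "x1 \<noteq> 0" "x2 \<noteq> 0" "x3 \<noteq> 0" "x2 \<noteq> x3" "x1 \<noteq> x3" "x1 \<noteq> x2"
      using in_XD(2)[OF m I(1) 1] in_XD(2)[OF m I(2) 1] in_XD(2)[OF m I(3) 1] in_XD(2)[OF m I(4) 1]
        in_XD(2)[OF m I(5) 1] in_XD(2)[OF m I(6) 1] x
      by (auto simp: x' line_simps pnt_in_line_iff)
    note xs = this
    let ?m = "mkU (1 / x1) (1 / x2) (1 / x3)"
    have ne: "1 / x1 \<noteq> 1 / x2" "1 / x1 \<noteq> 1 / x3" "1 / x2 \<noteq> 1 / x3" using xs by (auto simp: field_simps)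
    have "m = ?m"
    proof (rule eqI[OF mkU_in_X[OF ne]])
      show "m None = ?m None"
        unfolding x(2) x' mkU_def mk_simps using xs by (subst proj_pnt_eq_iff) (auto simp: field_simps)
    qed (use 1 in simp)
    then show ?thesis using U ne by blast
  next
    case 2
    obtain a1 a2 a3 where a: "a1 \<noteq> 0 \<or> a2 \<noteq> 0 \<or> a3 \<noteq> 0" "m (Some q1) = proj_pt (lin a1 a2 a3)"
      "q1 \<in> proj_line (proj_pt (lin a1 a2 a3))" using dir[of q1] by auto
    have a1: "a1 = 0" using a(1,3) by (simp add: centre_on_line_iff)
    have c: "m None \<in> centres" using 2 by simp
    have ne: "0 \<noteq> a2" "0 \<noteq> - a3" "a2 \<noteq> - a3"
      using in_XD(3)[OF m I(2) c] in_XD(3)[OF m I(3) c] in_XD(3)[OF m I(4) c] a(1,2) 2 a1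
      by (auto simp: line_simps proj_lin_eq_iff eq_neg_iff_add_eq_0 neg_eq_iff_add_eq_0)
    have "mkU 0 a2 (- a3) None = q1"
      unfolding mkU_def mk_simps q1_def using ne by (subst proj_pnt_eq_iff) auto
    then have "m = mkU 0 a2 (- a3)"
      using 2 ne a(2) a1 by (intro eqI mkU_in_X ne) (auto simp: mkU_def)
    then show ?thesis using U ne by blast
  next
    case 5
    obtain a1 a2 a3 where a: "a1 \<noteq> 0 \<or> a2 \<noteq> 0 \<or> a3 \<noteq> 0" "m (Some q4) = proj_pt (lin a1 a2 a3)"
      "q4 \<in> proj_line (proj_pt (lin a1 a2 a3))" using dir[of q4] by auto
    have a2: "a2 = 0" using a(1,3) by (simp add: centre_on_line_iff)
    have c: "m None \<in> centres" using 5 by simp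
    have ne: "a1 \<noteq> 0" "a1 \<noteq> - a3" "0 \<noteq> - a3"
      using in_XD(3)[OF m I(1) c] in_XD(3)[OF m I(3) c] in_XD(3)[OF m I(5) c] a(1,2) 5 a2
      by (auto simp: line_simps proj_lin_eq_iff eq_neg_iff_add_eq_0 neg_eq_iff_add_eq_0)
    have "mkU a1 0 (- a3) None = q4"
      unfolding mkU_def mk_simps q4_def using ne by (subst proj_pnt_eq_iff) auto
    then have "m = mkU a1 0 (- a3)"
      using 5 ne a(2) a2 by (intro eqI mkU_in_X ne) (auto simp: mkU_def)
    then show ?thesis using U ne by blast
  next
    case 6
    obtain a1 a2 a3 where a: "a1 \<noteq> 0 \<or> a2 \<noteq> 0 \<or> a3 \<noteq> 0" "m (Some q5) = proj_pt (lin a1 a2 a3)"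
      "q5 \<in> proj_line (proj_pt (lin a1 a2 a3))" using dir[of q5] by auto
    have a3: "a3 = 0" using a(1,3) by (simp add: centre_on_line_iff)
    have c: "m None \<in> centres" using 6 by simp
    have ne: "a1 \<noteq> - a2" "a1 \<noteq> 0" "- a2 \<noteq> 0"
      using in_XD(3)[OF m I(1) c] in_XD(3)[OF m I(2) c] in_XD(3)[OF m I(6) c] a(1,2) 6 a3
      by (auto simp: line_simps proj_lin_eq_iff eq_neg_iff_add_eq_0 neg_eq_iff_add_eq_0)
    have "mkU a1 (- a2) 0 None = q5"
      unfolding mkU_def mk_simps q5_def using ne by (subst proj_pnt_eq_iff) auto
    then have "m = mkU a1 (- a2) 0"
      using 6 ne a(2) a3 by (intro eqI mkU_in_X ne) (auto simp: mkU_def)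
    then show ?thesis using U ne by blast
  next
    case 3
    obtain a1 a2 a3 where a: "a1 \<noteq> 0 \<or> a2 \<noteq> 0 \<or> a3 \<noteq> 0" "m (Some q2) = proj_pt (lin a1 a2 a3)"
      "q2 \<in> proj_line (proj_pt (lin a1 a2 a3))" using dir[of q2] by auto
    have a3: "a3 = - a1" using a(1,3) by (simp add: centre_on_line_iff eq_neg_iff_add_eq_0 add.commute)
    have c: "m None \<in> centres" using 3 by simp
    have ne: "a1 \<noteq> 0" "a2 \<noteq> 0"
      using in_XD(3)[OF m I(2) c] in_XD(3)[OF m I(5) c] a(1,2) 3 a3
      by (auto simp: line_simps proj_lin_eq_iff)
    let ?p = "- (a1 / a2)"
    have p: "?p \<noteq> 0" using ne by simp
    have "proj_pt (lin a1 a2 a3) = proj_pt (lin ?p (-1) (- ?p))"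
      using ne by (subst proj_lin_eq_iff) (auto simp: a3)
    then have "m = E2 ?p"
      using 3 a(2) by (intro eqI E2_in_X p) (auto simp: E_simps)
    then show ?thesis using E2 p by blast
  next
    case 4
    obtain a1 a2 a3 where a: "a1 \<noteq> 0 \<or> a2 \<noteq> 0 \<or> a3 \<noteq> 0" "m (Some q3) = proj_pt (lin a1 a2 a3)"
      "q3 \<in> proj_line (proj_pt (lin a1 a2 a3))" using dir[of q3] by auto
    have a3: "a3 = - a2" using a(1,3) by (simp add: centre_on_line_iff eq_neg_iff_add_eq_0 add.commute)
    have c: "m None \<in> centres" using 4 by simp
    have ne: "a1 \<noteq> 0" "a2 \<noteq> 0"
      using in_XD(3)[OF m I(1) c] in_XD(3)[OF m I(4) c] a(1,2) 4 a3
      by (auto simp: line_simps proj_lin_eq_iff)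
    let ?q = "- (a2 / a1)"
    have q: "?q \<noteq> 0" using ne by simp
    have "proj_pt (lin a1 a2 a3) = proj_pt (lin 1 (- ?q) ?q)"
      using ne by (subst proj_lin_eq_iff) (auto simp: a3)
    then have "m = E3 ?q"
      using 4 a(2) by (intro eqI E3_in_X q) (auto simp: E_simps)
    then show ?thesis using E3 q by blast
  qed
qed

section \<open>The parametrization by the conic surface\<close>

lemma mkU_scale:
  assumes "t \<noteq> 0" "y1 \<noteq> y2" "y1 \<noteq> y3" "y2 \<noteq> y3"
  shows "mkU (t * y1) (t * y2) (t * y3) = mkU y1 y2 y3"
  unfolding mkU_def using assms
  by (intro mk_eqI[where c = "t\<^sup>2" and ?c1.0 = t and ?c2.0 = "t\<^sup>2" and ?c3.0 = "t\<^sup>2" and ?c4.0 = t and ?c5.0 = t])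
     (auto simp: smult_pnt smult_lin power2_eq_square algebra_simps)

text \<open>The generic formula is \<open>y3 = c\<close> with \<open>y2 - y1 = 1\<close> and
  \<open>y3 - y1 = \<sigma>\<close>. The parameter \<open>4 * b\<close> on the exceptional curves is
  the value of \<open>4 * (1 - \<sigma>) * b\<close> at \<open>\<sigma> = 0\<close> and of
  \<open>4 * \<sigma> * b\<close> at \<open>\<sigma> = 1\<close>, the parameters that occur in
  \<open>mk2\<close> and \<open>mk3\<close>.\<close>

definition to_X :: "complex \<times> complex \<times> complex \<Rightarrow> 3 proj option \<Rightarrow> 3 proj" where
  "to_X = (\<lambda>(y, c, b). let \<sigma> = (1 - y) / 2 in
    if y = 1 then E2 (4 * b) else if y = -1 then E3 (4 * b) else mkU (c - \<sigma>) (c + 1 - \<sigma>) c)"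

lemma to_X_in_X: "w \<in> conic_surface \<Longrightarrow> to_X w \<in> X"
  by (cases w) (auto simp: to_X_def Let_def conic_surface_def eq_neg_iff_add_eq_0 neg_eq_iff_add_eq_0 power2_eq_1_iff
      intro!: E2_in_X E3_in_X mkU_in_X)

lemma to_X_surj:
  assumes "m \<in> X"
  shows "m \<in> to_X ` conic_surface"
  using assms
proof (cases rule: X_cases)
  case (U y1 y2 y3)
  define d c \<sigma> where "d = y2 - y1" and "c = y3 / d" and "\<sigma> = (y3 - y1) / d"
  have d: "d \<noteq> 0" using U by (simp add: d_def)
  have \<sigma>: "\<sigma> \<noteq> 0" "\<sigma> \<noteq> 1" using U d by (auto simp: \<sigma>_def d_def)
  have "d * c = y3" "d * \<sigma> = y3 - y1" using d by (simp_all add: c_def \<sigma>_def)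
  then have "d * c = y3" "d * (c - \<sigma>) = y1" "d * (c + 1 - \<sigma>) = y2"
    by (simp_all add: right_diff_distrib distrib_left) (simp add: d_def)
  then have "m = mkU (d * (c - \<sigma>)) (d * (c + 1 - \<sigma>)) (d * c)" using U by simp
  also have "\<dots> = mkU (c - \<sigma>) (c + 1 - \<sigma>) c"
    using d \<sigma> by (intro mkU_scale) auto
  also have "\<dots> = to_X (conic_section c (1 - 2 * \<sigma>))"
    using \<sigma> by (simp add: to_X_def conic_section_def Let_def)
  also have "\<dots> \<in> to_X ` conic_surface"
    using \<sigma> by (intro imageI conic_section_in) auto
  finally show ?thesis .
next
  case (E2 p)
  then show ?thesis
    by (intro image_eqI[of _ _ "(1, 0, p / 4)"]) (auto simp: to_X_def conic_surface_def)
next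
  case (E3 q)
  then show ?thesis
    by (intro image_eqI[of _ _ "(-1, 0, q / 4)"]) (auto simp: to_X_def conic_surface_def)
qed

text \<open>This is \<open>mkU\<close> near \<open>y = 1\<close> with powers of \<open>c\<close>
  divided out of the coordinate vectors: \<open>\<sigma> = c * \<kappa>\<close> gives
  \<open>y1 = c * (1 - \<kappa>)\<close>, and \<open>p = c\<^sup>2 / \<sigma>\<close> extends to the
  exceptional curve with non-zero values.\<close>

definition mk2 :: "complex \<Rightarrow> complex \<Rightarrow> complex \<Rightarrow> 3 proj option \<Rightarrow> 3 proj" where
  "mk2 \<sigma> c p = (let \<kappa> = c / p; B = c + 1 - \<sigma> in
    mk (pnt B (c * (1 - \<kappa>)) ((1 - \<kappa>) * B)) (lin 0 B (- c)) (lin (1 - \<kappa>) (- B / p) (- (1 - \<kappa>)))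
      (lin ((1 - \<kappa>) * (\<sigma> - 1)) (- B) B) (lin (1 - \<kappa>) 0 (-1)) (lin (c * (1 - \<kappa>)) (- B) 0))"

text \<open>This is \<open>mkU\<close> near \<open>y = -1\<close>, where
  \<open>1 - \<sigma> = c * \<kappa>\<close> gives \<open>y2 = c * (1 + \<kappa>)\<close>.\<close>

definition mk3 :: "complex \<Rightarrow> complex \<Rightarrow> complex \<Rightarrow> 3 proj option \<Rightarrow> 3 proj" where
  "mk3 \<sigma> c q = (let \<kappa> = c / q; A = c - \<sigma> in
    mk (pnt (c * (1 + \<kappa>)) A (A * (1 + \<kappa>))) (lin 0 (1 + \<kappa>) (-1)) (lin A (- ((1 + \<kappa>) * \<sigma>)) (- A))
      (lin (- A / q) (- (1 + \<kappa>)) (1 + \<kappa>)) (lin A 0 (- c)) (lin A (- (c * (1 + \<kappa>))) 0))"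

lemma half_ne: "(1 - (1 - y) / 2 = 0) = (y = -1)" "((1 - y) / 2 = 1) = (y = -1)" for y :: complex
proof -
  have 1: "1 - (1 - y) / 2 = (1 + y) / 2" by (simp add: field_simps)
  show 2: "(1 - (1 - y) / 2 = 0) = (y = -1)" unfolding 1 by (simp add: add_eq_0_iff)
  have "((1 - y) / 2 = 1) = (1 - (1 - y) / 2 = 0)" by (metis right_minus_eq)
  then show "((1 - y) / 2 = 1) = (y = -1)" using 2 by simp
qed

text \<open>The equation of the surface reads
  \<open>c\<^sup>2 = 4 * \<sigma> * (1 - \<sigma>) * b\<close>. Where \<open>b\<close> and one of
  \<open>\<sigma>\<close>, \<open>1 - \<sigma>\<close> are non-zero, the other is
  \<open>c\<^sup>2\<close> times a unit, so its zero fibre is double.\<close>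

lemma conic_surface_double_fibre:
  assumes "(y, c, b) \<in> conic_surface" "b \<noteq> 0"
  defines "\<sigma> \<equiv> (1 - y) / 2"
  shows "y \<noteq> -1 \<Longrightarrow> \<sigma> = c * (c / (4 * (1 - \<sigma>) * b))" "y \<noteq> 1 \<Longrightarrow> 1 - \<sigma> = c * (c / (4 * \<sigma> * b))"
proof -
  have "4 * \<sigma> * (1 - \<sigma>) = 1 - y\<^sup>2" by (simp add: \<sigma>_def power2_eq_square field_simps)
  then have "c\<^sup>2 = 4 * \<sigma> * (1 - \<sigma>) * b" using assms(1) by (simp add: conic_surface_def)
  moreover have "y \<noteq> -1 \<Longrightarrow> 1 - \<sigma> \<noteq> 0" "y \<noteq> 1 \<Longrightarrow> \<sigma> \<noteq> 0"
    unfolding \<sigma>_def using half_ne(1)[of y] by (blast, simp)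
  ultimately show "y \<noteq> -1 \<Longrightarrow> \<sigma> = c * (c / (4 * (1 - \<sigma>) * b))" "y \<noteq> 1 \<Longrightarrow> 1 - \<sigma> = c * (c / (4 * \<sigma> * b))"
    using assms(2) by (simp_all add: power2_eq_square field_simps)
qed

text \<open>Controls which entries of \<open>mk2\<close> can vanish together, so that all of its
  vectors are seen to be non-zero.\<close>

lemma mk2_nonzero:
  fixes p \<sigma> c :: complex
  assumes "\<sigma> = c * (c / p)"
  defines "\<kappa> \<equiv> c / p" and "B \<equiv> c + 1 - \<sigma>"
  shows "B = 0 \<Longrightarrow> c * (1 - \<kappa>) = -1" "B = 0 \<Longrightarrow> \<sigma> - 1 = c" "\<kappa> = 1 \<Longrightarrow> B = 1"
proof -
  have *: "\<sigma> = c * \<kappa>" using assms(1) by (simp add: \<kappa>_def)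
  show "B = 0 \<Longrightarrow> c * (1 - \<kappa>) = -1" "B = 0 \<Longrightarrow> \<sigma> - 1 = c" "\<kappa> = 1 \<Longrightarrow> B = 1"
    by (simp_all add: B_def * algebra_simps)
qed

lemma mk3_nonzero:
  fixes q \<sigma> c :: complex
  assumes "1 - \<sigma> = c * (c / q)"
  defines "\<kappa> \<equiv> c / q" and "A \<equiv> c - \<sigma>"
  shows "A = 0 \<Longrightarrow> c * (1 + \<kappa>) = 1" "A = 0 \<Longrightarrow> \<sigma> = c" "\<kappa> = -1 \<Longrightarrow> A = -1"
proof -
  have "1 - \<sigma> = c * \<kappa>" using assms(1) by (simp add: \<kappa>_def)
  then have *: "\<sigma> = 1 - c * \<kappa>" by (simp add: algebra_simps)
  show "A = 0 \<Longrightarrow> c * (1 + \<kappa>) = 1" "A = 0 \<Longrightarrow> \<sigma> = c" "\<kappa> = -1 \<Longrightarrow> A = -1"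
    by (simp_all add: A_def * algebra_simps)
qed

lemma to_X_eq_mk2:
  assumes w: "(y, c, b) \<in> conic_surface" and ne: "y \<noteq> -1" "b \<noteq> 0"
  defines "\<sigma> \<equiv> (1 - y) / 2"
  shows "to_X (y, c, b) = mk2 \<sigma> c (4 * (1 - \<sigma>) * b)"
proof -
  define p \<kappa> B where "p = 4 * (1 - \<sigma>) * b" and "\<kappa> = c / p" and "B = c + 1 - \<sigma>"
  have "1 - \<sigma> \<noteq> 0" using ne(1) half_ne(1)[of y] unfolding \<sigma>_def by blast
  then have p: "p \<noteq> 0" using ne(2) by (simp add: p_def)
  have \<sigma>: "\<sigma> = c * \<kappa>"
    unfolding \<kappa>_def p_def \<sigma>_def by (rule conic_surface_double_fibre(1)[OF w ne(2,1)])
  show ?thesis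
  proof (cases "y = 1")
    case True
    then have c: "c = 0" "\<sigma> = 0" using w by (simp_all add: conic_surface_def \<sigma>_def)
    have "E2 (4 * b) = mk2 \<sigma> c p"
      unfolding E2_def mk2_def Let_def using c ne(2)
      by (intro mk_eqI[where c = 1 and ?c1.0 = 1 and ?c2.0 = p and ?c3.0 = 1 and ?c4.0 = 1 and ?c5.0 = 1])
        (auto simp: smult_pnt smult_lin p_def)
    then show ?thesis using True by (simp add: to_X_def p_def)
  next
    case False
    then have "\<sigma> \<noteq> 0" by (simp add: \<sigma>_def)
    then have c0: "c \<noteq> 0" using \<sigma> by auto
    note nz = mk2_nonzero[OF \<sigma>[unfolded \<kappa>_def], folded \<kappa>_def B_def]
    have "mkU (c * (1 - \<kappa>)) B c = mk2 \<sigma> c p"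
      unfolding mkU_def mk2_def Let_def B_def[symmetric] \<kappa>_def[symmetric]
    \<comment> \<open>The scalars are the powers of \<open>c\<close> that were divided out in
      \<open>mk2\<close>.\<close>
    proof (rule mk_eqI[where c = c and ?c1.0 = 1 and ?c2.0 = "c\<^sup>2" and ?c3.0 = c and ?c4.0 = c and ?c5.0 = 1])
      have cp: "c * \<kappa> * p = c * c" "\<kappa> * p = c" using p by (simp_all add: \<kappa>_def)
      show "c\<^sup>2 \<noteq> 0 \<and> lin (c * (1 - \<kappa>) * c) (B * (c * (1 - \<kappa>) - c)) (- (c * (1 - \<kappa>) * c)) =
          c\<^sup>2 *s lin (1 - \<kappa>) (- B / p) (- (1 - \<kappa>))"
        using c0 p by (simp add: smult_lin power2_eq_square \<kappa>_def field_simps)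
      show "c \<noteq> 0 \<and> lin (c * (1 - \<kappa>) * (c - B)) (- (B * c)) (B * c) = c *s lin ((1 - \<kappa>) * (\<sigma> - 1)) (- B) B"
        using c0 by (simp add: smult_lin B_def algebra_simps)
    qed (use nz p c0 in \<open>auto simp: smult_pnt smult_lin mult_ac\<close>)
    then show ?thesis using False ne(1) \<sigma> by (simp add: to_X_def B_def p_def \<sigma>_def[symmetric] algebra_simps)
  qed
qed

lemma to_X_eq_mk3:
  assumes w: "(y, c, b) \<in> conic_surface" and ne: "y \<noteq> 1" "b \<noteq> 0"
  defines "\<sigma> \<equiv> (1 - y) / 2"
  shows "to_X (y, c, b) = mk3 \<sigma> c (4 * \<sigma> * b)"
proof -
  define q \<kappa> A where "q = 4 * \<sigma> * b" and "\<kappa> = c / q" and "A = c - \<sigma>"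
  have "\<sigma> \<noteq> 0" using ne(1) by (simp add: \<sigma>_def)
  then have q: "q \<noteq> 0" using ne(2) by (simp add: q_def)
  have \<sigma>: "1 - \<sigma> = c * \<kappa>"
    unfolding \<kappa>_def q_def \<sigma>_def by (rule conic_surface_double_fibre(2)[OF w ne(2,1)])
  show ?thesis
  proof (cases "y = -1")
    case True
    then have c: "c = 0" "\<sigma> = 1" using w by (simp_all add: conic_surface_def \<sigma>_def)
    \<comment> \<open>At \<open>c = 0\<close> and \<open>\<sigma> = 1\<close> one has
      \<open>A = -1\<close>, hence the negative scalars.\<close>
    have "E3 (4 * b) = mk3 \<sigma> c q"
      unfolding E3_def mk3_def Let_def using c ne(2)
      by (intro mk_eqI[where c = "-1" and ?c1.0 = 1 and ?c2.0 = 1 and ?c3.0 = q and ?c4.0 = "-1" and ?c5.0 = "-1"])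
        (auto simp: smult_pnt smult_lin q_def)
    then show ?thesis using True by (simp add: to_X_def q_def)
  next
    case False
    then have "\<sigma> \<noteq> 1" using half_ne(2)[of y] unfolding \<sigma>_def by blast
    then have c0: "c \<noteq> 0" using \<sigma> by auto
    have Y: "c + 1 - \<sigma> = c * (1 + \<kappa>)" using \<sigma> by (simp add: algebra_simps)
    note nz = mk3_nonzero[OF \<sigma>[unfolded \<kappa>_def], folded \<kappa>_def A_def]
    have "mkU A (c * (1 + \<kappa>)) c = mk3 \<sigma> c q"
      unfolding mkU_def mk3_def Let_def A_def[symmetric] \<kappa>_def[symmetric]
    proof (rule mk_eqI[where c = c and ?c1.0 = c and ?c2.0 = c and ?c3.0 = "c\<^sup>2" and ?c4.0 = 1 and ?c5.0 = 1])
      show "c \<noteq> 0 \<and> lin (A * c) (c * (1 + \<kappa>) * (A - c)) (- (A * c)) = c *s lin A (- ((1 + \<kappa>) * \<sigma>)) (- A)"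
        using c0 by (simp add: smult_lin A_def algebra_simps)
      show "c\<^sup>2 \<noteq> 0 \<and> lin (A * (c - c * (1 + \<kappa>))) (- (c * (1 + \<kappa>) * c)) (c * (1 + \<kappa>) * c) =
          c\<^sup>2 *s lin (- A / q) (- (1 + \<kappa>)) (1 + \<kappa>)"
        using c0 q by (simp add: smult_lin power2_eq_square \<kappa>_def field_simps)
    qed (use nz q c0 in \<open>auto simp: smult_pnt smult_lin add_eq_0_iff mult_ac\<close>)
    then show ?thesis using False ne(1) Y by (simp add: to_X_def A_def q_def \<sigma>_def[symmetric])
  qed
qed

section \<open>Continuity of the parametrization\<close>

lemma continuous_on_pnt [continuous_intros]:
  "continuous_on S f \<Longrightarrow> continuous_on S g \<Longrightarrow> continuous_on S h \<Longrightarrow> continuous_on S (\<lambda>w. pnt (f w) (g w) (h w))"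
  unfolding pnt_def by (intro continuous_intros)

lemma continuous_on_lin [continuous_intros]:
  "continuous_on S f \<Longrightarrow> continuous_on S g \<Longrightarrow> continuous_on S h \<Longrightarrow> continuous_on S (\<lambda>w. lin (f w) (g w) (h w))"
  unfolding lin_def by (intro continuous_intros)

lemma continuous_on_mk:
  assumes "continuous_on S x" "continuous_on S a1" "continuous_on S a2" "continuous_on S a3"
    "continuous_on S a4" "continuous_on S a5"
    and "\<And>w. w \<in> S \<Longrightarrow> x w \<noteq> 0 \<and> a1 w \<noteq> 0 \<and> a2 w \<noteq> 0 \<and> a3 w \<noteq> 0 \<and> a4 w \<noteq> 0 \<and> a5 w \<noteq> 0"
  shows "continuous_on S (\<lambda>w. mk (x w) (a1 w) (a2 w) (a3 w) (a4 w) (a5 w))"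
proof (rule continuous_on_option_fun)
  have c: "continuous_on S (\<lambda>w. proj_pt (x w))" "continuous_on S (\<lambda>w. proj_pt (a1 w))" "continuous_on S (\<lambda>w. proj_pt (a2 w))"
    "continuous_on S (\<lambda>w. proj_pt (a3 w))" "continuous_on S (\<lambda>w. proj_pt (a4 w))" "continuous_on S (\<lambda>w. proj_pt (a5 w))"
    using assms by (auto intro!: continuous_on_proj_pt_compose)
  show "continuous_on S (\<lambda>w. mk (x w) (a1 w) (a2 w) (a3 w) (a4 w) (a5 w) i)" for i
  proof (cases i)
    case (Some a)
    show ?thesis
      unfolding mk_def Some using c
      by (cases "a = q1"; cases "a = q2"; cases "a = q3"; cases "a = q4"; cases "a = q5") simp_all
  qed (use c in \<open>simp add: mk_def\<close>)
qed

end

lemma continuous_on_locally: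
  assumes "\<And>x. x \<in> S \<Longrightarrow> \<exists>T. open T \<and> x \<in> T \<and> continuous_on (S \<inter> T) f"
  shows "continuous_on S f"
  unfolding continuous_on_def
proof
  fix x assume x: "x \<in> S"
  obtain T where T: "open T" "x \<in> T" "continuous_on (S \<inter> T) f" using assms[OF x] by blast
  then have "(f \<longlongrightarrow> f x) (at x within S \<inter> T)" using x by (auto simp: continuous_on_def)
  moreover have "at x within S \<inter> T = at x within S"
    using T(1,2) by (intro at_within_nhd[of x T]) auto
  ultimately show "(f \<longlongrightarrow> f x) (at x within S)" by simp
qed

context quadrilateral_frame
begin

text \<open>As the singular points are missing, \<open>b\<close> is non-zero wherever
  \<open>y\<close> is \<open>\<plusminus>1\<close>; so the formulas \<open>mkU\<close>,
  \<open>mk2\<close> and \<open>mk3\<close> cover the surface by three open pieces.\<close>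

lemma continuous_on_to_X: "continuous_on conic_surface to_X"
proof (rule continuous_on_locally)
  fix w assume w: "w \<in> conic_surface"
  obtain y c b where wy: "w = (y, c, b)" by (metis prod_cases3)
  let ?\<sigma> = "\<lambda>w :: complex \<times> complex \<times> complex. (1 - fst w) / 2"
  let ?c = "\<lambda>w :: complex \<times> complex \<times> complex. fst (snd w)" and ?b = "\<lambda>w :: complex \<times> complex \<times> complex. snd (snd w)"
  consider "y \<noteq> 1" "y \<noteq> -1" | "y \<noteq> -1" "b \<noteq> 0" | "y \<noteq> 1" "b \<noteq> 0"
    using w by (cases "y = 1") (auto simp: wy conic_surface_def power2_eq_1_iff)
  then show "\<exists>T. open T \<and> w \<in> T \<and> continuous_on (conic_surface \<inter> T) to_X"
  proof cases
    case 1
    let ?T = "{w :: complex \<times> complex \<times> complex. fst w \<noteq> 1} \<inter> {w. fst w \<noteq> -1}"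
    have "open ?T" by (intro open_Int open_Collect_neq continuous_intros)
    moreover have "continuous_on (conic_surface \<inter> ?T) (\<lambda>w. mkU (?c w - ?\<sigma> w) (?c w + 1 - ?\<sigma> w) (?c w))"
      unfolding mkU_def
    proof (intro continuous_on_mk continuous_intros)
      fix w assume "w \<in> conic_surface \<inter> ?T"
      then have ne: "?c w - ?\<sigma> w \<noteq> ?c w" "?c w + 1 - ?\<sigma> w \<noteq> ?c w" "?c w - ?\<sigma> w \<noteq> ?c w + 1 - ?\<sigma> w"
        using half_ne(2)[of "fst w"] by auto
      show "pnt ((?c w + 1 - ?\<sigma> w) * ?c w) ((?c w - ?\<sigma> w) * ?c w) ((?c w - ?\<sigma> w) * (?c w + 1 - ?\<sigma> w)) \<noteq> 0 \<and>
         lin 0 (?c w + 1 - ?\<sigma> w) (- ?c w) \<noteq> 0 \<and>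
         lin ((?c w - ?\<sigma> w) * ?c w) ((?c w + 1 - ?\<sigma> w) * (?c w - ?\<sigma> w - ?c w)) (- ((?c w - ?\<sigma> w) * ?c w)) \<noteq> 0 \<and>
         lin ((?c w - ?\<sigma> w) * (?c w - (?c w + 1 - ?\<sigma> w))) (- ((?c w + 1 - ?\<sigma> w) * ?c w)) ((?c w + 1 - ?\<sigma> w) * ?c w) \<noteq> 0 \<and>
         lin (?c w - ?\<sigma> w) 0 (- ?c w) \<noteq> 0 \<and> lin (?c w - ?\<sigma> w) (- (?c w + 1 - ?\<sigma> w)) 0 \<noteq> 0"
        by (rule mkU_nonzero[OF ne(3,1,2)])
    qed auto
    then have "continuous_on (conic_surface \<inter> ?T) to_X"
      by (rule continuous_on_eq) (auto simp: to_X_def Let_def)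
    ultimately show ?thesis using 1 wy by (intro exI[of _ ?T]) auto
  next
    case 2
    let ?T = "{w :: complex \<times> complex \<times> complex. fst w \<noteq> -1} \<inter> {w. snd (snd w) \<noteq> 0}"
    let ?p = "\<lambda>w. 4 * (1 - ?\<sigma> w) * ?b w"
    have "open ?T" by (intro open_Int open_Collect_neq continuous_intros)
    moreover have p: "?p w \<noteq> 0" "?\<sigma> w = ?c w * (?c w / ?p w)" if "w \<in> conic_surface \<inter> ?T" for w
    proof -
      have w: "(fst w, ?c w, ?b w) \<in> conic_surface" "fst w \<noteq> -1" "?b w \<noteq> 0" using that by auto
      show "?\<sigma> w = ?c w * (?c w / ?p w)" by (rule conic_surface_double_fibre(1)[OF w(1,3,2)])
      have "1 - ?\<sigma> w \<noteq> 0" using half_ne(1)[of "fst w"] w(2) by blast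
      then show "?p w \<noteq> 0" using w(3) by (simp only: mult_eq_0_iff) simp
    qed
    have "continuous_on (conic_surface \<inter> ?T) (\<lambda>w. mk2 (?\<sigma> w) (?c w) (?p w))"
      unfolding mk2_def Let_def
    proof (rule continuous_on_mk)
      fix w assume w: "w \<in> conic_surface \<inter> ?T"
      note nz = mk2_nonzero[OF p(2)[OF w]] and p0 = p(1)[OF w]
      show "pnt (?c w + 1 - ?\<sigma> w) (?c w * (1 - ?c w / ?p w)) ((1 - ?c w / ?p w) * (?c w + 1 - ?\<sigma> w)) \<noteq> 0 \<and>
         lin 0 (?c w + 1 - ?\<sigma> w) (- ?c w) \<noteq> 0 \<and>
         lin (1 - ?c w / ?p w) (- (?c w + 1 - ?\<sigma> w) / ?p w) (- (1 - ?c w / ?p w)) \<noteq> 0 \<and>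
         lin ((1 - ?c w / ?p w) * (?\<sigma> w - 1)) (- (?c w + 1 - ?\<sigma> w)) (?c w + 1 - ?\<sigma> w) \<noteq> 0 \<and>
         lin (1 - ?c w / ?p w) 0 (- 1) \<noteq> 0 \<and> lin (?c w * (1 - ?c w / ?p w)) (- (?c w + 1 - ?\<sigma> w)) 0 \<noteq> 0"
        using nz p0 by (simp only: pnt_eq_0 lin_eq_0 mult_eq_0_iff neg_equal_0_iff_equal right_minus_eq divide_eq_0_iff)
          (metis mult_zero_left mult_zero_right right_minus_eq zero_neq_neg_one zero_neq_one)
    qed (use p(1) in \<open>auto intro!: continuous_intros\<close>)
    then have "continuous_on (conic_surface \<inter> ?T) to_X"
      by (rule continuous_on_eq) (auto simp: to_X_eq_mk2)
    ultimately show ?thesis using 2 wy by (intro exI[of _ ?T]) auto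
  next
    case 3
    let ?T = "{w :: complex \<times> complex \<times> complex. fst w \<noteq> 1} \<inter> {w. snd (snd w) \<noteq> 0}"
    let ?q = "\<lambda>w. 4 * ?\<sigma> w * ?b w"
    have "open ?T" by (intro open_Int open_Collect_neq continuous_intros)
    moreover have q: "?q w \<noteq> 0" "1 - ?\<sigma> w = ?c w * (?c w / ?q w)" if "w \<in> conic_surface \<inter> ?T" for w
    proof -
      have w: "(fst w, ?c w, ?b w) \<in> conic_surface" "fst w \<noteq> 1" "?b w \<noteq> 0" using that by auto
      show "1 - ?\<sigma> w = ?c w * (?c w / ?q w)" by (rule conic_surface_double_fibre(2)[OF w(1,3,2)])
      show "?q w \<noteq> 0" using w(2,3) by simp
    qed
    have "continuous_on (conic_surface \<inter> ?T) (\<lambda>w. mk3 (?\<sigma> w) (?c w) (?q w))"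
      unfolding mk3_def Let_def
    proof (rule continuous_on_mk)
      fix w assume w: "w \<in> conic_surface \<inter> ?T"
      note nz = mk3_nonzero[OF q(2)[OF w]] and q0 = q(1)[OF w]
      show "pnt (?c w * (1 + ?c w / ?q w)) (?c w - ?\<sigma> w) ((?c w - ?\<sigma> w) * (1 + ?c w / ?q w)) \<noteq> 0 \<and>
         lin 0 (1 + ?c w / ?q w) (-1) \<noteq> 0 \<and>
         lin (?c w - ?\<sigma> w) (- ((1 + ?c w / ?q w) * ?\<sigma> w)) (- (?c w - ?\<sigma> w)) \<noteq> 0 \<and>
         lin (- (?c w - ?\<sigma> w) / ?q w) (- (1 + ?c w / ?q w)) (1 + ?c w / ?q w) \<noteq> 0 \<and>
         lin (?c w - ?\<sigma> w) 0 (- ?c w) \<noteq> 0 \<and> lin (?c w - ?\<sigma> w) (- (?c w * (1 + ?c w / ?q w))) 0 \<noteq> 0"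
        using nz q0 by (simp only: pnt_eq_0 lin_eq_0 mult_eq_0_iff neg_equal_0_iff_equal right_minus_eq divide_eq_0_iff)
          (metis mult_zero_left mult_zero_right right_minus_eq zero_neq_neg_one zero_neq_one)
    qed (use q(1) in \<open>auto intro!: continuous_intros\<close>)
    then have "continuous_on (conic_surface \<inter> ?T) to_X"
      by (rule continuous_on_eq) (auto simp: to_X_eq_mk3)
    ultimately show ?thesis using 3 wy by (intro exI[of _ ?T]) auto
  qed
qed

section \<open>The inverse of the parametrization in charts\<close>

definition from_X :: "(3 proj option \<Rightarrow> 3 proj) \<Rightarrow> complex \<times> complex \<times> complex" where
  "from_X = inv_into conic_surface to_X"

text \<open>The quotients \<open>y\<^sub>3 / y\<^sub>2\<close>, \<open>y\<^sub>1 / y\<^sub>2\<close>, \<open>y\<^sub>3 / y\<^sub>1\<close> and \<open>y\<^sub>2 / y\<^sub>1\<close>.\<close>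

definition "y32 m = - ratio e3 e2 (m (Some q1))"
definition "y12 m = - ratio e1 e2 (m (Some q5))"
definition "y31 m = - ratio e3 e1 (m (Some q4))"
definition "y21 m = - ratio e2 e1 (m (Some q5))"

text \<open>In terms of \<open>mkU y1 y2 y3\<close>, \<open>chartB\<close> is
  \<open>y2 \<noteq> 0\<close>, \<open>chartA\<close> is \<open>y1 \<noteq> 0\<close>, and the last
  two charts require both. The curve \<open>E2\<close> lies in \<open>chartB\<close> and
  \<open>chart2\<close>, the curve \<open>E3\<close> in \<open>chartA\<close> and
  \<open>chart3\<close>; \<open>b\<close> is read off there from the direction at \<open>q2\<close>
  or \<open>q3\<close>.\<close>

definition "chartB = {m. m (Some q1) \<in> nonvan e2 \<and> m (Some q5) \<in> nonvan e2}"
definition "chartA = {m. m (Some q4) \<in> nonvan e1 \<and> m (Some q5) \<in> nonvan e1}"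
definition "chart2 = {m. m (Some q2) \<in> nonvan e2 \<and> m (Some q4) \<in> nonvan e1 \<and> m (Some q5) \<in> nonvan e2}"
definition "chart3 = {m. m (Some q3) \<in> nonvan e1 \<and> m (Some q1) \<in> nonvan e2 \<and> m (Some q5) \<in> nonvan e1}"

lemma to_X_U_coords:
  assumes "y1 \<noteq> y2" "y1 \<noteq> y3" "y2 \<noteq> y3"
  shows "mkU y1 y2 y3 \<in> chartB \<longleftrightarrow> y2 \<noteq> 0" "mkU y1 y2 y3 \<in> chartA \<longleftrightarrow> y1 \<noteq> 0"
    "mkU y1 y2 y3 \<in> chart2 \<longleftrightarrow> y1 \<noteq> 0 \<and> y2 \<noteq> 0" "mkU y1 y2 y3 \<in> chart3 \<longleftrightarrow> y1 \<noteq> 0 \<and> y2 \<noteq> 0"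
    "y32 (mkU y1 y2 y3) = y3 / y2" "y12 (mkU y1 y2 y3) = y1 / y2"
    "y31 (mkU y1 y2 y3) = y3 / y1" "y21 (mkU y1 y2 y3) = y2 / y1"
    "ratio e1 e2 (mkU y1 y2 y3 (Some q2)) = y1 * y3 / (y2 * (y1 - y3))"
    "ratio e3 e1 (mkU y1 y2 y3 (Some q3)) = y2 * y3 / (y1 * (y3 - y2))"
proof -
  note nz = mkU_nonzero[OF assms]
  show "mkU y1 y2 y3 \<in> chartB \<longleftrightarrow> y2 \<noteq> 0" "mkU y1 y2 y3 \<in> chartA \<longleftrightarrow> y1 \<noteq> 0"
    "mkU y1 y2 y3 \<in> chart2 \<longleftrightarrow> y1 \<noteq> 0 \<and> y2 \<noteq> 0" "mkU y1 y2 y3 \<in> chart3 \<longleftrightarrow> y1 \<noteq> 0 \<and> y2 \<noteq> 0"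
    "y32 (mkU y1 y2 y3) = y3 / y2" "y12 (mkU y1 y2 y3) = y1 / y2"
    "y31 (mkU y1 y2 y3) = y3 / y1" "y21 (mkU y1 y2 y3) = y2 / y1"
    "ratio e1 e2 (mkU y1 y2 y3 (Some q2)) = y1 * y3 / (y2 * (y1 - y3))"
    "ratio e3 e1 (mkU y1 y2 y3 (Some q3)) = y2 * y3 / (y1 * (y3 - y2))"
    using nz assms
    by (auto simp: chartA_def chartB_def chart2_def chart3_def y32_def y12_def y31_def y21_def mkU_def
        nonvan_proj_pt ratio_proj_pt simp del: lin_eq_0)
qed

lemma E2_coords:
  assumes "p \<noteq> 0"
  shows "E2 p \<in> chartB" "E2 p \<notin> chartA" "E2 p \<in> chart2" "E2 p \<notin> chart3"
    "y32 (E2 p) = 0" "y12 (E2 p) = 0" "y31 (E2 p) = 1" "ratio e1 e2 (E2 p (Some q2)) = - p"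
  using assms by (simp_all add: chartA_def chartB_def chart2_def chart3_def y32_def y12_def y31_def E2_def
      nonvan_proj_pt ratio_proj_pt)

lemma E3_coords:
  assumes "q \<noteq> 0"
  shows "E3 q \<in> chartA" "E3 q \<notin> chartB" "E3 q \<in> chart3" "E3 q \<notin> chart2"
    "y31 (E3 q) = 0" "y21 (E3 q) = 0" "y32 (E3 q) = 1" "ratio e3 e1 (E3 q (Some q3)) = q"
  using assms by (simp_all add: chartA_def chartB_def chart2_def chart3_def y32_def y21_def y31_def E3_def
      nonvan_proj_pt ratio_proj_pt)

lemma to_X_cases:
  assumes "(y, c, b) \<in> conic_surface"
  obtains (U) y1 y2 y3 where "y \<noteq> 1" "y \<noteq> -1" "to_X (y, c, b) = mkU y1 y2 y3" "y1 \<noteq> y2" "y1 \<noteq> y3" "y2 \<noteq> y3"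
      "y3 = c" "y2 - y1 = 1" "(1 - y) / 2 = y3 - y1" "(1 + y) / 2 = y2 - y3" "c\<^sup>2 = 4 * (y3 - y1) * (y2 - y3) * b"
  | (E2) "y = 1" "c = 0" "b \<noteq> 0" "to_X (y, c, b) = E2 (4 * b)"
  | (E3) "y = -1" "c = 0" "b \<noteq> 0" "to_X (y, c, b) = E3 (4 * b)"
proof (cases "y = 1 \<or> y = -1")
  case True
  then show thesis using assms E2 E3 by (auto simp: conic_surface_def to_X_def)
next
  case False
  define \<sigma> where "\<sigma> = (1 - y) / 2"
  have \<sigma>: "\<sigma> \<noteq> 0" "\<sigma> \<noteq> 1" using False half_ne(2)[of y] unfolding \<sigma>_def by auto
  have \<sigma>': "(1 + y) / 2 = 1 - \<sigma>" by (simp add: \<sigma>_def field_simps)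
  have "4 * \<sigma> * (1 - \<sigma>) = 1 - y\<^sup>2" by (simp add: \<sigma>_def power2_eq_square field_simps)
  then have "c\<^sup>2 = 4 * (c - (c - \<sigma>)) * (c + 1 - \<sigma> - c) * b" using assms by (simp add: conic_surface_def)
  moreover have "to_X (y, c, b) = mkU (c - \<sigma>) (c + 1 - \<sigma>) c"
    using False by (simp add: to_X_def Let_def \<sigma>_def)
  ultimately show thesis
    using False \<sigma> \<sigma>' by (intro U[of "c - \<sigma>" "c + 1 - \<sigma>" c]) (auto simp: \<sigma>_def)
qed

lemma to_X_in_charts: "w \<in> conic_surface \<Longrightarrow> to_X w \<in> chartA \<or> to_X w \<in> chartB"
  by (cases w, simp only:, erule to_X_cases) (auto simp: to_X_U_coords E2_coords E3_coords)

text \<open>Dividing the normalization \<open>y2 - y1 = 1\<close> by \<open>y2\<close> gives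
  \<open>1 / y2 = 1 - y1 / y2\<close>, so the quotients determine \<open>y3\<close> and
  \<open>y3 - y1\<close>.\<close>

lemma to_X_chartB:
  assumes "(y, c, b) \<in> conic_surface" "to_X (y, c, b) \<in> chartB"
  defines "m \<equiv> to_X (y, c, b)"
  shows "y12 m \<noteq> 1" "c = y32 m / (1 - y12 m)" "(1 - y) / 2 = (y32 m - y12 m) / (1 - y12 m)"
proof -
  have "y12 m \<noteq> 1 \<and> c = y32 m / (1 - y12 m) \<and> (1 - y) / 2 = (y32 m - y12 m) / (1 - y12 m)"
    using assms(1)
  proof (cases rule: to_X_cases)
    case (U y1 y2 y3)
    then have y2: "y2 \<noteq> 0" using assms(2) by (simp add: to_X_U_coords)
    then have "1 - y1 / y2 = 1 / y2" "y3 / y2 - y1 / y2 = (y3 - y1) / y2"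
      using U(8) by (simp_all add: diff_divide_distrib[symmetric] field_simps)
    then show ?thesis using U y2 by (auto simp: m_def to_X_U_coords)
  qed (use assms(2) in \<open>auto simp: m_def E2_coords E3_coords\<close>)
  then show "y12 m \<noteq> 1" "c = y32 m / (1 - y12 m)" "(1 - y) / 2 = (y32 m - y12 m) / (1 - y12 m)" by blast+
qed

lemma to_X_chartA:
  assumes "(y, c, b) \<in> conic_surface" "to_X (y, c, b) \<in> chartA"
  defines "m \<equiv> to_X (y, c, b)"
  shows "y21 m \<noteq> 1" "c = y31 m / (y21 m - 1)" "(1 - y) / 2 = (y31 m - 1) / (y21 m - 1)"
proof -
  have "y21 m \<noteq> 1 \<and> c = y31 m / (y21 m - 1) \<and> (1 - y) / 2 = (y31 m - 1) / (y21 m - 1)"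
    using assms(1)
  proof (cases rule: to_X_cases)
    case (U y1 y2 y3)
    then have y1: "y1 \<noteq> 0" using assms(2) by (simp add: to_X_U_coords)
    then have "y2 / y1 - 1 = 1 / y1" "y3 / y1 - 1 = (y3 - y1) / y1"
      using U(8) by (simp_all add: field_simps)
    then show ?thesis using U y1 by (auto simp: m_def to_X_U_coords)
  qed (use assms(2) in \<open>auto simp: m_def E2_coords E3_coords\<close>)
  then show "y21 m \<noteq> 1" "c = y31 m / (y21 m - 1)" "(1 - y) / 2 = (y31 m - 1) / (y21 m - 1)" by blast+
qed

text \<open>The generic formula \<open>b = y3\<^sup>2 / (4 * (y3 - y1) * (y2 - y3))\<close> is
  indeterminate on the curve \<open>E2\<close>. The direction at \<open>q2\<close>, which
  distinguishes the points of that curve, supplies the quotient by \<open>y3 - y1\<close>.\<close>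

lemma to_X_chart2:
  assumes "(y, c, b) \<in> conic_surface" "to_X (y, c, b) \<in> chart2"
  defines "m \<equiv> to_X (y, c, b)"
  shows "y12 m \<noteq> 1" "1 + y \<noteq> 0" "b = - ratio e1 e2 (m (Some q2)) * y31 m / (1 - y12 m) / (2 * (1 + y))"
proof -
  have "y12 m \<noteq> 1 \<and> 1 + y \<noteq> 0 \<and> b = - ratio e1 e2 (m (Some q2)) * y31 m / (1 - y12 m) / (2 * (1 + y))"
    using assms(1)
  proof (cases rule: to_X_cases)
    case (U y1 y2 y3)
    then have y12: "y1 \<noteq> 0" "y2 \<noteq> 0" using assms(2) by (simp_all add: to_X_U_coords)
    have "1 - y1 / y2 = 1 / y2" using U(8) y12 by (simp add: field_simps)
    moreover have "2 * (1 + y) = 4 * (y2 - y3)"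
    proof -
      have "2 * (1 + y) = 4 * ((1 + y) / 2)" by simp
      then show ?thesis by (simp only: U(10))
    qed
    moreover have "- (y1 * y3 / (y2 * (y1 - y3))) * (y3 / y1) / (1 / y2) = y3\<^sup>2 / (y3 - y1)"
    proof -
      have "- (y1 * y3 / (y2 * (y1 - y3))) = y1 * y3 / (y2 * (y3 - y1))"
        by (metis minus_diff_eq minus_divide_right mult_minus_right)
      then show ?thesis using y12 by (simp add: power2_eq_square)
    qed
    moreover have "b = y3\<^sup>2 / (y3 - y1) / (4 * (y2 - y3))"
      unfolding U(11)[folded U(7)] using U(5,6) by (simp del: right_diff_distrib_numeral add: divide_divide_eq_left)
    moreover have "y12 m = y1 / y2" "ratio e1 e2 (m (Some q2)) = y1 * y3 / (y2 * (y1 - y3))" "y31 m = y3 / y1"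
      using U(4,5,6) by (simp_all add: m_def U(3) to_X_U_coords)
    moreover have "1 + y \<noteq> 0" using U(2) by (simp add: add_eq_0_iff)
    ultimately show ?thesis using U(1,4) y12 by simp
  qed (use assms(2) in \<open>auto simp: m_def E2_coords E3_coords\<close>)
  then show "y12 m \<noteq> 1" "1 + y \<noteq> 0" "b = - ratio e1 e2 (m (Some q2)) * y31 m / (1 - y12 m) / (2 * (1 + y))" by blast+
qed

lemma to_X_chart3:
  assumes "(y, c, b) \<in> conic_surface" "to_X (y, c, b) \<in> chart3"
  defines "m \<equiv> to_X (y, c, b)"
  shows "y21 m \<noteq> 1" "1 - y \<noteq> 0" "b = - ratio e3 e1 (m (Some q3)) * y32 m / (y21 m - 1) / (2 * (1 - y))"
proof -
  have "y21 m \<noteq> 1 \<and> 1 - y \<noteq> 0 \<and> b = - ratio e3 e1 (m (Some q3)) * y32 m / (y21 m - 1) / (2 * (1 - y))"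
    using assms(1)
  proof (cases rule: to_X_cases)
    case (U y1 y2 y3)
    then have y12: "y1 \<noteq> 0" "y2 \<noteq> 0" using assms(2) by (simp_all add: to_X_U_coords)
    have "y2 / y1 - 1 = 1 / y1" using U(8) y12 by (simp add: field_simps)
    moreover have "2 * (1 - y) = 4 * (y3 - y1)"
    proof -
      have "2 * (1 - y) = 4 * ((1 - y) / 2)" by simp
      then show ?thesis by (simp only: U(9))
    qed
    moreover have "- (y2 * y3 / (y1 * (y3 - y2))) * (y3 / y2) / (1 / y1) = y3\<^sup>2 / (y2 - y3)"
    proof -
      have "- (y2 * y3 / (y1 * (y3 - y2))) = y2 * y3 / (y1 * (y2 - y3))"
        by (metis minus_diff_eq minus_divide_right mult_minus_right)
      then show ?thesis using y12 by (simp add: power2_eq_square)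
    qed
    moreover have "b = y3\<^sup>2 / (y2 - y3) / (4 * (y3 - y1))"
      unfolding U(11)[folded U(7)] using U(5,6) by (simp del: right_diff_distrib_numeral add: divide_divide_eq_left)
    moreover have "y21 m = y2 / y1" "ratio e3 e1 (m (Some q3)) = y2 * y3 / (y1 * (y3 - y2))" "y32 m = y3 / y2"
      using U(4,5,6) by (simp_all add: m_def U(3) to_X_U_coords)
    ultimately show ?thesis using U(1,4) y12 by simp
  qed (use assms(2) in \<open>auto simp: m_def E2_coords E3_coords\<close>)
  then show "y21 m \<noteq> 1" "1 - y \<noteq> 0" "b = - ratio e3 e1 (m (Some q3)) * y32 m / (y21 m - 1) / (2 * (1 - y))" by blast+
qed

text \<open>\<open>chartA\<close> or \<open>chartB\<close> gives \<open>y\<close> and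
  \<open>c\<close>; the equation of the surface then gives \<open>b\<close> except on the double
  fibres, where \<open>chart2\<close> and \<open>chart3\<close> do.\<close>

lemma inj_on_to_X: "inj_on to_X conic_surface"
proof (rule inj_onI)
  fix w w' assume w: "w \<in> conic_surface" and w': "w' \<in> conic_surface" and eq: "to_X w = to_X w'"
  obtain y c b y' c' b' where wy: "w = (y, c, b)" "w' = (y', c', b')" by (metis prod_cases3)
  note A = w[unfolded wy] w'[unfolded wy] and eq' = eq[unfolded wy]
  have yc: "(1 - y) / 2 = (1 - y') / 2 \<and> c = c'"
  proof (cases "to_X w \<in> chartA")
    case True
    then show ?thesis
      using to_X_chartA(2,3)[OF A(1)] to_X_chartA(2,3)[OF A(2)] eq' by (simp only: wy)
  next
    case False
    then have "to_X w \<in> chartB" using to_X_in_charts[OF w] by blast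
    then show ?thesis
      using to_X_chartB(2,3)[OF A(1)] to_X_chartB(2,3)[OF A(2)] eq' by (simp only: wy)
  qed
  then have y: "y = y'" by simp
  have "b = b'"
    using A(1)
  proof (cases rule: to_X_cases)
    case (U y1 y2 y3)
    then have "1 - y\<^sup>2 \<noteq> 0" by (simp add: power2_eq_1_iff)
    then show ?thesis using A yc y by (simp add: conic_surface_def)
  next
    case E2
    then have "to_X (y, c, b) \<in> chart2" by (simp add: E2_coords)
    then show ?thesis using to_X_chart2(3)[OF A(1)] to_X_chart2(3)[OF A(2)] eq' y by metis
  next
    case E3
    then have "to_X (y, c, b) \<in> chart3" by (simp add: E3_coords)
    then show ?thesis using to_X_chart3(3)[OF A(1)] to_X_chart3(3)[OF A(2)] eq' y by metis
  qed
  with y yc show "w = w'" by (simp add: wy)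
qed

lemma from_X_to_X: "w \<in> conic_surface \<Longrightarrow> from_X (to_X w) = w"
  unfolding from_X_def by (rule inv_into_f_f[OF inj_on_to_X])

lemma to_X_from_X: "m \<in> X \<Longrightarrow> to_X (from_X m) = m"
  unfolding from_X_def by (rule f_inv_into_f[OF to_X_surj])

lemma from_X_in: "m \<in> X \<Longrightarrow> from_X m \<in> conic_surface"
  unfolding from_X_def by (rule inv_into_into[OF to_X_surj])

definition "yX m = fst (from_X m)"
definition "cX m = fst (snd (from_X m))"
definition "bX m = snd (snd (from_X m))"
definition "\<sigma>X m = (1 - yX m) / 2"

lemma X_coords:
  assumes "m \<in> X"
  shows "(yX m, cX m, bX m) \<in> conic_surface" "to_X (yX m, cX m, bX m) = m"
  using to_X_from_X[OF assms] from_X_in[OF assms] by (simp_all add: yX_def cX_def bX_def)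

lemma X_chartB:
  assumes "m \<in> X" "m \<in> chartB"
  shows "y12 m \<noteq> 1" "cX m = y32 m / (1 - y12 m)" "\<sigma>X m = (y32 m - y12 m) / (1 - y12 m)"
  using to_X_chartB[OF X_coords(1)[OF assms(1)]] assms(2) unfolding X_coords(2)[OF assms(1)] \<sigma>X_def by blast+

lemma X_chartA:
  assumes "m \<in> X" "m \<in> chartA"
  shows "y21 m \<noteq> 1" "cX m = y31 m / (y21 m - 1)" "\<sigma>X m = (y31 m - 1) / (y21 m - 1)"
  using to_X_chartA[OF X_coords(1)[OF assms(1)]] assms(2) unfolding X_coords(2)[OF assms(1)] \<sigma>X_def by blast+

lemma X_chart2:
  assumes "m \<in> X" "m \<in> chart2"
  shows "y12 m \<noteq> 1" "1 + yX m \<noteq> 0" "bX m = - ratio e1 e2 (m (Some q2)) * y31 m / (1 - y12 m) / (2 * (1 + yX m))"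
  using to_X_chart2[OF X_coords(1)[OF assms(1)]] assms(2) unfolding X_coords(2)[OF assms(1)] by blast+

lemma X_chart3:
  assumes "m \<in> X" "m \<in> chart3"
  shows "y21 m \<noteq> 1" "1 - yX m \<noteq> 0" "bX m = - ratio e3 e1 (m (Some q3)) * y32 m / (y21 m - 1) / (2 * (1 - yX m))"
  using to_X_chart3[OF X_coords(1)[OF assms(1)]] assms(2) unfolding X_coords(2)[OF assms(1)] by blast+

lemma X_in_charts: "m \<in> X \<Longrightarrow> m \<in> chartA \<or> m \<in> chartB"
  using to_X_in_charts X_coords by metis

lemma open_nonvan_coord: "open {m :: 3 proj option \<Rightarrow> 3 proj. m i \<in> nonvan a}"
proof -
  have "open ((\<lambda>m :: 3 proj option \<Rightarrow> 3 proj. m i) -` nonvan a)"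
    by (intro open_vimage open_nonvan continuous_on_product_coordinates)
  then show ?thesis by (simp add: vimage_def)
qed

lemma open_charts: "open chartA" "open chartB" "open chart2" "open chart3"
  unfolding chartA_def chartB_def chart2_def chart3_def
  by (intro open_Collect_conj open_nonvan_coord)+

lemma continuous_on_ratio_coord:
  assumes "\<And>m. m \<in> S \<Longrightarrow> m i \<in> nonvan b"
  shows "continuous_on S (\<lambda>m :: 3 proj option \<Rightarrow> 3 proj. ratio a b (m i))"
  by (rule continuous_on_compose2[OF continuous_on_ratio continuous_on_subset[OF continuous_on_product_coordinates]])
    (use assms in auto)

lemma continuous_on_y:
  "continuous_on (S \<inter> chartB) y32" "continuous_on (S \<inter> chartB) y12"
  "continuous_on (S \<inter> chartA) y31" "continuous_on (S \<inter> chartA) y21"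
  "continuous_on (S \<inter> chart2) y31" "continuous_on (S \<inter> chart2) y12"
  "continuous_on (S \<inter> chart3) y32" "continuous_on (S \<inter> chart3) y21"
  unfolding y32_def y12_def y31_def y21_def
  by (intro continuous_intros continuous_on_ratio_coord;
      simp add: chartA_def chartB_def chart2_def chart3_def)+

lemma continuous_on_X: "continuous_on X \<sigma>X" "continuous_on X cX"
proof -
  have "continuous_on (X \<inter> chartB) \<sigma>X" "continuous_on (X \<inter> chartB) cX"
  proof -
    have "continuous_on (X \<inter> chartB) (\<lambda>m. (y32 m - y12 m) / (1 - y12 m))"
      by (intro continuous_intros continuous_on_y; use X_chartB(1) in force)
    then show "continuous_on (X \<inter> chartB) \<sigma>X"
      by (rule continuous_on_eq) (use X_chartB in auto)
    have "continuous_on (X \<inter> chartB) (\<lambda>m. y32 m / (1 - y12 m))"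
      by (intro continuous_intros continuous_on_y; use X_chartB(1) in force)
    then show "continuous_on (X \<inter> chartB) cX"
      by (rule continuous_on_eq) (use X_chartB in auto)
  qed
  moreover have "continuous_on (X \<inter> chartA) \<sigma>X" "continuous_on (X \<inter> chartA) cX"
  proof -
    have "continuous_on (X \<inter> chartA) (\<lambda>m. (y31 m - 1) / (y21 m - 1))"
      by (intro continuous_intros continuous_on_y; use X_chartA(1) in force)
    then show "continuous_on (X \<inter> chartA) \<sigma>X"
      by (rule continuous_on_eq) (use X_chartA in auto)
    have "continuous_on (X \<inter> chartA) (\<lambda>m. y31 m / (y21 m - 1))"
      by (intro continuous_intros continuous_on_y; use X_chartA(1) in force)
    then show "continuous_on (X \<inter> chartA) cX"
      by (rule continuous_on_eq) (use X_chartA in auto)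
  qed
  ultimately show "continuous_on X \<sigma>X" "continuous_on X cX"
    by - (rule continuous_on_locally; use X_in_charts open_charts in metis)+
qed

lemma continuous_on_yX: "continuous_on X yX"
proof -
  have "yX = (\<lambda>m. 1 - 2 * \<sigma>X m)" by (simp add: \<sigma>X_def fun_eq_iff field_simps)
  then show ?thesis by (simp add: continuous_intros continuous_on_X)
qed

lemma continuous_on_bX: "continuous_on X bX"
proof (rule continuous_on_locally)
  fix m assume m: "m \<in> X"
  have sub: "continuous_on (X \<inter> T) yX" "continuous_on (X \<inter> T) cX" for T
    using continuous_on_yX continuous_on_X(2) by (auto intro: continuous_on_subset)
  from X_coords(1)[OF m] show "\<exists>T. open T \<and> m \<in> T \<and> continuous_on (X \<inter> T) bX"
  proof (cases rule: to_X_cases)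
    case (U y1 y2 y3)
    let ?T = "(\<lambda>m. m None) -` (- {q2, q3}) :: (3 proj option \<Rightarrow> 3 proj) set"
    have "open (- {q2, q3})"
    proof -
      have "{q2, q3} = {q2} \<union> {q3}" by blast
      then show ?thesis by (simp only: open_closed double_complement closed_Un closed_proj_singleton)
    qed
    then have "open ?T" by (intro open_vimage continuous_on_product_coordinates)
    moreover have "m \<in> ?T"
    proof -
      have "m None = proj_pt (pnt (y2 * y3) (y1 * y3) (y1 * y2))"
        using U(3) X_coords(2)[OF m] by (simp add: mkU_def)
      moreover have "y2 * y3 \<noteq> 0 \<or> y1 * y3 \<noteq> 0 \<or> y1 * y2 \<noteq> 0" using U(4,5,6) by auto
      ultimately show ?thesis using U(4,5,6) by (auto simp: q2_def q3_def proj_pnt_eq_iff)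
    qed
    moreover have ne: "1 - (yX m)\<^sup>2 \<noteq> 0 \<and> bX m = (cX m)\<^sup>2 / (1 - (yX m)\<^sup>2)" if "m \<in> X \<inter> ?T" for m
    proof -
      have mX: "m \<in> X" using that by simp
      from X_coords(1)[OF mX] have "yX m \<noteq> 1 \<and> yX m \<noteq> -1"
      proof (cases rule: to_X_cases)
        case E2
        then have "m None = q2" using X_coords(2)[OF mX] E_simps(1)[of "4 * bX m"] by metis
        then show ?thesis using that by simp
      next
        case E3
        then have "m None = q3" using X_coords(2)[OF mX] E_simps(3)[of "4 * bX m"] by metis
        then show ?thesis using that by simp
      qed auto
      then have 1: "1 - (yX m)\<^sup>2 \<noteq> 0" by (simp add: power2_eq_1_iff)
      moreover have "(cX m)\<^sup>2 = (1 - (yX m)\<^sup>2) * bX m" using X_coords(1)[OF mX] by (simp add: conic_surface_def)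
      ultimately show ?thesis by simp
    qed
    have "continuous_on (X \<inter> ?T) (\<lambda>m. (cX m)\<^sup>2 / (1 - (yX m)\<^sup>2))"
      using ne by (intro continuous_intros sub) auto
    then have "continuous_on (X \<inter> ?T) bX" by (rule continuous_on_eq) (use ne in auto)
    ultimately show ?thesis by (intro exI[of _ ?T]) auto
  next
    case E2
    then have "m \<in> chart2" using X_coords(2)[OF m] E2_coords(3)[of "4 * bX m"] by simp
    moreover have ne: "\<forall>m\<in>X \<inter> chart2. 1 - y12 m \<noteq> 0" "\<forall>m\<in>X \<inter> chart2. 2 * (1 + yX m) \<noteq> 0"
      using X_chart2(1,2) by (auto simp del: distrib_left_numeral right_diff_distrib_numeral)
    have "continuous_on (X \<inter> chart2)
        (\<lambda>m. - ratio e1 e2 (m (Some q2)) * y31 m / (1 - y12 m) / (2 * (1 + yX m)))"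
      using ne by (intro continuous_intros continuous_on_y sub continuous_on_ratio_coord) (auto simp: chart2_def)
    then have "continuous_on (X \<inter> chart2) bX" by (rule continuous_on_eq) (use X_chart2(3) in auto)
    ultimately show ?thesis using open_charts by blast
  next
    case E3
    then have "m \<in> chart3" using X_coords(2)[OF m] E3_coords(3)[of "4 * bX m"] by simp
    moreover have ne: "\<forall>m\<in>X \<inter> chart3. y21 m - 1 \<noteq> 0" "\<forall>m\<in>X \<inter> chart3. 2 * (1 - yX m) \<noteq> 0"
      using X_chart3(1,2) by (auto simp del: distrib_left_numeral right_diff_distrib_numeral)
    have "continuous_on (X \<inter> chart3)
        (\<lambda>m. - ratio e3 e1 (m (Some q3)) * y32 m / (y21 m - 1) / (2 * (1 - yX m)))"
      using ne by (intro continuous_intros continuous_on_y sub continuous_on_ratio_coord) (auto simp: chart3_def)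
    then have "continuous_on (X \<inter> chart3) bX" by (rule continuous_on_eq) (use X_chart3(3) in auto)
    ultimately show ?thesis using open_charts by blast
  qed
qed

lemma continuous_on_from_X: "continuous_on X from_X"
proof -
  have "from_X = (\<lambda>m. (yX m, cX m, bX m))" by (simp add: yX_def cX_def bX_def fun_eq_iff)
  then show ?thesis by (simp add: continuous_intros continuous_on_yX continuous_on_X continuous_on_bX)
qed

end

section \<open>The orbifold\<close>

lemma homotopic_paths_image:
  assumes "homotopic_paths S p q" "continuous_on S h" "h ` S \<subseteq> T"
  shows "homotopic_paths T (h \<circ> p) (h \<circ> q)"
  using assms by (intro homotopic_paths_continuous_image) auto

lemma P1_pt_nonzero [simp]: "vector [a, b] = (0 :: complex ^ 2) \<longleftrightarrow> a = 0 \<and> b = 0"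
  by (auto simp: vec_eq_iff forall_2)

lemma proj_pt_eq_P1_iff:
  fixes v :: "complex ^ 2"
  assumes "v \<noteq> 0"
  shows "proj_pt v = P1_pt 0 1 \<longleftrightarrow> v $ 1 = 0" "proj_pt v = P1_pt 1 0 \<longleftrightarrow> v $ 2 = 0"
    "proj_pt v = P1_pt 1 (-1) \<longleftrightarrow> v $ 1 + v $ 2 = 0"
proof -
  have nz: "v $ 1 \<noteq> 0 \<or> v $ 2 \<noteq> 0" using assms by (auto simp: vec_eq_iff forall_2)
  have *: "proj_pt v = P1_pt a b \<longleftrightarrow> (\<exists>c. c \<noteq> 0 \<and> v $ 1 = c * a \<and> v $ 2 = c * b)" if "a \<noteq> 0 \<or> b \<noteq> 0" for a b
    using proj_pt_eq_iff[of "vector [a, b]" v] that assms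
    by (subst eq_commute) (simp add: vec_eq_iff[of v] forall_2)
  show "proj_pt v = P1_pt 0 1 \<longleftrightarrow> v $ 1 = 0" "proj_pt v = P1_pt 1 0 \<longleftrightarrow> v $ 2 = 0"
    using nz by (auto simp: *)
  have "v $ 1 + v $ 2 = 0 \<longleftrightarrow> v $ 2 = - v $ 1" by (simp add: add_eq_0_iff)
  then show "proj_pt v = P1_pt 1 (-1) \<longleftrightarrow> v $ 1 + v $ 2 = 0"
    using nz by (auto simp: *)
qed

section \<open>The orbifold line and its affine coordinate\<close>

definition conic_orbifold :: orbifold_data where
  "conic_orbifold = [(P1_pt 0 1, 2), (P1_pt 1 (-1), \<infinity>), (P1_pt 1 0, 2)]"

abbreviation "marked \<equiv> marked_points conic_orbifold"

lemma marked_eq: "marked = {P1_pt 0 1, P1_pt 1 (-1), P1_pt 1 0}"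
  by (simp add: marked_points_def conic_orbifold_def)

lemma marked_iff: "v \<noteq> 0 \<Longrightarrow> proj_pt v \<in> marked \<longleftrightarrow> v $ 1 = 0 \<or> v $ 2 = 0 \<or> v $ 1 + v $ 2 = 0"
  by (auto simp: marked_eq proj_pt_eq_P1_iff)

text \<open>The affine coordinate in which the three marked points are \<open>1\<close>, \<open>\<infinity>\<close> and \<open>-1\<close>.\<close>

definition P1_coord :: "2 proj \<Rightarrow> complex" where
  "P1_coord = ratio (vector [-1, 1]) (vector [1, 1])"

definition P1_param :: "complex \<Rightarrow> 2 proj" where
  "P1_param y = P1_pt ((1 - y) / 2) ((1 + y) / 2)"

lemma P1_coord_proj_pt: "v \<noteq> 0 \<Longrightarrow> P1_coord (proj_pt v) = (v $ 2 - v $ 1) / (v $ 1 + v $ 2)"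
  by (simp add: P1_coord_def ratio_proj_pt dot_2)

lemma P1_param_nonzero: "vector [(1 - y) / 2, (1 + y) / 2] \<noteq> (0 :: complex ^ 2)"
  by (simp add: add_eq_0_iff)

lemma P1_coord_param [simp]: "P1_coord (P1_param y) = y"
proof -
  have "(1 - y) / 2 + (1 + y) / 2 = 1" "(1 + y) / 2 - (1 - y) / 2 = y" by (simp_all add: field_simps)
  then show ?thesis unfolding P1_param_def by (simp only: P1_coord_proj_pt[OF P1_param_nonzero] vector_2) simp
qed

lemma P1_param_coord:
  assumes "z \<noteq> P1_pt 1 (-1)"
  shows "P1_param (P1_coord z) = z"
proof -
  obtain v :: "complex ^ 2" where v: "v \<noteq> 0" "z = proj_pt v" by (rule proj_pt_cases)
  define s where "s = v $ 1 + v $ 2"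
  have s: "s \<noteq> 0" using assms v by (simp add: proj_pt_eq_P1_iff s_def)
  let ?y = "P1_coord z"
  have "?y = (v $ 2 - v $ 1) / s" using v by (simp add: P1_coord_proj_pt s_def)
  then have "(1 - ?y) / 2 = v $ 1 / s" "(1 + ?y) / 2 = v $ 2 / s"
    using s by (simp_all add: field_simps) (simp_all add: s_def)
  then have "P1_param ?y = proj_pt (vector [v $ 1 / s, v $ 2 / s])" unfolding P1_param_def by (simp only:)
  also have "\<dots> = proj_pt v"
    using v s by (intro proj_pt_eqI[of _ s]) (auto simp: vec_eq_iff forall_2)
  finally show ?thesis using v by simp
qed

lemma P1_param_marked: "P1_param y \<in> marked \<longleftrightarrow> y \<in> {1, -1}"
proof -
  have "(1 - y) / 2 + (1 + y) / 2 = 1" by (simp add: field_simps)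
  then show ?thesis
    unfolding P1_param_def by (subst marked_iff[OF P1_param_nonzero]) (auto simp: add_eq_0_iff)
qed

lemma P1_coord_unmarked: "z \<notin> marked \<Longrightarrow> P1_coord z \<in> twice_punctured"
  using P1_param_marked[of "P1_coord z"] P1_param_coord[of z] by (auto simp: marked_eq)

lemma P1_coord_image: "P1_coord ` (- marked) \<subseteq> twice_punctured"
proof (rule image_subsetI)
  fix z assume "z \<in> - marked"
  then have "z \<notin> marked" by simp
  then show "P1_coord z \<in> twice_punctured" by (rule P1_coord_unmarked)
qed

lemma P1_param_unmarked: "y \<in> twice_punctured \<Longrightarrow> P1_param y \<in> - marked"
  using P1_param_marked[of y] by auto

lemma continuous_on_P1_param: "continuous_on S P1_param"
proof -
  have "continuous_on S (\<lambda>y::complex. vector [(1 - y) / 2, (1 + y) / 2] :: complex ^ 2)"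
  proof (rule continuous_on_vecI)
    show "continuous_on S (\<lambda>y. (vector [(1 - y) / 2, (1 + y) / 2] :: complex ^ 2) $ k)" for k
      using exhaust_2[of k] by (elim disjE) (simp_all add: continuous_intros)
  qed
  then show ?thesis
    unfolding P1_param_def by (rule continuous_on_proj_pt_compose) (rule P1_param_nonzero)
qed

lemma continuous_on_P1_coord: "continuous_on (- marked) P1_coord"
proof (rule continuous_on_subset)
  show "continuous_on (nonvan (vector [1, 1])) P1_coord"
    unfolding P1_coord_def by (rule continuous_on_ratio)
  show "- marked \<subseteq> nonvan (vector [1, 1])"
  proof
    fix z assume z: "z \<in> - marked"
    obtain v :: "complex ^ 2" where v: "v \<noteq> 0" "z = proj_pt v" by (rule proj_pt_cases)
    then show "z \<in> nonvan (vector [1, 1])" using z by (simp add: marked_iff nonvan_proj_pt dot_2)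
  qed
qed

text \<open>A disc around a marked point of finite order is, in the affine coordinate, a disc around
  \<open>k = 1\<close> or \<open>k = -1\<close> whose parametrization has a simple zero at the centre.\<close>

lemma marked_disc:
  fixes u w :: "complex ^ 2"
  assumes y: "y = P1_pt 0 1 \<or> y = P1_pt 1 0" and u: "u \<noteq> 0" "proj_pt u = y" and w: "w \<noteq> 0" "proj_pt w \<noteq> y"
    and disc: "\<And>t. 0 < norm t \<Longrightarrow> norm t \<le> 1 \<Longrightarrow> proj_pt (u + t *s w) \<notin> marked"
  obtains k :: real and \<rho> :: "complex \<Rightarrow> complex" where "k \<in> {1, -1}" "continuous_on (cball 0 1) \<rho>"
    "\<And>t. t \<in> cball 0 1 \<Longrightarrow> \<rho> t \<noteq> 0" "\<And>t. t \<in> cball 0 1 \<Longrightarrow> t * \<rho> t \<noteq> 1"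
    "\<And>t. t \<in> cball 0 1 \<Longrightarrow> P1_coord (proj_pt (u + t *s w)) = of_real k * (1 - 2 * (t * \<rho> t))"
proof -
  have nz: "u + t *s w \<noteq> 0" for t
  proof
    assume "u + t *s w = 0"
    then have eq: "u = (- t) *s w" by (simp add: eq_neg_iff_add_eq_0)
    then have "- t \<noteq> 0" using u(1) by auto
    then have "proj_pt u = proj_pt w" using proj_pt_scale[of "- t" w] w eq by simp
    then show False using u w by simp
  qed
  define A B where "A = (\<lambda>t. (u + t *s w) $ 1)" and "B = (\<lambda>t. (u + t *s w) $ 2)"
  have AB: "A t \<noteq> 0 \<and> B t \<noteq> 0 \<and> A t + B t \<noteq> 0" if "norm t \<le> 1" "t \<noteq> 0" for t
    using disc[of t] that marked_iff[OF nz] by (simp add: A_def B_def)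
  have coord: "P1_coord (proj_pt (u + t *s w)) = (B t - A t) / (A t + B t)" for t
    using P1_coord_proj_pt[OF nz] by (simp add: A_def B_def)
  have cont: "continuous_on (cball 0 1) (\<lambda>t. A t + B t)"
    unfolding A_def B_def vector_add_component vector_smult_component by (intro continuous_intros)
  from y show thesis
  proof
    assume y: "y = P1_pt 0 1"
    then have u1: "u $ 1 = 0" and w1: "w $ 1 \<noteq> 0" using u w by (simp_all add: proj_pt_eq_P1_iff)
    have u2: "u $ 2 \<noteq> 0" using u(1) u1 by (auto simp: vec_eq_iff forall_2)
    have At: "A t = t * w $ 1" for t by (simp add: A_def u1)
    have B0: "B t \<noteq> 0 \<and> A t + B t \<noteq> 0" if "norm t \<le> 1" for t
      using AB[OF that] u1 u2 by (cases "t = 0") (auto simp: A_def B_def)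
    \<comment> \<open>Here \<open>A t / (A t + B t)\<close> is \<open>t * \<rho> t\<close>, as
      \<open>A\<close> is linear with its zero at the centre; the unmarkedness of the punctured disc
      keeps \<open>A + B\<close> and \<open>B\<close> away from 0.\<close>
    show thesis
    proof (rule that[of 1 "\<lambda>t. w $ 1 / (A t + B t)"])
      show "continuous_on (cball 0 1) (\<lambda>t. w $ 1 / (A t + B t))"
        using B0 by (intro continuous_intros cont) auto
      fix t :: complex assume "t \<in> cball 0 1"
      then have n: "B t \<noteq> 0" "A t + B t \<noteq> 0" using B0 by auto
      then show "w $ 1 / (A t + B t) \<noteq> 0" using w1 by simp
      show "t * (w $ 1 / (A t + B t)) \<noteq> 1" using n by (simp add: At[symmetric])
      have "(B t - A t) / (A t + B t) = 1 - 2 * (A t / (A t + B t))" using n by (simp add: field_simps)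
      then show "P1_coord (proj_pt (u + t *s w)) = of_real 1 * (1 - 2 * (t * (w $ 1 / (A t + B t))))"
        by (simp add: coord At)
    qed simp
  next
    assume y: "y = P1_pt 1 0"
    then have u1: "u $ 2 = 0" and w1: "w $ 2 \<noteq> 0" using u w by (simp_all add: proj_pt_eq_P1_iff)
    have u2: "u $ 1 \<noteq> 0" using u(1) u1 by (auto simp: vec_eq_iff forall_2)
    have Bt: "B t = t * w $ 2" for t by (simp add: B_def u1)
    have A0: "A t \<noteq> 0 \<and> A t + B t \<noteq> 0" if "norm t \<le> 1" for t
      using AB[OF that] u1 u2 by (cases "t = 0") (auto simp: A_def B_def)
    show thesis
    proof (rule that[of "-1" "\<lambda>t. w $ 2 / (A t + B t)"])
      show "continuous_on (cball 0 1) (\<lambda>t. w $ 2 / (A t + B t))"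
        using A0 by (intro continuous_intros cont) auto
      fix t :: complex assume "t \<in> cball 0 1"
      then have n: "A t \<noteq> 0" "A t + B t \<noteq> 0" using A0 by auto
      then show "w $ 2 / (A t + B t) \<noteq> 0" using w1 by simp
      show "t * (w $ 2 / (A t + B t)) \<noteq> 1" using n by (simp add: Bt[symmetric])
      have "(B t - A t) / (A t + B t) = - 1 + 2 * (B t / (A t + B t))" using n by (simp add: field_simps)
      then show "P1_coord (proj_pt (u + t *s w)) = of_real (-1) * (1 - 2 * (t * (w $ 2 / (A t + B t))))"
        by (simp add: coord Bt)
    qed simp
  qed
qed

section \<open>Meridians and the kernel of the section\<close>

lemma power_two_path_class:
  assumes "p \<in> loops_at X a"
  shows "path_class X p [^]\<^bsub>fundamental_group X a\<^esub> (2::nat) = path_class X (p +++ p)"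
proof -
  have aX: "a \<in> X" using assms by (metis loops_atD(2,3) pathstart_in_path_image subsetD)
  interpret group "fundamental_group X a" using aX by (rule group_fundamental_group)
  have "path_class X p \<in> carrier (fundamental_group X a)"
    using assms by (simp add: carrier_fundamental_group)
  then have "path_class X p [^]\<^bsub>fundamental_group X a\<^esub> (2::nat) =
      path_class X p \<otimes>\<^bsub>fundamental_group X a\<^esub> path_class X p"
    by (simp add: numeral_2_eq_2)
  then show ?thesis using assms by (simp add: mult_fundamental_group)
qed

lemma meridianE:
  assumes "\<mu> \<in> meridians Y b y"
  obtains \<kappa> u w where "u \<noteq> 0" "w \<noteq> 0" "proj_pt u = y" "proj_pt w \<noteq> y"
    "\<And>t. 0 < norm t \<Longrightarrow> norm t \<le> 1 \<Longrightarrow> proj_pt (u + t *s w) \<notin> Y"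
    "path_from (- Y) \<kappa> b (proj_pt (u + w))"
    "\<mu> = path_class (- Y) (\<kappa> +++ ((\<lambda>s. proj_pt (u + unit_circle s *s w)) +++ reversepath \<kappa>))"
    "path_from (- Y) (\<lambda>s. proj_pt (u + unit_circle s *s w)) (proj_pt (u + w)) (proj_pt (u + w))"
proof -
  from assms obtain \<kappa> u w where *: "u \<noteq> 0" "w \<noteq> 0" "proj_pt u = y" "proj_pt w \<noteq> y"
    "\<forall>t. 0 < norm t \<and> norm t \<le> 1 \<longrightarrow> proj_pt (u + t *s w) \<notin> Y"
    "path_from (- Y) \<kappa> b (proj_pt (u + w))"
    "\<mu> = path_class (- Y) (\<kappa> +++ ((\<lambda>s. proj_pt (u + unit_circle s *s w)) +++ reversepath \<kappa>))"
    unfolding meridians_def path_from_def unit_circle_def by blast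
  have nz: "u + t *s w \<noteq> 0" for t
  proof
    assume "u + t *s w = 0"
    then have eq: "u = (- t) *s w" by (simp add: eq_neg_iff_add_eq_0)
    then have "- t \<noteq> 0" using *(1) by auto
    then have "proj_pt u = proj_pt w" using proj_pt_scale[of "- t" w] * eq by simp
    then show False using * by simp
  qed
  have "path (\<lambda>s. proj_pt (u + unit_circle s *s w))"
    unfolding path_def unit_circle_def by (intro continuous_on_proj_pt_compose continuous_intros) (rule nz)
  moreover have "proj_pt (u + unit_circle s *s w) \<notin> Y" for s using *(5)[rule_format, of "unit_circle s"] by simp
  moreover have "unit_circle 0 = 1" "unit_circle 1 = 1" by (simp_all add: unit_circle_def)
  ultimately have "path_from (- Y) (\<lambda>s. proj_pt (u + unit_circle s *s w)) (proj_pt (u + w)) (proj_pt (u + w))"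
    by (auto simp: path_from_def path_image_def pathstart_def pathfinish_def)
  then show thesis using * that by blast
qed

lemma orbifold_kernel_normal:
  assumes "b \<notin> marked_points D"
  shows "orbifold_kernel D b \<lhd> fundamental_group (- marked_points D) b"
  unfolding orbifold_kernel_def Let_def
proof (rule normal_closure_normal)
  show G: "group (fundamental_group (- marked_points D) b)" using assms by (intro group_fundamental_group) auto
  interpret group "fundamental_group (- marked_points D) b" by fact
  have "\<mu> \<in> carrier (fundamental_group (- marked_points D) b)" if "\<mu> \<in> meridians (marked_points D) b y" for \<mu> y
    using that by (elim meridianE)
      (auto simp: carrier_fundamental_group path_from_loop[symmetric] intro!: imageI path_from_join path_from_reverse)
  then show "{\<mu> [^]\<^bsub>fundamental_group (- marked_points D) b\<^esub> k | \<mu> k y. (y, enat k) \<in> set D \<and>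
      \<mu> \<in> meridians (marked_points D) b y} \<subseteq> carrier (fundamental_group (- marked_points D) b)"
    by blast
qed

lemma conic_orbifold_finite: "(y, enat k) \<in> set conic_orbifold \<longleftrightarrow> k = 2 \<and> (y = P1_pt 0 1 \<or> y = P1_pt 1 0)"
  by (auto simp: conic_orbifold_def numeral_eq_enat)

text \<open>The kernel of the map induced by the section is normal, so only the squares of meridians
  have to be checked. A meridian may come from any disc around its point, which is why
  \<open>conic_section_double_loop_null\<close> allows a general function
  \<open>\<rho>\<close>.\<close>

lemma conic_orbifold_kernel_null:
  fixes c :: complex
  assumes b: "b \<notin> marked" and \<delta>: "\<delta> \<in> loops_at (- marked) b"
    and K: "path_class (- marked) \<delta> \<in> orbifold_kernel conic_orbifold b"
  defines "S \<equiv> conic_section c \<circ> P1_coord"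
  shows "homotopic_paths conic_surface (S \<circ> \<delta>) (\<lambda>_. S b)"
proof -
  let ?G = "fundamental_group (- marked) b" and ?H = "fundamental_group conic_surface (S b)"
  let ?i = "induced_map conic_surface S"
  have sub: "P1_coord ` (- marked) \<subseteq> twice_punctured" by (rule P1_coord_image)
  have cS: "continuous_on (- marked) S"
    unfolding S_def using continuous_on_P1_coord continuous_on_subset[OF continuous_on_conic_section sub]
    by (rule continuous_on_compose)
  have S: "S ` (- marked) \<subseteq> conic_surface"
    using P1_coord_unmarked by (auto simp: S_def intro!: conic_section_in)
  interpret group_hom ?G ?H ?i using b by (intro induced_map_hom[OF cS S]) simp
  have i: "?i (path_class (- marked) p) = path_class conic_surface (S \<circ> p)" if "p \<in> loops_at (- marked) b" for p
    using loops_atD[OF that] by (intro induced_map_class[OF _ _ cS S])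
  have "orbifold_kernel conic_orbifold b \<subseteq> kernel ?G ?H ?i"
    unfolding orbifold_kernel_def Let_def
  proof (rule normal_closure_least[OF normal_kernel], clarify)
    fix \<mu> k y assume "(y, enat k) \<in> set conic_orbifold" and \<mu>: "\<mu> \<in> meridians marked b y"
    then have k: "k = 2" and y: "y = P1_pt 0 1 \<or> y = P1_pt 1 0" by (simp_all add: conic_orbifold_finite)
    from \<mu> obtain \<kappa> u w where m: "u \<noteq> 0" "w \<noteq> 0" "proj_pt u = y" "proj_pt w \<noteq> y"
      "\<And>t. 0 < norm t \<Longrightarrow> norm t \<le> 1 \<Longrightarrow> proj_pt (u + t *s w) \<notin> marked"
      "path_from (- marked) \<kappa> b (proj_pt (u + w))"
      "\<mu> = path_class (- marked) (\<kappa> +++ ((\<lambda>s. proj_pt (u + unit_circle s *s w)) +++ reversepath \<kappa>))"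
      "path_from (- marked) (\<lambda>s. proj_pt (u + unit_circle s *s w)) (proj_pt (u + w)) (proj_pt (u + w))"
      by (rule meridianE) blast
    let ?l = "\<lambda>s. proj_pt (u + unit_circle s *s w)"
    let ?m = "\<kappa> +++ (?l +++ reversepath \<kappa>)"
    obtain k' :: real and \<rho> where \<rho>: "k' \<in> {1, -1}" "continuous_on (cball 0 1) \<rho>"
      "\<And>t. t \<in> cball 0 1 \<Longrightarrow> \<rho> t \<noteq> 0" "\<And>t. t \<in> cball 0 1 \<Longrightarrow> t * \<rho> t \<noteq> 1"
      "\<And>t. t \<in> cball 0 1 \<Longrightarrow> P1_coord (proj_pt (u + t *s w)) = of_real k' * (1 - 2 * (t * \<rho> t))"
      using marked_disc[OF y m(1,3,2,4,5)] by blast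
    have "P1_coord \<circ> ?l = (\<lambda>s. of_real k' * (1 - 2 * (unit_circle s * \<rho> (unit_circle s))))"
      using \<rho>(5) by (auto simp: fun_eq_iff)
    then have "homotopic_paths conic_surface (conic_section c \<circ> ((P1_coord \<circ> ?l) +++ (P1_coord \<circ> ?l)))
        (\<lambda>_. conic_section c ((P1_coord \<circ> ?l) 0))"
      using conic_section_double_loop_null(1)[OF \<rho>(1-4), of c] by (simp only:)
    moreover have "unit_circle 0 = 1" by (simp add: unit_circle_def)
    ultimately have null: "homotopic_paths conic_surface ((S \<circ> ?l) +++ (S \<circ> ?l)) (\<lambda>_. S (proj_pt (u + w)))"
      by (simp add: S_def joinpaths_compose comp_assoc)
    have mm: "?m \<in> loops_at (- marked) b"
      using m(6,8) by (auto simp: path_from_loop[symmetric] intro!: path_from_join path_from_reverse)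
    have "homotopic_paths conic_surface ((S \<circ> ?m) +++ (S \<circ> ?m)) (\<lambda>_. S b)"
      unfolding joinpaths_compose reversepath_compose
      using path_from_image[OF m(6) cS S] path_from_image[OF m(8) cS S] null by (rule conjugate_square)
    then have "path_class conic_surface (S \<circ> (?m +++ ?m)) = \<one>\<^bsub>?H\<^esub>"
      unfolding joinpaths_compose one_fundamental_group by (rule path_class_eqI)
    moreover have "\<mu> [^]\<^bsub>?G\<^esub> k = path_class (- marked) (?m +++ ?m)"
      unfolding k m(7) by (rule power_two_path_class[OF mm])
    ultimately show "\<mu> [^]\<^bsub>?G\<^esub> k \<in> kernel ?G ?H ?i"
      using i[OF loops_at_join[OF mm mm]] loops_at_join[OF mm mm]
      by (simp add: kernel_def carrier_fundamental_group)
  qed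
  then have "path_class conic_surface (S \<circ> \<delta>) = path_class conic_surface (\<lambda>_. S b)"
    using K i[OF \<delta>] by (auto simp: kernel_def one_fundamental_group)
  moreover have "S \<circ> \<delta> \<in> loops_at conic_surface (S b)" using loops_at_image[OF \<delta> cS S] by simp
  ultimately show ?thesis using path_class_eq_iff[OF loops_atD(1,2)] by metis
qed

text \<open>The orbifold kernel is pulled back along \<open>P1_param\<close> to the punctured plane,
  where \<open>conic_section_kernel\<close> asks for the squares of the conjugates of two circles;
  so the point is that these circles are meridians.\<close>

lemma conic_orbifold_null_kernel:
  fixes c :: complex
  assumes b: "b \<notin> marked" and \<delta>: "\<delta> \<in> loops_at (- marked) b"
  defines "S \<equiv> conic_section c \<circ> P1_coord"
  assumes null: "homotopic_paths conic_surface (S \<circ> \<delta>) (\<lambda>_. S b)"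
  shows "path_class (- marked) \<delta> \<in> orbifold_kernel conic_orbifold b"
proof -
  define y0 K where "y0 = P1_coord b" and "K = orbifold_kernel conic_orbifold b"
  let ?G = "fundamental_group (- marked) b" and ?H = "fundamental_group twice_punctured y0"
  let ?i = "induced_map (- marked) P1_param"
  have y0: "y0 \<in> twice_punctured" unfolding y0_def by (rule P1_coord_unmarked[OF b])
  have yb: "P1_param y0 = b" unfolding y0_def using b by (intro P1_param_coord) (auto simp: marked_eq)
  have sub: "P1_param ` twice_punctured \<subseteq> - marked" by (rule image_subsetI) (rule P1_param_unmarked)
  have hom: "group_hom ?H ?G ?i"
    using induced_map_hom[OF continuous_on_P1_param sub y0] unfolding yb .
  have i: "?i (path_class twice_punctured p) = path_class (- marked) (P1_param \<circ> p)"
    if "p \<in> loops_at twice_punctured y0" for p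
    using loops_atD[OF that] by (intro induced_map_class[OF _ _ continuous_on_P1_param sub])
  define N where "N = {x \<in> carrier ?H. ?i x \<in> K}"
  have N: "N \<lhd> ?H"
    unfolding N_def K_def by (rule normal_vimage[OF hom orbifold_kernel_normal[OF b]])
  have "path_class twice_punctured (P1_coord \<circ> \<delta>) \<in> N"
  proof (rule conic_section_kernel[OF y0 N])
    show "P1_coord \<circ> \<delta> \<in> loops_at twice_punctured y0"
      using \<delta> continuous_on_P1_coord by (rule loops_at_image) (simp_all only: P1_coord_image y0_def)
    show "homotopic_paths conic_surface (conic_section c \<circ> (P1_coord \<circ> \<delta>)) (\<lambda>_. conic_section c y0)"
      using null by (simp add: S_def y0_def comp_assoc)
    fix \<kappa> and k :: real assume \<kappa>: "path_from twice_punctured \<kappa> y0 0" and k: "k \<in> {1, -1}"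
    let ?m = "\<kappa> +++ (pole_loop k +++ reversepath \<kappa>)"
    have m: "?m \<in> loops_at twice_punctured y0"
      using \<kappa> path_from_pole_loop[OF k]
      by (auto simp: path_from_loop[symmetric] intro!: path_from_join path_from_reverse)
    have \<mu>: "path_class (- marked) (P1_param \<circ> ?m) \<in> meridians marked b (P1_param (of_real k))"
    proof -
      \<comment> \<open>The disc consists of the points \<open>P1_param (k * (1 - t))\<close>: its
        centre is \<open>k\<close>, the value \<open>t = 1\<close> gives the start 0 of the circle,
        and the other puncture would need \<open>t = 2\<close>.\<close>
      define u w :: "complex ^ 2" where "u = vector [(1 - of_real k) / 2, (1 + of_real k) / 2]"
        and "w = vector [of_real k / 2, - of_real k / 2]"
      have uw: "u + t *s w = vector [(1 - of_real k * (1 - t)) / 2, (1 + of_real k * (1 - t)) / 2]" for t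
        by (simp add: u_def w_def vec_eq_iff forall_2 field_simps)
      then have par: "proj_pt (u + t *s w) = P1_param (of_real k * (1 - t))" for t
        by (simp add: P1_param_def)
      have circ: "P1_param \<circ> pole_loop k = (\<lambda>s. proj_pt (u + exp (2 * of_real pi * \<i> * of_real s) *s w))"
        by (simp add: fun_eq_iff par pole_loop_def unit_circle_def)
      have fin: "proj_pt (u + w) = P1_param 0" using par[of 1] by simp
      have "proj_pt u = P1_param (of_real k)" by (simp add: u_def P1_param_def)
      moreover have "u \<noteq> 0" "w \<noteq> 0" using k by (auto simp: u_def w_def)
      moreover have "proj_pt w \<noteq> P1_param (of_real k)"
      proof -
        have "proj_pt w = P1_pt 1 (-1)" using \<open>w \<noteq> 0\<close> by (simp add: proj_pt_eq_P1_iff w_def)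
        moreover have "P1_param (of_real k) \<noteq> P1_pt 1 (-1)"
          using P1_param_nonzero[of "of_real k"] unfolding P1_param_def
          by (subst proj_pt_eq_P1_iff) (auto simp: field_simps)
        ultimately show ?thesis by simp
      qed
      moreover have "proj_pt (u + t *s w) \<notin> marked" if "0 < norm t \<and> norm t \<le> 1" for t
      proof -
        have "t \<noteq> 0" "t \<noteq> 2" using that by auto
        then have "of_real k * (1 - t) \<notin> {1, -1}" using k by (auto simp: algebra_simps)
        then show ?thesis by (simp only: par P1_param_marked) simp
      qed
      moreover have "path_from (- marked) (P1_param \<circ> \<kappa>) b (P1_param 0)"
        using path_from_image[OF \<kappa> continuous_on_P1_param sub] unfolding yb .
      ultimately show ?thesis
        unfolding meridians_def joinpaths_compose reversepath_compose circ path_from_def fin[symmetric]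
        by blast
    qed
    have "P1_param (of_real k) = P1_pt 0 1 \<or> P1_param (of_real k) = P1_pt 1 0"
      using k by (auto simp: P1_param_def)
    then have "(P1_param (of_real k), enat 2) \<in> set conic_orbifold" by (simp add: conic_orbifold_finite)
    with \<mu> have "path_class (- marked) (P1_param \<circ> ?m) [^]\<^bsub>?G\<^esub> (2::nat) \<in> K"
      unfolding K_def orbifold_kernel_def Let_def by (intro subsetD[OF normal_closure_subset]) blast
    moreover have "P1_param \<circ> ?m \<in> loops_at (- marked) b"
      using m continuous_on_P1_param sub yb[symmetric] by (rule loops_at_image)
    ultimately have "path_class (- marked) (P1_param \<circ> (?m +++ ?m)) \<in> K"
      unfolding joinpaths_compose[of _ ?m] using power_two_path_class by metis
    then show "path_class twice_punctured ?m [^]\<^bsub>?H\<^esub> (2::nat) \<in> N"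
      unfolding power_two_path_class[OF m] N_def
      using i[OF loops_at_join[OF m m]] loops_at_join[OF m m] by (simp add: carrier_fundamental_group)
  qed
  then have "?i (path_class twice_punctured (P1_coord \<circ> \<delta>)) \<in> K" by (simp add: N_def)
  moreover have "P1_coord \<circ> \<delta> \<in> loops_at twice_punctured y0"
    using \<delta> continuous_on_P1_coord by (rule loops_at_image) (simp_all only: P1_coord_image y0_def)
  moreover have "path_class (- marked) \<delta> = path_class (- marked) (P1_param \<circ> (P1_coord \<circ> \<delta>))"
  proof (rule path_class_eqI, rule homotopic_paths_eq)
    fix t :: real assume "t \<in> {0..1}"
    then have "\<delta> t \<in> - marked" using loops_atD(2)[OF \<delta>] unfolding path_image_def by blast
    then show "\<delta> t = (P1_param \<circ> (P1_coord \<circ> \<delta>)) t" by (auto simp: P1_param_coord marked_eq)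
  qed (use loops_atD[OF \<delta>] in auto)
  ultimately show ?thesis using i unfolding K_def by metis
qed

section \<open>The isomorphism of fundamental groups\<close>

context quadrilateral_frame
begin

definition fX :: "(3 proj option \<Rightarrow> 3 proj) \<Rightarrow> 2 proj" where
  "fX m = P1_pt (\<sigma>X m) (1 - \<sigma>X m)"

lemma fX_eq: "fX m = P1_param (yX m)"
proof -
  have "1 - (1 - yX m) / 2 = (1 + yX m) / 2" by (simp add: field_simps)
  then show ?thesis unfolding fX_def P1_param_def \<sigma>X_def by (simp only:)
qed

lemma P1_coord_fX [simp]: "P1_coord (fX m) = yX m"
  by (simp add: fX_eq)

lemma fX_unmarked: "fX m \<notin> marked \<longleftrightarrow> yX m \<in> twice_punctured"
  by (simp add: fX_eq P1_param_marked)

lemma to_X_in: "to_X ` conic_surface \<subseteq> X" "from_X ` X \<subseteq> conic_surface"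
  using to_X_in_X from_X_in by (metis image_subsetI prod_cases3)+

lemma fX_pushforward_iso:
  assumes a: "a \<in> X" "fX a \<notin> marked"
  shows "orbifold_pushforward conic_orbifold fX a
    \<in> iso (fundamental_group X a) (orbifold_fundamental_group conic_orbifold (fX a))"
proof -
  \<comment> \<open>The section has to pass through the base point.\<close>
  define c where "c = cX a"
  define S where "S = conic_section c \<circ> P1_coord"
  have sub: "P1_coord ` (- marked) \<subseteq> twice_punctured" by (rule P1_coord_image)
  have cS: "continuous_on (- marked) S"
    unfolding S_def using continuous_on_P1_coord continuous_on_subset[OF continuous_on_conic_section sub]
    by (rule continuous_on_compose)
  have S: "S ` (- marked) \<subseteq> conic_surface"
    using P1_coord_unmarked by (auto simp: S_def intro!: conic_section_in)
  have fa: "from_X a = (yX a, cX a, bX a)" by (simp add: yX_def cX_def bX_def)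
  have Sa: "S (fX a) = from_X a"
    using conic_surface_eq_section[OF from_X_in[OF a(1)]] a(2) fX_unmarked[of a]
    by (simp add: fa S_def c_def)
  have y0: "yX a \<in> twice_punctured" using a(2) fX_unmarked by blast
  show ?thesis
  proof (rule orbifold_pushforward_iso[where s = "to_X \<circ> S"])
    show "orbifold_kernel conic_orbifold (fX a) \<lhd> fundamental_group (- marked) (fX a)"
      by (rule orbifold_kernel_normal[OF a(2)])
    show "continuous_on (- marked) (to_X \<circ> S)"
      using cS continuous_on_subset[OF continuous_on_to_X S] by (rule continuous_on_compose)
    show "(to_X \<circ> S) ` (- marked) \<subseteq> X" unfolding image_comp[symmetric] using S to_X_in(1) by blast
    show "fX ((to_X \<circ> S) z) = z" if z: "z \<notin> marked" for z
    proof -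
      have "S z \<in> conic_surface" using S z by blast
      then have "yX (to_X (S z)) = P1_coord z"
        by (simp add: yX_def from_X_to_X) (simp add: S_def conic_section_def)
      then show ?thesis using z by (auto simp: fX_eq P1_param_coord marked_eq)
    qed
    show "(to_X \<circ> S) (fX a) = a" using Sa to_X_from_X[OF a(1)] by simp
    show "continuous_on {m \<in> X. fX m \<notin> marked} fX"
    proof (rule continuous_on_subset[of X])
      have "continuous_on X (P1_param \<circ> yX)"
        using continuous_on_yX continuous_on_P1_param by (rule continuous_on_compose)
      then show "continuous_on X fX" by (simp add: fX_eq comp_def)
    qed blast
    show "homotopic_paths X \<gamma> (to_X \<circ> S \<circ> (fX \<circ> \<gamma>))" if \<gamma>: "\<gamma> \<in> loops_at {m \<in> X. fX m \<notin> marked} a" for \<gamma>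
    proof -
      have "from_X \<circ> \<gamma> \<in> loops_at {w \<in> conic_surface. fst w \<in> twice_punctured} (from_X a)"
        using \<gamma> by (rule loops_at_image[OF _ continuous_on_subset[OF continuous_on_from_X]])
          (use from_X_in fX_unmarked in \<open>auto simp: yX_def\<close>)
      from conic_surface_retract[OF this]
      have h1: "homotopic_paths X (to_X \<circ> (from_X \<circ> \<gamma>)) (to_X \<circ> (conic_section c \<circ> (fst \<circ> (from_X \<circ> \<gamma>))))"
        unfolding c_def cX_def by (rule homotopic_paths_image[OF _ continuous_on_to_X to_X_in(1)])
      have h2: "conic_section c \<circ> (fst \<circ> (from_X \<circ> \<gamma>)) = S \<circ> (fX \<circ> \<gamma>)"
        by (simp add: S_def fun_eq_iff yX_def)
      have h3: "homotopic_paths X \<gamma> (to_X \<circ> (from_X \<circ> \<gamma>))"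
      proof (rule homotopic_paths_eq)
        fix t :: real assume "t \<in> {0..1}"
        then have "\<gamma> t \<in> X" using loops_atD(2)[OF \<gamma>] unfolding path_image_def by blast
        then show "\<gamma> t = (to_X \<circ> (from_X \<circ> \<gamma>)) t" by (simp add: to_X_from_X)
      next
        show "path_image \<gamma> \<subseteq> X" using loops_atD(2)[OF \<gamma>] by blast
      qed (rule loops_atD(1)[OF \<gamma>])
      show ?thesis using homotopic_paths_trans[OF h3 h1] unfolding h2 comp_assoc .
    qed
    show "\<exists>\<delta>\<in>loops_at (- marked) (fX a). homotopic_paths X p (to_X \<circ> S \<circ> \<delta>)" if p: "p \<in> loops_at X a" for p
    proof -
      have "from_X a = conic_section c (yX a)" using Sa by (simp add: S_def)
      then have "from_X \<circ> p \<in> loops_at conic_surface (conic_section c (yX a))"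
        using loops_at_image[OF p continuous_on_from_X to_X_in(2)] by simp
      from conic_surface_loop_lift[OF y0 this] obtain \<delta> where
        \<delta>: "\<delta> \<in> loops_at twice_punctured (yX a)" "homotopic_paths conic_surface (from_X \<circ> p) (conic_section c \<circ> \<delta>)"
        by blast
      have h1: "homotopic_paths X (to_X \<circ> (from_X \<circ> p)) (to_X \<circ> (conic_section c \<circ> \<delta>))"
        using \<delta>(2) by (rule homotopic_paths_image[OF _ continuous_on_to_X to_X_in(1)])
      have h2: "conic_section c \<circ> \<delta> = S \<circ> (P1_param \<circ> \<delta>)" by (simp add: S_def fun_eq_iff)
      have h3: "homotopic_paths X p (to_X \<circ> (from_X \<circ> p))"
      proof (rule homotopic_paths_eq)
        fix t :: real assume "t \<in> {0..1}"
        then have "p t \<in> X" using loops_atD(2)[OF p] unfolding path_image_def by blast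
        then show "p t = (to_X \<circ> (from_X \<circ> p)) t" by (simp add: to_X_from_X)
      qed (rule loops_atD(1,2)[OF p])+
      moreover have "P1_param \<circ> \<delta> \<in> loops_at (- marked) (fX a)"
        using \<delta>(1) continuous_on_P1_param by (rule loops_at_image) (simp_all only: fX_eq, rule image_subsetI, rule P1_param_unmarked)
      ultimately show ?thesis
        using homotopic_paths_trans[OF h3 h1] unfolding h2 comp_assoc by blast
    qed
    show "homotopic_paths X (to_X \<circ> S \<circ> \<delta>) (\<lambda>_. a) \<longleftrightarrow>
        path_class (- marked) \<delta> \<in> orbifold_kernel conic_orbifold (fX a)"
      if \<delta>: "\<delta> \<in> loops_at (- marked) (fX a)" for \<delta>
    proof
      assume "path_class (- marked) \<delta> \<in> orbifold_kernel conic_orbifold (fX a)"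
      then have "homotopic_paths conic_surface (S \<circ> \<delta>) (\<lambda>_. S (fX a))"
        unfolding S_def by (rule conic_orbifold_kernel_null[OF a(2) \<delta>])
      then have "homotopic_paths X (to_X \<circ> (S \<circ> \<delta>)) (to_X \<circ> (\<lambda>_. S (fX a)))"
        by (rule homotopic_paths_image[OF _ continuous_on_to_X to_X_in(1)])
      then show "homotopic_paths X (to_X \<circ> S \<circ> \<delta>) (\<lambda>_. a)"
        using Sa to_X_from_X[OF a(1)] by (simp add: comp_def)
    next
      assume "homotopic_paths X (to_X \<circ> S \<circ> \<delta>) (\<lambda>_. a)"
      then have "homotopic_paths conic_surface (from_X \<circ> (to_X \<circ> S \<circ> \<delta>)) (from_X \<circ> (\<lambda>_. a))"
        by (rule homotopic_paths_image[OF _ continuous_on_from_X to_X_in(2)])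
      moreover have "homotopic_paths conic_surface (S \<circ> \<delta>) (from_X \<circ> (to_X \<circ> S \<circ> \<delta>))"
      proof (rule homotopic_paths_eq)
        show "path (S \<circ> \<delta>)" "path_image (S \<circ> \<delta>) \<subseteq> conic_surface"
          using loops_at_image[OF \<delta> cS S refl] loops_atD by blast+
        fix t :: real assume "t \<in> {0..1}"
        then have "(S \<circ> \<delta>) t \<in> path_image (S \<circ> \<delta>)" by (simp add: path_image_def)
        then show "(S \<circ> \<delta>) t = (from_X \<circ> (to_X \<circ> S \<circ> \<delta>)) t"
          using loops_at_image[OF \<delta> cS S refl] loops_atD(2) by (fastforce simp: from_X_to_X)
      qed
      ultimately have "homotopic_paths conic_surface (S \<circ> \<delta>) (\<lambda>_. S (fX a))"
        unfolding Sa comp_def by (metis homotopic_paths_trans)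
      then show "path_class (- marked) \<delta> \<in> orbifold_kernel conic_orbifold (fX a)"
        unfolding S_def by (rule conic_orbifold_null_kernel[OF a(2) \<delta>])
    qed
  qed (use a in auto)
qed

end

section \<open>Multihomogeneous forms\<close>

abbreviation coordinate_funs :: "(('i \<Rightarrow> complex ^ 'n::finite) \<Rightarrow> complex) set" where
  "coordinate_funs \<equiv> {\<lambda>w. w i $ k | i k. True}"

lemma poly_funs_sum: "(\<And>k. k \<in> A \<Longrightarrow> P k \<in> poly_funs G) \<Longrightarrow> (\<lambda>w. \<Sum>k\<in>A. P k w) \<in> poly_funs G"
  by (induction A rule: infinite_finite_induct) (auto intro: poly_funs.intros)

lemma multiformsI:
  "P \<in> poly_funs coordinate_funs \<Longrightarrow> (\<And>w i c. P (w(i := c *s w i)) = c ^ d i * P w) \<Longrightarrow> P \<in> multiforms d"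
  by (simp add: multiforms_def)

lemma multiforms_const: "(\<lambda>_. c) \<in> multiforms (\<lambda>_. 0)"
  by (rule multiformsI) (auto intro: poly_funs.const)

lemma multiforms_linear: "(\<lambda>w. dot a (w i)) \<in> multiforms (\<lambda>j. if j = i then 1 else 0)"
proof (rule multiformsI)
  show "(\<lambda>w. dot a (w i)) \<in> poly_funs coordinate_funs"
    unfolding dot_def by (intro poly_funs_sum poly_funs.mult poly_funs.const poly_funs.gen) blast
qed simp

lemma multiforms_mult:
  assumes "P \<in> multiforms d" "Q \<in> multiforms e"
  shows "(\<lambda>w. P w * Q w) \<in> multiforms (\<lambda>i. d i + e i)"
  using assms by (auto simp: multiforms_def power_add intro: poly_funs.mult)

lemma multiforms_diff:
  assumes "P \<in> multiforms d" "Q \<in> multiforms d"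
  shows "(\<lambda>w. P w - Q w) \<in> multiforms d"
proof (rule multiformsI)
  have "(\<lambda>w. P w + (\<lambda>_. -1) w * Q w) \<in> poly_funs coordinate_funs"
    using assms unfolding multiforms_def by (intro poly_funs.add poly_funs.mult poly_funs.const) auto
  then show "(\<lambda>w. P w - Q w) \<in> poly_funs coordinate_funs" by simp
qed (use assms in \<open>auto simp: multiforms_def algebra_simps\<close>)

text \<open>Kept as a list of pairs so that the multidegree can be counted and products of equal
  multidegree are recognized by their second components.\<close>

definition linear_product :: "((complex ^ 'n::finite) \<times> 'i) list \<Rightarrow> ('i \<Rightarrow> complex ^ 'n) \<Rightarrow> complex" where
  "linear_product l w = (\<Prod>(a, i)\<leftarrow>l. dot a (w i))"

lemma linear_product_multiform: "linear_product l \<in> multiforms (count_list (map snd l))"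
proof (induction l)
  case Nil
  then show ?case using multiforms_const[of 1] by (simp add: linear_product_def[abs_def])
next
  case (Cons x l)
  obtain a i where x: "x = (a, i)" by (cases x)
  have "(\<lambda>w. dot a (w i) * linear_product l w) \<in>
      multiforms (\<lambda>j. (if j = i then 1 else 0) + count_list (map snd l) j)"
    using multiforms_linear Cons by (rule multiforms_mult)
  moreover have "(\<lambda>j. (if j = i then 1 else 0) + count_list (map snd l) j) = count_list (map snd (x # l))"
    by (auto simp: x)
  moreover have "linear_product (x # l) = (\<lambda>w. dot a (w i) * linear_product l w)"
    by (auto simp: linear_product_def x)
  ultimately show ?case by (simp only:)
qed

lemma linear_product_simps [simp]:
  "linear_product [] w = 1" "linear_product ((a, i) # l) w = dot a (w i) * linear_product l w"
  by (simp_all add: linear_product_def)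

lemma hom_coords_exist: "\<exists>w. hom_coords w m"
proof -
  have "\<forall>i. \<exists>v. v \<noteq> 0 \<and> proj_pt v = m i" by (metis proj_pt_cases)
  then show ?thesis unfolding hom_coords_def by metis
qed

lemma hom_coordsD:
  assumes "hom_coords w m"
  shows "m i \<in> nonvan a \<longleftrightarrow> dot a (w i) \<noteq> 0" "ratio a b (m i) = dot a (w i) / dot b (w i)"
  using assms nonvan_proj_pt[of "w i"] ratio_proj_pt[of "w i"] by (auto simp: hom_coords_def)

lemma zariski_open_nonvan: "zariski_open X {m \<in> X. \<forall>(a, i)\<in>set l. m i \<in> nonvan a}"
proof -
  have iff: "linear_product l w \<noteq> 0 \<longleftrightarrow> (\<forall>(a, i)\<in>set l. m i \<in> nonvan a)" if "hom_coords w m" for w m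
    by (induction l) (auto simp: hom_coordsD[OF that])
  show ?thesis
    unfolding zariski_open_def
  proof (intro conjI ballI)
    fix m assume m: "m \<in> {m \<in> X. \<forall>(a, i)\<in>set l. m i \<in> nonvan a}"
    obtain w where "hom_coords w m" using hom_coords_exist by blast
    with m show "\<exists>d. \<exists>P\<in>multiforms d. (\<exists>w. hom_coords w m \<and> P w \<noteq> 0) \<and>
        {m' \<in> X. \<exists>w. hom_coords w m' \<and> P w \<noteq> 0} \<subseteq> {m \<in> X. \<forall>(a, i)\<in>set l. m i \<in> nonvan a}"
      using linear_product_multiform[of l] iff by blast
  qed blast
qed

lemma zariski_open_self: "zariski_open U U"
  using zariski_open_nonvan[of U "[]"] by simp

lemma regular_functionI:
  assumes "A \<in> multiforms d" "B \<in> multiforms d"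
    and "\<And>m w. m \<in> U \<Longrightarrow> hom_coords w m \<Longrightarrow> B w \<noteq> 0 \<and> h m = A w / B w"
  shows "regular_function U h"
  unfolding regular_function_def using assms zariski_open_self by metis

lemma poly_funs_poly:
  assumes "P \<in> poly_funs G" "\<And>g. g \<in> G \<Longrightarrow> \<exists>q. \<forall>t. g (c t) = poly q t"
  shows "\<exists>q. \<forall>t::complex. P (c t) = poly q t"
  using assms(1)
proof induction
  case (const k)
  then show ?case by (intro exI[of _ "[:k:]"]) simp
next
  case (add P Q)
  then show ?case by (metis poly_add)
next
  case (mult P Q)
  then show ?case by (metis poly_mult)
qed (use assms(2) in auto)

subsection \<open>Polynomial curves\<close>

text \<open>Along such a curve regular functions become rational functions of one variable, whose
  orders at 0 can be compared.\<close>

definition poly_curve :: "(complex \<Rightarrow> 'i \<Rightarrow> complex ^ 'n) \<Rightarrow> bool" where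
  "poly_curve W \<longleftrightarrow> (\<forall>i k. \<exists>q. \<forall>t. W t i $ k = poly q t)"

lemma poly_curve_multiform:
  assumes "poly_curve W" "P \<in> multiforms d"
  shows "\<exists>q. \<forall>t. P (W t) = poly q t"
proof (rule poly_funs_poly[where P = P and c = W and G = coordinate_funs])
  show "P \<in> poly_funs coordinate_funs" using assms(2) by (simp add: multiforms_def)
qed (use assms(1) in \<open>auto simp: poly_curve_def\<close>)

lemma poly_nonzero_near: "poly q a \<noteq> 0 \<Longrightarrow> \<forall>\<^sub>F t in nhds a. poly q t \<noteq> (0 :: complex)"
  using eventually_nhds_in_open[of "{t. poly q t \<noteq> 0}" a] by (simp add: open_Collect_neq continuous_intros)

text \<open>A Zariski open set comes with a form that is non-zero at some coordinates of the
  starting point; the curve is rescaled to start at these.\<close>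

lemma hom_coords_rescale:
  assumes W: "poly_curve W" and hc: "\<forall>\<^sub>F t in nhds 0. hom_coords (W t) (m t)" and w0: "hom_coords w0 (m 0)"
  shows "\<exists>W'. poly_curve W' \<and> W' 0 = w0 \<and> (\<forall>\<^sub>F t in nhds 0. hom_coords (W' t) (m t))"
proof -
  have W0: "hom_coords (W 0) (m 0)" using hc by (rule eventually_nhds_x_imp_x)
  have "\<exists>c. c \<noteq> 0 \<and> w0 i = c *s W 0 i" for i
    using W0 w0 proj_pt_eq_iff[of "W 0 i" "w0 i"] by (auto simp: hom_coords_def)
  then obtain c where c: "\<And>i. c i \<noteq> 0" "\<And>i. w0 i = c i *s W 0 i" by metis
  let ?W = "\<lambda>t i. c i *s W t i"
  have "\<exists>q. \<forall>t. ?W t i $ k = poly q t" for i k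
    using W unfolding poly_curve_def vector_smult_component by (metis poly_smult)
  then have "poly_curve ?W" by (simp add: poly_curve_def)
  moreover have "\<forall>\<^sub>F t in nhds 0. hom_coords (?W t) (m t)"
    using hc by eventually_elim (use c(1) in \<open>auto simp: hom_coords_def proj_pt_scale\<close>)
  moreover have "?W 0 = w0" using c(2) by auto
  ultimately show ?thesis by (intro exI[of _ ?W]) auto
qed

lemma zariski_open_near:
  assumes W: "poly_curve W" and hc: "\<forall>\<^sub>F t in nhds 0. hom_coords (W t) (m t)"
    and X: "\<forall>\<^sub>F t in nhds 0. m t \<in> X" and U: "zariski_open X U" "m 0 \<in> U"
  shows "\<forall>\<^sub>F t in nhds 0. m t \<in> U"
proof -
  from U obtain d P w0 where P: "P \<in> multiforms d" "hom_coords w0 (m 0)" "P w0 \<noteq> 0"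
    "{m' \<in> X. \<exists>w. hom_coords w m' \<and> P w \<noteq> 0} \<subseteq> U"
    unfolding zariski_open_def by blast
  obtain W' where W': "poly_curve W'" "W' 0 = w0" "\<forall>\<^sub>F t in nhds 0. hom_coords (W' t) (m t)"
    using hom_coords_rescale[OF W hc P(2)] by blast
  obtain q where q: "\<And>t. P (W' t) = poly q t" using poly_curve_multiform[OF W'(1) P(1)] by blast
  have "poly q 0 \<noteq> 0" using q[of 0] W'(2) P(3) by simp
  then have "\<forall>\<^sub>F t in nhds 0. poly q t \<noteq> 0" by (rule poly_nonzero_near)
  then show ?thesis using W'(3) X
    by eventually_elim (use P(4) q in \<open>fastforce simp: subset_iff\<close>)
qed

lemma regular_function_near:
  assumes W: "poly_curve W" and hc: "\<forall>\<^sub>F t in nhds 0. hom_coords (W t) (m t)"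
    and U: "\<forall>\<^sub>F t in nhds 0. m t \<in> U" and h: "regular_function U h"
  shows "\<exists>a b. poly b 0 \<noteq> 0 \<and> (\<forall>\<^sub>F t in nhds 0. poly b t \<noteq> 0 \<and> h (m t) = poly a t / poly b t)"
proof -
  have m0: "m 0 \<in> U" using U by (rule eventually_nhds_x_imp_x)
  from h m0 obtain V d A B where V: "zariski_open U V" "m 0 \<in> V" "A \<in> multiforms d" "B \<in> multiforms d"
    "\<And>m' w. m' \<in> V \<Longrightarrow> hom_coords w m' \<Longrightarrow> B w \<noteq> 0 \<and> h m' = A w / B w"
    unfolding regular_function_def by metis
  obtain a b where ab: "\<And>t. A (W t) = poly a t" "\<And>t. B (W t) = poly b t"
    using poly_curve_multiform[OF W V(3)] poly_curve_multiform[OF W V(4)] by blast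
  have "\<forall>\<^sub>F t in nhds 0. poly b t \<noteq> 0 \<and> h (m t) = poly a t / poly b t"
    using zariski_open_near[OF W hc U V(1,2)] hc
    by eventually_elim (use V(5) ab in fastforce)
  moreover from this have "poly b 0 \<noteq> 0" by (blast dest: eventually_nhds_x_imp_x)
  ultimately show ?thesis by blast
qed

lemma vanishing_regular_function_near:
  assumes "poly_curve W" "\<forall>\<^sub>F t in nhds 0. hom_coords (W t) (m t)"
    "\<forall>\<^sub>F t in nhds 0. m t \<in> U" "regular_function U h" "h (m 0) = 0"
  shows "\<exists>a b. poly b 0 \<noteq> 0 \<and> (\<forall>\<^sub>F t in nhds 0. poly b t \<noteq> 0 \<and> h (m t) = t * (poly a t / poly b t))"
proof -
  obtain a b where ab: "poly b 0 \<noteq> 0" "\<forall>\<^sub>F t in nhds 0. poly b t \<noteq> 0 \<and> h (m t) = poly a t / poly b t"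
    using regular_function_near[OF assms(1-4)] by blast
  from ab(2) have "h (m 0) = poly a 0 / poly b 0" by (blast dest: eventually_nhds_x_imp_x)
  then have "poly a 0 = 0" using assms(5) ab(1) by simp
  then have "[:0, 1:] dvd a" using poly_eq_0_iff_dvd[of a 0] by simp
  then obtain a' where "a = [:0, 1:] * a'" by blast
  then have "poly a t = t * poly a' t" for t by simp
  then show ?thesis using ab by (intro exI[of _ a'] exI[of _ b]) (simp add: mult.assoc[symmetric])
qed

text \<open>A curve along which the pullback of a coordinate at \<open>y\<close> vanishes exactly to order two
  bounds the multiplicity of the components through its starting point.\<close>

lemma multiplicity_le_2:
  fixes f :: "('i \<Rightarrow> ('n::finite) proj) \<Rightarrow> 2 proj" and k :: nat
  assumes W: "poly_curve W" and hc: "\<forall>\<^sub>F t in nhds 0. hom_coords (W t) (m t)"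
    and X: "\<forall>\<^sub>F t in nhds 0. m t \<in> X"
    and f: "\<forall>\<^sub>F t in nhds 0. v t \<noteq> 0 \<and> f (m t) = proj_pt (v t) \<and> dot \<alpha> (v t) = s * t\<^sup>2 \<and> dot \<beta> (v t) = 1 - s * t\<^sup>2"
    and s: "s \<noteq> 0"
    and \<alpha>\<beta>: "\<And>v. dot \<alpha> v = 0 \<Longrightarrow> dot \<beta> v = 0 \<Longrightarrow> v = 0"
    and U: "zariski_open X U" "m 0 \<in> U"
    and uw: "u \<noteq> 0" "w \<noteq> 0" "dot \<alpha> u = 0" "dot \<alpha> w \<noteq> 0" "\<And>m. m \<in> U \<Longrightarrow> f m = proj_pt (u + g m *s w)"
    and e: "regular_function U e"
    and h: "\<And>j. j < k \<Longrightarrow> regular_function U (h j) \<and> h j (m 0) = 0"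
    and g: "\<And>m. m \<in> U \<Longrightarrow> g m = e m * (\<Prod>j<k. h j m)"
  shows "k \<le> 2"
proof (rule ccontr)
  assume k: "\<not> k \<le> 2"
  have mU: "\<forall>\<^sub>F t in nhds 0. m t \<in> U" by (rule zariski_open_near[OF W hc X U])
  obtain a b where ab: "poly b 0 \<noteq> 0" "\<forall>\<^sub>F t in nhds 0. poly b t \<noteq> 0 \<and> e (m t) = poly a t / poly b t"
    using regular_function_near[OF W hc mU e] by blast
  have "\<forall>j\<in>{..<k}. \<exists>a b. poly b 0 \<noteq> 0 \<and> (\<forall>\<^sub>F t in nhds 0. poly b t \<noteq> 0 \<and> h j (m t) = t * (poly a t / poly b t))"
    using vanishing_regular_function_near[OF W hc mU] h by blast
  from bchoice[OF this] obtain A where A: "\<forall>j\<in>{..<k}. \<exists>b. poly b 0 \<noteq> 0 \<and>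
      (\<forall>\<^sub>F t in nhds 0. poly b t \<noteq> 0 \<and> h j (m t) = t * (poly (A j) t / poly b t))"
    by blast
  from bchoice[OF this] obtain B where AB: "\<And>j. j < k \<Longrightarrow> poly (B j) 0 \<noteq> 0"
    "\<And>j. j < k \<Longrightarrow> \<forall>\<^sub>F t in nhds 0. poly (B j) t \<noteq> 0 \<and> h j (m t) = t * (poly (A j) t / poly (B j) t)"
    by blast
  \<comment> \<open>After a factor \<open>t\<close> is split off from each \<open>h j\<close>, what
    remains of \<open>g\<close> is \<open>t ^ k\<close> times \<open>G\<close>, which is continuous
    at 0.\<close>
  define G where "G = (\<lambda>t. poly a t / poly b t * (\<Prod>j<k. poly (A j) t / poly (B j) t))"
  have "\<forall>\<^sub>F t in nhds 0. \<forall>j\<in>{..<k}. h j (m t) = t * (poly (A j) t / poly (B j) t)"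
  proof (intro eventually_ball_finite ballI)
    fix j assume "j \<in> {..<k}"
    then have "j < k" by simp
    from AB(2)[OF this] show "\<forall>\<^sub>F t in nhds 0. h j (m t) = t * (poly (A j) t / poly (B j) t)"
      by (rule eventually_mono) blast
  qed simp
  with ab(2) mU have gG: "\<forall>\<^sub>F t in nhds 0. g (m t) = t ^ k * G t"
  proof eventually_elim
    case (elim t)
    have "(\<Prod>j<k. h j (m t)) = (\<Prod>j<k. t * (poly (A j) t / poly (B j) t))"
      by (intro prod.cong refl) (use elim in blast)
    then have "(\<Prod>j<k. h j (m t)) = t ^ k * (\<Prod>j<k. poly (A j) t / poly (B j) t)"
      by (simp only: prod.distrib prod_constant card_lessThan)
    then show ?case using elim by (simp add: g G_def)
  qed
  have G: "(G \<longlongrightarrow> G 0) (at 0)"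
  proof -
    have "isCont G 0" unfolding G_def using ab(1) AB(1) by (intro continuous_intros) auto
    then show ?thesis by (simp add: isCont_def)
  qed
  have "dot \<beta> u \<noteq> 0" using \<alpha>\<beta> uw by blast
  \<comment> \<open>The two descriptions of \<open>f\<close> along the curve are proportional
    vectors. Eliminating the factor of proportionality and dividing by \<open>t\<^sup>2\<close>
    leaves a non-zero constant on the right, while for \<open>k > 2\<close> the left side tends to
    0.\<close>
  have key: "\<forall>\<^sub>F t in at 0. t ^ (k - 2) * G t * (dot \<alpha> w - s * t\<^sup>2 * (dot \<alpha> w + dot \<beta> w)) = s * dot \<beta> u"
  proof -
    have "\<forall>\<^sub>F t in at 0. t \<noteq> 0 \<and> m t \<in> U \<and> g (m t) = t ^ k * G t \<and>
        (v t \<noteq> 0 \<and> f (m t) = proj_pt (v t) \<and> dot \<alpha> (v t) = s * t\<^sup>2 \<and> dot \<beta> (v t) = 1 - s * t\<^sup>2)"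
      by (intro eventually_conj eventually_neq_at_within filter_leD[OF at_within_le_nhds gG]
          filter_leD[OF at_within_le_nhds mU] filter_leD[OF at_within_le_nhds f])
    then show ?thesis
    proof eventually_elim
      case (elim t)
      have nz: "u + g (m t) *s w \<noteq> 0"
      proof
        assume 0: "u + g (m t) *s w = 0"
        then have "dot \<alpha> (u + g (m t) *s w) = 0" by simp
        then have "g (m t) = 0" using uw(3,4) by simp
        then show False using 0 uw(1) by simp
      qed
      have "proj_pt (v t) = proj_pt (u + g (m t) *s w)" using elim uw(5) by metis
      then obtain c where c: "u + g (m t) *s w = c *s v t" using proj_pt_eq_iff[OF _ nz] elim by blast
      have "g (m t) * dot \<alpha> w = c * (s * t\<^sup>2)" "dot \<beta> u + g (m t) * dot \<beta> w = c * (1 - s * t\<^sup>2)"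
        using arg_cong[OF c, of "dot \<alpha>"] arg_cong[OF c, of "dot \<beta>"] elim uw(3) by simp_all
      then have "g (m t) * dot \<alpha> w * (1 - s * t\<^sup>2) = (dot \<beta> u + g (m t) * dot \<beta> w) * (s * t\<^sup>2)"
        by (simp add: mult_ac)
      then have "g (m t) * (dot \<alpha> w - s * t\<^sup>2 * (dot \<alpha> w + dot \<beta> w)) = t\<^sup>2 * (s * dot \<beta> u)"
        by (simp add: algebra_simps)
      moreover have "t ^ k = t\<^sup>2 * t ^ (k - 2)"
      proof -
        have "k = 2 + (k - 2)" using k by simp
        then show ?thesis by (metis power_add)
      qed
      ultimately have "t\<^sup>2 * (t ^ (k - 2) * G t * (dot \<alpha> w - s * t\<^sup>2 * (dot \<alpha> w + dot \<beta> w))) = t\<^sup>2 * (s * dot \<beta> u)"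
        using elim by (simp only: mult.assoc)
      then show ?case using elim by simp
    qed
  qed
  have "((\<lambda>t. t ^ (k - 2) * G t * (dot \<alpha> w - s * t\<^sup>2 * (dot \<alpha> w + dot \<beta> w))) \<longlongrightarrow>
      0 ^ (k - 2) * G 0 * (dot \<alpha> w - s * 0\<^sup>2 * (dot \<alpha> w + dot \<beta> w))) (at 0)"
    by (intro tendsto_intros G)
  moreover have "((\<lambda>t. t ^ (k - 2) * G t * (dot \<alpha> w - s * t\<^sup>2 * (dot \<alpha> w + dot \<beta> w))) \<longlongrightarrow> s * dot \<beta> u) (at 0)"
    using key by (rule tendsto_eventually)
  ultimately have "0 ^ (k - 2) * G 0 * (dot \<alpha> w - s * 0\<^sup>2 * (dot \<alpha> w + dot \<beta> w)) = s * dot \<beta> u"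
    by (intro tendsto_unique[of "at (0::complex)"]) auto
  moreover have "(0 :: complex) ^ (k - 2) = 0" using k by (intro zero_power) simp
  ultimately show False using s \<open>dot \<beta> u \<noteq> 0\<close> by simp
qed

definition poly_fun :: "(complex \<Rightarrow> complex) \<Rightarrow> bool" where
  "poly_fun f \<longleftrightarrow> (\<exists>q. \<forall>t. f t = poly q t)"

lemma poly_fun_const: "poly_fun (\<lambda>_. c)"
  unfolding poly_fun_def by (rule exI[of _ "[:c:]"]) simp

lemma poly_fun_id: "poly_fun (\<lambda>t. t)"
  unfolding poly_fun_def by (rule exI[of _ "[:0, 1:]"]) simp

lemma poly_fun_add: "poly_fun f \<Longrightarrow> poly_fun g \<Longrightarrow> poly_fun (\<lambda>t. f t + g t)"
  unfolding poly_fun_def by (metis poly_add)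

lemma poly_fun_mult: "poly_fun f \<Longrightarrow> poly_fun g \<Longrightarrow> poly_fun (\<lambda>t. f t * g t)"
  unfolding poly_fun_def by (metis poly_mult)

lemma poly_fun_diff: "poly_fun f \<Longrightarrow> poly_fun g \<Longrightarrow> poly_fun (\<lambda>t. f t - g t)"
  unfolding poly_fun_def by (metis poly_diff)

lemma poly_fun_minus: "poly_fun f \<Longrightarrow> poly_fun (\<lambda>t. - f t)"
  unfolding poly_fun_def by (metis poly_minus)

lemma poly_fun_divide: "poly_fun f \<Longrightarrow> poly_fun (\<lambda>t. f t / c)"
  using poly_fun_mult[OF _ poly_fun_const[of "1 / c"]] by simp

lemmas poly_fun_intros = poly_fun_const poly_fun_id poly_fun_add poly_fun_mult poly_fun_diff poly_fun_minus
  poly_fun_divide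

lemma poly_curve_iff: "poly_curve W \<longleftrightarrow> (\<forall>i k. poly_fun (\<lambda>t. W t i $ k))"
  by (simp add: poly_curve_def poly_fun_def)

text \<open>A greatest order exists only if the orders are bounded: the factorization
  \<open>g = e * c\<^sup>2\<close> attains 2, and the curve excludes more.\<close>

lemma component_multiplicity_eq_2:
  fixes f :: "('i \<Rightarrow> ('n::finite) proj) \<Rightarrow> 2 proj"
  assumes C: "C \<noteq> {}"
    and y: "\<And>v. v \<noteq> 0 \<Longrightarrow> proj_pt v = y \<longleftrightarrow> dot \<alpha> v = 0"
    and \<alpha>\<beta>: "\<And>v. dot \<alpha> v = 0 \<Longrightarrow> dot \<beta> v = 0 \<Longrightarrow> v = 0"
    and U: "zariski_open X U" "C \<subseteq> U" "u \<noteq> 0" "w \<noteq> 0" "proj_pt u = y" "proj_pt w \<noteq> y"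
      "\<And>m. m \<in> U \<Longrightarrow> f m = proj_pt (u + g m *s w)"
      "regular_function U e" "regular_function U c" "\<And>m. m \<in> C \<Longrightarrow> c m = 0" "\<And>m. m \<in> U \<Longrightarrow> g m = e m * (c m)\<^sup>2"
    and curve: "\<And>m0. m0 \<in> C \<Longrightarrow> \<exists>W m v s. poly_curve W \<and> m 0 = m0 \<and> (\<forall>\<^sub>F t in nhds 0. hom_coords (W t) (m t)) \<and>
      (\<forall>\<^sub>F t in nhds 0. m t \<in> X) \<and> s \<noteq> 0 \<and>
      (\<forall>\<^sub>F t in nhds 0. v t \<noteq> 0 \<and> f (m t) = proj_pt (v t) \<and> dot \<alpha> (v t) = s * t\<^sup>2 \<and> dot \<beta> (v t) = 1 - s * t\<^sup>2)"
  shows "component_multiplicity X f y C = 2"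
  unfolding component_multiplicity_def
proof (rule Greatest_equality)
  have "(\<Prod>j<2::nat. c m) = (c m)\<^sup>2" for m by simp
  then show "\<exists>U u w g e h. zariski_open X U \<and> U \<inter> C \<noteq> {} \<and> u \<noteq> 0 \<and> w \<noteq> 0 \<and> proj_pt u = y \<and> proj_pt w \<noteq> y \<and>
     (\<forall>m\<in>U. f m = proj_pt (u + g m *s w)) \<and> regular_function U e \<and>
     (\<forall>j<2::nat. regular_function U (h j) \<and> (\<forall>m\<in>U \<inter> C. h j m = 0)) \<and>
     (\<forall>m\<in>U. g m = e m * (\<Prod>j<2::nat. h j m))"
    using U C
    by (intro exI[of _ U] exI[of _ u] exI[of _ w] exI[of _ g] exI[of _ e] exI[of _ "\<lambda>_. c"]) auto
next
  fix k :: nat assume "\<exists>U u w g e h. zariski_open X U \<and> U \<inter> C \<noteq> {} \<and> u \<noteq> 0 \<and> w \<noteq> 0 \<and> proj_pt u = y \<and> proj_pt w \<noteq> y \<and>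
     (\<forall>m\<in>U. f m = proj_pt (u + g m *s w)) \<and> regular_function U e \<and>
     (\<forall>j<k. regular_function U (h j) \<and> (\<forall>m\<in>U \<inter> C. h j m = 0)) \<and>
     (\<forall>m\<in>U. g m = e m * (\<Prod>j<k. h j m))"
  then obtain U u w g e h where *: "zariski_open X U" "U \<inter> C \<noteq> {}" "u \<noteq> 0" "w \<noteq> 0" "proj_pt u = y" "proj_pt w \<noteq> y"
     "\<And>m. m \<in> U \<Longrightarrow> f m = proj_pt (u + g m *s w)" "regular_function U e"
     "\<And>j. j < k \<Longrightarrow> regular_function U (h j) \<and> (\<forall>m\<in>U \<inter> C. h j m = 0)"
     "\<And>m. m \<in> U \<Longrightarrow> g m = e m * (\<Prod>j<k. h j m)"
    by blast
  then obtain m0 where m0: "m0 \<in> U" "m0 \<in> C" by blast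
  obtain W m v s where c: "poly_curve W" "m 0 = m0" "\<forall>\<^sub>F t in nhds 0. hom_coords (W t) (m t)"
    "\<forall>\<^sub>F t in nhds 0. m t \<in> X" "s \<noteq> 0"
    "\<forall>\<^sub>F t in nhds 0. v t \<noteq> 0 \<and> f (m t) = proj_pt (v t) \<and> dot \<alpha> (v t) = s * t\<^sup>2 \<and> dot \<beta> (v t) = 1 - s * t\<^sup>2"
    using curve[OF m0(2)] by blast
  show "k \<le> 2"
  proof (rule multiplicity_le_2[OF c(1,3,4,6,5) \<alpha>\<beta> *(1) _ *(3,4) _ _ *(7,8) _ *(10)])
    show "m 0 \<in> U" "dot \<alpha> u = 0" "dot \<alpha> w \<noteq> 0" using c(2) m0 * y by simp_all
    show "regular_function U (h j) \<and> h j (m 0) = 0" if "j < k" for j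
      using *(9)[OF that] c(2) m0 by simp
  qed
qed

lemma P1_pt_normalize:
  assumes "A + B = s" "s \<noteq> 0" "\<sigma> = A / s"
  shows "(A \<noteq> 0 \<or> B \<noteq> 0) \<and> P1_pt \<sigma> (1 - \<sigma>) = P1_pt A B"
proof -
  have "A \<noteq> 0 \<or> B \<noteq> 0" using assms by auto
  moreover have "\<sigma> = 1 / s * A" "1 - \<sigma> = 1 / s * B" using assms by (auto simp: field_simps)
  then have "vector [\<sigma>, 1 - \<sigma>] = (1 / s) *s (vector [A, B] :: complex ^ 2)"
    by (simp add: vec_eq_iff forall_2)
  ultimately show ?thesis using assms(2) by (auto simp: proj_pt_scale)
qed

lemma constant_poly_nonzero:
  assumes "\<And>t. poly q t \<noteq> (0 :: complex)"
  shows "poly q t = poly q t'"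
proof (cases "degree q = 0")
  case False
  then have "coeff q 0 = 0 \<or> (\<exists>i\<in>{1..degree q}. coeff q i \<noteq> 0)"
    by (intro disjI2 bexI[of _ "degree q"]) auto
  then obtain z where "(\<Sum>i\<le>degree q. coeff q i * z ^ i) = 0"
    by (rule fundamental_theorem_of_algebra)
  then have "poly q z = 0" by (simp add: poly_altdef)
  then show ?thesis using assms by simp
qed (auto elim!: degree_eq_zeroE)

section \<open>The map is an orbifold morphism\<close>

context quadrilateral_frame
begin

lemma chart_coords:
  assumes "hom_coords w m"
  shows "y32 m = - (dot e3 (w (Some q1)) / dot e2 (w (Some q1)))" "y12 m = - (dot e1 (w (Some q5)) / dot e2 (w (Some q5)))"
    "y31 m = - (dot e3 (w (Some q4)) / dot e1 (w (Some q4)))" "y21 m = - (dot e2 (w (Some q5)) / dot e1 (w (Some q5)))"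
    "m \<in> chartB \<longleftrightarrow> dot e2 (w (Some q1)) \<noteq> 0 \<and> dot e2 (w (Some q5)) \<noteq> 0"
    "m \<in> chartA \<longleftrightarrow> dot e1 (w (Some q4)) \<noteq> 0 \<and> dot e1 (w (Some q5)) \<noteq> 0"
    "m \<in> chart2 \<longleftrightarrow> dot e2 (w (Some q2)) \<noteq> 0 \<and> dot e1 (w (Some q4)) \<noteq> 0 \<and> dot e2 (w (Some q5)) \<noteq> 0"
    "m \<in> chart3 \<longleftrightarrow> dot e1 (w (Some q3)) \<noteq> 0 \<and> dot e2 (w (Some q1)) \<noteq> 0 \<and> dot e1 (w (Some q5)) \<noteq> 0"
  by (simp_all add: y32_def y12_def y31_def y21_def chartA_def chartB_def chart2_def chart3_def hom_coordsD[OF assms])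

lemma chartB_forms:
  assumes m: "m \<in> X" "m \<in> chartB" and w: "hom_coords w m"
  defines "a \<equiv> dot e2 (w (Some q1))" and "b \<equiv> dot e3 (w (Some q1))"
    and "c \<equiv> dot e1 (w (Some q5))" and "d \<equiv> dot e2 (w (Some q5))"
  shows "a \<noteq> 0" "d \<noteq> 0" "c + d \<noteq> 0" "\<sigma>X m = (a * c - b * d) / (a * (c + d))" "cX m = - (b * d) / (a * (c + d))"
    "1 - y12 m = (c + d) / d"
proof -
  note X = X_chartB[OF m] and C = chart_coords[OF w, folded a_def b_def c_def d_def]
  show ad: "a \<noteq> 0" "d \<noteq> 0" using m(2) C(5) by auto
  show 1: "1 - y12 m = (c + d) / d" using ad by (simp add: C(2) field_simps)
  then show cd: "c + d \<noteq> 0" using X(1) by auto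
  show "cX m = - (b * d) / (a * (c + d))" using X(2) ad cd by (simp add: 1 C(1) field_simps)
  have "y32 m - y12 m = (a * c - b * d) / (a * d)" using ad by (simp add: C(1,2) field_simps)
  then show "\<sigma>X m = (a * c - b * d) / (a * (c + d))" using X(3) ad cd by (simp add: 1)
qed

lemma chartA_forms:
  assumes m: "m \<in> X" "m \<in> chartA" and w: "hom_coords w m"
  defines "a \<equiv> dot e1 (w (Some q4))" and "b \<equiv> dot e3 (w (Some q4))"
    and "c \<equiv> dot e1 (w (Some q5))" and "d \<equiv> dot e2 (w (Some q5))"
  shows "a \<noteq> 0" "c \<noteq> 0" "c + d \<noteq> 0" "\<sigma>X m = (a + b) * c / (a * (c + d))" "cX m = b * c / (a * (c + d))"
    "y21 m - 1 = - (c + d) / c"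
proof -
  note X = X_chartA[OF m] and C = chart_coords[OF w, folded a_def b_def c_def d_def]
  show ad: "a \<noteq> 0" "c \<noteq> 0" using m(2) C(6) by auto
  show 1: "y21 m - 1 = - (c + d) / c" using ad by (simp add: C(4) field_simps)
  show cd: "c + d \<noteq> 0"
  proof
    assume "c + d = 0"
    then have "y21 m - 1 = 0" using 1 by (simp only:) simp
    then show False using X(1) by simp
  qed
  have "- (b / a) / (- D / c) = b * c / (a * D)" if "D \<noteq> 0" for D using ad that by (simp add: field_simps)
  from this[OF cd] have "y31 m / (- (c + d) / c) = b * c / (a * (c + d))" unfolding C(3) .
  then show "cX m = b * c / (a * (c + d))" using X(2) by (simp add: 1)
  have "y31 m - 1 = - (a + b) / a" using ad by (simp add: C(3) field_simps)
  moreover have "(- A / a) / (- D / c) = A * c / (a * D)" if "D \<noteq> 0" for A D using ad that by (simp add: field_simps)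
  note this[OF cd, of "a + b"]
  ultimately show "\<sigma>X m = (a + b) * c / (a * (c + d))" using X(3) by (simp add: 1)
qed

lemma fX_morphism: "morphism_to_P1 X fX"
  unfolding morphism_to_P1_def
proof
  fix m assume m: "m \<in> X"
  from X_in_charts[OF m] show "\<exists>V d A B. zariski_open X V \<and> m \<in> V \<and> A \<in> multiforms d \<and> B \<in> multiforms d \<and>
      (\<forall>m'\<in>V. \<forall>w. hom_coords w m' \<longrightarrow> (A w \<noteq> 0 \<or> B w \<noteq> 0) \<and> fX m' = P1_pt (A w) (B w))"
  proof
    assume mB: "m \<in> chartB"
    \<comment> \<open>Numerators of \<open>\<sigma>X\<close> and \<open>1 - \<sigma>X\<close> over
      the common denominator found in \<open>chartB_forms\<close>.\<close>
    let ?A = "\<lambda>w. linear_product [(e2, Some q1), (e1, Some q5)] w - linear_product [(e3, Some q1), (e2, Some q5)] w"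
    let ?B = "linear_product [(e2 + e3, Some q1), (e2, Some q5)]"
    have "zariski_open X (X \<inter> chartB)"
      using zariski_open_nonvan[of X "[(e2, Some q1), (e2, Some q5)]"] by (simp add: chartB_def Int_def)
    moreover have "?A \<in> multiforms (count_list [Some q1, Some q5])" "?B \<in> multiforms (count_list [Some q1, Some q5])"
      using multiforms_diff[OF linear_product_multiform[of "[(e2, Some q1), (e1, Some q5)]", unfolded list.map snd_conv]
          linear_product_multiform[of "[(e3, Some q1), (e2, Some q5)]", unfolded list.map snd_conv]]
        linear_product_multiform[of "[(e2 + e3, Some q1), (e2, Some q5)]", unfolded list.map snd_conv]
      by blast+
    moreover have "(?A w \<noteq> 0 \<or> ?B w \<noteq> 0) \<and> fX m' = P1_pt (?A w) (?B w)"
      if m': "m' \<in> X \<inter> chartB" and w: "hom_coords w m'" for m' w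
    proof -
      have m'': "m' \<in> X" "m' \<in> chartB" using m' by auto
      note B = chartB_forms[OF m'' w]
      show ?thesis unfolding fX_def
      proof (rule P1_pt_normalize[where s = "dot e2 (w (Some q1)) * (dot e1 (w (Some q5)) + dot e2 (w (Some q5)))"])
        show "?A w + ?B w = dot e2 (w (Some q1)) * (dot e1 (w (Some q5)) + dot e2 (w (Some q5)))"
          by (simp add: algebra_simps)
        show "dot e2 (w (Some q1)) * (dot e1 (w (Some q5)) + dot e2 (w (Some q5))) \<noteq> 0"
          using B(1,3) by simp
      qed (use B(4) in simp)
    qed
    ultimately show ?thesis using m mB by blast
  next
    assume mA: "m \<in> chartA"
    let ?A = "linear_product [(e1 + e3, Some q4), (e1, Some q5)]"
    let ?B = "\<lambda>w. linear_product [(e1, Some q4), (e2, Some q5)] w - linear_product [(e3, Some q4), (e1, Some q5)] w"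
    have "zariski_open X (X \<inter> chartA)"
      using zariski_open_nonvan[of X "[(e1, Some q4), (e1, Some q5)]"] by (simp add: chartA_def Int_def)
    moreover have "?A \<in> multiforms (count_list [Some q4, Some q5])" "?B \<in> multiforms (count_list [Some q4, Some q5])"
      using multiforms_diff[OF linear_product_multiform[of "[(e1, Some q4), (e2, Some q5)]", unfolded list.map snd_conv]
          linear_product_multiform[of "[(e3, Some q4), (e1, Some q5)]", unfolded list.map snd_conv]]
        linear_product_multiform[of "[(e1 + e3, Some q4), (e1, Some q5)]", unfolded list.map snd_conv]
      by blast+
    moreover have "(?A w \<noteq> 0 \<or> ?B w \<noteq> 0) \<and> fX m' = P1_pt (?A w) (?B w)"
      if m': "m' \<in> X \<inter> chartA" and w: "hom_coords w m'" for m' w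
    proof -
      have m'': "m' \<in> X" "m' \<in> chartA" using m' by auto
      note B = chartA_forms[OF m'' w]
      show ?thesis unfolding fX_def
      proof (rule P1_pt_normalize[where s = "dot e1 (w (Some q4)) * (dot e1 (w (Some q5)) + dot e2 (w (Some q5)))"])
        show "?A w + ?B w = dot e1 (w (Some q4)) * (dot e1 (w (Some q5)) + dot e2 (w (Some q5)))"
          by (simp add: algebra_simps)
        show "dot e1 (w (Some q4)) * (dot e1 (w (Some q5)) + dot e2 (w (Some q5))) \<noteq> 0"
          using B(1,3) by simp
      qed (use B(4) in simp)
    qed
    ultimately show ?thesis using m mA by blast
  qed
qed

lemma X_of_coords:
  assumes "(y, c, b) \<in> conic_surface"
  shows "to_X (y, c, b) \<in> X" "yX (to_X (y, c, b)) = y" "\<sigma>X (to_X (y, c, b)) = (1 - y) / 2"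
  using assms to_X_in(1) by (auto simp: yX_def \<sigma>X_def from_X_to_X)

text \<open>A form that is non-zero at one point is non-zero at almost all points of a line through
  it, among them an unmarked point; the section with \<open>c = 0\<close> gives a preimage of
  that.\<close>

lemma fX_dominant: "dominant X fX"
  unfolding dominant_def
proof (intro allI impI, elim conjE)
  fix U :: "(unit \<Rightarrow> 2 proj) set" assume U: "zariski_open UNIV U" "U \<noteq> {}"
  then obtain m d P w where P: "P \<in> multiforms d" "hom_coords w m" "P w \<noteq> 0"
    "{m'. \<exists>w. hom_coords w m' \<and> P w \<noteq> 0} \<subseteq> U"
    unfolding zariski_open_def by blast
  \<comment> \<open>The direction \<open>(1, 1)\<close> changes both coordinates and their sum, so
    each marked point excludes one value of \<open>t\<close>.\<close>
  define W :: "complex \<Rightarrow> unit \<Rightarrow> complex ^ 2" where "W = (\<lambda>t _. w () + t *s vector [1, 1])"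
  have "poly_curve W"
    unfolding poly_curve_iff W_def vector_add_component vector_smult_component
    by (intro allI poly_fun_intros)
  then obtain q where q: "\<And>t. P (W t) = poly q t" using poly_curve_multiform[OF _ P(1)] by blast
  have "W 0 = w" by (auto simp: W_def)
  then have "q \<noteq> 0" using q[of 0] P(3) by auto
  then have "finite ({t. poly q t = 0} \<union> {- w () $ 1, - w () $ 2, - (w () $ 1 + w () $ 2) / 2})"
    by (simp add: poly_roots_finite)
  then obtain t where t: "t \<notin> {t. poly q t = 0} \<union> {- w () $ 1, - w () $ 2, - (w () $ 1 + w () $ 2) / 2}"
    using ex_new_if_finite[OF infinite_UNIV_char_0] by blast
  define v where "v = W t ()"
  have v: "v $ 1 = w () $ 1 + t" "v $ 2 = w () $ 2 + t" by (simp_all add: v_def W_def)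
  have ne: "v $ 1 \<noteq> 0" "v $ 2 \<noteq> 0" using t v by (auto simp: add_eq_0_iff)
  have "v $ 1 + v $ 2 \<noteq> 0"
  proof
    assume "v $ 1 + v $ 2 = 0"
    then have "2 * t = - (w () $ 1 + w () $ 2)" unfolding v by (simp add: algebra_simps eq_neg_iff_add_eq_0)
    then have "t = - (w () $ 1 + w () $ 2) / 2" by (metis nonzero_mult_div_cancel_left zero_neq_numeral)
    then show False using t by blast
  qed
  moreover have v0: "v \<noteq> 0" using ne by auto
  ultimately have um: "proj_pt v \<notin> marked" using ne by (simp add: marked_iff)
  have "W t = (\<lambda>_. v)" by (auto simp: v_def)
  then have "hom_coords (W t) (\<lambda>_. proj_pt v)" using v0 by (simp add: hom_coords_def)
  moreover have "P (W t) \<noteq> 0" using t q by simp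
  ultimately have vU: "(\<lambda>_. proj_pt v) \<in> U" using P(4) by blast
  let ?w = "conic_section 0 (P1_coord (proj_pt v))"
  have "?w \<in> conic_surface" using P1_coord_unmarked[OF um] by (rule conic_section_in)
  then have "to_X ?w \<in> X \<and> yX (to_X ?w) = P1_coord (proj_pt v)"
    using X_of_coords(1,2) unfolding conic_section_def by blast
  moreover have "P1_param (P1_coord (proj_pt v)) = proj_pt v"
    using um by (intro P1_param_coord) (auto simp: marked_eq)
  ultimately show "\<exists>m\<in>X. (\<lambda>_. fX m) \<in> U" using vU by (intro bexI[of _ "to_X ?w"]) (auto simp: fX_eq)
qed

definition mkW :: "complex ^ 3 \<Rightarrow> complex ^ 3 \<Rightarrow> complex ^ 3 \<Rightarrow> complex ^ 3 \<Rightarrow> complex ^ 3 \<Rightarrow> complex ^ 3 \<Rightarrow>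
    3 proj option \<Rightarrow> complex ^ 3" where
  "mkW x a1 a2 a3 a4 a5 i = (case i of None \<Rightarrow> x | Some q \<Rightarrow>
    if q = q1 then a1 else if q = q2 then a2 else if q = q3 then a3
    else if q = q4 then a4 else if q = q5 then a5 else (SOME v. v \<noteq> 0 \<and> proj_pt v = undefined))"

lemma hom_coords_mkW:
  assumes "x \<noteq> 0 \<and> a1 \<noteq> 0 \<and> a2 \<noteq> 0 \<and> a3 \<noteq> 0 \<and> a4 \<noteq> 0 \<and> a5 \<noteq> 0"
  shows "hom_coords (mkW x a1 a2 a3 a4 a5) (mk x a1 a2 a3 a4 a5)"
proof -
  have "\<exists>v. v \<noteq> 0 \<and> proj_pt v = (undefined :: 3 proj)" by (metis proj_pt_cases)
  from someI_ex[OF this] show ?thesis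
    using assms by (auto simp: hom_coords_def mkW_def mk_def split: option.split)
qed

lemma poly_curve_mkW:
  fixes x a1 a2 a3 a4 a5 :: "complex \<Rightarrow> complex ^ 3"
  assumes "\<And>k. poly_fun (\<lambda>t. x t $ k)" "\<And>k. poly_fun (\<lambda>t. a1 t $ k)" "\<And>k. poly_fun (\<lambda>t. a2 t $ k)"
    "\<And>k. poly_fun (\<lambda>t. a3 t $ k)" "\<And>k. poly_fun (\<lambda>t. a4 t $ k)" "\<And>k. poly_fun (\<lambda>t. a5 t $ k)"
  shows "poly_curve (\<lambda>t. mkW (x t) (a1 t) (a2 t) (a3 t) (a4 t) (a5 t))"
  unfolding poly_curve_iff
proof (intro allI)
  fix i k
  show "poly_fun (\<lambda>t. mkW (x t) (a1 t) (a2 t) (a3 t) (a4 t) (a5 t) i $ k)"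
  proof (cases i)
    case (Some q)
    then show ?thesis unfolding mkW_def using assms
      by (cases "q = q1"; cases "q = q2"; cases "q = q3"; cases "q = q4"; cases "q = q5")
        (simp_all add: poly_fun_const)
  qed (simp add: mkW_def assms)
qed

lemma poly_fun_pnt:
  "poly_fun f \<Longrightarrow> poly_fun g \<Longrightarrow> poly_fun h \<Longrightarrow> poly_fun (\<lambda>t. pnt (f t) (g t) (h t) $ k)"
  "poly_fun f \<Longrightarrow> poly_fun g \<Longrightarrow> poly_fun h \<Longrightarrow> poly_fun (\<lambda>t. lin (f t) (g t) (h t) $ k)"
  unfolding pnt_def lin_def vector_add_component vector_smult_component by (intro poly_fun_intros; assumption)+

lemma fX_fibre:
  assumes "m \<in> X"
  shows "fX m = P1_pt 0 1 \<Longrightarrow> yX m = 1 \<and> cX m = 0 \<and> bX m \<noteq> 0 \<and> m = E2 (4 * bX m)"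
    "fX m = P1_pt 1 0 \<Longrightarrow> yX m = -1 \<and> cX m = 0 \<and> bX m \<noteq> 0 \<and> m = E3 (4 * bX m)"
proof -
  note m = X_coords[OF assms]
  have pole: "cX m = 0 \<and> bX m \<noteq> 0" if "yX m = 1 \<or> yX m = -1"
    using m(1) that by (auto simp: conic_surface_def)
  have "P1_coord (P1_pt 0 1) = 1" "P1_coord (P1_pt 1 0) = -1" by (simp_all add: P1_coord_proj_pt)
  then have "fX m = P1_pt 0 1 \<Longrightarrow> yX m = 1" "fX m = P1_pt 1 0 \<Longrightarrow> yX m = -1" by (metis P1_coord_fX)+
  then show "fX m = P1_pt 0 1 \<Longrightarrow> yX m = 1 \<and> cX m = 0 \<and> bX m \<noteq> 0 \<and> m = E2 (4 * bX m)"
    "fX m = P1_pt 1 0 \<Longrightarrow> yX m = -1 \<and> cX m = 0 \<and> bX m \<noteq> 0 \<and> m = E3 (4 * bX m)"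
    using pole m(2) by (auto simp: to_X_def)
qed

text \<open>These are the curves with \<open>c = t\<close> along which the parameter
  \<open>4 * (1 - \<sigma>) * b\<close> of the exceptional curve over \<open>q2\<close>, or
  \<open>4 * \<sigma> * b\<close> over \<open>q3\<close>, is constantly \<open>p\<close>.\<close>

lemma conic_surface_curve:
  assumes "p \<noteq> 0"
  shows "t\<^sup>2 / p \<noteq> 1 \<Longrightarrow> (1 - 2 * (t\<^sup>2 / p), t, p / (4 * (1 - t\<^sup>2 / p))) \<in> conic_surface"
    "t\<^sup>2 / p \<noteq> 1 \<Longrightarrow> (2 * (t\<^sup>2 / p) - 1, t, p / (4 * (1 - t\<^sup>2 / p))) \<in> conic_surface"
proof -
  define r where "r = t\<^sup>2 / p"
  have t: "t\<^sup>2 = r * p" using assms by (simp add: r_def)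
  have 1: "1 - (1 - 2 * r)\<^sup>2 = 4 * r * (1 - r)" "1 - (2 * r - 1)\<^sup>2 = 4 * r * (1 - r)"
    by (simp_all add: power2_eq_square algebra_simps)
  have "r \<noteq> 1 \<Longrightarrow> (1 - 2 * r, t, p / (4 * (1 - r))) \<in> conic_surface \<and> (2 * r - 1, t, p / (4 * (1 - r))) \<in> conic_surface"
  proof -
    assume r: "r \<noteq> 1"
    define Q where "Q = p / (4 * (1 - r))"
    have nz: "4 * (1 - r) \<noteq> 0" using r by simp
    have "4 * (1 - r) * Q = p" unfolding Q_def using nz by (metis nonzero_mult_div_cancel_left times_divide_eq_right)
    then have "4 * r * (1 - r) * Q = r * p" by (metis mult.assoc mult.commute)
    moreover have "Q \<noteq> 0" unfolding Q_def using nz assms by (simp del: right_diff_distrib_numeral)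
    ultimately show ?thesis unfolding conic_surface_def Q_def[symmetric] by (auto simp: 1 t)
  qed
  then show "t\<^sup>2 / p \<noteq> 1 \<Longrightarrow> (1 - 2 * (t\<^sup>2 / p), t, p / (4 * (1 - t\<^sup>2 / p))) \<in> conic_surface"
    "t\<^sup>2 / p \<noteq> 1 \<Longrightarrow> (2 * (t\<^sup>2 / p) - 1, t, p / (4 * (1 - t\<^sup>2 / p))) \<in> conic_surface"
    unfolding r_def by blast+
qed

lemma eventually_square_ne: "p \<noteq> 0 \<Longrightarrow> \<forall>\<^sub>F t in nhds 0. t\<^sup>2 / p \<noteq> (1 :: complex)"
  using eventually_nhds_in_open[of "{t. t\<^sup>2 / p \<noteq> 1}" 0] by (simp add: open_Collect_neq continuous_intros)

text \<open>Keeping \<open>p\<close> fixed in \<open>mk2\<close> and setting \<open>c = t\<close>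
  gives coordinates polynomial in \<open>t\<close>. The curve crosses the fibre at
  \<open>E2 p\<close>, and \<open>\<sigma> = t\<^sup>2 / p\<close> vanishes there to order
  two.\<close>

lemma E2_curve:
  assumes p: "p \<noteq> 0"
  shows "\<exists>W m v s. poly_curve W \<and> m 0 = E2 p \<and> (\<forall>\<^sub>F t in nhds 0. hom_coords (W t) (m t)) \<and>
      (\<forall>\<^sub>F t in nhds 0. m t \<in> X) \<and> s \<noteq> 0 \<and>
      (\<forall>\<^sub>F t in nhds 0. v t \<noteq> 0 \<and> fX (m t) = proj_pt (v t) \<and> dot (vector [1, 0]) (v t) = s * t\<^sup>2 \<and>
        dot (vector [0, 1]) (v t) = 1 - s * t\<^sup>2)"
proof -
  define \<sigma> where "\<sigma> = (\<lambda>t. t\<^sup>2 / p)"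
  define m where "m = (\<lambda>t. to_X (1 - 2 * \<sigma> t, t, p / (4 * (1 - \<sigma> t))))"
  define W where "W = (\<lambda>t. let \<kappa> = t / p; B = t + 1 - t * t / p in
    mkW (pnt B (t * (1 - \<kappa>)) ((1 - \<kappa>) * B)) (lin 0 B (- t)) (lin (1 - \<kappa>) (- B / p) (- (1 - \<kappa>)))
      (lin ((1 - \<kappa>) * (t * t / p - 1)) (- B) B) (lin (1 - \<kappa>) 0 (-1)) (lin (t * (1 - \<kappa>)) (- B) 0))"
  have ev: "\<forall>\<^sub>F t in nhds 0. \<sigma> t \<noteq> 1" unfolding \<sigma>_def using p by (rule eventually_square_ne)
  have surf: "(1 - 2 * \<sigma> t, t, p / (4 * (1 - \<sigma> t))) \<in> conic_surface" if "\<sigma> t \<noteq> 1" for t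
    using conic_surface_curve(1)[OF p] that unfolding \<sigma>_def by blast
  have half: "(1 - (1 - 2 * z)) / 2 = z" for z :: complex by simp
  have hc: "hom_coords (W t) (m t)" if t: "\<sigma> t \<noteq> 1" for t
  proof -
    have \<sigma>: "\<sigma> t = t * t / p" by (simp add: \<sigma>_def power2_eq_square)
    have ne: "1 - 2 * \<sigma> t \<noteq> -1" using t by (auto simp: algebra_simps)
    have b: "p / (4 * (1 - \<sigma> t)) \<noteq> 0" using p t by simp
    have "4 * (1 - \<sigma> t) * (p / (4 * (1 - \<sigma> t))) = p" using t by simp
    then have m: "m t = mk2 (\<sigma> t) t p"
      unfolding m_def using to_X_eq_mk2[OF surf[OF t] ne b] unfolding half by (simp only:)
    have "\<sigma> t = t * (t / p)" by (simp add: \<sigma>)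
    note nz = mk2_nonzero[OF this]
    show ?thesis
      unfolding m mk2_def W_def Let_def \<sigma>[symmetric]
    proof (rule hom_coords_mkW)
      show "pnt (t + 1 - \<sigma> t) (t * (1 - t / p)) ((1 - t / p) * (t + 1 - \<sigma> t)) \<noteq> 0 \<and>
         lin 0 (t + 1 - \<sigma> t) (- t) \<noteq> 0 \<and>
         lin (1 - t / p) (- (t + 1 - \<sigma> t) / p) (- (1 - t / p)) \<noteq> 0 \<and>
         lin ((1 - t / p) * (\<sigma> t - 1)) (- (t + 1 - \<sigma> t)) (t + 1 - \<sigma> t) \<noteq> 0 \<and>
         lin (1 - t / p) 0 (- 1) \<noteq> 0 \<and> lin (t * (1 - t / p)) (- (t + 1 - \<sigma> t)) 0 \<noteq> 0"
        using nz p by (simp only: pnt_eq_0 lin_eq_0 mult_eq_0_iff neg_equal_0_iff_equal right_minus_eq divide_eq_0_iff)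
          (metis mult_zero_left mult_zero_right right_minus_eq zero_neq_neg_one zero_neq_one)
    qed
  qed
  have W: "poly_curve W"
    unfolding W_def Let_def by (intro poly_curve_mkW poly_fun_pnt poly_fun_intros)
  have m0: "m 0 = E2 p" using p by (simp add: m_def \<sigma>_def to_X_def)
  have "m t \<in> X \<and> fX (m t) = P1_pt (\<sigma> t) (1 - \<sigma> t)" if "\<sigma> t \<noteq> 1" for t
    using X_of_coords(1,3)[OF surf[OF that]] unfolding m_def fX_def half by (simp only:)
  then have f: "\<forall>\<^sub>F t in nhds 0. m t \<in> X \<and> fX (m t) = P1_pt (\<sigma> t) (1 - \<sigma> t)"
    using ev by (rule eventually_mono[rotated]) blast
  have v: "vector [\<sigma> t, 1 - \<sigma> t] \<noteq> (0 :: complex ^ 2)" for t by auto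
  show ?thesis
  proof (intro exI conjI)
    show "poly_curve W" "m 0 = E2 p" by fact+
    show "\<forall>\<^sub>F t in nhds 0. hom_coords (W t) (m t)" using ev by (rule eventually_mono) (rule hc)
    show "\<forall>\<^sub>F t in nhds 0. m t \<in> X" using f by (rule eventually_mono) blast
    show "1 / p \<noteq> 0" using p by simp
    show "\<forall>\<^sub>F t in nhds 0. vector [\<sigma> t, 1 - \<sigma> t] \<noteq> (0 :: complex ^ 2) \<and> fX (m t) = P1_pt (\<sigma> t) (1 - \<sigma> t) \<and>
        dot (vector [1, 0]) (vector [\<sigma> t, 1 - \<sigma> t] :: complex ^ 2) = 1 / p * t\<^sup>2 \<and>
        dot (vector [0, 1]) (vector [\<sigma> t, 1 - \<sigma> t] :: complex ^ 2) = 1 - 1 / p * t\<^sup>2"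
      using f by (rule eventually_mono) (use v in \<open>auto simp: dot_2 \<sigma>_def\<close>)
  qed
qed

text \<open>The same over \<open>q3\<close> with \<open>mk3\<close>, where
  \<open>1 - \<sigma> = t\<^sup>2 / q\<close>.\<close>

lemma E3_curve:
  assumes q: "q \<noteq> 0"
  shows "\<exists>W m v s. poly_curve W \<and> m 0 = E3 q \<and> (\<forall>\<^sub>F t in nhds 0. hom_coords (W t) (m t)) \<and>
      (\<forall>\<^sub>F t in nhds 0. m t \<in> X) \<and> s \<noteq> 0 \<and>
      (\<forall>\<^sub>F t in nhds 0. v t \<noteq> 0 \<and> fX (m t) = proj_pt (v t) \<and> dot (vector [0, 1]) (v t) = s * t\<^sup>2 \<and>
        dot (vector [1, 0]) (v t) = 1 - s * t\<^sup>2)"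
proof -
  define \<tau> where "\<tau> = (\<lambda>t. t\<^sup>2 / q)"
  define m where "m = (\<lambda>t. to_X (2 * \<tau> t - 1, t, q / (4 * (1 - \<tau> t))))"
  define W where "W = (\<lambda>t. let \<kappa> = t / q; \<sigma> = 1 - t * t / q; A = t - \<sigma> in
    mkW (pnt (t * (1 + \<kappa>)) A (A * (1 + \<kappa>))) (lin 0 (1 + \<kappa>) (-1)) (lin A (- ((1 + \<kappa>) * \<sigma>)) (- A))
      (lin (- A / q) (- (1 + \<kappa>)) (1 + \<kappa>)) (lin A 0 (- t)) (lin A (- (t * (1 + \<kappa>))) 0))"
  have ev: "\<forall>\<^sub>F t in nhds 0. \<tau> t \<noteq> 1" unfolding \<tau>_def using q by (rule eventually_square_ne)
  have surf: "(2 * \<tau> t - 1, t, q / (4 * (1 - \<tau> t))) \<in> conic_surface" if "\<tau> t \<noteq> 1" for t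
    using conic_surface_curve(2)[OF q] that unfolding \<tau>_def by blast
  have half: "(1 - (2 * z - 1)) / 2 = 1 - z" for z :: complex by (simp add: field_simps)
  have hc: "hom_coords (W t) (m t)" if t: "\<tau> t \<noteq> 1" for t
  proof -
    define \<sigma> where "\<sigma> = 1 - \<tau> t"
    have \<sigma>: "\<sigma> = 1 - t * t / q" by (simp add: \<sigma>_def \<tau>_def power2_eq_square)
    have ne: "2 * \<tau> t - 1 \<noteq> 1" using t by (auto simp: algebra_simps)
    have b: "q / (4 * (1 - \<tau> t)) \<noteq> 0" using q t by simp
    have "4 * (1 - \<tau> t) * (q / (4 * (1 - \<tau> t))) = q" using t by simp
    then have m: "m t = mk3 \<sigma> t q"
      unfolding m_def \<sigma>_def using to_X_eq_mk3[OF surf[OF t] ne b] unfolding half by (simp only:)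
    have "1 - \<sigma> = t * (t / q)" by (simp add: \<sigma>)
    note nz = mk3_nonzero[OF this]
    show ?thesis
      unfolding m mk3_def W_def Let_def \<sigma>[symmetric]
    proof (rule hom_coords_mkW)
      show "pnt (t * (1 + t / q)) (t - \<sigma>) ((t - \<sigma>) * (1 + t / q)) \<noteq> 0 \<and>
         lin 0 (1 + t / q) (-1) \<noteq> 0 \<and>
         lin (t - \<sigma>) (- ((1 + t / q) * \<sigma>)) (- (t - \<sigma>)) \<noteq> 0 \<and>
         lin (- (t - \<sigma>) / q) (- (1 + t / q)) (1 + t / q) \<noteq> 0 \<and>
         lin (t - \<sigma>) 0 (- t) \<noteq> 0 \<and> lin (t - \<sigma>) (- (t * (1 + t / q))) 0 \<noteq> 0"
        using nz q by (simp only: pnt_eq_0 lin_eq_0 mult_eq_0_iff neg_equal_0_iff_equal right_minus_eq divide_eq_0_iff)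
          (metis mult_zero_left mult_zero_right right_minus_eq zero_neq_neg_one zero_neq_one)
    qed
  qed
  have W: "poly_curve W"
    unfolding W_def Let_def by (intro poly_curve_mkW poly_fun_pnt poly_fun_intros)
  have m0: "m 0 = E3 q" using q by (simp add: m_def \<tau>_def to_X_def)
  have "m t \<in> X \<and> fX (m t) = P1_pt (1 - \<tau> t) (\<tau> t)" if "\<tau> t \<noteq> 1" for t
    using X_of_coords(1,3)[OF surf[OF that]] unfolding m_def fX_def half by (simp only:) simp
  then have f: "\<forall>\<^sub>F t in nhds 0. m t \<in> X \<and> fX (m t) = P1_pt (1 - \<tau> t) (\<tau> t)"
    using ev by (rule eventually_mono[rotated]) blast
  have v: "vector [1 - \<tau> t, \<tau> t] \<noteq> (0 :: complex ^ 2)" for t by auto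
  show ?thesis
  proof (intro exI conjI)
    show "poly_curve W" "m 0 = E3 q" by fact+
    show "\<forall>\<^sub>F t in nhds 0. hom_coords (W t) (m t)" using ev by (rule eventually_mono) (rule hc)
    show "\<forall>\<^sub>F t in nhds 0. m t \<in> X" using f by (rule eventually_mono) blast
    show "1 / q \<noteq> 0" using q by simp
    show "\<forall>\<^sub>F t in nhds 0. vector [1 - \<tau> t, \<tau> t] \<noteq> (0 :: complex ^ 2) \<and> fX (m t) = P1_pt (1 - \<tau> t) (\<tau> t) \<and>
        dot (vector [0, 1]) (vector [1 - \<tau> t, \<tau> t] :: complex ^ 2) = 1 / q * t\<^sup>2 \<and>
        dot (vector [1, 0]) (vector [1 - \<tau> t, \<tau> t] :: complex ^ 2) = 1 - 1 / q * t\<^sup>2"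
      using f by (rule eventually_mono) (use v in \<open>auto simp: dot_2 \<tau>_def\<close>)
  qed
qed

lemma regular_quotient:
  assumes "map snd A = map snd B"
    and "\<And>m w. m \<in> U \<Longrightarrow> hom_coords w m \<Longrightarrow> linear_product B w \<noteq> 0 \<and> h m = linear_product A w / linear_product B w"
  shows "regular_function U h"
proof (rule regular_functionI)
  show "linear_product A \<in> multiforms (count_list (map snd B))"
    using linear_product_multiform[of A] assms(1) by simp
qed (use linear_product_multiform assms(2) in blast)+

text \<open>By the equation of the surface, \<open>\<sigma>\<close> is \<open>c\<^sup>2\<close>
  divided by \<open>4 * (1 - \<sigma>) * b\<close>; \<open>e\<close> is the inverse of this divisor,
  written with the formula for \<open>b\<close> in \<open>chart2\<close>.\<close>

lemma fX_multiplicity_0: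
  assumes C: "C \<subseteq> {m \<in> X. fX m = P1_pt 0 1}" "C \<noteq> {}"
  shows "component_multiplicity X fX (P1_pt 0 1) C = 2"
proof -
  \<comment> \<open>The first four conditions give \<open>chartB\<close> and \<open>chart2\<close>,
    the last two keep the denominator of \<open>e\<close> away from 0.\<close>
  let ?l = "[(e2, Some q1), (e2, Some q5), (e2, Some q2), (e1, Some q4), (e1, Some q2), (e3, Some q4)]"
  define U where "U = {m \<in> X. \<forall>(a, i)\<in>set ?l. m i \<in> nonvan a}"
  define e where "e = (\<lambda>m. - ((1 - y12 m) / (ratio e1 e2 (m (Some q2)) * y31 m)))"
  have E: "\<exists>p. p \<noteq> 0 \<and> m = E2 p" "cX m = 0" if "m \<in> C" for m
  proof -
    have m: "m \<in> X" "fX m = P1_pt 0 1" using that C(1) by blast+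
    show "\<exists>p. p \<noteq> 0 \<and> m = E2 p" using fX_fibre(1)[OF m] by (intro exI[of _ "4 * bX m"]) simp
    show "cX m = 0" using fX_fibre(1)[OF m] by blast
  qed
  have U: "m \<in> X" "m \<in> chartB" "m \<in> chart2" if "m \<in> U" for m
    using that by (auto simp: U_def chartB_def chart2_def)
  have Ud: "dot e1 (w (Some q2)) \<noteq> 0" "dot e3 (w (Some q4)) \<noteq> 0" "dot e2 (w (Some q2)) \<noteq> 0" "dot e1 (w (Some q4)) \<noteq> 0"
    if "m \<in> U" "hom_coords w m" for m w
    using that by (auto simp: U_def hom_coordsD)
  show ?thesis
  proof (rule component_multiplicity_eq_2[where \<alpha> = "vector [1, 0]" and \<beta> = "vector [0, 1]" and U = U
        and u = "vector [0, 1]" and w = "vector [1, -1]" and g = \<sigma>X and e = e and c = cX])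
    show "C \<noteq> {}" by fact
    show "proj_pt v = P1_pt 0 1 \<longleftrightarrow> dot (vector [1, 0]) v = 0" if "v \<noteq> 0" for v
      using that by (simp add: proj_pt_eq_P1_iff dot_2)
    show "v = 0" if "dot (vector [1, 0]) v = 0" "dot (vector [0, 1]) v = 0" for v :: "complex ^ 2"
      using that by (simp add: dot_2 vec_eq_iff forall_2)
    show "zariski_open X U" unfolding U_def by (rule zariski_open_nonvan)
    show "C \<subseteq> U"
    proof
      fix m assume m: "m \<in> C"
      then obtain p where "p \<noteq> 0" "m = E2 p" using E by blast
      then show "m \<in> U" using E2_in_X[of p] by (simp add: U_def E2_def nonvan_proj_pt)
    qed
    show "proj_pt (vector [1, -1]) \<noteq> P1_pt 0 1" by (simp add: proj_pt_eq_P1_iff)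
    show "fX m = proj_pt (vector [0, 1] + \<sigma>X m *s vector [1, -1])" if "m \<in> U" for m
    proof -
      have "vector [\<sigma>X m, 1 - \<sigma>X m] = vector [0, 1] + \<sigma>X m *s (vector [1, -1] :: complex ^ 2)"
        by (simp add: vec_eq_iff forall_2)
      then show ?thesis by (simp add: fX_def)
    qed
    show "regular_function U e"
    proof (rule regular_quotient[where A = "[(e1 + e2, Some q5), (e2, Some q2), (e1, Some q4)]"
          and B = "[(e2, Some q5), (e1, Some q2), (e3, Some q4)]"])
      fix m w assume m: "m \<in> U" and w: "hom_coords w m"
      note B = chartB_forms[OF U(1,2)[OF m] w]
      have "e m = (dot e1 (w (Some q5)) + dot e2 (w (Some q5))) * (dot e2 (w (Some q2)) * dot e1 (w (Some q4))) /
          (dot e2 (w (Some q5)) * (dot e1 (w (Some q2)) * dot e3 (w (Some q4))))"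
        unfolding e_def B(6) chart_coords(3)[OF w] hom_coordsD(2)[OF w] by simp
      then show "linear_product [(e2, Some q5), (e1, Some q2), (e3, Some q4)] w \<noteq> 0 \<and>
          e m = linear_product [(e1 + e2, Some q5), (e2, Some q2), (e1, Some q4)] w /
            linear_product [(e2, Some q5), (e1, Some q2), (e3, Some q4)] w"
        using B(2) Ud[OF m w] by simp
    qed simp
    show "regular_function U cX"
    proof (rule regular_quotient[where A = "[(- e3, Some q1), (e2, Some q5)]"
          and B = "[(e2, Some q1), (e1 + e2, Some q5)]"])
      fix m w assume m: "m \<in> U" and w: "hom_coords w m"
      note B = chartB_forms[OF U(1,2)[OF m] w]
      show "linear_product [(e2, Some q1), (e1 + e2, Some q5)] w \<noteq> 0 \<and>
          cX m = linear_product [(- e3, Some q1), (e2, Some q5)] w / linear_product [(e2, Some q1), (e1 + e2, Some q5)] w"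
        using B(1-3,5) by simp
    qed simp
    show "cX m = 0" if "m \<in> C" for m using E(2)[OF that] .
    show "\<sigma>X m = e m * (cX m)\<^sup>2" if m: "m \<in> U" for m
    proof -
      note c2 = X_chart2[OF U(1,3)[OF m]]
      obtain w where w: "hom_coords w m" using hom_coords_exist by blast
      define r where "r = ratio e1 e2 (m (Some q2)) * y31 m"
      have r: "r \<noteq> 0" using Ud[OF m w] by (simp add: r_def chart_coords(3)[OF w] hom_coordsD(2)[OF w])
      have b: "2 * (1 + yX m) * bX m = - r / (1 - y12 m)"
        unfolding c2(3) r_def using c2(2) by (simp del: distrib_left_numeral)
      have "(cX m)\<^sup>2 = (1 - (yX m)\<^sup>2) * bX m" using X_coords(1)[OF U(1)[OF m]] by (simp add: conic_surface_def)
      also have "\<dots> = \<sigma>X m * (2 * (1 + yX m) * bX m)"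
      proof -
        have y: "yX m = 1 - 2 * \<sigma>X m" by (simp add: \<sigma>X_def field_simps)
        have "(1 - (1 - 2 * z)\<^sup>2) * b = z * (2 * (1 + (1 - 2 * z)) * b)" for z b :: complex
          by (simp add: power2_eq_square algebra_simps)
        then show ?thesis unfolding y .
      qed
      finally have "(cX m)\<^sup>2 = \<sigma>X m * (- r / (1 - y12 m))" unfolding b .
      moreover have "e m = - ((1 - y12 m) / r)" by (simp add: e_def r_def)
      ultimately show ?thesis using r c2(1) by simp
    qed
    show "\<exists>W m v s. poly_curve W \<and> m 0 = m0 \<and> (\<forall>\<^sub>F t in nhds 0. hom_coords (W t) (m t)) \<and>
      (\<forall>\<^sub>F t in nhds 0. m t \<in> X) \<and> s \<noteq> 0 \<and>
      (\<forall>\<^sub>F t in nhds 0. v t \<noteq> 0 \<and> fX (m t) = proj_pt (v t) \<and> dot (vector [1, 0]) (v t) = s * t\<^sup>2 \<and>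
        dot (vector [0, 1]) (v t) = 1 - s * t\<^sup>2)" if "m0 \<in> C" for m0
      using E(1)[OF that] E2_curve by blast
  qed simp_all
qed

text \<open>At \<open>y = -1\<close> the vanishing coordinate is \<open>1 - \<sigma>\<close>, and
  \<open>e\<close> is the inverse of \<open>4 * \<sigma> * b\<close>, taken from
  \<open>chart3\<close>.\<close>

lemma fX_multiplicity_1:
  assumes C: "C \<subseteq> {m \<in> X. fX m = P1_pt 1 0}" "C \<noteq> {}"
  shows "component_multiplicity X fX (P1_pt 1 0) C = 2"
proof -
  let ?l = "[(e1, Some q4), (e1, Some q5), (e1, Some q3), (e2, Some q1), (e3, Some q3), (e3, Some q1)]"
  define U where "U = {m \<in> X. \<forall>(a, i)\<in>set ?l. m i \<in> nonvan a}"
  define e where "e = (\<lambda>m. - ((y21 m - 1) / (ratio e3 e1 (m (Some q3)) * y32 m)))"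
  have E: "\<exists>q. q \<noteq> 0 \<and> m = E3 q" "cX m = 0" if "m \<in> C" for m
  proof -
    have m: "m \<in> X" "fX m = P1_pt 1 0" using that C(1) by blast+
    show "\<exists>q. q \<noteq> 0 \<and> m = E3 q" using fX_fibre(2)[OF m] by (intro exI[of _ "4 * bX m"]) simp
    show "cX m = 0" using fX_fibre(2)[OF m] by blast
  qed
  have U: "m \<in> X" "m \<in> chartA" "m \<in> chart3" if "m \<in> U" for m
    using that by (auto simp: U_def chartA_def chart3_def)
  have Ud: "dot e3 (w (Some q3)) \<noteq> 0" "dot e3 (w (Some q1)) \<noteq> 0" "dot e1 (w (Some q3)) \<noteq> 0" "dot e2 (w (Some q1)) \<noteq> 0"
    if "m \<in> U" "hom_coords w m" for m w
    using that by (auto simp: U_def hom_coordsD)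
  show ?thesis
  proof (rule component_multiplicity_eq_2[where \<alpha> = "vector [0, 1]" and \<beta> = "vector [1, 0]" and U = U
        and u = "vector [1, 0]" and w = "vector [-1, 1]" and g = "\<lambda>m. 1 - \<sigma>X m" and e = e and c = cX])
    show "C \<noteq> {}" by fact
    show "proj_pt v = P1_pt 1 0 \<longleftrightarrow> dot (vector [0, 1]) v = 0" if "v \<noteq> 0" for v
      using that by (simp add: proj_pt_eq_P1_iff dot_2)
    show "v = 0" if "dot (vector [0, 1]) v = 0" "dot (vector [1, 0]) v = 0" for v :: "complex ^ 2"
      using that by (simp add: dot_2 vec_eq_iff forall_2)
    show "zariski_open X U" unfolding U_def by (rule zariski_open_nonvan)
    show "C \<subseteq> U"
    proof
      fix m assume m: "m \<in> C"
      then obtain q where "q \<noteq> 0" "m = E3 q" using E by blast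
      then show "m \<in> U" using E3_in_X[of q] by (simp add: U_def E3_def nonvan_proj_pt)
    qed
    show "proj_pt (vector [-1, 1]) \<noteq> P1_pt 1 0" by (simp add: proj_pt_eq_P1_iff)
    show "fX m = proj_pt (vector [1, 0] + (1 - \<sigma>X m) *s vector [-1, 1])" if "m \<in> U" for m
    proof -
      have "vector [\<sigma>X m, 1 - \<sigma>X m] = vector [1, 0] + (1 - \<sigma>X m) *s (vector [-1, 1] :: complex ^ 2)"
        by (simp add: vec_eq_iff forall_2)
      then show ?thesis by (simp add: fX_def)
    qed
    show "regular_function U e"
    proof (rule regular_quotient[where A = "[(- (e1 + e2), Some q5), (e1, Some q3), (e2, Some q1)]"
          and B = "[(e1, Some q5), (e3, Some q3), (e3, Some q1)]"])
      fix m w assume m: "m \<in> U" and w: "hom_coords w m"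
      note B = chartA_forms[OF U(1,2)[OF m] w]
      have "- (- (x + z) / c / (r / s * - (a / b))) = - (x + z) * (s * b) / (c * (r * a))" for x z c r s a b :: complex
        by simp
      then have "e m = - (dot e1 (w (Some q5)) + dot e2 (w (Some q5))) * (dot e1 (w (Some q3)) * dot e2 (w (Some q1))) /
          (dot e1 (w (Some q5)) * (dot e3 (w (Some q3)) * dot e3 (w (Some q1))))"
        unfolding e_def B(6) chart_coords(1)[OF w] hom_coordsD(2)[OF w] .
      then show "linear_product [(e1, Some q5), (e3, Some q3), (e3, Some q1)] w \<noteq> 0 \<and>
          e m = linear_product [(- (e1 + e2), Some q5), (e1, Some q3), (e2, Some q1)] w /
            linear_product [(e1, Some q5), (e3, Some q3), (e3, Some q1)] w"
        using B(2) Ud[OF m w] by simp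
    qed simp
    show "regular_function U cX"
    proof (rule regular_quotient[where A = "[(e3, Some q4), (e1, Some q5)]"
          and B = "[(e1, Some q4), (e1 + e2, Some q5)]"])
      fix m w assume m: "m \<in> U" and w: "hom_coords w m"
      note B = chartA_forms[OF U(1,2)[OF m] w]
      show "linear_product [(e1, Some q4), (e1 + e2, Some q5)] w \<noteq> 0 \<and>
          cX m = linear_product [(e3, Some q4), (e1, Some q5)] w / linear_product [(e1, Some q4), (e1 + e2, Some q5)] w"
        using B(1-3,5) by simp
    qed simp
    show "cX m = 0" if "m \<in> C" for m using E(2)[OF that] .
    show "1 - \<sigma>X m = e m * (cX m)\<^sup>2" if m: "m \<in> U" for m
    proof -
      note c3 = X_chart3[OF U(1,3)[OF m]]
      obtain w where w: "hom_coords w m" using hom_coords_exist by blast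
      define r where "r = ratio e3 e1 (m (Some q3)) * y32 m"
      have r: "r \<noteq> 0" using Ud[OF m w] by (simp add: r_def chart_coords(1)[OF w] hom_coordsD(2)[OF w])
      have b: "2 * (1 - yX m) * bX m = - r / (y21 m - 1)"
        unfolding c3(3) r_def using c3(2) by (simp del: right_diff_distrib_numeral)
      have \<sigma>: "1 - \<sigma>X m = (1 + yX m) / 2" by (simp add: \<sigma>X_def field_simps)
      have "(cX m)\<^sup>2 = (1 - (yX m)\<^sup>2) * bX m" using X_coords(1)[OF U(1)[OF m]] by (simp add: conic_surface_def)
      also have "\<dots> = (1 - \<sigma>X m) * (2 * (1 - yX m) * bX m)"
        unfolding \<sigma> by (simp add: power2_eq_square algebra_simps)
      finally have "(cX m)\<^sup>2 = (1 - \<sigma>X m) * (- r / (y21 m - 1))" unfolding b .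
      moreover have "e m = - ((y21 m - 1) / r)" by (simp add: e_def r_def)
      ultimately show ?thesis using r c3(1) by simp
    qed
    show "\<exists>W m v s. poly_curve W \<and> m 0 = m0 \<and> (\<forall>\<^sub>F t in nhds 0. hom_coords (W t) (m t)) \<and>
      (\<forall>\<^sub>F t in nhds 0. m t \<in> X) \<and> s \<noteq> 0 \<and>
      (\<forall>\<^sub>F t in nhds 0. v t \<noteq> 0 \<and> fX (m t) = proj_pt (v t) \<and> dot (vector [0, 1]) (v t) = s * t\<^sup>2 \<and>
        dot (vector [1, 0]) (v t) = 1 - s * t\<^sup>2)" if "m0 \<in> C" for m0
      using E(1)[OF that] E3_curve by blast
  qed simp_all
qed

lemma fX_orbifold_morphism: "orbifold_morphism X conic_orbifold fX"
proof -
  have dvd: "2 dvd fibre_multiplicity X fX y" if "y = P1_pt 0 1 \<or> y = P1_pt 1 0" for y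
    unfolding fibre_multiplicity_def
  proof (rule Gcd_greatest, clarify)
    fix C assume "C \<in> irreducible_components X {m \<in> X. fX m = y}"
    then have "C \<subseteq> {m \<in> X. fX m = y}" "C \<noteq> {}"
      by (auto simp: irreducible_components_def zariski_irreducible_def)
    then have "component_multiplicity X fX y C = 2"
      using that fX_multiplicity_0 fX_multiplicity_1 by blast
    then show "2 dvd component_multiplicity X fX y C" by simp
  qed
  have "P1_pt 1 (-1) \<noteq> fX m" for m
    using proj_pt_eq_P1_iff(3)[of "vector [\<sigma>X m, 1 - \<sigma>X m]"] by (auto simp: fX_def)
  then have "P1_pt 1 (-1) \<notin> fX ` X" by blast
  then show ?thesis
    using dvd fX_morphism fX_dominant
    by (simp add: orbifold_morphism_def conic_orbifold_def numeral_eq_enat)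
qed

end

section \<open>The pencil of conics\<close>

lemma quadratic_form_dot_mult: "quadratic_form (\<lambda>v. dot a v * dot b v)"
  unfolding quadratic_form_def
proof (intro exI allI)
  show "dot a v * dot b v = (\<Sum>i\<in>UNIV. \<Sum>j\<in>UNIV. (\<chi> i j. a $ i * b $ j) $ i $ j * v $ i * v $ j)" for v
    by (simp add: dot_def sum_product mult_ac)
qed

lemma poly_eq_const_cofinite:
  assumes "finite S" "\<And>t. t \<notin> S \<Longrightarrow> poly q t = (c :: complex)"
  shows "poly q t = c"
proof -
  have "UNIV = S \<union> {t. poly (q - [:c:]) t = 0}" using assms(2) by auto
  then have "infinite {t. poly (q - [:c:]) t = 0}"
    using assms(1) infinite_UNIV_char_0[where 'a = complex] by (metis finite_Un)
  then have "q - [:c:] = 0" using poly_roots_finite by blast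
  then show ?thesis by simp
qed

lemma poly_funs_line:
  fixes v d :: "complex ^ 3"
  assumes "H \<in> poly_funs {\<lambda>v :: complex ^ 3. v $ k | k. True}"
  shows "\<exists>q. \<forall>t. H (v + t *s d) = poly q t"
proof (rule poly_funs_poly[OF assms])
  fix g :: "complex ^ 3 \<Rightarrow> complex" assume "g \<in> {\<lambda>v :: complex ^ 3. v $ k | k. True}"
  then obtain k where g: "g = (\<lambda>v. v $ k)" by blast
  have "poly_fun (\<lambda>t. v $ k + t * d $ k)" by (intro poly_fun_intros)
  then show "\<exists>q. \<forall>t. g (v + t *s d) = poly q t" by (simp add: g poly_fun_def)
qed

context quadrilateral_frame
begin

definition conicF :: "complex ^ 3 \<Rightarrow> complex" where "conicF v = dot l2 v * dot (l1 - l3) v"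
definition conicG :: "complex ^ 3 \<Rightarrow> complex" where "conicG v = dot l1 v * dot (l3 - l2) v"

text \<open>In the plane \<open>x\<^sub>1 + x\<^sub>2 + x\<^sub>3 = 0\<close> the two forms have no common zero but the origin, so a common
  factor \<open>H\<close> has no zero there on lines avoiding the origin, hence is constant along them. This makes
  \<open>H\<close> nonzero at the origin; as it divides a monomial along each line through the origin, it is
  constant there, too.\<close>

lemma conics_no_common_factor: "no_common_factor conicF conicG"
  unfolding no_common_factor_def
proof (intro allI impI, elim conjE)
  fix H A B :: "complex ^ 3 \<Rightarrow> complex"
  assume "{H, A, B} \<subseteq> poly_funs {\<lambda>v :: complex ^ 3. v $ k | k. True}"
    and F: "conicF = (\<lambda>v. H v * A v)" and G: "conicG = (\<lambda>v. H v * B v)"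
  then have H: "H \<in> poly_funs {\<lambda>v :: complex ^ 3. v $ k | k. True}" by blast
  have H0: "H v \<noteq> 0" if "conicF v \<noteq> 0 \<or> conicG v \<noteq> 0" for v
    using that fun_cong[OF F, of v] fun_cong[OF G, of v] by auto
  \<comment> \<open>These two vectors span the plane of coordinate sum zero; for
    \<open>s \<noteq> 0\<close> the line through \<open>s *s a\<close> and \<open>b\<close> avoids
    the origin.\<close>
  define a b where "a = pnt 1 (-1) 0" and "b = pnt 0 1 (-1)"
  have const: "H (v + t *s d) = H (v + t' *s d)" if "\<And>t. H (v + t *s d) \<noteq> 0" for v d t t'
  proof -
    obtain q where q: "\<And>t. H (v + t *s d) = poly q t" using poly_funs_line[OF H] by blast
    then have "poly q t = poly q t'" using that by (intro constant_poly_nonzero) metis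
    then show ?thesis by (simp add: q)
  qed
  have sb: "H (s *s a) = H b" if s: "s \<noteq> 0" for s
  proof -
    have "H (s *s a + t *s (b - s *s a)) \<noteq> 0" for t
    proof (rule H0)
      have pt: "s *s a + t *s (b - s *s a) = pnt (s * (1 - t)) (t - s * (1 - t)) (- t)"
        by (simp add: a_def b_def pnt_def vec_eq_iff algebra_simps)
      show "conicF (s *s a + t *s (b - s *s a)) \<noteq> 0 \<or> conicG (s *s a + t *s (b - s *s a)) \<noteq> 0"
      proof (rule ccontr)
        assume "\<not> (conicF (s *s a + t *s (b - s *s a)) \<noteq> 0 \<or> conicG (s *s a + t *s (b - s *s a)) \<noteq> 0)"
        then have e: "t - s * (1 - t) = 0 \<or> s * (1 - t) + t = 0" "s * (1 - t) = 0 \<or> - t - (t - s * (1 - t)) = 0"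
          unfolding pt conicF_def conicG_def by simp_all
        have "t = 0 \<and> s * (1 - t) = 0"
        proof -
          define z where "z = s * (1 - t)"
          have "t - z = 0 \<or> z + t = 0" "z = 0 \<or> - t - (t - z) = 0" using e unfolding z_def by blast+
          then have "t = 0 \<and> z = 0" by (auto simp: add_eq_0_iff)
          then show ?thesis unfolding z_def .
        qed
        then have "t = 0" "s * (1 - t) = 0" by blast+
        then show False using s by simp
      qed
    qed
    from const[OF this, of 0 1] show ?thesis by simp
  qed
  have Hb: "H b \<noteq> 0" by (rule H0) (simp add: conicF_def conicG_def b_def)
  \<comment> \<open>All values on the line through \<open>a\<close> except the one at the origin are
    \<open>H b\<close>, so the polynomial on this line is constant.\<close>
  have "H 0 = H b"
  proof -
    obtain q where q: "\<And>t. H (0 + t *s a) = poly q t" using poly_funs_line[OF H] by blast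
    have "poly q 0 = H b"
      by (rule poly_eq_const_cofinite[of "{0}"]) (use sb q in auto)
    then show ?thesis using q[of 0] by simp
  qed
  then have H00: "H 0 \<noteq> 0" using Hb by simp
  have HF: "H v = H 0" if v: "conicF v \<noteq> 0" for v
  proof -
    have "H (0 + t *s v) \<noteq> 0" for t
    proof (cases "t = 0")
      case False
      then have "conicF (t *s v) \<noteq> 0" using v by (simp add: conicF_def)
      then show ?thesis using H0 by simp
    qed (use H00 in simp)
    from const[OF this, of 0 1] show ?thesis by simp
  qed
  have "H v = H 0" for v
  proof -
    \<comment> \<open>Both factors of \<open>conicF\<close> are non-constant in this direction, so
      \<open>conicF\<close> has at most two zeros on the line, and the values of \<open>H\<close>
      off them decide.\<close>
    let ?d = "pnt 1 1 0"
    obtain q where q: "\<And>t. H (v + t *s ?d) = poly q t" using poly_funs_line[OF H] by blast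
    have h: "poly q t = H 0" if "t \<noteq> - dot l2 v" "t \<noteq> dot l3 v - dot l1 v" for t
    proof -
      have "dot l2 v + t \<noteq> 0" "dot l1 v - dot l3 v + t \<noteq> 0" using that by (auto simp: add_eq_0_iff)
      moreover have "conicF (v + t *s ?d) = (dot l2 v + t) * (dot l1 v - dot l3 v + t)"
        by (simp add: conicF_def algebra_simps)
      ultimately have "conicF (v + t *s ?d) \<noteq> 0" by simp
      then show ?thesis using HF q[of t] by simp
    qed
    have "poly q 0 = H 0"
    proof (rule poly_eq_const_cofinite)
      show "finite {- dot l2 v, dot l3 v - dot l1 v}" by simp
      fix t assume "t \<notin> {- dot l2 v, dot l3 v - dot l1 v}"
      then have "t \<noteq> - dot l2 v \<and> t \<noteq> dot l3 v - dot l1 v" by blast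
      then show "poly q t = H 0" using h by blast
    qed
    then show ?thesis using q[of 0] by simp
  qed
  then show "\<exists>c. H = (\<lambda>_. c)" by (intro exI[of _ "H 0"]) auto
qed

lemma fX_mkU:
  assumes "y1 \<noteq> y2" "y1 \<noteq> y3" "y2 \<noteq> y3" "y2 \<noteq> 0"
  shows "\<sigma>X (mkU y1 y2 y3) = (y3 - y1) / (y2 - y1)"
proof -
  have "mkU y1 y2 y3 \<in> X" "mkU y1 y2 y3 \<in> chartB" using assms mkU_in_X by (simp_all add: to_X_U_coords)
  from X_chartB(3)[OF this] have "\<sigma>X (mkU y1 y2 y3) = (y3 / y2 - y1 / y2) / (1 - y1 / y2)"
    using assms by (simp add: to_X_U_coords)
  also have "\<dots> = ((y3 - y1) / y2) / ((y2 - y1) / y2)" using assms by (simp add: diff_divide_distrib)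
  finally show ?thesis using assms by simp
qed

lemma fX_pencil: "from_pencil_of_conics ((\<lambda>i. proj_line (line i)) ` {1..6}) centres fX"
  unfolding from_pencil_of_conics_def X_def[symmetric]
proof (rule exI[of _ conicF], rule exI[of _ conicG], intro conjI)
  show "quadratic_form conicF" "quadratic_form conicG"
    using quadratic_form_dot_mult[of l2 "l1 - l3"] quadratic_form_dot_mult[of l1 "l3 - l2"]
    unfolding conicF_def[abs_def] conicG_def[abs_def] by blast+
  show "no_common_factor conicF conicG" by (rule conics_no_common_factor)
  show "\<forall>a b. (\<forall>v. a * conicF v + b * conicG v = 0) \<longrightarrow> a = 0 \<and> b = 0"
  proof (intro allI impI)
    fix a b assume ab: "\<forall>v. a * conicF v + b * conicG v = 0"
    show "a = 0 \<and> b = 0"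
      using ab[rule_format, of "pnt 0 1 1"] ab[rule_format, of "pnt 1 0 1"] by (simp add: conicF_def conicG_def)
  qed
  show "\<forall>m\<in>X. \<forall>v. v \<noteq> 0 \<and> proj_pt v = m None \<and> m None \<notin> \<Union> ((\<lambda>i. proj_line (line i)) ` {1..6}) \<longrightarrow>
      (conicF v \<noteq> 0 \<or> conicG v \<noteq> 0) \<and> fX m = P1_pt (conicF v) (conicG v)"
  proof (intro ballI allI impI, elim conjE)
    fix m v assume m: "m \<in> X" and v: "v \<noteq> 0" "proj_pt v = m None"
      and "m None \<notin> \<Union> ((\<lambda>i. proj_line (line i)) ` {1..6})"
    then have off: "m None \<notin> proj_line (line i)" if "i \<in> {1..6}" for i using that by blast
    show "(conicF v \<noteq> 0 \<or> conicG v \<noteq> 0) \<and> fX m = P1_pt (conicF v) (conicG v)"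
      using m
    proof (cases rule: X_cases)
      case (U y1 y2 y3)
      define x where "x = pnt (y2 * y3) (y1 * y3) (y1 * y2)"
      have nz: "y2 * y3 \<noteq> 0 \<or> y1 * y3 \<noteq> 0 \<or> y1 * y2 \<noteq> 0" using U by auto
      have x: "x \<noteq> 0" unfolding x_def using nz by simp
      have mx: "m None = proj_pt x" by (simp add: U(4) mkU_def x_def)
      have "y2 * y3 \<noteq> 0" "y1 * y3 \<noteq> 0"
        using off[of 1] off[of 2] nz unfolding mx x_def
        by (simp_all add: line_simps pnt_in_line_iff del: One_nat_def)
      then have y: "y1 \<noteq> 0" "y2 \<noteq> 0" "y3 \<noteq> 0" by auto
      obtain c where c: "c \<noteq> 0" "v = c *s x" using v x mx proj_pt_eq_iff[OF x v(1)] by auto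
      \<comment> \<open>With \<open>x = (y2 y3, y1 y3, y1 y2)\<close> both conics contain the factor
        \<open>y1 y2 y3\<close>; the square of \<open>c\<close> comes from the degree two of the
        conics.\<close>
      define k where "k = c\<^sup>2 * (y1 * y2 * y3)"
      have k: "k \<noteq> 0" using c y by (simp add: k_def)
      have FG: "conicF v = k * (y3 - y1)" "conicG v = k * (y2 - y3)"
        unfolding c(2) x_def conicF_def conicG_def k_def by (simp_all add: power2_eq_square algebra_simps)
      show ?thesis
        unfolding fX_def
      proof (rule P1_pt_normalize[where s = "k * (y2 - y1)"])
        show "conicF v + conicG v = k * (y2 - y1)" unfolding FG by (simp add: algebra_simps)
        show "k * (y2 - y1) \<noteq> 0" using k U by simp
        show "\<sigma>X m = conicF v / (k * (y2 - y1))" unfolding FG U(4) using fX_mkU[OF U(1-3) y(2)] k by simp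
      qed
    next
      case (E2 p)
      have "q2 \<in> proj_line (line 5)" by (simp add: line_simps centre_on_line_iff)
      then show ?thesis using off[of 5] E2 by (simp add: E_simps)
    next
      case (E3 q)
      have "q3 \<in> proj_line (line 4)" by (simp add: line_simps centre_on_line_iff)
      then show ?thesis using off[of 4] E3 by (simp add: E_simps)
    qed
  qed
qed

section \<open>Return to the labelled arrangement\<close>

lemma frame_lines:
  fixes L :: "nat \<Rightarrow> 3 proj set"
  assumes "L 1 = proj_line (proj_pt l1)" "L 2 = proj_line (proj_pt l2)" "L 3 = proj_line (proj_pt l3)"
    "L 4 = proj_line (proj_pt (l2 - l3))" "L 5 = proj_line (proj_pt (l1 - l3))" "L 6 = proj_line (proj_pt (l1 - l2))"
  shows "L ` {1..6} = (\<lambda>i. proj_line (line i)) ` {1..6}"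
proof (rule image_cong[OF refl])
  fix i :: nat assume "i \<in> {1..6}"
  from six_cases[OF this] show "L i = proj_line (line i)"
    by (elim disjE) (simp_all add: assms line_simps lin_def del: One_nat_def)
qed

lemma frame_points:
  assumes "p 1 = proj_pt e1" "p 4 = proj_pt e2" "p 5 = proj_pt e3" "p 2 = proj_pt (e1 + e3)" "p 3 = proj_pt (e2 + e3)"
  shows "p ` {1..5::nat} = centres"
proof -
  have "{1..5::nat} = {1, 2, 3, 4, 5}" by auto
  then show ?thesis
    by (simp only: image_insert image_empty assms) (simp add: centres_def q_defs pnt_def)
qed

end

theorem proposition5p2:
  fixes L :: "nat \<Rightarrow> 3 proj set" and p :: "nat \<Rightarrow> 3 proj"
  assumes "complete_quadrilateral L p"
  defines "I \<equiv> p ` {1..5}"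
    and "M \<equiv> blowup_complement (L ` {1..6}) (p ` {1..5})"
    and "D \<equiv> [(P1_pt 0 1, 2), (P1_pt 1 (-1), \<infinity>), (P1_pt 1 0, 2)]"
  shows "\<exists>f. orbifold_morphism M D f \<and>
             from_pencil_of_conics (L ` {1..6}) I f \<and>
             (\<forall>a\<in>M. f a \<notin> marked_points D \<longrightarrow>
                orbifold_pushforward D f a
                  \<in> iso (fundamental_group M a) (orbifold_fundamental_group D (f a)))"
proof -
  obtain e1 e2 e3 l1 l2 l3 where frame: "quadrilateral_frame e1 e2 e3 l1 l2 l3"
    and L: "L 1 = proj_line (proj_pt l1)" "L 2 = proj_line (proj_pt l2)" "L 3 = proj_line (proj_pt l3)"
      "L 4 = proj_line (proj_pt (l2 - l3))" "L 5 = proj_line (proj_pt (l1 - l3))" "L 6 = proj_line (proj_pt (l1 - l2))"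
    and p: "p 1 = proj_pt e1" "p 4 = proj_pt e2" "p 5 = proj_pt e3" "p 2 = proj_pt (e1 + e3)" "p 3 = proj_pt (e2 + e3)"
    using complete_quadrilateral_frame[OF assms(1)] by blast
  interpret quadrilateral_frame e1 e2 e3 l1 l2 l3 by (rule frame)
  note lines = frame_lines[OF L] and points = frame_points[OF p]
  have D: "D = conic_orbifold" by (simp add: D_def conic_orbifold_def)
  have M: "M = X" unfolding M_def X_def lines points ..
  show ?thesis
    unfolding I_def M D lines points
    using fX_orbifold_morphism fX_pencil fX_pushforward_iso by blast
qed
end
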